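(* Let $n\ge 2$, let $F_g$ denote the free group on $g\ge 1$ generators, and let $\rho:F_g\to\mathrm{PSL}(n,\mathbb{R})$ be a purely hyperbolic (generalized) Schottky representation acting on $\mathrm{Flag}^+(\mathbb{R}^n)$. Then $\rho$ is $B$-Anosov, where $B\subset\mathrm{PSL}(n,\mathbb{R})$ is the Borel subgroup of upper triangular matrices.
   Context: Oriented flags. $\mathbb{R}^n$ has its standard orientation. Consider complete flags $F^{(1)}\subset\dots\subset F^{(n-1)}$ in $\mathbb{R}^n$ ($\dim F^{(i)}=i$) with a choice of orientation on each $F^{(i)}$. $\mathrm{Flag}^+(\mathbb{R}^n)$ is the set of these if $n$ is odd, and the quotient by simultaneously reversing the orientations of all odd-dimensional $F^{(i)}$ if $n$ is even; an oriented flag before passing to this quotient is called a lift (if $n$ is odd, a lift is the flag itself). $\mathrm{PSL}(n,\mathbb{R})$ acts on $\mathrm{Flag}^+(\mathbb{R}^n)$. Direct sums of oriented subspaces are oriented by concatenating positive bases in order; $F^{(0)}=\{0\}$. A triple $(F_1,F_2,F_3)$ in $\mathrm{Flag}^+(\mathbb{R}^n)$ is hyperconvex if there are lifts $\widehat F_1,\widehat F_2,\widehat F_3$ such that $\widehat F_1^{(i_1)}\oplus \widehat F_2^{(i_2)}\oplus \widehat F_3^{(i_3)}=\mathbb{R}^n$ as oriented vector spaces for all integers $0\le i_1,i_2,i_3\le n-1$ with $i_1+i_2+i_3=n$. The interval between $F$ and $G$ is $(\!(F,G)\!)=\{H: (F,H,G)\text{ hyperconvex}\}$, and its opposite is $-(\!(F,G)\!)=(\!(G,F)\!)$.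 Purely hyperbolic Schottky representations. $\mathbb{RP}^1$ carries its standard cyclic order, $(a,b)\subset\mathbb{RP}^1$ is the set of $x$ with $(a,x,b)$ positively ordered, and $-(a,b)=(b,a)$. Let $A_1,\dots,A_g\in\mathrm{PSL}(2,\mathbb{R})$ and let $I_j^\pm=(a_j^\pm,b_j^\pm)\subset\mathbb{RP}^1$, $1\le j\le g$, be $2g$ intervals with pairwise disjoint closures such that $A_j(-I_j^-)=I_j^+$; then $\Gamma=\langle A_1,\dots,A_g\rangle\cong F_g$ is free on the $A_j$. Let $\xi_0$ be a map from the set of endpoints of the $I_j^\pm$ to $\mathrm{Flag}^+(\mathbb{R}^n)$ sending positively cyclically ordered triples to hyperconvex triples. Put $J_j^\pm=(\!(\xi_0(a_j^\pm),\xi_0(b_j^\pm))\!)$ and let $h_1,\dots,h_g\in\mathrm{PSL}(n,\mathbb{R})$ satisfy $h_j\xi_0(b_j^-)=\xi_0(a_j^+)$, $h_j\xi_0(a_j^-)=\xi_0(b_j^+)$, so $h_j(-J_j^-)=J_j^+$. The homomorphism $\rho:F_g\cong\Gamma\to\mathrm{PSL}(n,\mathbb{R})$, $A_j\mapsto h_j$, is a purely hyperbolic Schottky representation. Anosov. Let $\mathrm{Flag}(\mathbb{R}^n)$ be the space of complete flags. A sequence $(g_m)$ in $\mathrm{PSL}(n,\mathbb{R})$ is $B$-contracting if there are $F_+,F_-\in\mathrm{Flag}(\mathbb{R}^n)$ such that $g_m$ converges to the constant $F_+$ locally uniformly on the set of flags transverse to $F_-$. The $\mathrm{Flag}(\mathbb{R}^n)$-limit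 set of a subgroup is the set of all $F_+$ arising this way from $B$-contracting sequences in the subgroup. A representation $\rho$ of a word hyperbolic group $\Gamma$ into $\mathrm{PSL}(n,\mathbb{R})$ is $B$-Anosov if and only if (i) there is a $\rho$-equivariant (topological) embedding $\partial_\infty\Gamma\to\mathrm{Flag}(\mathbb{R}^n)$ whose image is the $\mathrm{Flag}(\mathbb{R}^n)$-limit set of $\rho(\Gamma)$ and which sends distinct points to transverse flags, and (ii) for every sequence $\gamma_m\to\infty$ in $\Gamma$, the sequence $\rho(\gamma_m)$ has a $B$-contracting subsequence. (This is equivalent to the other standard definitions of $B$-Anosov.) *)

theory Defs
  imports
    "HOL-Analysis.Analysis"
    "HOL-Algebra.Coset"
    "HOL-Algebra.Generated_Groups"
    "HOL-Combinatorics.Permutations"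
begin

text \<open>
  Throughout, \<open>\<real>\<^sup>n\<close> is \<open>real ^ 'n\<close> with \<open>'n\<close> finite and linearly ordered; the order is what
  makes ``the standard basis'' an ordered basis and hence gives \<open>\<real>\<^sup>n\<close> its standard orientation.
\<close>

type_synonym 'n rvec = "(real, 'n) vec"
type_synonym 'n rmat = "((real, 'n) vec, 'n) vec"
type_synonym 'n flag = "nat \<Rightarrow> 'n rvec set"
type_synonym 'n oflag = "nat \<Rightarrow> 'n rvec list set"


section \<open>The groups SL(n) and PSL(n)\<close>

definition SL :: "('n::finite) rmat monoid" where
  "SL = \<lparr>carrier = {A. det A = 1}, monoid.mult = (**), one = mat 1\<rparr>"

text \<open>
  An element of PSL is a coset: \<open>{A, -A}\<close> if \<open>n\<close> is even, and \<open>{A}\<close> if \<open>n\<close> is odd (then \<open>-1\<close> has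
  determinant \<open>-1\<close>).
\<close>

definition SL_centre :: "('n::finite) rmat set" where
  "SL_centre = carrier SL \<inter> {mat 1, - mat 1}"

definition PSL :: "('n::finite) rmat set monoid" where
  "PSL = SL Mod SL_centre"

lemma group_SL: "group (SL :: ('n::finite) rmat monoid)"
proof (rule groupI)
  fix A :: "'n rmat" assume A: "A \<in> carrier SL"
  then have "det A = 1" by (simp add: SL_def)
  then have "invertible A" by (simp add: invertible_det_nz)
  then obtain B where B: "A ** B = mat 1" "B ** A = mat 1" by (auto simp: invertible_def)
  then have "det B * det A = 1" by (metis det_I det_mul)
  with \<open>det A = 1\<close> B show "\<exists>B\<in>carrier SL. B \<otimes>\<^bsub>SL\<^esub> A = \<one>\<^bsub>SL\<^esub>"
    by (auto simp: SL_def)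
qed (auto simp: SL_def det_mul matrix_mul_assoc)

lemma uminus_mat_mult:
  fixes A :: "('n::finite) rmat"
  shows "(- mat 1) ** A = - A" "A ** (- mat 1) = - A"
  using scalar_matrix_assoc[of "-1" "mat 1" A] matrix_scalar_ac[of A "-1" "mat 1"] by simp_all

lemma normal_SL_centre: "SL_centre \<lhd> (SL :: ('n::finite) rmat monoid)"
proof -
  interpret group "SL :: 'n rmat monoid" by (rule group_SL)
  have one: "(mat 1 :: 'n rmat) = \<one>\<^bsub>SL\<^esub>" by (simp add: SL_def)
  have mm: "(- mat 1) \<otimes>\<^bsub>SL\<^esub> (- mat 1) = (\<one>\<^bsub>SL\<^esub> :: 'n rmat)"
    by (simp add: SL_def uminus_mat_mult)
  have "subgroup SL_centre (SL :: 'n rmat monoid)"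
  proof (rule subgroupI)
    fix A :: "'n rmat" assume A: "A \<in> SL_centre"
    then have "A \<otimes>\<^bsub>SL\<^esub> A = \<one>\<^bsub>SL\<^esub>" using mm one unfolding SL_centre_def by (auto simp: one)
    with A show "inv\<^bsub>SL\<^esub> A \<in> SL_centre"
      using inv_equality[of A A] by (simp add: SL_centre_def)
  next
    fix A B :: "'n rmat" assume "A \<in> SL_centre" "B \<in> SL_centre"
    then show "A \<otimes>\<^bsub>SL\<^esub> B \<in> SL_centre"
      by (auto simp: SL_centre_def SL_def det_mul uminus_mat_mult)
  qed (auto simp: SL_centre_def SL_def)
  moreover have "A \<otimes>\<^bsub>SL\<^esub> C \<otimes>\<^bsub>SL\<^esub> inv\<^bsub>SL\<^esub> A \<in> SL_centre"
    if A: "A \<in> carrier SL" and C: "C \<in> SL_centre" for A C :: "'n rmat"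
  proof -
    have "A \<otimes>\<^bsub>SL\<^esub> C = C \<otimes>\<^bsub>SL\<^esub> A" using C by (auto simp: SL_centre_def SL_def uminus_mat_mult)
    moreover have "C \<in> carrier SL" using C by (simp add: SL_centre_def)
    ultimately have "A \<otimes>\<^bsub>SL\<^esub> C \<otimes>\<^bsub>SL\<^esub> inv\<^bsub>SL\<^esub> A = C" using A by (simp add: m_assoc)
    with C show ?thesis by simp
  qed
  ultimately show ?thesis by (simp add: normal_inv_iff)
qed

lemma group_PSL: "group (PSL :: ('n::finite) rmat set monoid)"
  unfolding PSL_def by (rule normal.factorgroup_is_group[OF normal_SL_centre])


section \<open>Complete flags\<close>

text \<open>
  A flag is a function of the dimension, normalised by \<open>F 0 = {0}\<close> and \<open>F i = \<real>\<^sup>n\<close> for \<open>i \<ge> n\<close>.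
\<close>

definition flags :: "('n::finite) flag set" where
  "flags = {F. (\<forall>i. subspace (F i) \<and> dim (F i) = min i CARD('n)) \<and> mono F}"

definition transverse :: "('n::finite) flag \<Rightarrow> 'n flag \<Rightarrow> bool" where
  "transverse F G \<longleftrightarrow> (\<forall>i\<le>CARD('n). F i \<inter> G (CARD('n) - i) = {0})"

text \<open>The \<open>i\<close>-th subspace is spanned by the first \<open>i\<close> columns of the matrix.\<close>

definition flag_of_matrix :: "('n::{finite,linorder}) rmat \<Rightarrow> nat \<Rightarrow> 'n rvec set" where
  "flag_of_matrix A i = span ((\<lambda>k. column k A) ` {k. card {l. l < k} < i})"

text \<open>The quotient topology of GL(n)/(upper triangular matrices).\<close>

definition flag_topology :: "('n::{finite,linorder}) flag topology" where
  "flag_topology =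
     topology (\<lambda>U. U \<subseteq> flags \<and> open {A. invertible A \<and> flag_of_matrix A \<in> U})"

lemma openin_flag_topology:
  "openin flag_topology U \<longleftrightarrow>
     U \<subseteq> flags \<and> open {A :: ('n::{finite,linorder}) rmat. invertible A \<and> flag_of_matrix A \<in> U}"
proof -
  have "istopology (\<lambda>U. U \<subseteq> flags \<and>
          open {A :: 'n rmat. invertible A \<and> flag_of_matrix A \<in> U})"
    unfolding istopology_def
  proof (intro conjI allI impI)
    fix S T :: "'n flag set"
    assume "S \<subseteq> flags \<and> open {A. invertible A \<and> flag_of_matrix A \<in> S}"
      and "T \<subseteq> flags \<and> open {A. invertible A \<and> flag_of_matrix A \<in> T}"
    then have "open ({A. invertible A \<and> flag_of_matrix A \<in> S} \<inter>
                     {A. invertible A \<and> flag_of_matrix A \<in> T})" by blast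
    then show "open {A. invertible A \<and> flag_of_matrix A \<in> S \<inter> T}"
      by (rule back_subst[where P = "open"]) auto
  next
    fix \<K> :: "'n flag set set"
    assume *: "\<forall>K\<in>\<K>. K \<subseteq> flags \<and> open {A. invertible A \<and> flag_of_matrix A \<in> K}"
    then have "open (\<Union>K\<in>\<K>. {A. invertible A \<and> flag_of_matrix A \<in> K})" by blast
    then show "open {A. invertible A \<and> flag_of_matrix A \<in> \<Union>\<K>}"
      by (rule back_subst[where P = "open"]) auto
  qed auto
  then show ?thesis unfolding flag_topology_def by (simp add: topology_inverse')
qed

text \<open>
  The set of images under the representatives of \<open>h\<close> is a singleton, since \<open>A\<close> and \<open>-A\<close> move
  subspaces in the same way.
\<close>

definition flag_act :: "('n::finite) rmat set \<Rightarrow> 'n flag \<Rightarrow> nat \<Rightarrow> 'n rvec set" where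
  "flag_act h F = the_elem ((\<lambda>A i. (\<lambda>v. A *v v) ` F i) ` h)"


section \<open>Oriented subspaces\<close>

text \<open>
  Change-of-basis matrices between bases of a \<open>d\<close>-dimensional subspace have size \<open>d\<close> depending on a
  natural number, so their determinant is written out rather than taken from type-indexed matrices.
\<close>

definition leibniz_det :: "nat \<Rightarrow> (nat \<Rightarrow> nat \<Rightarrow> real) \<Rightarrow> real" where
  "leibniz_det d M = (\<Sum>p | p permutes {..<d}. of_int (sign p) * (\<Prod>i<d. M i (p i)))"

definition pos_related :: "('n::finite) rvec list \<Rightarrow> 'n rvec list \<Rightarrow> bool" where
  "pos_related vs ws \<longleftrightarrow> length ws = length vs \<and>
     (\<exists>M. leibniz_det (length vs) M > 0 \<and>
        (\<forall>i<length vs. ws ! i = (\<Sum>j<length vs. M i j *\<^sub>R vs ! j)))"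

text \<open>
  An oriented subspace is encoded as the set of its positively oriented ordered bases; the only
  orientation of \<open>{0}\<close> is \<open>{[]}\<close>.
\<close>

definition orient :: "('n::finite) rvec list \<Rightarrow> 'n rvec list set" where
  "orient vs = {ws. pos_related vs ws}"

definition ordered_bases :: "('n::finite) rvec set \<Rightarrow> 'n rvec list set" where
  "ordered_bases V = {vs. distinct vs \<and> independent (set vs) \<and> span (set vs) = V}"

definition orientations :: "('n::finite) rvec set \<Rightarrow> 'n rvec list set set" where
  "orientations V = orient ` ordered_bases V"

definition opposite :: "('n::finite) rvec list set \<Rightarrow> 'n rvec list set" where
  "opposite O' = ordered_bases (span (\<Union>vs\<in>O'. set vs)) - O'"

definition standard_orientation :: "('n::{finite,linorder}) rvec list set" where
  "standard_orientation = orient (map (\<lambda>k. axis k 1) (sorted_list_of_set UNIV))"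

definition oriented_sum :: "('n::finite) rvec list set \<Rightarrow> 'n rvec list set \<Rightarrow> 'n rvec list set" where
  "oriented_sum O' P' = (\<Union>vs\<in>O'. \<Union>ws\<in>P'. orient (vs @ ws))"


section \<open>Oriented flags\<close>

text \<open>Complete flags with a choice of orientation in each dimension \<open>1, \<dots>, n - 1\<close>.\<close>

definition lifts :: "('n::{finite,linorder}) oflag set" where
  "lifts = {F'. (\<exists>F\<in>flags. \<forall>i. F' i \<in> orientations (F i)) \<and>
                (\<forall>i\<ge>CARD('n). F' i = standard_orientation)}"

definition reverse_odd ::
  "('n::{finite,linorder}) oflag \<Rightarrow> nat \<Rightarrow> 'n rvec list set" where
  "reverse_odd F' = (\<lambda>i. if odd i \<and> i < CARD('n) then opposite (F' i) else F' i)"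

text \<open>A point of \<open>Flag\<^sup>+\<close> is the set of its lifts: one if \<open>n\<close> is odd, two if \<open>n\<close> is even.\<close>

definition Flag_plus :: "('n::{finite,linorder}) oflag set set" where
  "Flag_plus = lifts // {(F', G'). F' \<in> lifts \<and> G' \<in> lifts \<and>
                                   (G' = F' \<or> even CARD('n) \<and> G' = reverse_odd F')}"

definition Flag_plus_act ::
  "('n::finite) rmat set \<Rightarrow> 'n oflag set \<Rightarrow> 'n oflag set" where
  "Flag_plus_act h X = {(\<lambda>i. map (\<lambda>v. A *v v) ` F' i) | A F'. A \<in> h \<and> F' \<in> X}"

definition hyperconvex ::
  "('n::{finite,linorder}) oflag set \<Rightarrow> 'n oflag set \<Rightarrow>
   'n oflag set \<Rightarrow> bool" where
  "hyperconvex X1 X2 X3 \<longleftrightarrow> X1 \<in> Flag_plus \<and> X2 \<in> Flag_plus \<and> X3 \<in> Flag_plus \<and>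
     (\<exists>F1\<in>X1. \<exists>F2\<in>X2. \<exists>F3\<in>X3. \<forall>i1 i2 i3.
        i1 < CARD('n) \<and> i2 < CARD('n) \<and> i3 < CARD('n) \<and> i1 + i2 + i3 = CARD('n) \<longrightarrow>
        oriented_sum (oriented_sum (F1 i1) (F2 i2)) (F3 i3) = standard_orientation)"


section \<open>The projective line\<close>

definition RP1 :: "(real^2) set set" where
  "RP1 = {L. subspace L \<and> dim L = 1}"

definition RP1_topology :: "(real^2) set topology" where
  "RP1_topology = topology (\<lambda>U. U \<subseteq> RP1 \<and> open {v. v \<noteq> 0 \<and> span {v} \<in> U})"

lemma openin_RP1_topology:
  "openin RP1_topology U \<longleftrightarrow> U \<subseteq> RP1 \<and> open {v. v \<noteq> 0 \<and> span {v} \<in> U}"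
proof -
  have "istopology (\<lambda>U. U \<subseteq> RP1 \<and> open {v. v \<noteq> 0 \<and> span {v} \<in> U})"
    unfolding istopology_def
  proof (intro conjI allI impI)
    fix S T
    assume "S \<subseteq> RP1 \<and> open {v. v \<noteq> 0 \<and> span {v} \<in> S}"
      and "T \<subseteq> RP1 \<and> open {v. v \<noteq> 0 \<and> span {v} \<in> T}"
    then have "open ({v. v \<noteq> 0 \<and> span {v} \<in> S} \<inter> {v. v \<noteq> 0 \<and> span {v} \<in> T})" by blast
    then show "open {v. v \<noteq> 0 \<and> span {v} \<in> S \<inter> T}"
      by (rule back_subst[where P = "open"]) auto
  next
    fix \<K> assume "\<forall>K\<in>\<K>. K \<subseteq> RP1 \<and> open {v. v \<noteq> 0 \<and> span {v} \<in> K}"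
    then have "open (\<Union>K\<in>\<K>. {v. v \<noteq> 0 \<and> span {v} \<in> K})" by blast
    then show "open {v. v \<noteq> 0 \<and> span {v} \<in> \<Union>\<K>}"
      by (rule back_subst[where P = "open"]) auto
  qed auto
  then show ?thesis unfolding RP1_topology_def by (simp add: topology_inverse')
qed

definition RP1_act :: "(real^2^2) set \<Rightarrow> (real^2) set \<Rightarrow> (real^2) set" where
  "RP1_act h L = the_elem ((\<lambda>A. (\<lambda>v. A *v v) ` L) ` h)"

text \<open>
  The cyclic order of \<open>\<real>/\<pi>\<int>\<close>, a line being given by its angle: directions \<open>u, v, w\<close> of the three
  lines can be chosen at angles \<open>\<alpha> < \<beta> < \<gamma> < \<alpha> + \<pi>\<close>, positive angles being those of the standard
  orientation of the plane.  For \<open>n = 2\<close> this is exactly hyperconvexity.  (The index type \<open>2\<close> is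
  ordered by \<open>0 < 1\<close>, where \<open>2 = 0\<close>, so \<open>axis 2 1\<close> is the first standard basis vector.)
\<close>

definition cyclically_ordered :: "(real^2) set \<Rightarrow> (real^2) set \<Rightarrow> (real^2) set \<Rightarrow> bool" where
  "cyclically_ordered x y z \<longleftrightarrow> x \<in> RP1 \<and> y \<in> RP1 \<and> z \<in> RP1 \<and>
     (\<exists>u\<in>x. \<exists>v\<in>y. \<exists>w\<in>z. [u, v] \<in> standard_orientation \<and>
        [v, w] \<in> standard_orientation \<and> [u, w] \<in> standard_orientation)"

definition arc :: "(real^2) set \<Rightarrow> (real^2) set \<Rightarrow> (real^2) set set" where
  "arc a b = {x. cyclically_ordered a x b}"


section \<open>Free groups and purely hyperbolic Schottky representations\<close>

text \<open>A letter \<open>(i, True)\<close> stands for \<open>x i\<close> and \<open>(i, False)\<close> for its inverse.\<close>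

definition word_value :: "('a, 'b) monoid_scheme \<Rightarrow> ('i \<Rightarrow> 'a) \<Rightarrow> ('i \<times> bool) list \<Rightarrow> 'a" where
  "word_value G x w =
     foldr (\<lambda>(i, e) y. (if e then x i else inv\<^bsub>G\<^esub> (x i)) \<otimes>\<^bsub>G\<^esub> y) w \<one>\<^bsub>G\<^esub>"

definition reduced :: "('i \<times> bool) list \<Rightarrow> bool" where
  "reduced w \<longleftrightarrow> (\<forall>k. Suc k < length w \<longrightarrow>
     \<not> (fst (w ! k) = fst (w ! Suc k) \<and> snd (w ! k) \<noteq> snd (w ! Suc k)))"

definition free_basis :: "('a, 'b) monoid_scheme \<Rightarrow> 'i set \<Rightarrow> ('i \<Rightarrow> 'a) \<Rightarrow> bool" where
  "free_basis G I x \<longleftrightarrow> group G \<and> x ` I \<subseteq> carrier G \<and> generate G (x ` I) = carrier G \<and>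
     (\<forall>w. fst ` set w \<subseteq> I \<and> reduced w \<and> w \<noteq> [] \<longrightarrow> word_value G x w \<noteq> \<one>\<^bsub>G\<^esub>)"

text \<open>
  The \<open>2g\<close> intervals are \<open>arc (a j s) (b j s)\<close>, where \<open>s = True\<close> stands for the sign \<open>+\<close>.
  The group generated by \<open>A 1, \<dots>, A g\<close> is free on the \<open>A j\<close>, hence identified with the free group
  \<open>F\<close> by sending \<open>x j\<close> to \<open>A j\<close>; accordingly \<open>\<rho>\<close> is the homomorphism with \<open>\<rho> (x j) = h j\<close>.
\<close>

definition purely_hyperbolic_schottky ::
  "('f, 'e) monoid_scheme \<Rightarrow> nat \<Rightarrow> (nat \<Rightarrow> 'f) \<Rightarrow>
   ('f \<Rightarrow> ('n::{finite,linorder}) rmat set) \<Rightarrow> bool" where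
  "purely_hyperbolic_schottky F g x \<rho> \<longleftrightarrow>
     (\<exists>(A :: nat \<Rightarrow> (real^2^2) set)
       (a :: nat \<Rightarrow> bool \<Rightarrow> (real^2) set) (b :: nat \<Rightarrow> bool \<Rightarrow> (real^2) set)
       (\<xi> :: (real^2) set \<Rightarrow> 'n oflag set)
       (h :: nat \<Rightarrow> 'n rmat set).
        (\<forall>j\<in>{1..g}. A j \<in> carrier PSL) \<and>
        (\<forall>j\<in>{1..g}. \<forall>s. a j s \<in> RP1 \<and> b j s \<in> RP1 \<and> a j s \<noteq> b j s) \<and>
        (\<forall>j\<in>{1..g}. \<forall>k\<in>{1..g}. \<forall>s t. (j, s) \<noteq> (k, t) \<longrightarrow>
           disjnt (RP1_topology closure_of arc (a j s) (b j s))
                  (RP1_topology closure_of arc (a k t) (b k t))) \<and>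
        (\<forall>j\<in>{1..g}. RP1_act (A j) ` arc (b j False) (a j False) = arc (a j True) (b j True)) \<and>
        (let E = {e. \<exists>j\<in>{1..g}. \<exists>s. e = a j s \<or> e = b j s} in
           (\<forall>e\<in>E. \<xi> e \<in> Flag_plus) \<and>
           (\<forall>e1\<in>E. \<forall>e2\<in>E. \<forall>e3\<in>E. cyclically_ordered e1 e2 e3 \<longrightarrow>
              hyperconvex (\<xi> e1) (\<xi> e2) (\<xi> e3))) \<and>
        (\<forall>j\<in>{1..g}. h j \<in> carrier PSL \<and>
           Flag_plus_act (h j) (\<xi> (b j False)) = \<xi> (a j True) \<and>
           Flag_plus_act (h j) (\<xi> (a j False)) = \<xi> (b j True)) \<and>
        \<rho> \<in> hom F PSL \<and> (\<forall>j\<in>{1..g}. \<rho> (x j) = h j))"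


section \<open>Word hyperbolic groups and their Gromov boundary\<close>

definition word_length :: "('a, 'b) monoid_scheme \<Rightarrow> 'a set \<Rightarrow> 'a \<Rightarrow> nat" where
  "word_length G S y =
     (LEAST k. \<exists>w. length w = k \<and> fst ` set w \<subseteq> S \<and> word_value G (\<lambda>s. s) w = y)"

definition word_dist :: "('a, 'b) monoid_scheme \<Rightarrow> 'a set \<Rightarrow> 'a \<Rightarrow> 'a \<Rightarrow> real" where
  "word_dist G S y z = real (word_length G S (inv\<^bsub>G\<^esub> y \<otimes>\<^bsub>G\<^esub> z))"

definition gromov_product :: "('a, 'b) monoid_scheme \<Rightarrow> 'a set \<Rightarrow> 'a \<Rightarrow> 'a \<Rightarrow> 'a \<Rightarrow> real" where
  "gromov_product G S o' y z = (word_dist G S o' y + word_dist G S o' z - word_dist G S y z) / 2"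

definition word_hyperbolic :: "('a, 'b) monoid_scheme \<Rightarrow> 'a set \<Rightarrow> bool" where
  "word_hyperbolic G S \<longleftrightarrow> group G \<and> finite S \<and> S \<subseteq> carrier G \<and> generate G S = carrier G \<and>
     (\<exists>\<delta>. \<forall>o'\<in>carrier G. \<forall>x\<in>carrier G. \<forall>y\<in>carrier G. \<forall>z\<in>carrier G.
        gromov_product G S o' x z \<ge> min (gromov_product G S o' x y) (gromov_product G S o' y z) - \<delta>)"

definition boundary_rel ::
  "('a, 'b) monoid_scheme \<Rightarrow> 'a set \<Rightarrow> ((nat \<Rightarrow> 'a) \<times> (nat \<Rightarrow> 'a)) set" where
  "boundary_rel G S = {(u, v). range u \<subseteq> carrier G \<and> range v \<subseteq> carrier G \<and>
     filterlim (\<lambda>(i, j). gromov_product G S \<one>\<^bsub>G\<^esub> (u i) (v j)) at_top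
       (sequentially \<times>\<^sub>F sequentially)}"

definition gromov_boundary :: "('a, 'b) monoid_scheme \<Rightarrow> 'a set \<Rightarrow> (nat \<Rightarrow> 'a) set set" where
  "gromov_boundary G S = {u. (u, u) \<in> boundary_rel G S} // boundary_rel G S"

text \<open>
  The points \<open>q\<close> with \<open>liminf (u i | v j) \<ge> r\<close> for some sequences \<open>u\<close> in \<open>p\<close> and \<open>v\<close> in \<open>q\<close>;
  these sets (\<open>r\<close> varying) form the usual neighbourhood basis of \<open>p\<close>.
\<close>

definition boundary_nhd ::
  "('a, 'b) monoid_scheme \<Rightarrow> 'a set \<Rightarrow> (nat \<Rightarrow> 'a) set \<Rightarrow> real \<Rightarrow> (nat \<Rightarrow> 'a) set set" where
  "boundary_nhd G S p r = {q \<in> gromov_boundary G S. \<exists>u\<in>p. \<exists>v\<in>q.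
     \<forall>\<^sub>F (i, j) in sequentially \<times>\<^sub>F sequentially. gromov_product G S \<one>\<^bsub>G\<^esub> (u i) (v j) \<ge> r}"

definition boundary_topology ::
  "('a, 'b) monoid_scheme \<Rightarrow> 'a set \<Rightarrow> (nat \<Rightarrow> 'a) set topology" where
  "boundary_topology G S =
     topology (\<lambda>U. U \<subseteq> gromov_boundary G S \<and> (\<forall>p\<in>U. \<exists>r. boundary_nhd G S p r \<subseteq> U))"

lemma boundary_nhd_mono: "r \<le> r' \<Longrightarrow> boundary_nhd G S p r' \<subseteq> boundary_nhd G S p r"
proof
  fix q
  assume "r \<le> r'" and "q \<in> boundary_nhd G S p r'"
  then obtain u v where "q \<in> gromov_boundary G S" "u \<in> p" "v \<in> q"
    and "\<forall>\<^sub>F (i, j) in sequentially \<times>\<^sub>F sequentially. gromov_product G S \<one>\<^bsub>G\<^esub> (u i) (v j) \<ge> r'"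
    by (auto simp: boundary_nhd_def)
  moreover from this(4) \<open>r \<le> r'\<close>
  have "\<forall>\<^sub>F (i, j) in sequentially \<times>\<^sub>F sequentially. gromov_product G S \<one>\<^bsub>G\<^esub> (u i) (v j) \<ge> r"
    by (auto elim!: eventually_mono)
  ultimately show "q \<in> boundary_nhd G S p r" by (auto simp: boundary_nhd_def)
qed

lemma openin_boundary_topology:
  "openin (boundary_topology G S) U \<longleftrightarrow>
     U \<subseteq> gromov_boundary G S \<and> (\<forall>p\<in>U. \<exists>r. boundary_nhd G S p r \<subseteq> U)"
proof -
  have "istopology (\<lambda>U. U \<subseteq> gromov_boundary G S \<and> (\<forall>p\<in>U. \<exists>r. boundary_nhd G S p r \<subseteq> U))"
    unfolding istopology_def
  proof (intro conjI allI impI ballI)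
    fix U V p
    assume U: "U \<subseteq> gromov_boundary G S \<and> (\<forall>p\<in>U. \<exists>r. boundary_nhd G S p r \<subseteq> U)"
      and V: "V \<subseteq> gromov_boundary G S \<and> (\<forall>p\<in>V. \<exists>r. boundary_nhd G S p r \<subseteq> V)"
      and p: "p \<in> U \<inter> V"
    from U p obtain r where r: "boundary_nhd G S p r \<subseteq> U" by blast
    from V p obtain r' where r': "boundary_nhd G S p r' \<subseteq> V" by blast
    have "boundary_nhd G S p (max r r') \<subseteq> U \<inter> V"
      using r r' boundary_nhd_mono[of r "max r r'" G S p]
        boundary_nhd_mono[of r' "max r r'" G S p] by auto
    then show "\<exists>r. boundary_nhd G S p r \<subseteq> U \<inter> V" by blast
  next
    fix \<K> p
    assume K: "\<forall>K\<in>\<K>. K \<subseteq> gromov_boundary G S \<and> (\<forall>p\<in>K. \<exists>r. boundary_nhd G S p r \<subseteq> K)"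
      and "p \<in> \<Union>\<K>"
    then obtain K where "K \<in> \<K>" "p \<in> K" by blast
    with K obtain r where "boundary_nhd G S p r \<subseteq> K" by blast
    with \<open>K \<in> \<K>\<close> show "\<exists>r. boundary_nhd G S p r \<subseteq> \<Union>\<K>" by blast
  qed blast+
  then show ?thesis unfolding boundary_topology_def by (simp add: topology_inverse')
qed

definition boundary_act ::
  "('a, 'b) monoid_scheme \<Rightarrow> 'a \<Rightarrow> (nat \<Rightarrow> 'a) set \<Rightarrow> (nat \<Rightarrow> 'a) set" where
  "boundary_act G y p = (\<lambda>u i. y \<otimes>\<^bsub>G\<^esub> u i) ` p"


section \<open>Anosov representations\<close>

text \<open>
  Locally uniform convergence on the set of flags transverse to \<open>F_-\<close>: every such flag has a
  neighbourhood on which the convergence is uniform.  As the limit is constant, uniformity only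
  refers to the neighbourhoods \<open>U\<close> of the point \<open>F_+\<close>.
\<close>

definition contracting ::
  "(nat \<Rightarrow> ('n::{finite,linorder}) rmat set) \<Rightarrow>
   'n flag \<Rightarrow> 'n flag \<Rightarrow> bool" where
  "contracting h Fp Fm \<longleftrightarrow> Fp \<in> flags \<and> Fm \<in> flags \<and>
     (\<forall>H\<in>flags. transverse H Fm \<longrightarrow>
        (\<exists>N. openin flag_topology N \<and> H \<in> N \<and>
           (\<forall>U. openin flag_topology U \<and> Fp \<in> U \<longrightarrow>
              (\<forall>\<^sub>F m in sequentially. \<forall>K\<in>N. transverse K Fm \<longrightarrow> flag_act (h m) K \<in> U))))"

definition flag_limit_set ::
  "('n::{finite,linorder}) rmat set set \<Rightarrow> 'n flag set" where
  "flag_limit_set H = {Fp. \<exists>h Fm. range h \<subseteq> H \<and> contracting h Fp Fm}"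

text \<open>
  \<open>B\<close> is the group of upper triangular matrices, so that the flag manifold of the definition is the
  space of complete flags.  Word hyperbolicity and the boundary do not depend on the finite
  generating set \<open>S\<close>.
\<close>

definition B_anosov ::
  "('f, 'e) monoid_scheme \<Rightarrow> ('f \<Rightarrow> ('n::{finite,linorder}) rmat set) \<Rightarrow> bool" where
  "B_anosov G \<rho> \<longleftrightarrow> \<rho> \<in> hom G PSL \<and>
     (\<exists>S. word_hyperbolic G S \<and>
        (\<exists>\<zeta>. embedding_map (boundary_topology G S) flag_topology \<zeta> \<and>
           (\<forall>y\<in>carrier G. \<forall>p\<in>gromov_boundary G S.
              \<zeta> (boundary_act G y p) = flag_act (\<rho> y) (\<zeta> p)) \<and>
           \<zeta> ` gromov_boundary G S = flag_limit_set (\<rho> ` carrier G) \<and>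
           (\<forall>p\<in>gromov_boundary G S. \<forall>q\<in>gromov_boundary G S.
              p \<noteq> q \<longrightarrow> transverse (\<zeta> p) (\<zeta> q)))) \<and>
     (\<forall>y. range y \<subseteq> carrier G \<and>
          (\<forall>K. finite K \<longrightarrow> (\<forall>\<^sub>F m in sequentially. y m \<notin> K)) \<longrightarrow>
        (\<exists>k Fp Fm. strict_mono k \<and> contracting (\<lambda>m. \<rho> (y (k m))) Fp Fm))"

end

theory Submission
  imports Defs "Jordan_Normal_Form.Determinant" "HOL-Library.Diagonal_Subsequence"
begin

text \<open>
  The representation is a ping-pong action in which the players are cones of totally positive
  matrices.  Write \<open>(\<alpha> s, \<beta> s)\<close> for the endpoints of the interval of a letter \<open>s\<close>, that is, of a
  generator or the inverse of one, and choose a basis \<open>B s\<close> of \<open>\<real>\<^sup>n\<close> adapted to the pair of flags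
  \<open>\<xi> (\<alpha> s)\<close>, \<open>\<xi> (\<beta> s)\<close>.  If the letter \<open>t\<close> is not the inverse of \<open>s\<close>, then \<open>s\<close> maps the interval of \<open>t\<close>
  into the interval of \<open>s\<close>, and the matrix \<open>M s t\<close> of this map with respect to the bases \<open>B t\<close> and \<open>B s\<close>
  is, up to sign, strictly totally positive: hyperconvexity of two triples of flags says exactly that
  two families of minors are positive, and these suffice by a criterion of Cryer's type
  (\<open>hyperconvex_STP\<close>, \<open>STP_criterion\<close>).  A reduced word \<open>s1 s2 \<dots> sm\<close>, continued by a letter \<open>r\<close>, thus
  acts as \<open>B s1\<close> times the product of \<open>M s1 s2, \<dots>, M sm r\<close> times the inverse of \<open>B r\<close>.

  There are only finitely many matrices \<open>M s t\<close>, and products of strictly totally positive matrices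
  from a finite set contract uniformly.  Indeed, all exterior powers are positive, so that ratios of
  minors in fixed rows become independent of the columns at an exponential rate
  (\<open>minor_ratio_oscillation\<close>).  For the triangular factorization of a product into a lower unipotent,
  a diagonal and an upper unipotent matrix this means that the unipotent factors stay bounded, that
  the lower one converges along an infinite word, and that the quotients of consecutive diagonal
  entries tend to 0 (\<open>lower_factor_mprod_limit\<close>, \<open>mprod_factorization\<close>).  Hence every sequence of group elements of growing word
  length has a subsequence that contracts towards the flag determined by the limit of the lower
  factors; the inverse elements contract towards the repelling flag (\<open>contraction_subsequence\<close>).

  The Gromov boundary of a free group consists of the infinite reduced words, and the boundary map
  sends a word to the limit flag along its prefixes.  Since attracting flags are unique, the map is
  equivariant and its image is the limit set.  The limit flag of a word that does not begin with \<open>a\<close> is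
  the repelling flag of words continued by \<open>a\<close>; it is therefore transverse to all flags that are
  positive with respect to \<open>B a\<close>, because the relevant leading minors are sums of products of
  nonnegative minors with a positive term (\<open>transverse_end_flag\<close>).  This yields transversality of the
  limit flags of distinct ends and shows that the open set of positive flags attached to a letter
  contains exactly the limit flags of words that begin with that letter, so that the boundary map is an
  embedding (\<open>boundary_map_embedding\<close>).
\<close>

no_notation Matrix.vec_index (infixl "$" 100)
no_notation Matrix.scalar_prod (infix "\<bullet>" 70)
no_notation Matrix.transpose_mat ("(_\<^sup>T)" [1000])
hide_const (open) Matrix.vec Matrix.row Matrix.col Matrix.rows Matrix.cols
hide_type (open) Matrix.vec

section \<open>Determinants of matrices indexed by natural numbers\<close>

text \<open>
  Determinants whose size is a number have their theory for matrices of variable size, from which the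
  properties of the Leibniz sum are transferred.
\<close>

lemma leibniz_det_eq_det:
  "leibniz_det d M = Determinant.det (Matrix.mat d d (\<lambda>(i, j). M i j))"
proof -
  have "Determinant.det (Matrix.mat d d (\<lambda>(i, j). M i j)) =
      (\<Sum>p | p permutes {0..<d}. of_int (sign p) *
        (\<Prod>i = 0..<d. Matrix.mat d d (\<lambda>(i, j). M i j) $$ (i, p i)))"
    by (rule det_def') simp
  also have "\<dots> = leibniz_det d M"
    unfolding leibniz_det_def
  proof (rule sum.cong)
    fix p assume "p \<in> {p. p permutes {..<d}}"
    then have "p i < d" if "i < d" for i
      using that permutes_in_image[of p "{..<d}" i] by auto
    then show "of_int (sign p) * (\<Prod>i = 0..<d. Matrix.mat d d (\<lambda>(i, j). M i j) $$ (i, p i)) =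
       of_int (sign p) * (\<Prod>i<d. M i (p i))"
      by (simp add: atLeast0LessThan)
  qed (simp add: atLeast0LessThan)
  finally show ?thesis by simp
qed

lemma leibniz_det_cong:
  "(\<And>i j. i < d \<Longrightarrow> j < d \<Longrightarrow> M i j = N i j) \<Longrightarrow> leibniz_det d M = leibniz_det d N"
  unfolding leibniz_det_eq_det by (intro arg_cong[where f = Determinant.det] cong_mat) auto

lemma leibniz_det_transpose: "leibniz_det d (\<lambda>i j. M j i) = leibniz_det d M"
proof -
  have "Matrix.mat d d (\<lambda>(i, j). M j i) = transpose_mat (Matrix.mat d d (\<lambda>(i, j). M i j))"
    by (intro eq_matI) auto
  then show ?thesis
    unfolding leibniz_det_eq_det by (simp add: Determinant.det_transpose[of _ d])
qed

lemma leibniz_det_permute_rows: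
  assumes "p permutes {..<d}"
  shows "leibniz_det d (\<lambda>i j. M (p i) j) = of_int (sign p) * leibniz_det d M"
proof -
  have p: "p permutes {0..<d}" using assms by (simp add: atLeast0LessThan)
  have "p i < d" if "i < d" for i
    using that permutes_in_image[OF assms, of i] by auto
  then have "Matrix.mat d d (\<lambda>(i, j). M (p i) j) =
      Matrix.mat d d (\<lambda>(i, j). Matrix.mat d d (\<lambda>(i, j). M i j) $$ (p i, j))"
    by (intro eq_matI) auto
  then show ?thesis
    unfolding leibniz_det_eq_det by (simp add: Determinant.det_permute_rows[OF _ p])
qed

lemma leibniz_det_equal_rows:
  assumes "i < d" "j < d" "i \<noteq> j" "\<And>c. c < d \<Longrightarrow> M i c = M j c"
  shows "leibniz_det d M = 0"
  unfolding leibniz_det_eq_det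
  by (rule Determinant.det_identical_rows[of _ d i j]) (use assms in auto)

lemma leibniz_det_zero_row:
  assumes "i < d" "\<And>c. c < d \<Longrightarrow> M i c = 0"
  shows "leibniz_det d M = 0"
  unfolding leibniz_det_def
proof (rule sum.neutral, safe)
  fix p assume "p permutes {..<d}"
  then have "p i < d" using assms(1) permutes_in_image[of p "{..<d}" i] by auto
  then have "(\<Prod>i<d. M i (p i)) = 0" using assms by (intro prod_zero) auto
  then show "of_int (sign p) * (\<Prod>i<d. M i (p i)) = 0" by simp
qed

lemma leibniz_det_upper_triangular:
  assumes "\<And>i j. j < i \<Longrightarrow> i < d \<Longrightarrow> M i j = 0"
  shows "leibniz_det d M = (\<Prod>i<d. M i i)"
proof -
  have "diag_mat (Matrix.mat d d (\<lambda>(i, j). M i j)) = map (\<lambda>i. M i i) [0..<d]"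
    unfolding diag_mat_def by (auto intro!: map_cong)
  moreover have "upper_triangular (Matrix.mat d d (\<lambda>(i, j). M i j))"
    using assms by (auto simp: upper_triangular_def)
  ultimately show ?thesis
    unfolding leibniz_det_eq_det
    by (subst Determinant.det_upper_triangular[of _ d])
      (auto simp: prod.distinct_set_conv_list[symmetric] atLeast0LessThan)
qed

lemma leibniz_det_scale_rows:
  "leibniz_det d (\<lambda>i j. c i * M i j) = (\<Prod>i<d. c i) * leibniz_det d M"
  unfolding leibniz_det_def by (simp add: prod.distrib sum_distrib_left algebra_simps)

lemma leibniz_det_scale_cols:
  "leibniz_det d (\<lambda>i j. M i j * c j) = leibniz_det d M * (\<Prod>i<d. c i)"
  using leibniz_det_scale_rows[of d c "\<lambda>i j. M j i"] leibniz_det_transpose[of d M]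
    leibniz_det_transpose[of d "\<lambda>i j. M i j * c j"] by (simp add: mult.commute)

lemma leibniz_det_last_row:
  "leibniz_det (Suc d) M = (\<Sum>c<Suc d. M d c * ((-1) ^ (d + c) *
      leibniz_det d (\<lambda>i j. M i (if j < c then j else Suc j))))"
proof -
  let ?A = "Matrix.mat (Suc d) (Suc d) (\<lambda>(i, j). M i j)"
  have "mat_delete ?A d c = Matrix.mat d d (\<lambda>(i, j). M i (if j < c then j else Suc j))"
    if "c < Suc d" for c
    using that unfolding mat_delete_def by (intro eq_matI) auto
  then show ?thesis
    unfolding leibniz_det_eq_det
    by (subst laplace_expansion_row[of _ "Suc d" d]) (auto simp: cofactor_def)
qed

lemma leibniz_det_first_col:
  assumes "\<And>i. 0 < i \<Longrightarrow> i \<le> d \<Longrightarrow> M i 0 = 0"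
  shows "leibniz_det (Suc d) M = M 0 0 * leibniz_det d (\<lambda>i j. M (Suc i) (Suc j))"
proof -
  let ?A = "Matrix.mat (Suc d) (Suc d) (\<lambda>(i, j). M i j)"
  have *: "mat_delete ?A 0 0 = Matrix.mat d d (\<lambda>(i, j). M (Suc i) (Suc j))"
    unfolding mat_delete_def by (intro eq_matI) auto
  have "Determinant.det ?A = (\<Sum>i<Suc d. ?A $$ (i, 0) * cofactor ?A i 0)"
    by (rule laplace_expansion_column) auto
  also have "\<dots> = (\<Sum>i\<in>{0}. ?A $$ (i, 0) * cofactor ?A i 0)"
    by (rule sum.mono_neutral_right) (use assms in auto)
  finally show ?thesis
    unfolding leibniz_det_eq_det by (simp add: cofactor_def *)
qed

lemma leibniz_det_reverse:
  "leibniz_det d (\<lambda>i j. M (d - Suc i) (d - Suc j)) = leibniz_det d M"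
proof -
  define p where "p i = (if i < d then d - Suc i else i)" for i
  have p: "p permutes {..<d}"
  proof (rule bij_imp_permutes)
    show "bij_betw p {..<d} {..<d}"
      by (rule bij_betw_byWitness[where f' = p]) (auto simp: p_def)
  qed (simp add: p_def)
  have s: "of_int (sign p) * (of_int (sign p) :: real) = 1"
    by (metis of_int_mult of_int_1 sign_idempotent)
  have "leibniz_det d (\<lambda>i j. M (d - Suc i) (d - Suc j)) = leibniz_det d (\<lambda>i j. M (p i) (p j))"
    by (rule leibniz_det_cong) (auto simp: p_def)
  also have "\<dots> = of_int (sign p) * leibniz_det d (\<lambda>i j. M i (p j))"
    by (rule leibniz_det_permute_rows[OF p, of "\<lambda>i j. M i (p j)"])
  also have "leibniz_det d (\<lambda>i j. M i (p j)) = leibniz_det d (\<lambda>i j. M j (p i))"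
    by (rule leibniz_det_transpose[symmetric])
  also have "\<dots> = of_int (sign p) * leibniz_det d (\<lambda>i j. M j i)"
    by (rule leibniz_det_permute_rows[OF p, of "\<lambda>i j. M j i"])
  also have "leibniz_det d (\<lambda>i j. M j i) = leibniz_det d M"
    by (rule leibniz_det_transpose)
  finally show ?thesis using s by (simp add: mult.assoc[symmetric])
qed

lemma leibniz_det_eq_0_iff:
  "leibniz_det d M = 0 \<longleftrightarrow> (\<exists>v. (\<exists>j<d. v j \<noteq> 0) \<and> (\<forall>i<d. (\<Sum>j<d. M i j * v j) = 0))"
proof -
  let ?A = "Matrix.mat d d (\<lambda>(i, j). M i j)"
  have mv: "(?A *\<^sub>v v = 0\<^sub>v d) = (\<forall>i<d. (\<Sum>j<d. M i j * vec_index v j) = 0)" if "v \<in> carrier_vec d" for v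
    using that by (auto simp: Matrix.vec_eq_iff scalar_prod_def atLeast0LessThan)
  have "leibniz_det d M = 0 \<longleftrightarrow> (\<exists>v. v \<in> carrier_vec d \<and> v \<noteq> 0\<^sub>v d \<and> ?A *\<^sub>v v = 0\<^sub>v d)"
    unfolding leibniz_det_eq_det by (rule Determinant.det_0_iff_vec_prod_zero) auto
  also have "\<dots> \<longleftrightarrow> (\<exists>v. (\<exists>j<d. v j \<noteq> 0) \<and> (\<forall>i<d. (\<Sum>j<d. M i j * v j) = 0))"
    (is "?L \<longleftrightarrow> ?R")
  proof
    assume ?L
    then obtain v where v: "v \<in> carrier_vec d" "v \<noteq> 0\<^sub>v d" "?A *\<^sub>v v = 0\<^sub>v d" by blast
    then have "\<exists>j<d. vec_index v j \<noteq> 0" by (auto simp: Matrix.vec_eq_iff)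
    with v mv[OF v(1)] show ?R by (intro exI[of _ "vec_index v"]) auto
  next
    assume ?R
    then obtain v where v: "\<exists>j<d. v j \<noteq> 0" "\<forall>i<d. (\<Sum>j<d. M i j * v j) = 0" by blast
    have "Matrix.vec d v \<in> carrier_vec d" "Matrix.vec d v \<noteq> 0\<^sub>v d"
      using v(1) by (auto simp: Matrix.vec_eq_iff)
    moreover have "?A *\<^sub>v Matrix.vec d v = 0\<^sub>v d"
      by (subst mv) (use v(2) in auto)
    ultimately show ?L by blast
  qed
  finally show ?thesis .
qed

section \<open>Minors and the Cauchy--Binet formula\<close>

text \<open>
  Rows and columns are given by lists, so that minors can be expanded by recursion.
\<close>

definition minor :: "(nat \<Rightarrow> nat \<Rightarrow> real) \<Rightarrow> nat list \<Rightarrow> nat list \<Rightarrow> real" where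
  "minor A rs cs = leibniz_det (length rs) (\<lambda>i j. A (rs ! i) (cs ! j))"

definition strict_lists :: "nat \<Rightarrow> nat \<Rightarrow> nat list set" where
  "strict_lists n k = {ks. length ks = k \<and> sorted_wrt (<) ks \<and> set ks \<subseteq> {..<n}}"

lemma finite_strict_lists [simp]: "finite (strict_lists n k)"
  by (rule finite_subset[OF _ finite_lists_length_eq[of "{..<n}" k]])
    (auto simp: strict_lists_def)

lemma strict_lists_eqI:
  assumes "ks \<in> strict_lists n k" "ls \<in> strict_lists n k" "set ks = set ls"
  shows "ks = ls"
  using assms strict_sorted_equal by (auto simp: strict_lists_def)

lemma upt_strict_lists: "a + k \<le> n \<Longrightarrow> [a..<a+k] \<in> strict_lists n k"
  by (auto simp: strict_lists_def)

lemma minor_cong: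
  assumes "length cs = length rs" "\<And>i j. i \<in> set rs \<Longrightarrow> j \<in> set cs \<Longrightarrow> A i j = B i j"
  shows "minor A rs cs = minor B rs cs"
  unfolding minor_def by (rule leibniz_det_cong) (use assms in auto)

lemma minor_Nil [simp]: "minor A [] cs = 1"
  by (simp add: minor_def leibniz_det_def)

lemma minor_transpose:
  "length cs = length rs \<Longrightarrow> minor (\<lambda>i j. A j i) rs cs = minor A cs rs"
  unfolding minor_def by (subst leibniz_det_transpose[symmetric]) simp

text \<open>
  Expanding every row of the product leaves a sum over all functions \<open>f\<close> choosing a summand in
  each row; the non-injective ones have two equal rows, and an injective one is a strictly
  increasing list composed with a permutation.
\<close>

lemma Cauchy_Binet:
  assumes "length cs = length rs"
  shows "minor (\<lambda>i j. \<Sum>l<n. A i l * B l j) rs cs =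
    (\<Sum>ks\<in>strict_lists n (length rs). minor A rs ks * minor B ks cs)"
proof -
  define k where "k = length rs"
  define a where "a i l = A (rs ! i) l" for i l
  define b where "b l j = B l (cs ! j)" for l j
  let ?P = "{p. p permutes {..<k}}"
  let ?F = "{..<k} \<rightarrow>\<^sub>E {..<n}"
  have fP: "finite ?P" by (simp add: finite_permutations)
  have fF: "finite ?F" by (intro finite_PiE) auto
    define \<phi> where "\<phi> = (\<lambda>(ks :: nat list, p :: nat \<Rightarrow> nat). \<lambda>i\<in>{..<k}. ks ! p i)"
    have bij: "bij_betw \<phi> (strict_lists n k \<times> ?P) {f\<in>?F. inj_on f {..<k}}"
      unfolding bij_betw_def
    proof (intro conjI subset_antisym subsetI)
      have im: "set ks = \<phi> (ks, p) ` {..<k}" if "ks \<in> strict_lists n k" "p permutes {..<k}" for ks p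
      proof -
        have "\<phi> (ks, p) ` {..<k} = (\<lambda>i. ks ! p i) ` {..<k}" by (auto simp: \<phi>_def)
        also have "\<dots> = (!) ks ` p ` {..<k}" by auto
        also have "\<dots> = (!) ks ` {..<k}" using that permutes_image by metis
        also have "\<dots> = set ks" using that by (auto simp: strict_lists_def set_conv_nth)
        finally show ?thesis by simp
      qed
      show "inj_on \<phi> (strict_lists n k \<times> ?P)"
      proof (rule inj_onI, clarify)
        fix ks p ls q
        assume *: "ks \<in> strict_lists n k" "p permutes {..<k}" "ls \<in> strict_lists n k" "q permutes {..<k}"
          and eq: "\<phi> (ks, p) = \<phi> (ls, q)"
        have "ks = ls" using im[OF *(1,2)] im[OF *(3,4)] eq * by (intro strict_lists_eqI) auto
        moreover have "p i = q i" for i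
        proof (cases "i < k")
          case True
          then have lt: "p i < k" "q i < k"
            using permutes_in_image[OF *(2), of i] permutes_in_image[OF *(4), of i] by auto
          have "distinct ks" using *(1) strict_sorted_iff by (auto simp: strict_lists_def)
          moreover have "ks ! p i = ks ! q i"
            using fun_cong[OF eq, of i] True \<open>ks = ls\<close> by (simp add: \<phi>_def)
          ultimately show ?thesis using lt *(1) by (auto simp: strict_lists_def nth_eq_iff_index_eq)
        qed (use * in \<open>auto simp: permutes_def\<close>)
        ultimately show "ks = ls \<and> p = q" by blast
      qed
      fix f
      {
        assume "f \<in> \<phi> ` (strict_lists n k \<times> ?P)"
        then obtain ks p where f: "f = \<phi> (ks, p)" and ks: "ks \<in> strict_lists n k" and p: "p permutes {..<k}"
          by auto
        have lt: "p i < k" if "i < k" for i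
          using permutes_in_image[OF p, of i] that by auto
        have d: "distinct ks" using ks strict_sorted_iff by (auto simp: strict_lists_def)
        have "ks ! j < n" if "j < k" for j
          using ks that nth_mem[of j ks] by (auto simp: strict_lists_def subset_iff)
        then have "f \<in> ?F" using lt by (auto simp: f \<phi>_def)
        moreover have "inj_on f {..<k}"
        proof (rule inj_onI)
          fix i j assume ij: "i \<in> {..<k}" "j \<in> {..<k}" "f i = f j"
          then have "ks ! p i = ks ! p j" by (simp add: f \<phi>_def)
          then have "p i = p j"
            using d ks lt ij by (simp add: strict_lists_def nth_eq_iff_index_eq)
          then show "i = j" using permutes_inj[OF p] by (simp add: inj_eq)
        qed
        ultimately show "f \<in> {f\<in>?F. inj_on f {..<k}}" by blast
      }
      assume "f \<in> {f\<in>?F. inj_on f {..<k}}"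
      then have f: "f \<in> ?F" "inj_on f {..<k}" by auto
      define ks where "ks = sorted_list_of_set (f ` {..<k})"
      have ks: "ks \<in> strict_lists n k" "set ks = f ` {..<k}" "distinct ks" "length ks = k"
        using f by (auto simp: ks_def strict_lists_def card_image)
      define p where "p i = (if i < k then the_inv_into {..<k} ((!) ks) (f i) else i)" for i
      have bn: "bij_betw ((!) ks) {..<k} (f ` {..<k})"
        using ks by (intro bij_betw_nth) auto
      have "bij_betw (the_inv_into {..<k} ((!) ks) \<circ> f) {..<k} {..<k}"
        using inj_on_imp_bij_betw[OF f(2)] bij_betw_the_inv_into[OF bn] by (rule bij_betw_trans)
      moreover have "bij_betw p {..<k} {..<k} =
          bij_betw (the_inv_into {..<k} ((!) ks) \<circ> f) {..<k} {..<k}"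
        by (rule bij_betw_cong) (simp add: p_def)
      ultimately have "bij_betw p {..<k} {..<k}" by simp
      then have p: "p permutes {..<k}" by (rule bij_imp_permutes) (simp add: p_def)
      have "f i = \<phi> (ks, p) i" for i
      proof (cases "i < k")
        case True
        then show ?thesis using bn
          by (auto simp: \<phi>_def p_def bij_betw_def intro!: f_the_inv_into_f[symmetric])
      next
        case False
        then show ?thesis using PiE_arb[OF f(1), of i] by (simp add: \<phi>_def)
      qed
      then have "f = \<phi> (ks, p)" by blast
      with ks p show "f \<in> \<phi> ` (strict_lists n k \<times> ?P)" by blast
    qed
  have "leibniz_det k (\<lambda>i j. \<Sum>l<n. a i l * b l j) =
      (\<Sum>p\<in>?P. of_int (sign p) * (\<Sum>f\<in>?F. \<Prod>i<k. a i (f i) * b (f i) (p i)))"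
    unfolding leibniz_det_def by (subst prod_sum_PiE) auto
  also have "\<dots> = (\<Sum>f\<in>?F. \<Sum>p\<in>?P. of_int (sign p) * (\<Prod>i<k. a i (f i) * b (f i) (p i)))"
    by (subst sum.swap) (simp add: sum_distrib_left)
  also have "\<dots> = (\<Sum>f\<in>?F. (\<Prod>i<k. a i (f i)) * leibniz_det k (\<lambda>i j. b (f i) j))"
    unfolding leibniz_det_def
    by (simp add: prod.distrib sum_distrib_left algebra_simps)
  also have "\<dots> = (\<Sum>f\<in>{f\<in>?F. inj_on f {..<k}}. (\<Prod>i<k. a i (f i)) * leibniz_det k (\<lambda>i j. b (f i) j))"
  proof (rule sum.mono_neutral_right[OF fF], blast, rule ballI)
    fix f assume "f \<in> ?F - {f\<in>?F. inj_on f {..<k}}"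
    then obtain i j where "i < k" "j < k" "i \<noteq> j" "f i = f j" by (auto simp: inj_on_def)
    then have "leibniz_det k (\<lambda>i j. b (f i) j) = 0" by (intro leibniz_det_equal_rows[of i _ j]) auto
    then show "(\<Prod>i<k. a i (f i)) * leibniz_det k (\<lambda>i j. b (f i) j) = 0" by simp
  qed
  also have "\<dots> = (\<Sum>x\<in>strict_lists n k \<times> ?P.
      (\<Prod>i<k. a i (\<phi> x i)) * leibniz_det k (\<lambda>i j. b (\<phi> x i) j))"
    by (rule sum.reindex_bij_betw[OF bij, symmetric])
  also have "\<dots> = (\<Sum>(ks, p)\<in>strict_lists n k \<times> ?P.
      (\<Prod>i<k. a i (ks ! p i)) * (of_int (sign p) * leibniz_det k (\<lambda>i j. b (ks ! i) j)))"
  proof (rule sum.cong[OF refl])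
    fix x assume "x \<in> strict_lists n k \<times> ?P"
    then obtain ks p where x: "x = (ks, p)" and ks: "ks \<in> strict_lists n k" and p: "p permutes {..<k}"
      by auto
    have "leibniz_det k (\<lambda>i j. b (\<phi> (ks, p) i) j) = leibniz_det k (\<lambda>i j. b (ks ! p i) j)"
      by (rule leibniz_det_cong) (auto simp: \<phi>_def)
    also have "\<dots> = of_int (sign p) * leibniz_det k (\<lambda>i j. b (ks ! i) j)"
      by (rule leibniz_det_permute_rows[OF p, of "\<lambda>i j. b (ks ! i) j"])
    finally show "(\<Prod>i<k. a i (\<phi> x i)) * leibniz_det k (\<lambda>i j. b (\<phi> x i) j) =
        (case x of (ks, p) \<Rightarrow> (\<Prod>i<k. a i (ks ! p i)) *
          (of_int (sign p) * leibniz_det k (\<lambda>i j. b (ks ! i) j)))"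
      by (simp add: x \<phi>_def)
  qed
  also have "\<dots> = (\<Sum>ks\<in>strict_lists n k.
      leibniz_det k (\<lambda>i j. a i (ks ! j)) * leibniz_det k (\<lambda>i j. b (ks ! i) j))"
    unfolding leibniz_det_def[of k "\<lambda>i j. a i (_ ! j)"]
    by (subst sum.cartesian_product[symmetric]) (simp add: sum_distrib_left mult_ac)
  finally show ?thesis
    by (simp add: minor_def a_def b_def k_def strict_lists_def)
qed


section \<open>Expansion rules for minors\<close>

lemma minor_first_col:
  assumes "\<And>r'. r' \<in> set rs \<Longrightarrow> A r' c = 0"
  shows "minor A (r # rs) (c # cs) = A r c * minor A rs cs"
  unfolding minor_def using leibniz_det_first_col[of "length rs" "\<lambda>i j. A ((r # rs) ! i) ((c # cs) ! j)"] assms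
  by (simp add: nth_Cons' )

lemma minor_first_row:
  assumes "\<And>c'. c' \<in> set cs \<Longrightarrow> A r c' = 0" "length cs = length rs"
  shows "minor A (r # rs) (c # cs) = A r c * minor A rs cs"
  using minor_first_col[of cs "\<lambda>i j. A j i" r c rs] assms
    minor_transpose[where rs = "c # cs" and cs = "r # rs" and A = A]
    minor_transpose[where rs = cs and cs = rs and A = A] by simp

lemma minor_zero_row:
  assumes "r \<in> set rs" "\<And>c. c \<in> set cs \<Longrightarrow> A r c = 0" "length cs = length rs"
  shows "minor A rs cs = 0"
proof -
  obtain i where "i < length rs" "rs ! i = r" using assms(1) by (auto simp: in_set_conv_nth)
  then show ?thesis
    unfolding minor_def by (intro leibniz_det_zero_row[of i]) (use assms in auto)
qed

lemma minor_zero_col: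
  assumes "c \<in> set cs" "\<And>r. r \<in> set rs \<Longrightarrow> A r c = 0" "length cs = length rs"
  shows "minor A rs cs = 0"
  using minor_zero_row[of c cs rs "\<lambda>i j. A j i"] assms
    minor_transpose[where rs = cs and cs = rs and A = A] by simp

lemma minor_equal_rows:
  assumes "i < length rs" "j < length rs" "i \<noteq> j" "length cs = length rs"
    "\<And>c. c \<in> set cs \<Longrightarrow> A (rs ! i) c = A (rs ! j) c"
  shows "minor A rs cs = 0"
  unfolding minor_def by (rule leibniz_det_equal_rows[of i _ j]) (use assms in auto)

lemma minor_equal_cols:
  assumes "i < length cs" "j < length cs" "i \<noteq> j" "length cs = length rs"
    "\<And>r. r \<in> set rs \<Longrightarrow> A r (cs ! i) = A r (cs ! j)"
  shows "minor A rs cs = 0"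
proof -
  have "minor (\<lambda>i j. A j i) cs rs = 0"
    by (rule minor_equal_rows[OF assms(1-3) assms(4)[symmetric] assms(5)])
  then show ?thesis using minor_transpose[where rs = cs and cs = rs and A = A] assms(4) by simp
qed

lemma minor_rev:
  assumes "length cs = length rs"
  shows "minor A (rev rs) (rev cs) = minor A rs cs"
proof -
  have "leibniz_det (length rs) (\<lambda>i j. A (rs ! (length rs - Suc i)) (cs ! (length rs - Suc j))) =
      leibniz_det (length rs) (\<lambda>i j. A (rs ! i) (cs ! j))"
    by (rule leibniz_det_reverse[of "length rs" "\<lambda>i j. A (rs ! i) (cs ! j)"])
  moreover have "leibniz_det (length rs) (\<lambda>i j. A (rev rs ! i) (rev cs ! j)) =
      leibniz_det (length rs) (\<lambda>i j. A (rs ! (length rs - Suc i)) (cs ! (length rs - Suc j)))"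
    by (rule leibniz_det_cong) (use assms in \<open>simp add: rev_nth\<close>)
  ultimately show ?thesis by (simp add: minor_def)
qed

lemma minor_map:
  assumes "length cs = length rs"
  shows "minor A (map f rs) (map g cs) = minor (\<lambda>i j. A (f i) (g j)) rs cs"
  unfolding minor_def by (simp, rule leibniz_det_cong) (use assms in auto)

lemma minor_last_col:
  assumes "\<And>r'. r' \<in> set rs \<Longrightarrow> A r' c = 0" "length cs = length rs"
  shows "minor A (rs @ [r]) (cs @ [c]) = minor A rs cs * A r c"
proof -
  have "minor A (rs @ [r]) (cs @ [c]) = minor A (rev (rs @ [r])) (rev (cs @ [c]))"
    by (rule minor_rev[symmetric]) (simp add: assms)
  also have "\<dots> = A r c * minor A (rev rs) (rev cs)"
    using assms minor_first_col[of "rev rs" A c r "rev cs"] by simp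
  finally show ?thesis using assms by (simp add: minor_rev)
qed

lemma prod_nth_eq_prod_list: "(\<Prod>i<length xs. f (xs ! i)) = prod_list (map f xs)"
  for f :: "'a \<Rightarrow> 'b :: comm_monoid_mult"
  by (induction xs rule: rev_induct) (auto simp: nth_append)

lemma minor_scale_rows:
  "minor (\<lambda>i j. c i * A i j) rs cs = prod_list (map c rs) * minor A rs cs"
  unfolding minor_def by (simp add: leibniz_det_scale_rows prod_nth_eq_prod_list[symmetric])

lemma prod_list_pos: "(\<And>x. x \<in> set xs \<Longrightarrow> (0::real) < f x) \<Longrightarrow> 0 < prod_list (map f xs)"
  by (induction xs) auto

section \<open>Total positivity of triangular matrices\<close>

text \<open>
  Multiplication by this matrix on the left forms partial sums of rows.
\<close>

definition tri :: "nat \<Rightarrow> nat \<Rightarrow> real" where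
  "tri i j = (if j \<le> i then 1 else 0)"

lemma minor_tri_Cons:
  assumes "sorted_wrt (<) (i # I)" "sorted_wrt (<) (k # K)" "length K = length I"
  shows "minor tri (i # I) (k # K) =
    (if k \<le> i \<and> (\<forall>k'\<in>set K. i < k') then minor tri I K else 0)"
proof (cases "k \<le> i \<and> (\<forall>k'\<in>set K. i < k')")
  case True
  then have "minor tri (i # I) (k # K) = tri i k * minor tri I K"
    using assms by (intro minor_first_row) (auto simp: tri_def)
  with True show ?thesis by (simp add: tri_def)
next
  case False
  then consider "i < k" | "k \<le> i" "\<exists>k'\<in>set K. k' \<le> i" by force
  then have "minor tri (i # I) (k # K) = 0"
  proof cases
    case 1
    show ?thesis
      by (rule minor_zero_row[of i]) (use 1 assms in \<open>auto simp: tri_def\<close>)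
  next
    case 2
    then obtain j where j: "j < length K" "K ! j \<le> i" by (auto simp: in_set_conv_nth)
    show ?thesis
      by (rule minor_equal_cols[of 0 _ "Suc j"]) (use 2 j assms in \<open>auto simp: tri_def\<close>)
  qed
  with False show ?thesis by auto
qed

lemma minor_tri_nonneg:
  "sorted_wrt (<) I \<Longrightarrow> sorted_wrt (<) K \<Longrightarrow> length K = length I \<Longrightarrow> 0 \<le> minor tri I K"
proof (induction I arbitrary: K)
  case (Cons i I)
  then obtain k K' where "K = k # K'" by (cases K) auto
  with Cons show ?case by (subst \<open>K = k # K'\<close>, subst minor_tri_Cons) auto
qed simp

lemma minor_tri_refl: "sorted_wrt (<) I \<Longrightarrow> minor tri I I = 1"
proof (induction I)
  case (Cons i I)
  then show ?case by (subst minor_tri_Cons) auto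
qed simp

text \<open>
  In the Cauchy--Binet sum for consecutive rows of partial sums that start in row \<open>i\<close> a single term
  survives.
\<close>

lemma minor_tri_upt:
  assumes "sorted_wrt (<) K" "length K = k" "\<forall>k'\<in>set K. i \<le> k'" "minor tri [i..<i+k] K \<noteq> 0"
  shows "K = [i..<i+k]"
  using assms
proof (induction k arbitrary: i K)
  case (Suc k)
  then obtain m K' where K: "K = m # K'" by (cases K) auto
  have u: "[i..<i + Suc k] = i # [Suc i..<Suc i + k]" by (simp add: upt_conv_Cons)
  have "sorted_wrt (<) (i # [Suc i..<Suc i + k])" by (simp del: upt_Suc)
  then have *: "m \<le> i \<and> (\<forall>k'\<in>set K'. i < k')" "minor tri [Suc i..<Suc i + k] K' \<noteq> 0"
    using Suc.prems unfolding u K by (simp_all add: minor_tri_Cons split: if_splits)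
  have "K' = [Suc i..<Suc i + k]"
    by (rule Suc.IH) (use * Suc.prems K in \<open>simp_all add: Suc_le_eq del: upt_Suc\<close>)
  with * Suc.prems K u show ?case by auto
qed simp

text \<open>
  Dividing row \<open>i\<close> by its first entry and taking differences of consecutive rows clears the first
  column below the diagonal.  Conversely the rows of \<open>L\<close> are, up to positive factors, the partial
  sums of the rows of the reduced matrix, so that by the Cauchy--Binet formula its minors are
  nonnegative combinations of those of the reduced matrix, and the minors in consecutive rows and
  initial columns of the two matrices correspond to each other.
\<close>

theorem lower_triangular_totally_positive:
  assumes "\<And>i j. a \<le> i \<Longrightarrow> i < j \<Longrightarrow> j < n \<Longrightarrow> L i j = 0"
    and "\<And>i k. a \<le> i \<Longrightarrow> i + k \<le> n \<Longrightarrow> 0 < minor L [i..<i+k] [a..<a+k]"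
    and "sorted_wrt (<) I" "sorted_wrt (<) J" "length J = length I"
    and "set I \<subseteq> {a..<n}" "set J \<subseteq> {a..<n}"
  shows "0 \<le> minor L I J \<and> (list_all2 (\<lambda>i j. j \<le> i) I J \<longrightarrow> 0 < minor L I J)"
  using assms
proof (induction "n - a" arbitrary: a L I J)
  case 0
  then have "I = []" by auto
  then show ?case by simp
next
  case (Suc d)
  note lower = Suc.prems(1) and solid = Suc.prems(2)
  have an: "a < n" using Suc.hyps(2) by simp
  define l where "l i = L i a" for i
  have l: "0 < l i" if "a \<le> i" "i < n" for i
    using solid[of i 1] that minor_first_col[of "[]" L a i "[]"]
    by (simp add: l_def)
  define X where "X m j = (if m < a then 0 else if m = a then if j = a then 1 else 0
      else L m j / l m - L (m - 1) j / l (m - 1))" for m j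
  have Xa: "X m a = (if m = a then 1 else 0)" if "m < n" for m
  proof (cases "a < m")
    case True
    then have "0 < l m" "0 < l (m - 1)" using that by (auto intro!: l)
    with True show ?thesis by (simp add: X_def l_def)
  qed (auto simp: X_def)
  have sum: "(\<Sum>m<n. tri i m * X m j) = L i j / l i" if i: "a \<le> i" "i < n" and j: "a \<le> j" "j < n" for i j
  proof -
    have "(\<Sum>m<n. tri i m * X m j) = (\<Sum>m\<in>{a..i}. tri i m * X m j)"
      by (rule sum.mono_neutral_right) (use i in \<open>auto simp: tri_def X_def\<close>)
    also have "\<dots> = (\<Sum>m\<in>{a..i}. X m j)"
      by (rule sum.cong) (auto simp: tri_def)
    also have "\<dots> = L i j / l i"
      using i
    proof (induction i rule: dec_induct)
      case base
      then show ?case using lower[of a j] j l[of a] an by (auto simp: X_def l_def)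
    next
      case (step i)
      then show ?case by (simp add: X_def)
    qed
    finally show ?thesis .
  qed
  have minL: "minor L I J = prod_list (map l I) *
      (\<Sum>K\<in>strict_lists n (length I). minor tri I K * minor X K J)"
    if "length J = length I" "set I \<subseteq> {a..<n}" "set J \<subseteq> {a..<n}" for I J
  proof -
    have "minor L I J = minor (\<lambda>i j. l i * (\<Sum>m<n. tri i m * X m j)) I J"
    proof (rule minor_cong)
      fix i j assume "i \<in> set I" "j \<in> set J"
      with that have "a \<le> i" "i < n" "a \<le> j" "j < n" by auto
      with sum[OF this] l[of i] show "L i j = l i * (\<Sum>m<n. tri i m * X m j)" by simp
    qed (use that in simp)
    then show ?thesis
      by (simp add: minor_scale_rows Cauchy_Binet[OF that(1)])
  qed
  have lpos: "0 < prod_list (map l I)" if "set I \<subseteq> {a..<n}" for I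
    using that l by (intro prod_list_pos) auto
  have IH: "0 \<le> minor X I J \<and> (list_all2 (\<lambda>i j. j \<le> i) I J \<longrightarrow> 0 < minor X I J)"
    if "sorted_wrt (<) I" "sorted_wrt (<) J" "length J = length I"
      "set I \<subseteq> {Suc a..<n}" "set J \<subseteq> {Suc a..<n}" for I J
  proof (rule Suc.hyps(1)[of "Suc a"])
    show "d = n - Suc a" using Suc.hyps(2) by simp
    show "X i j = 0" if "Suc a \<le> i" "i < j" "j < n" for i j
      using that lower[of i j] lower[of "i - 1" j] by (auto simp: X_def)
    fix i k assume ik: "Suc a \<le> i" "i + k \<le> n"
    let ?R = "[i..<i + k]" and ?C = "[Suc a..<Suc a + k]"
    have u: "[i - 1..<i - 1 + Suc k] = (i - 1) # ?R" "[a..<a + Suc k] = a # ?C"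
      using ik by (simp_all add: upt_conv_Cons)
    have srt: "sorted_wrt (<) ((i - 1) # ?R)" using ik by auto
    have "0 < minor L ((i - 1) # ?R) (a # ?C)"
      using solid[of "i - 1" "Suc k"] ik unfolding u by simp
    also have "minor L ((i - 1) # ?R) (a # ?C) = prod_list (map l ((i - 1) # ?R)) *
      (\<Sum>K\<in>strict_lists n (Suc k). minor tri ((i - 1) # ?R) K * minor X K (a # ?C))"
      by (subst minL) (use ik in auto)
    also have "(\<Sum>K\<in>strict_lists n (Suc k). minor tri ((i - 1) # ?R) K * minor X K (a # ?C)) =
        (\<Sum>K\<in>{a # ?R}. minor tri ((i - 1) # ?R) K * minor X K (a # ?C))"
    proof (rule sum.mono_neutral_right)
      show "{a # ?R} \<subseteq> strict_lists n (Suc k)" using ik by (auto simp: strict_lists_def)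
      show "\<forall>K\<in>strict_lists n (Suc k) - {a # ?R}. minor tri ((i - 1) # ?R) K * minor X K (a # ?C) = 0"
      proof
        fix K assume K: "K \<in> strict_lists n (Suc k) - {a # ?R}"
        then obtain m K' where mK: "K = m # K'" by (cases K) (auto simp: strict_lists_def)
        have K': "sorted_wrt (<) (m # K')" "length K' = k" "set K \<subseteq> {..<n}"
          using K mK by (auto simp: strict_lists_def)
        show "minor tri ((i - 1) # ?R) K * minor X K (a # ?C) = 0"
        proof (cases "minor tri ((i - 1) # ?R) K = 0")
          case False
          then have "\<forall>k'\<in>set K'. i - 1 < k'" "minor tri ?R K' \<noteq> 0"
            using minor_tri_Cons[OF srt K'(1)] K' mK by (auto split: if_splits)
          then have "K' = ?R" using K' ik by (intro minor_tri_upt) force+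
          with K mK have "m \<noteq> a" by auto
          have "X r a = 0" if "r \<in> set K" for r
          proof -
            have "r \<noteq> a" using that mK \<open>K' = ?R\<close> \<open>m \<noteq> a\<close> ik by auto
            then show ?thesis using Xa[of r] that K'(3) by auto
          qed
          then have "minor X K (a # ?C) = 0"
            by (intro minor_zero_col[of a]) (use K' mK in auto)
          then show ?thesis by simp
        qed simp
      qed
    qed simp
    also have "\<dots> = minor tri ((i - 1) # ?R) (a # ?R) * minor X (a # ?R) (a # ?C)" by simp
    also have "minor tri ((i - 1) # ?R) (a # ?R) = 1"
      using srt ik by (subst minor_tri_Cons) (auto simp: minor_tri_refl)
    also have "minor X (a # ?R) (a # ?C) = X a a * minor X ?R ?C"
      by (rule minor_first_col) (use ik Xa in auto)
    finally have "0 < prod_list (map l ((i - 1) # ?R)) * (1 * (X a a * minor X ?R ?C))" .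
    moreover have "0 < prod_list (map l ((i - 1) # ?R))" by (rule lpos) (use ik in auto)
    moreover have "X a a = 1" using Xa[of a] an by simp
    ultimately show "0 < minor X ?R ?C" by (metis mult_1 zero_less_mult_pos)
  qed (use that in auto)
  have XJ: "0 \<le> minor X K J" if K: "K \<in> strict_lists n (length J)" and J: "sorted_wrt (<) J" "set J \<subseteq> {a..<n}" for K J
  proof (cases J)
    case Nil
    then show ?thesis using K by (simp add: strict_lists_def)
  next
    case (Cons j J')
    then obtain m K' where mK: "K = m # K'" using K by (cases K) (auto simp: strict_lists_def)
    have K': "sorted_wrt (<) (m # K')" "length K' = length J'" "set K \<subseteq> {..<n}"
      using K mK Cons by (auto simp: strict_lists_def)
    have len: "length J = length K" using K' mK Cons by simp
    consider "m < a" | "m = a" "j = a" | "m = a" "a < j" | "a < m" "j = a" | "a < m" "a < j"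
      using J Cons by fastforce
    then show ?thesis
    proof cases
      case 1
      have "minor X K J = 0"
        by (rule minor_zero_row[of m]) (use 1 mK len in \<open>auto simp: X_def\<close>)
      then show ?thesis by simp
    next
      case 2
      have "minor X K J = X m j * minor X K' J'"
        unfolding mK Cons
      proof (rule minor_first_col)
        fix r' assume "r' \<in> set K'"
        then have "r' < n" "r' \<noteq> a" using 2 K' mK by auto
        then show "X r' j = 0" using 2 Xa[of r'] by simp
      qed
      moreover have "0 \<le> minor X K' J'"
        using IH[of K' J'] K' J Cons mK 2 by force
      ultimately show ?thesis using 2 Xa[of a] an by simp
    next
      case 3
      have "minor X K J = 0"
        by (rule minor_zero_row[of m]) (use 3 mK len J Cons in \<open>auto simp: X_def\<close>)
      then show ?thesis by simp
    next
      case 4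
      have "minor X K J = 0"
      proof (rule minor_zero_col[of a])
        fix r' assume "r' \<in> set K"
        then have "r' < n" "r' \<noteq> a" using 4 K' mK by auto
        then show "X r' a = 0" using Xa[of r'] by simp
      qed (use 4 len Cons in auto)
      then show ?thesis by simp
    next
      case 5
      then show ?thesis using IH[of K J] K' J Cons mK len by force
    qed
  qed
  have sI: "sorted_wrt (<) I" and sJ: "sorted_wrt (<) J" and len: "length J = length I"
    and setI: "set I \<subseteq> {a..<n}" and setJ: "set J \<subseteq> {a..<n}"
    using Suc.prems by auto
  have terms: "0 \<le> minor tri I K * minor X K J" if "K \<in> strict_lists n (length I)" for K
    using that XJ[of K J] len sI sJ setJ minor_tri_nonneg[of I K] by (auto simp: strict_lists_def)
  have "0 < minor L I J" if ge: "list_all2 (\<lambda>i j. j \<le> i) I J"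
  proof (cases I)
    case Nil
    then show ?thesis by simp
  next
    case (Cons i I')
    then obtain j J' where J: "J = j # J'" using len by (cases J) auto
    have "\<exists>K\<in>strict_lists n (length I). 0 < minor tri I K * minor X K J"
    proof (cases "j = a")
      case True
      have "minor tri I (a # I') = 1"
        unfolding Cons using sI setI Cons by (subst minor_tri_Cons) (auto simp: minor_tri_refl)
      moreover have "minor X (a # I') J = X a a * minor X I' J'"
        unfolding J True by (rule minor_first_col) (use sI setI Cons Xa in force)
      moreover have "0 < minor X I' J'"
        using IH[of I' J'] sI sJ len setI setJ Cons J ge True by force
      moreover have "a # I' \<in> strict_lists n (length I)"
        using sI setI Cons by (force simp: strict_lists_def)
      ultimately show ?thesis using Xa[of a] an by (intro bexI[of _ "a # I'"]) auto
    next
      case False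
      then have "a < j" using setJ J by auto
      then have "set I \<subseteq> {Suc a..<n}" "set J \<subseteq> {Suc a..<n}"
        using sI sJ setI setJ Cons J ge by fastforce+
      then have "0 < minor X I J" using IH[of I J] sI sJ len ge by auto
      moreover have "I \<in> strict_lists n (length I)" using sI setI by (force simp: strict_lists_def)
      ultimately show ?thesis using minor_tri_refl[OF sI] by (intro bexI[of _ I]) auto
    qed
    then obtain K where "K \<in> strict_lists n (length I)" "0 < minor tri I K * minor X K J" by blast
    then have "0 < (\<Sum>K\<in>strict_lists n (length I). minor tri I K * minor X K J)"
      using terms by (intro sum_pos2[of _ K]) auto
    then show ?thesis using lpos[OF setI] unfolding minL[OF len setI setJ] by (rule mult_pos_pos[rotated])
  qed
  moreover have "0 \<le> minor L I J"
    using lpos[OF setI] unfolding minL[OF len setI setJ]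
    by (intro mult_nonneg_nonneg sum_nonneg terms) auto
  ultimately show ?case by blast
qed

hide_const (open) Matrix.mat Determinant.det

abbreviation trp :: "'a ^ 'n ^ 'm \<Rightarrow> 'a ^ 'm ^ 'n" where
  "trp \<equiv> Finite_Cartesian_Product.transpose"

section \<open>Matrices indexed by a finite linear order\<close>

text \<open>
  Minors are indexed by numbers, so that rows and columns of a matrix are numbered by their rank in
  the index type.
\<close>

definition ix :: "'n::{finite,linorder} \<Rightarrow> nat" where
  "ix k = card {l. l < k}"

definition en :: "nat \<Rightarrow> 'n::{finite,linorder}" where
  "en = inv_into UNIV ix"

lemma ix_less_iff [simp]: "ix i < ix j \<longleftrightarrow> i < j" for i j :: "'n::{finite,linorder}"
proof
  show "i < j \<Longrightarrow> ix i < ix j"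
    unfolding ix_def by (rule psubset_card_mono) auto
  show "ix i < ix j \<Longrightarrow> i < j"
  proof (rule ccontr)
    assume "ix i < ix j" "\<not> i < j"
    then have "ix j \<le> ix i" unfolding ix_def by (intro card_mono) auto
    with \<open>ix i < ix j\<close> show False by simp
  qed
qed

lemma inj_ix: "inj (ix :: 'n::{finite,linorder} \<Rightarrow> nat)"
  by (rule injI) (metis ix_less_iff less_irrefl linorder_neqE)

lemma ix_bound [simp]: "ix (i :: 'n::{finite,linorder}) < CARD('n)"
  unfolding ix_def by (rule psubset_card_mono) auto

lemma range_ix: "range (ix :: 'n::{finite,linorder} \<Rightarrow> nat) = {..<CARD('n)}"
  by (rule card_subset_eq) (auto simp: card_image inj_ix)

lemma en_ix [simp]: "en (ix i) = i"
  by (simp add: en_def inj_ix)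

lemma ix_en [simp]: "k < CARD('n) \<Longrightarrow> ix (en k :: 'n::{finite,linorder}) = k"
  unfolding en_def by (rule f_inv_into_f) (simp add: range_ix)

lemma bij_betw_en: "bij_betw (en :: nat \<Rightarrow> 'n::{finite,linorder}) {..<CARD('n)} UNIV"
  by (rule bij_betw_byWitness[where f' = ix]) auto

lemma sum_en: "(\<Sum>l\<in>UNIV. f l) = (\<Sum>l<CARD('n). f (en l :: 'n::{finite,linorder}))"
  by (rule sum.reindex_bij_betw[OF bij_betw_en, symmetric])

lemma all_en: "(\<forall>i. P (i :: 'n::{finite,linorder})) \<longleftrightarrow> (\<forall>k<CARD('n). P (en k))"
  by (metis en_ix ix_bound)

lemma sorted_list_of_UNIV:
  "sorted_list_of_set (UNIV :: 'n::{finite,linorder} set) = map en [0..<CARD('n)]"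
proof (rule strict_sorted_equal)
  show "set (sorted_list_of_set (UNIV :: 'n set)) = set (map (en :: nat \<Rightarrow> 'n) [0..<CARD('n)])"
    using bij_betw_en by (auto simp: bij_betw_def atLeast0LessThan)
  show "sorted_wrt (<) (map (en :: nat \<Rightarrow> 'n) [0..<CARD('n)])"
    unfolding sorted_wrt_map
    by (rule sorted_wrt_mono_rel[of _ "(<)"]) (auto simp flip: ix_less_iff)
qed simp

definition mn :: "('n::{finite,linorder}) rmat \<Rightarrow> nat \<Rightarrow> nat \<Rightarrow> real" where
  "mn A i j = A $ en i $ en j"

definition mk :: "(nat \<Rightarrow> nat \<Rightarrow> real) \<Rightarrow> ('n::{finite,linorder}) rmat" where
  "mk f = (\<chi> i j. f (ix i) (ix j))"

lemma mn_mk [simp]: "i < CARD('n) \<Longrightarrow> j < CARD('n) \<Longrightarrow> mn (mk f :: ('n::{finite,linorder}) rmat) i j = f i j"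
  by (simp add: mn_def mk_def)

lemma mn_eqI:
  fixes A B :: "('n::{finite,linorder}) rmat"
  assumes "\<And>i j. i < CARD('n) \<Longrightarrow> j < CARD('n) \<Longrightarrow> mn A i j = mn B i j"
  shows "A = B"
proof -
  have "A $ i $ j = B $ i $ j" for i j
    using assms[of "ix i" "ix j"] by (simp add: mn_def)
  then show ?thesis by (simp add: Finite_Cartesian_Product.vec_eq_iff)
qed

lemma mn_mult: "mn (A ** B) i j = (\<Sum>l<CARD('n). mn A i l * mn B l j)"
  for A B :: "('n::{finite,linorder}) rmat"
  by (simp add: mn_def matrix_matrix_mult_def sum_en)

lemma mn_one: "i < CARD('n) \<Longrightarrow> j < CARD('n) \<Longrightarrow>
    mn (mat 1 :: ('n::{finite,linorder}) rmat) i j = (if i = j then 1 else 0)"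
  by (simp add: mn_def Finite_Cartesian_Product.mat_def) (metis ix_en)

lemma mn_transpose [simp]: "mn (trp A) i j = mn A j i"
  by (simp add: mn_def Finite_Cartesian_Product.transpose_def)

abbreviation tminor :: "('n::{finite,linorder}) rmat \<Rightarrow> nat list \<Rightarrow> nat list \<Rightarrow> real" where
  "tminor A \<equiv> minor (mn A)"

abbreviation lead :: "('n::{finite,linorder}) rmat \<Rightarrow> nat \<Rightarrow> real" where
  "lead A k \<equiv> tminor A [0..<k] [0..<k]"

lemma tminor_mult:
  fixes A B :: "('n::{finite,linorder}) rmat"
  assumes "length cs = length rs"
  shows "tminor (A ** B) rs cs =
    (\<Sum>ks\<in>strict_lists CARD('n) (length rs). tminor A rs ks * tminor B ks cs)"
proof -
  have "mn (A ** B) = (\<lambda>i j. \<Sum>l<CARD('n). mn A i l * mn B l j)"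
    by (intro ext) (rule mn_mult)
  then show ?thesis by (simp only: Cauchy_Binet[OF assms])
qed

lemma tminor_transpose:
  "length cs = length rs \<Longrightarrow> tminor (trp A) rs cs = tminor A cs rs"
proof -
  assume "length cs = length rs"
  then have "minor (\<lambda>i j. mn A j i) rs cs = tminor A cs rs" by (rule minor_transpose)
  moreover have "mn (trp A) = (\<lambda>i j. mn A j i)"
    by (intro ext) simp
  ultimately show ?thesis by (simp only:)
qed

lemma det_eq_lead: "det A = lead A CARD('n)" for A :: "('n::{finite,linorder}) rmat"
proof -
  let ?N = "{..<CARD('n)}"
  have inj: "inj_on (en :: nat \<Rightarrow> 'n) ?N" and im: "en ` ?N = (UNIV :: 'n set)"
    using bij_betw_en by (auto simp: bij_betw_def)
  let ?\<phi> = "\<lambda>\<pi> x. if x \<in> (UNIV :: 'n set) then en (\<pi> (inv_into ?N en x)) else x"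
  have bij: "bij_betw ?\<phi> {p. p permutes ?N} {p. p permutes (UNIV :: 'n set)}"
    by (rule bij_betw_permutations[OF bij_betw_en])
  have inv: "inv_into ?N en x = ix x" for x :: 'n
    by (rule inv_into_f_eq[OF inj]) auto
  have "det A =
      (\<Sum>p\<in>{p. p permutes ?N}. of_int (sign (?\<phi> p)) * (\<Prod>i\<in>UNIV. A $ i $ ?\<phi> p i))"
    unfolding Determinants.det_def by (rule sum.reindex_bij_betw[OF bij, symmetric])
  also have "\<dots> = (\<Sum>p\<in>{p. p permutes ?N}. of_int (sign p) * (\<Prod>i\<in>?N. mn A i (p i)))"
  proof (rule sum.cong[OF refl])
    fix p assume "p \<in> {p. p permutes ?N}"
    then have p: "p permutes ?N" by simp
    have "?\<phi> p = map_permutation ?N en p"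
      by (auto simp: map_permutation_def im restrict_id_def)
    then have "sign (?\<phi> p) = sign p"
      using sign_map_permutation[OF inj p] by simp
    moreover have "(\<Prod>i\<in>UNIV. A $ i $ ?\<phi> p i) = (\<Prod>i\<in>?N. A $ en i $ en (p (ix (en i :: 'n))))"
      using prod.reindex_bij_betw[OF bij_betw_en, of "\<lambda>i. A $ i $ en (p (ix i))"]
      by (simp add: inv)
    moreover have "\<dots> = (\<Prod>i\<in>?N. mn A i (p i))"
      by (rule prod.cong) (auto simp: mn_def)
    ultimately show "of_int (sign (?\<phi> p)) * (\<Prod>i\<in>UNIV. A $ i $ ?\<phi> p i) =
        of_int (sign p) * (\<Prod>i\<in>?N. mn A i (p i))" by simp
  qed
  also have "\<dots> = leibniz_det CARD('n) (mn A)" by (simp add: leibniz_det_def)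
  also have "\<dots> = lead A CARD('n)"
    unfolding minor_def length_upt by (simp, rule leibniz_det_cong) simp
  finally show ?thesis .
qed

section \<open>Triangular factorization\<close>

definition upper_inv :: "('n::{finite,linorder}) rmat \<Rightarrow> bool" where
  "upper_inv S \<longleftrightarrow> (\<forall>i j. j < i \<longrightarrow> S $ i $ j = 0) \<and> (\<forall>i. S $ i $ i \<noteq> 0)"

definition lower_unip :: "('n::{finite,linorder}) rmat \<Rightarrow> bool" where
  "lower_unip L \<longleftrightarrow> (\<forall>i j. i < j \<longrightarrow> L $ i $ j = 0) \<and> (\<forall>i. L $ i $ i = 1)"

definition regular :: "('n::{finite,linorder}) rmat \<Rightarrow> bool" where
  "regular A \<longleftrightarrow> (\<forall>k\<le>CARD('n). lead A k \<noteq> 0)"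

text \<open>
  The lower unipotent factor of the triangular factorization; by Cramer's rule its entries are
  quotients of minors in initial columns.  It only depends on the flag spanned by the columns and
  will serve as a coordinate on the big cell of the flag manifold.
\<close>

definition lower_factor :: "('n::{finite,linorder}) rmat \<Rightarrow> 'n rmat" where
  "lower_factor A = mk (\<lambda>i j. tminor A ([0..<j] @ [i]) [0..<Suc j] / lead A (Suc j))"

text \<open>
  The cofactors that clear the entries above the diagonal: not the upper triangular factor itself but
  its inverse, so that \<open>A ** upper_factor A = lower_factor A\<close>.
\<close>

definition upper_factor :: "('n::{finite,linorder}) rmat \<Rightarrow> 'n rmat" where
  "upper_factor A = mk (\<lambda>c j. if c \<le> j then (-1) ^ (j + c) *
     leibniz_det j (\<lambda>r l. mn A r (if l < c then l else Suc l)) / lead A (Suc j) else 0)"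

lemma upper_inv_mn:
  "upper_inv (S :: ('n::{finite,linorder}) rmat) \<longleftrightarrow>
     (\<forall>i<CARD('n). \<forall>j<i. mn S i j = 0) \<and> (\<forall>i<CARD('n). mn S i i \<noteq> 0)"
proof
  assume S: "upper_inv S"
  have "en j < (en i :: 'n)" if "j < i" "i < CARD('n)" for i j
    using that by (subst ix_less_iff[symmetric]) simp
  with S show "(\<forall>i<CARD('n). \<forall>j<i. mn S i j = 0) \<and> (\<forall>i<CARD('n). mn S i i \<noteq> 0)"
    by (auto simp: upper_inv_def mn_def)
next
  assume *: "(\<forall>i<CARD('n). \<forall>j<i. mn S i j = 0) \<and> (\<forall>i<CARD('n). mn S i i \<noteq> 0)"
  have "S $ i $ j = mn S (ix i) (ix j)" for i j by (simp add: mn_def)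
  with * show "upper_inv S" by (simp add: upper_inv_def)
qed

lemma lower_unip_mn:
  "lower_unip (L :: ('n::{finite,linorder}) rmat) \<longleftrightarrow>
     (\<forall>j<CARD('n). \<forall>i<j. mn L i j = 0) \<and> (\<forall>i<CARD('n). mn L i i = 1)"
proof
  assume L: "lower_unip L"
  have "en j < (en i :: 'n)" if "j < i" "i < CARD('n)" for i j
    using that by (subst ix_less_iff[symmetric]) simp
  with L show "(\<forall>j<CARD('n). \<forall>i<j. mn L i j = 0) \<and> (\<forall>i<CARD('n). mn L i i = 1)"
    by (auto simp: lower_unip_def mn_def)
next
  assume *: "(\<forall>j<CARD('n). \<forall>i<j. mn L i j = 0) \<and> (\<forall>i<CARD('n). mn L i i = 1)"
  have "L $ i $ j = mn L (ix i) (ix j)" for i j by (simp add: mn_def)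
  with * show "lower_unip L" by (simp add: lower_unip_def)
qed

lemma lower_unip_imp_upper_inv: "lower_unip L \<Longrightarrow> upper_inv (trp L)"
  by (auto simp: lower_unip_def upper_inv_def Finite_Cartesian_Product.transpose_def)

text \<open>
  The Laplace expansion of the numerators along the last row writes column \<open>j\<close> of \<open>lower_factor A\<close> as a
  combination of the columns up to \<open>j\<close> of \<open>A\<close>, with coefficients independent of the row.
\<close>

lemma mult_upper_factor:
  fixes A :: "('n::{finite,linorder}) rmat"
  assumes "regular A"
  shows "A ** upper_factor A = lower_factor A"
proof (rule mn_eqI)
  fix i j assume ij: "i < CARD('n)" "j < CARD('n)"
  let ?C = "\<lambda>c. (-1) ^ (j + c) * leibniz_det j (\<lambda>r l. mn A r (if l < c then l else Suc l))"
  have "tminor A ([0..<j] @ [i]) [0..<Suc j] =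
      (\<Sum>c<Suc j. mn A (([0..<j] @ [i]) ! j) ([0..<Suc j] ! c) * ((-1) ^ (j + c) *
        leibniz_det j (\<lambda>r l. mn A (([0..<j] @ [i]) ! r) ([0..<Suc j] ! (if l < c then l else Suc l)))))"
    unfolding minor_def
    using leibniz_det_last_row[of j "\<lambda>r l. mn A (([0..<j] @ [i]) ! r) ([0..<Suc j] ! l)"] by simp
  also have "\<dots> = (\<Sum>c<Suc j. mn A i c * ?C c)"
  proof (rule sum.cong[OF refl], intro arg_cong2[where f = "(*)"] leibniz_det_cong refl)
    fix c assume "c \<in> {..<Suc j}"
    then show "mn A (([0..<j] @ [i]) ! j) ([0..<Suc j] ! c) = mn A i c"
      by (simp add: nth_append del: upt_Suc)
    fix r l assume "r < j" "l < j"
    then show "mn A (([0..<j] @ [i]) ! r) ([0..<Suc j] ! (if l < c then l else Suc l)) =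
        mn A r (if l < c then l else Suc l)"
      by (simp add: nth_append del: upt_Suc)
  qed
  finally have "mn (lower_factor A) i j = (\<Sum>c<Suc j. mn A i c * ?C c) / lead A (Suc j)"
    using ij by (simp add: lower_factor_def)
  also have "\<dots> = (\<Sum>c<Suc j. mn A i c * (?C c / lead A (Suc j)))"
    by (simp only: sum_divide_distrib times_divide_eq_right)
  also have "\<dots> = (\<Sum>c<Suc j. mn A i c * mn (upper_factor A) c j)"
    by (rule sum.cong[OF refl]) (use ij in \<open>simp add: upper_factor_def\<close>)
  also have "\<dots> = (\<Sum>c<CARD('n). mn A i c * mn (upper_factor A) c j)"
    by (rule sum.mono_neutral_left) (use ij in \<open>auto simp: upper_factor_def\<close>)
  finally show "mn (A ** upper_factor A) i j = mn (lower_factor A) i j" by (simp add: mn_mult)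
qed

lemma upper_inv_upper_factor:
  fixes A :: "('n::{finite,linorder}) rmat"
  assumes "regular A"
  shows "upper_inv (upper_factor A)"
  unfolding upper_inv_mn
proof (intro conjI allI impI)
  fix j assume j: "j < CARD('n)"
  have "leibniz_det j (\<lambda>r l. mn A r (if l < j then l else Suc l)) = lead A j"
    unfolding minor_def length_upt by (simp, rule leibniz_det_cong) simp
  with j have "mn (upper_factor A) j j = lead A j / lead A (Suc j)"
    by (simp add: upper_factor_def)
  then show "mn (upper_factor A) j j \<noteq> 0"
    using assms j unfolding regular_def by (metis Suc_leI divide_eq_0_iff less_imp_le)
qed (simp add: upper_factor_def)

lemma lower_unip_lower_factor:
  fixes A :: "('n::{finite,linorder}) rmat"
  assumes "regular A"
  shows "lower_unip (lower_factor A)"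
  unfolding lower_unip_mn
proof (intro conjI allI impI)
  fix i j assume ij: "j < CARD('n)" "i < j"
  have "tminor A ([0..<j] @ [i]) [0..<Suc j] = 0"
    by (rule minor_equal_rows[of i _ j]) (use ij in \<open>auto simp: nth_append\<close>)
  then show "mn (lower_factor A) i j = 0" using ij by (simp add: lower_factor_def)
next
  fix i assume i: "i < CARD('n)"
  with assms have "lead A (Suc i) \<noteq> 0" by (simp add: regular_def del: upt_Suc)
  with i show "mn (lower_factor A) i i = 1" by (simp add: lower_factor_def)
qed

lemma strict_list_initial:
  assumes "K \<in> strict_lists n k" "set K \<subseteq> {..<k}"
  shows "K = [0..<k]"
proof -
  have "distinct K" "card (set K) = k" "set K \<subseteq> {..<n}"
    using assms(1) strict_sorted_iff[of K] distinct_card[of K] by (auto simp: strict_lists_def)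
  then have eq: "set K = {..<k}" using assms(2) by (intro card_subset_eq) auto
  then have "k \<le> n" using \<open>set K \<subseteq> {..<n}\<close> by simp
  then have "[0..<k] \<in> strict_lists n k" using upt_strict_lists[of 0 k n] by simp
  then show ?thesis by (rule strict_lists_eqI[OF assms(1)]) (simp add: eq atLeast0LessThan)
qed

lemma minor_prefix:
  assumes "sorted_wrt (\<lambda>p q. A q p = 0) ps" "\<And>p r. p \<in> set ps \<Longrightarrow> r \<in> set rs \<Longrightarrow> A r p = 0"
  shows "minor A (ps @ rs) (ps @ cs) = prod_list (map (\<lambda>p. A p p) ps) * minor A rs cs"
  using assms
proof (induction ps)
  case (Cons p ps)
  have "A r' p = 0" if "r' \<in> set (ps @ rs)" for r'
    using Cons.prems(1) Cons.prems(2)[of p r'] that by auto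
  then have "minor A (p # (ps @ rs)) (p # (ps @ cs)) = A p p * minor A (ps @ rs) (ps @ cs)"
    by (rule minor_first_col)
  moreover have "minor A (ps @ rs) (ps @ cs) = prod_list (map (\<lambda>p. A p p) ps) * minor A rs cs"
    using Cons.prems by (intro Cons.IH) simp_all
  ultimately show ?case by (simp add: mult.assoc)
qed simp

lemma sorted_upt_upper:
  assumes "upper_inv (S :: ('n::{finite,linorder}) rmat)" "k \<le> CARD('n)"
  shows "sorted_wrt (\<lambda>p q. mn S q p = 0) [0..<k]"
  using assms by (auto simp: sorted_wrt_iff_nth_less upper_inv_mn)

lemma tminor_upper:
  fixes S :: "('n::{finite,linorder}) rmat"
  assumes S: "upper_inv S" and K: "K \<in> strict_lists CARD('n) k" and k: "k \<le> CARD('n)"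
  shows "tminor S K [0..<k] = (if K = [0..<k] then prod_list (map (\<lambda>i. mn S i i) [0..<k]) else 0)"
proof (cases "K = [0..<k]")
  case True
  then show ?thesis
    using minor_prefix[OF sorted_upt_upper[OF S k], of "[]" "[]"] by simp
next
  case False
  then obtain r where r: "r \<in> set K" "k \<le> r" using strict_list_initial[OF K] by force
  have "tminor S K [0..<k] = 0"
  proof (rule minor_zero_row[OF r(1)])
    fix c assume "c \<in> set [0..<k]"
    then show "mn S r c = 0" using S r K by (auto simp: upper_inv_mn strict_lists_def)
  qed (use K in \<open>simp add: strict_lists_def\<close>)
  with False show ?thesis by simp
qed

lemma tminor_mult_upper:
  fixes S :: "('n::{finite,linorder}) rmat"
  assumes S: "upper_inv S" and I: "length I = k" and k: "k \<le> CARD('n)"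
  shows "tminor (A ** S) I [0..<k] = tminor A I [0..<k] * prod_list (map (\<lambda>i. mn S i i) [0..<k])"
proof -
  have "tminor (A ** S) I [0..<k] = (\<Sum>K\<in>strict_lists CARD('n) k. tminor A I K *
      (if K = [0..<k] then prod_list (map (\<lambda>i. mn S i i) [0..<k]) else 0))"
    using I by (subst tminor_mult) (auto intro!: sum.cong simp: tminor_upper[OF S _ k])
  also have "\<dots> = (\<Sum>K\<in>{[0..<k]}. tminor A I K *
      (if K = [0..<k] then prod_list (map (\<lambda>i. mn S i i) [0..<k]) else 0))"
    by (rule sum.mono_neutral_right) (use upt_strict_lists[of 0 k "CARD('n)"] k in auto)
  finally show ?thesis by simp
qed

lemma prod_diag_nonzero:
  fixes S :: "('n::{finite,linorder}) rmat"
  assumes "upper_inv S" "k \<le> CARD('n)"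
  shows "prod_list (map (\<lambda>i. mn S i i) [0..<k]) \<noteq> 0"
  using assms by (auto simp: prod_list_zero_iff upper_inv_mn)

lemma regular_mult_upper:
  fixes S :: "('n::{finite,linorder}) rmat"
  assumes S: "upper_inv S"
  shows "regular (A ** S) \<longleftrightarrow> regular A"
proof -
  have "lead (A ** S) k \<noteq> 0 \<longleftrightarrow> lead A k \<noteq> 0" if "k \<le> CARD('n)" for k
    using tminor_mult_upper[OF S _ that, of "[0..<k]" A] prod_diag_nonzero[OF S that] by simp
  then show ?thesis by (auto simp: regular_def)
qed

lemma lower_factor_mult_upper:
  fixes S :: "('n::{finite,linorder}) rmat"
  assumes "upper_inv S"
  shows "lower_factor (A ** S) = lower_factor A"
proof (rule mn_eqI)
  fix i j assume "i < CARD('n)" "j < CARD('n)"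
  moreover from this have "tminor (A ** S) ([0..<j] @ [i]) [0..<Suc j] =
      tminor A ([0..<j] @ [i]) [0..<Suc j] * prod_list (map (\<lambda>i. mn S i i) [0..<Suc j])"
    using assms by (intro tminor_mult_upper) auto
  moreover from calculation have "lead (A ** S) (Suc j) =
      lead A (Suc j) * prod_list (map (\<lambda>i. mn S i i) [0..<Suc j])"
    using assms by (intro tminor_mult_upper) auto
  ultimately show "mn (lower_factor (A ** S)) i j = mn (lower_factor A) i j"
    using prod_diag_nonzero[OF assms, of "Suc j"] by (simp add: lower_factor_def del: upt_Suc)
qed

lemma lead_lower_unip:
  fixes L :: "('n::{finite,linorder}) rmat"
  assumes "lower_unip L" "k \<le> CARD('n)"
  shows "lead L k = 1"
proof -
  have U: "upper_inv (trp L)"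
    using assms by (rule_tac lower_unip_imp_upper_inv)
  have "lead L k = lead (trp L) k"
    by (simp add: tminor_transpose)
  also have "\<dots> = prod_list (map (\<lambda>i. mn L i i) [0..<k])"
    using tminor_upper[OF U upt_strict_lists[of 0 k]] assms by simp
  also have "map (\<lambda>i. mn L i i) [0..<k] = map (\<lambda>i. 1) [0..<k]"
    using assms by (intro map_cong) (auto simp: lower_unip_mn)
  also have "prod_list (map (\<lambda>i. 1 :: real) [0..<k]) = 1"
    by (induction k) auto
  finally show ?thesis .
qed

lemma regular_lower_unip: "lower_unip L \<Longrightarrow> regular L"
  by (simp add: regular_def lead_lower_unip)

lemma lower_factor_lower_unip:
  fixes L :: "('n::{finite,linorder}) rmat"
  assumes "lower_unip L"
  shows "lower_factor L = L"
proof (rule mn_eqI)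
  fix i j assume ij: "i < CARD('n)" "j < CARD('n)"
  have "tminor L ([0..<j] @ [i]) ([0..<j] @ [j]) = lead L j * mn L i j"
    by (rule minor_last_col) (use assms ij in \<open>auto simp: lower_unip_mn\<close>)
  then have "tminor L ([0..<j] @ [i]) [0..<Suc j] = mn L i j"
    using ij assms by (simp add: lead_lower_unip)
  then show "mn (lower_factor L) i j = mn L i j"
    using ij lead_lower_unip[OF assms, of "Suc j"] by (simp add: lower_factor_def del: upt_Suc)
qed

lemma lower_factor_eqI:
  assumes "upper_inv S" "lower_unip L" "A ** S = L"
  shows "regular A" "lower_factor A = L"
  using assms regular_mult_upper[of S A] lower_factor_mult_upper[of S A]
  by (auto simp: regular_lower_unip lower_factor_lower_unip)

lemma lower_factor_eqI':
  assumes "upper_inv T" "lower_unip L"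
  shows "regular (L ** T)" "lower_factor (L ** T) = L"
  using assms by (auto simp: regular_mult_upper lower_factor_mult_upper regular_lower_unip lower_factor_lower_unip)

lemma lower_unip_mult:
  fixes K L :: "('n::{finite,linorder}) rmat"
  assumes "lower_unip K" "lower_unip L"
  shows "lower_unip (K ** L)"
  unfolding lower_unip_mn
proof (intro conjI allI impI)
  fix i j assume "j < CARD('n)" "i < j"
  then have "mn K i l * mn L l j = 0" if "l < CARD('n)" for l
    using assms that by (cases "i < l") (auto simp: lower_unip_mn)
  then show "mn (K ** L) i j = 0" unfolding mn_mult by (intro sum.neutral) auto
next
  fix i assume i: "i < CARD('n)"
  then have "(\<Sum>l<CARD('n). mn K i l * mn L l i) = (\<Sum>l\<in>{i}. mn K i l * mn L l i)"
    using assms by (intro sum.mono_neutral_right) (auto simp: lower_unip_mn, metis linorder_neqE_nat)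
  then show "mn (K ** L) i i = 1" using assms i by (simp add: mn_mult lower_unip_mn)
qed

lemma upper_inv_inverse:
  fixes S :: "('n::{finite,linorder}) rmat"
  assumes S: "upper_inv S"
  shows "upper_inv (upper_factor S)" "S ** upper_factor S = mat 1"
    "upper_factor S ** S = mat 1"
proof -
  let ?I = "mat 1 :: 'n rmat"
  have I: "lower_unip ?I" by (auto simp: lower_unip_mn mn_one)
  have r: "regular S" "lower_factor S = ?I"
    using lower_factor_eqI'[OF S I] by auto
  show "upper_inv (upper_factor S)" by (rule upper_inv_upper_factor[OF r(1)])
  show "S ** upper_factor S = ?I" using mult_upper_factor[OF r(1)] r(2) by simp
  then show "upper_factor S ** S = ?I" using matrix_left_right_inverse by blast
qed

lemma lower_unip_inverse:
  fixes L :: "('n::{finite,linorder}) rmat"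
  assumes L: "lower_unip L"
  defines "L' \<equiv> trp (upper_factor (trp L))"
  shows "L ** L' = mat 1" "L' ** L = mat 1"
proof -
  have "upper_factor (trp L) ** trp L = mat 1"
    by (rule upper_inv_inverse[OF lower_unip_imp_upper_inv[OF L]])
  then have "trp
      (upper_factor (trp L) ** trp L) = mat 1"
    by simp
  then show "L ** L' = mat 1"
    by (simp add: L'_def matrix_transpose_mul)
  then show "L' ** L = mat 1" using matrix_left_right_inverse by blast
qed

section \<open>A criterion for total positivity\<close>

text \<open>
  Strict total positivity: the matrix acts on every exterior power as a matrix with positive entries.
\<close>

definition STP :: "('n::{finite,linorder}) rmat \<Rightarrow> bool" where
  "STP M \<longleftrightarrow> (\<forall>k. \<forall>I\<in>strict_lists CARD('n) k. \<forall>J\<in>strict_lists CARD('n) k. 0 < tminor M I J)"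

lemma nth_strict_list_ge:
  "J \<in> strict_lists n k \<Longrightarrow> i < k \<Longrightarrow> i \<le> J ! i"
proof (induction i)
  case (Suc i)
  then have "J ! i < J ! Suc i" by (auto simp: strict_lists_def sorted_wrt_iff_nth_less)
  with Suc show ?case by simp
qed simp

lemma initial_le: "J \<in> strict_lists n k \<Longrightarrow> list_all2 (\<lambda>i j. i \<le> j) [0..<k] J"
  using nth_strict_list_ge[of J n k] by (auto simp: list_all2_conv_all_nth strict_lists_def)

lemma strict_lists_le: "J \<in> strict_lists n k \<Longrightarrow> k \<le> n"
  using card_mono[of "{..<n}" "set J"] distinct_card[of J] strict_sorted_iff[of J]
  by (auto simp: strict_lists_def)

lemma tminor_mult_lower_initial:
  fixes L :: "('n::{finite,linorder}) rmat"
  assumes L: "lower_unip L" and J: "length J = k" and k: "k \<le> CARD('n)"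
  shows "tminor (L ** A) [0..<k] J = tminor A [0..<k] J"
proof -
  have U: "upper_inv (trp L)" by (rule lower_unip_imp_upper_inv[OF L])
  have diag: "prod_list (map (\<lambda>i. mn (trp L) i i) [0..<k]) = 1"
    using tminor_upper[OF U upt_strict_lists[of 0 k] k] k lead_lower_unip[OF L k]
    by (simp add: tminor_transpose)
  have "tminor (L ** A) [0..<k] J = tminor (trp (L ** A)) J [0..<k]"
    using J by (simp add: tminor_transpose)
  also have "\<dots> = tminor (trp A ** trp L) J [0..<k]" by (simp add: matrix_transpose_mul)
  also have "\<dots> = tminor (trp A) J [0..<k]"
    using tminor_mult_upper[OF U J k, of "trp A"] diag by simp
  finally show ?thesis using J by (simp add: tminor_transpose)
qed

lemma minor_reflect:
  assumes "set I \<subseteq> {..<n}" "set J \<subseteq> {..<n}" "length J = length I"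
  shows "minor (\<lambda>i j. A (n - Suc i) (n - Suc j)) (map (\<lambda>i. n - Suc i) (rev I)) (map (\<lambda>i. n - Suc i) (rev J))
    = minor A I J"
proof -
  have "map (\<lambda>i. n - Suc (n - Suc i)) (rev I) = rev I" "map (\<lambda>i. n - Suc (n - Suc i)) (rev J) = rev J"
    using assms by (auto intro!: map_idI)
  then have "minor (\<lambda>i j. A (n - Suc i) (n - Suc j)) (map (\<lambda>i. n - Suc i) (rev I)) (map (\<lambda>i. n - Suc i) (rev J))
      = minor A (rev I) (rev J)"
    using minor_map[of "map (\<lambda>i. n - Suc i) (rev J)" "map (\<lambda>i. n - Suc i) (rev I)" A "\<lambda>i. n - Suc i" "\<lambda>i. n - Suc i"] assms
    by (simp add: o_def)
  also have "\<dots> = minor A I J" by (rule minor_rev[OF assms(3)])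
  finally show ?thesis .
qed

lemma sorted_reflect:
  assumes "sorted_wrt (<) I" "set I \<subseteq> {..<n}"
  shows "sorted_wrt (<) (map (\<lambda>i. n - Suc i) (rev I))"
  unfolding sorted_wrt_map sorted_wrt_rev
  by (rule sorted_wrt_mono_rel[OF _ assms(1)]) (use assms(2) in auto)

text \<open>
  In the factorization \<open>M = L ** T\<close> the minors of \<open>M\<close> in the first \<open>k\<close> columns are those of \<open>L\<close>, and
  those in the first \<open>k\<close> rows are those of \<open>T\<close>, up to positive factors.  The two hypotheses become
  the solid minors required for \<open>L\<close> and for \<open>T\<close> with the orders of rows and columns reversed.
\<close>

theorem STP_criterion:
  fixes M :: "('n::{finite,linorder}) rmat"
  assumes col: "\<And>i k. i + k \<le> CARD('n) \<Longrightarrow> 0 < tminor M [i..<i+k] [0..<k]"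
    and row: "\<And>p k. p + k \<le> CARD('n) \<Longrightarrow> 0 < tminor M [0..<p+k] ([0..<p] @ [CARD('n)-k..<CARD('n)])"
  shows "STP M"
proof -
  let ?n = "CARD('n)"
  define L where "L = lower_factor M"
  define S where "S = upper_factor M"
  define T where "T = upper_factor S"
  have lead_pos: "0 < lead M k" if "k \<le> ?n" for k using col[of 0 k] that by simp
  then have reg: "regular M" by (force simp: regular_def)
  have S: "upper_inv S" unfolding S_def by (rule upper_inv_upper_factor[OF reg])
  have L: "lower_unip L" unfolding L_def by (rule lower_unip_lower_factor[OF reg])
  have LMS: "L = M ** S" unfolding L_def S_def by (rule mult_upper_factor[OF reg, symmetric])
  have T: "upper_inv T" "S ** T = mat 1"
    unfolding T_def using upper_inv_inverse[OF S] by auto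
  have MLT: "M = L ** T" using T by (simp add: LMS flip: matrix_mul_assoc)
  have L_col: "tminor L I [0..<k] = tminor M I [0..<k] / lead M k" if "length I = k" "k \<le> ?n" for I k
  proof -
    let ?d = "prod_list (map (\<lambda>i. mn S i i) [0..<k])"
    have "1 = lead M k * ?d"
      using tminor_mult_upper[OF S _ that(2), of "[0..<k]" M] lead_lower_unip[OF L that(2)] by (simp add: LMS)
    moreover have "tminor L I [0..<k] = tminor M I [0..<k] * ?d"
      using tminor_mult_upper[OF S that, of M] by (simp add: LMS)
    ultimately show ?thesis using lead_pos[OF that(2)] by (simp add: field_simps)
  qed
  have T_row: "tminor T [0..<k] J = tminor M [0..<k] J" if "length J = k" "k \<le> ?n" for J k
    unfolding MLT using tminor_mult_lower_initial[OF L that] by simp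
  have Lpos: "0 \<le> tminor L I J \<and> (list_all2 (\<lambda>i j. j \<le> i) I J \<longrightarrow> 0 < tminor L I J)"
    if "I \<in> strict_lists ?n k" "J \<in> strict_lists ?n k" for I J k
  proof (rule lower_triangular_totally_positive[of 0 ?n])
    show "mn L i j = 0" if "i < j" "j < ?n" for i j using that L by (auto simp: lower_unip_mn)
    show "0 < tminor L [i..<i+l] [0..<0+l]" if "i + l \<le> ?n" for i l
      using L_col[of "[i..<i+l]" l] col[OF that] lead_pos[of l] that by simp
  qed (use that in \<open>auto simp: strict_lists_def\<close>)
  define R where "R i j = mn T (?n - Suc i) (?n - Suc j)" for i j
  have Tdiag: "0 < prod_list (map (\<lambda>i. mn T i i) [0..<k])" if "k \<le> ?n" for k
    using tminor_upper[OF T(1) upt_strict_lists[of 0 k] that] that T_row[of "[0..<k]" k] lead_pos[OF that]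
    by simp
  have Rpos: "0 \<le> minor R I J \<and> (list_all2 (\<lambda>i j. j \<le> i) I J \<longrightarrow> 0 < minor R I J)"
    if "sorted_wrt (<) I" "sorted_wrt (<) J" "length J = length I" "set I \<subseteq> {..<?n}" "set J \<subseteq> {..<?n}" for I J
  proof (rule lower_triangular_totally_positive[of 0 ?n])
    show "R i j = 0" if "i < j" "j < ?n" for i j using that T(1) by (auto simp: R_def upper_inv_mn)
    fix i l assume il: "i + l \<le> ?n"
    define p where "p = ?n - i - l"
    have "map (\<lambda>i. ?n - Suc i) (rev [p..<p + l]) = [i..<i + l]"
      "map (\<lambda>i. ?n - Suc i) (rev [?n - l..<?n]) = [0..<l]"
      using il by (auto intro!: nth_equalityI simp: rev_nth p_def)
    moreover have "set [p..<p + l] \<subseteq> {..<?n}" "set [?n - l..<?n] \<subseteq> {..<?n}"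
      "length [?n - l..<?n] = length [p..<p + l]" using il by (auto simp: p_def)
    ultimately have e1: "minor R [i..<i+l] [0..<l] = tminor T [p..<p + l] [?n - l..<?n]"
      unfolding R_def using minor_reflect[of "[p..<p + l]" ?n "[?n - l..<?n]" "mn T"] by (simp only:)
    have e2: "tminor T [0..<p+l] ([0..<p] @ [?n - l..<?n]) =
        prod_list (map (\<lambda>i. mn T i i) [0..<p]) * tminor T [p..<p+l] [?n - l..<?n]"
    proof -
      have e: "[0..<p+l] = [0..<p] @ [p..<p+l]" by (rule upt_add_eq_append) simp
      have "mn T r q = 0" if "q \<in> set [0..<p]" "r \<in> set [p..<p+l]" for q r
        using T(1) that il by (auto simp: upper_inv_mn p_def)
      moreover have "p \<le> ?n" by (simp add: p_def)
      ultimately show ?thesis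
        unfolding e by (intro minor_prefix sorted_upt_upper[OF T(1)])
    qed
    have py: "0 < tminor T [0..<p+l] ([0..<p] @ [?n - l..<?n])"
      using T_row[of "[0..<p] @ [?n - l..<?n]" "p + l"] row[of p l] il by (simp add: p_def)
    have pp: "0 < prod_list (map (\<lambda>i. mn T i i) [0..<p])" by (rule Tdiag) (simp add: p_def)
    have "0 < tminor T [p..<p+l] [?n - l..<?n]"
      by (rule zero_less_mult_pos[OF py[unfolded e2] pp])
    then show "0 < minor R [i..<i+l] [0..<0+l]" unfolding add_0 e1 .
  qed (use that in auto)
  have Tpos: "0 \<le> tminor T I J \<and> (list_all2 (\<lambda>i j. i \<le> j) I J \<longrightarrow> 0 < tminor T I J)"
    if "I \<in> strict_lists ?n k" "J \<in> strict_lists ?n k" for I J k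
  proof -
    have I: "sorted_wrt (<) I" "set I \<subseteq> {..<?n}" "length I = k"
      and J: "sorted_wrt (<) J" "set J \<subseteq> {..<?n}" "length J = k"
      using that by (auto simp: strict_lists_def)
    let ?I = "map (\<lambda>i. ?n - Suc i) (rev I)" and ?J = "map (\<lambda>i. ?n - Suc i) (rev J)"
    have "minor R ?I ?J = tminor T I J"
      unfolding R_def by (rule minor_reflect) (use I J in auto)
    moreover have "list_all2 (\<lambda>i j. j \<le> i) ?I ?J" if "list_all2 (\<lambda>i j. i \<le> j) I J"
    proof -
      have "list_all2 (\<lambda>i j. i \<le> j) (rev I) (rev J)" using that by simp
      then show ?thesis by (auto simp: list_all2_map1 list_all2_map2 elim!: list_all2_mono)
    qed
    moreover have "set ?I \<subseteq> {..<?n}" "set ?J \<subseteq> {..<?n}" by auto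
    ultimately show ?thesis
      using Rpos[OF sorted_reflect[OF I(1,2)] sorted_reflect[OF J(1,2)]] I J by simp
  qed
  show ?thesis unfolding STP_def
  proof (intro allI ballI)
    fix k I J assume I: "I \<in> strict_lists ?n k" and J: "J \<in> strict_lists ?n k"
    have k: "k \<le> ?n" by (rule strict_lists_le[OF I])
    have ini: "[0..<k] \<in> strict_lists ?n k" using upt_strict_lists[of 0 k ?n] k by simp
    have "list_all2 (\<lambda>i j. j \<le> i) I [0..<k]"
      using initial_le[OF I] by (auto simp: list_all2_conv_all_nth)
    then have "0 < tminor L I [0..<k] * tminor T [0..<k] J"
      using Lpos[OF I ini] Tpos[OF ini J] initial_le[OF J] by simp
    then have "0 < (\<Sum>K\<in>strict_lists ?n k. tminor L I K * tminor T K J)"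
      using Lpos[OF I] Tpos[OF _ J] by (intro sum_pos2[OF _ ini]) auto
    then show "0 < tminor M I J"
      using I J by (simp add: MLT tminor_mult strict_lists_def)
  qed
qed

section \<open>Contraction by products of totally positive matrices\<close>

text \<open>
  A quantitative form of total positivity.  Finitely many matrices share a constant \<open>\<kappa>\<close>, and this
  constant controls the rate at which their products contract.
\<close>

definition comparable :: "real \<Rightarrow> ('n::{finite,linorder}) rmat \<Rightarrow> bool" where
  "comparable \<kappa> M \<longleftrightarrow> STP M \<and> (\<forall>k. \<forall>I\<in>strict_lists CARD('n) k. \<forall>J\<in>strict_lists CARD('n) k.
     \<forall>I'\<in>strict_lists CARD('n) k. \<forall>J'\<in>strict_lists CARD('n) k. tminor M I J \<le> \<kappa> * tminor M I' J')"

lemma comparable_exists: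
  fixes \<M> :: "('n::{finite,linorder}) rmat set"
  assumes "finite \<M>" "\<And>M. M \<in> \<M> \<Longrightarrow> STP M"
  shows "\<exists>\<kappa>>1. \<forall>M\<in>\<M>. comparable \<kappa> M"
proof -
  let ?S = "\<lambda>k. strict_lists CARD('n) k"
  define Q where "Q = (\<Union>M\<in>\<M>. \<Union>k\<in>{..CARD('n)}.
    (\<lambda>(I, J, I', J'). tminor M I J / tminor M I' J') ` (?S k \<times> ?S k \<times> ?S k \<times> ?S k))"
  have fin: "finite (insert 1 Q)" unfolding Q_def using assms(1) by auto
  define \<kappa> where "\<kappa> = Max (insert 1 Q) + 1"
  have "comparable \<kappa> M" if M: "M \<in> \<M>" for M
    unfolding comparable_def
  proof (intro conjI allI ballI assms M)
    fix k I J I' J' assume *: "I \<in> ?S k" "J \<in> ?S k" "I' \<in> ?S k" "J' \<in> ?S k"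
    then have "tminor M I J / tminor M I' J' \<in> Q"
      using M strict_lists_le[OF *(1)] unfolding Q_def by force
    then have "tminor M I J / tminor M I' J' \<le> \<kappa>"
      using Max_ge[OF fin, of "tminor M I J / tminor M I' J'"] unfolding \<kappa>_def by auto
    moreover have "0 < tminor M I' J'" using assms(2)[OF M] * unfolding STP_def by blast
    ultimately show "tminor M I J \<le> \<kappa> * tminor M I' J'" by (simp add: field_simps)
  qed
  moreover have "1 \<le> Max (insert 1 Q)" using Max_ge[OF fin, of 1] by simp
  ultimately show ?thesis unfolding \<kappa>_def by (intro exI[of _ "Max (insert 1 Q) + 1"]) auto
qed

text \<open>
  The probability weights proportional to \<open>b K * m K\<close> dominate \<open>1 / \<kappa>\<close> times those proportional to
  \<open>b K\<close>, and the mean \<open>c\<close> for the latter does not depend on \<open>m\<close>.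
\<close>

lemma averaging_step:
  fixes a b m :: "'k \<Rightarrow> real"
  assumes "finite S" "S \<noteq> {}" and \<kappa>: "0 < \<kappa>"
    and b: "\<And>K. K \<in> S \<Longrightarrow> 0 < b K" and m: "\<And>K. K \<in> S \<Longrightarrow> 0 < m K"
    and cmp: "\<And>K K'. K \<in> S \<Longrightarrow> K' \<in> S \<Longrightarrow> m K' \<le> \<kappa> * m K"
    and lo: "\<And>K. K \<in> S \<Longrightarrow> lo * b K \<le> a K"
  defines "c \<equiv> sum a S / sum b S"
  shows "lo \<le> c" "lo + (c - lo) / \<kappa> \<le> (\<Sum>K\<in>S. a K * m K) / (\<Sum>K\<in>S. b K * m K)"
proof -
  have sb: "0 < sum b S" using assms(1,2) b by (intro sum_pos) auto
  have sbm: "0 < (\<Sum>K\<in>S. b K * m K)" using assms(1,2) b m by (intro sum_pos) auto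
  have "lo * sum b S \<le> sum a S" unfolding sum_distrib_left by (intro sum_mono lo)
  then show loc: "lo \<le> c" using sb by (simp add: c_def field_simps)
  define mx where "mx = Max (m ` S)"
  have mx: "m K \<le> mx" "mx \<le> \<kappa> * m K" if "K \<in> S" for K
  proof -
    show "m K \<le> mx" unfolding mx_def using assms(1) that by simp
    have "mx \<in> m ` S" unfolding mx_def using assms(1,2) by (intro Max_in) auto
    then show "mx \<le> \<kappa> * m K" using cmp[OF that] by auto
  qed
  have "(\<Sum>K\<in>S. b K * m K) \<le> sum b S * mx"
    unfolding sum_distrib_right using b mx(1) by (intro sum_mono mult_left_mono) (auto intro: less_imp_le)
  then have "(c - lo) / \<kappa> * (\<Sum>K\<in>S. b K * m K) \<le> (c - lo) / \<kappa> * (sum b S * mx)"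
    using loc \<kappa> by (intro mult_left_mono) auto
  also have "\<dots> = (\<Sum>K\<in>S. (a K - lo * b K) * (mx / \<kappa>))"
  proof -
    have "(c - lo) * sum b S = (\<Sum>K\<in>S. a K - lo * b K)"
    proof -
      have "c * sum b S = sum a S" using sb by (simp add: c_def)
      then show ?thesis by (simp add: sum_subtractf sum_distrib_left[symmetric] left_diff_distrib)
    qed
    then have "(c - lo) / \<kappa> * (sum b S * mx) = (\<Sum>K\<in>S. a K - lo * b K) * (mx / \<kappa>)"
      by (metis (no_types, lifting) mult.assoc mult.commute times_divide_eq_left times_divide_eq_right)
    then show ?thesis by (simp only: sum_distrib_right)
  qed
  also have "\<dots> \<le> (\<Sum>K\<in>S. (a K - lo * b K) * m K)"
    using lo mx(2) \<kappa> by (intro sum_mono mult_left_mono) (auto simp: field_simps)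
  also have "\<dots> = (\<Sum>K\<in>S. a K * m K) - lo * (\<Sum>K\<in>S. b K * m K)"
    by (simp add: algebra_simps sum_subtractf sum_distrib_left)
  finally show "lo + (c - lo) / \<kappa> \<le> (\<Sum>K\<in>S. a K * m K) / (\<Sum>K\<in>S. b K * m K)"
    using sbm by (simp add: pos_le_divide_eq algebra_simps)
qed

lemma averaging_step_upper:
  fixes a b m :: "'k \<Rightarrow> real"
  assumes "finite S" "S \<noteq> {}" and \<kappa>: "0 < \<kappa>"
    and b: "\<And>K. K \<in> S \<Longrightarrow> 0 < b K" and m: "\<And>K. K \<in> S \<Longrightarrow> 0 < m K"
    and cmp: "\<And>K K'. K \<in> S \<Longrightarrow> K' \<in> S \<Longrightarrow> m K' \<le> \<kappa> * m K"
    and hi: "\<And>K. K \<in> S \<Longrightarrow> a K \<le> hi * b K"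
  defines "c \<equiv> sum a S / sum b S"
  shows "c \<le> hi" "(\<Sum>K\<in>S. a K * m K) / (\<Sum>K\<in>S. b K * m K) \<le> hi - (hi - c) / \<kappa>"
  using averaging_step[where a = "\<lambda>K. - a K" and lo = "- hi", OF assms(1-6)] hi
  by (simp_all add: c_def sum_negf algebra_simps)

definition mprod :: "('n::finite) rmat list \<Rightarrow> 'n rmat" where
  "mprod Ms = foldr (**) Ms (mat 1)"

lemma mprod_simps [simp]:
  "mprod [] = mat 1" "mprod (M # Ms) = M ** mprod Ms"
  by (simp_all add: mprod_def)

lemma mprod_append: "mprod (Ms @ Ns) = mprod Ms ** mprod Ns"
  by (induction Ms) (auto simp: matrix_mul_assoc)

lemma STP_mult:
  fixes P M :: "('n::{finite,linorder}) rmat"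
  assumes "STP P" "STP M"
  shows "STP (P ** M)"
  unfolding STP_def
proof (intro allI ballI)
  fix k I J assume IJ: "I \<in> strict_lists CARD('n) k" "J \<in> strict_lists CARD('n) k"
  then have "0 < (\<Sum>K\<in>strict_lists CARD('n) k. tminor P I K * tminor M K J)"
    using assms unfolding STP_def by (intro sum_pos mult_pos_pos) auto
  then show "0 < tminor (P ** M) I J" using IJ by (simp add: tminor_mult strict_lists_def)
qed

lemma tminor_mult':
  fixes A B :: "('n::{finite,linorder}) rmat"
  assumes "I \<in> strict_lists n k" "length J = k"
  shows "tminor (A ** B) I J = (\<Sum>K\<in>strict_lists CARD('n) k. tminor A I K * tminor B K J)"
  using assms by (simp add: tminor_mult strict_lists_def)

text \<open>
  For fixed rows \<open>I\<close> and \<open>I0\<close> the ratios of the minors of a product over all column sets lie in an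
  interval whose length decays geometrically in the number of factors.
\<close>

lemma minor_ratio_oscillation:
  fixes Ms :: "('n::{finite,linorder}) rmat list"
  assumes \<kappa>: "1 < \<kappa>" and "Ms \<noteq> []" and Ms: "\<And>M. M \<in> set Ms \<Longrightarrow> comparable \<kappa> M"
    and I: "I \<in> strict_lists CARD('n) k" and I0: "I0 \<in> strict_lists CARD('n) k"
  shows "STP (mprod Ms) \<and> (\<exists>lo hi. 1 / \<kappa> \<le> lo \<and> hi \<le> \<kappa> \<and> hi - lo \<le> \<kappa> * (1 - 1 / \<kappa>) ^ (length Ms - 1) \<and>
    (\<forall>J\<in>strict_lists CARD('n) k. lo * tminor (mprod Ms) I0 J \<le> tminor (mprod Ms) I J \<and>
      tminor (mprod Ms) I J \<le> hi * tminor (mprod Ms) I0 J))"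
  using assms(2) Ms
proof (induction Ms rule: rev_nonempty_induct)
  case (single M)
  then have M: "comparable \<kappa> M" by simp
  have pos: "0 < tminor M I J" if "I \<in> strict_lists CARD('n) k" "J \<in> strict_lists CARD('n) k" for I J
    using M that unfolding comparable_def STP_def by blast
  have cmp: "tminor M I J \<le> \<kappa> * tminor M I' J'"
    if "I \<in> strict_lists CARD('n) k" "J \<in> strict_lists CARD('n) k"
      "I' \<in> strict_lists CARD('n) k" "J' \<in> strict_lists CARD('n) k" for I J I' J'
    using M that unfolding comparable_def by blast
  have "1 / \<kappa> * tminor M I0 J \<le> tminor M I J \<and> tminor M I J \<le> \<kappa> * tminor M I0 J"
    if "J \<in> strict_lists CARD('n) k" for J
    using cmp[OF I that I0 that] cmp[OF I0 that I that] \<kappa> by (simp add: field_simps)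
  then show ?case using M \<kappa>
    by (intro conjI exI[of _ "1 / \<kappa>"] exI[of _ \<kappa>]) (auto simp: comparable_def)
next
  case (snoc M Ms)
  let ?S = "strict_lists CARD('n) k"
  let ?P = "mprod Ms"
  have M: "comparable \<kappa> M" using snoc.prems by simp
  from snoc have P: "STP ?P" and "\<exists>lo hi. 1 / \<kappa> \<le> lo \<and> hi \<le> \<kappa> \<and> hi - lo \<le> \<kappa> * (1 - 1 / \<kappa>) ^ (length Ms - 1) \<and>
    (\<forall>J\<in>?S. lo * tminor ?P I0 J \<le> tminor ?P I J \<and> tminor ?P I J \<le> hi * tminor ?P I0 J)"
    by auto
  then obtain lo hi where lo: "1 / \<kappa> \<le> lo" and hi: "hi \<le> \<kappa>"
    and osc: "hi - lo \<le> \<kappa> * (1 - 1 / \<kappa>) ^ (length Ms - 1)"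
    and bnd: "\<And>J. J \<in> ?S \<Longrightarrow> lo * tminor ?P I0 J \<le> tminor ?P I J"
      "\<And>J. J \<in> ?S \<Longrightarrow> tminor ?P I J \<le> hi * tminor ?P I0 J" by blast
  have PM: "STP (?P ** M)" using P M by (simp add: comparable_def STP_mult)
  define c where "c = sum (tminor ?P I) ?S / sum (tminor ?P I0) ?S"
  have ne: "?S \<noteq> {}" using I by blast
  have pos: "0 < tminor ?P I0 K" if "K \<in> ?S" for K using P that I0 unfolding STP_def by blast
  have bounds: "lo \<le> c \<and> c \<le> hi \<and>
      lo + (c - lo) / \<kappa> \<le> tminor (?P ** M) I J / tminor (?P ** M) I0 J \<and>
      tminor (?P ** M) I J / tminor (?P ** M) I0 J \<le> hi - (hi - c) / \<kappa>" if J: "J \<in> ?S" for J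
  proof -
    have m: "\<And>K. K \<in> ?S \<Longrightarrow> 0 < tminor M K J"
      and cmp: "\<And>K K'. K \<in> ?S \<Longrightarrow> K' \<in> ?S \<Longrightarrow> tminor M K' J \<le> \<kappa> * tminor M K J"
      using M J unfolding comparable_def STP_def by blast+
    have e: "tminor (?P ** M) I J = (\<Sum>K\<in>?S. tminor ?P I K * tminor M K J)"
      "tminor (?P ** M) I0 J = (\<Sum>K\<in>?S. tminor ?P I0 K * tminor M K J)"
      using I I0 J by (auto simp: strict_lists_def tminor_mult')
    show ?thesis
      unfolding e c_def
      using averaging_step[where a = "tminor ?P I" and b = "tminor ?P I0" and m = "\<lambda>K. tminor M K J" and S = ?S and \<kappa> = \<kappa> and lo = lo]
        averaging_step_upper[where a = "tminor ?P I" and b = "tminor ?P I0" and m = "\<lambda>K. tminor M K J" and S = ?S and \<kappa> = \<kappa> and hi = hi]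
        finite_strict_lists ne \<kappa> pos m cmp bnd by (smt (verit) zero_less_one)
  qed
  have c: "lo \<le> c" "c \<le> hi" using bounds I by blast+
  define lo' hi' where "lo' = lo + (c - lo) / \<kappa>" and "hi' = hi - (hi - c) / \<kappa>"
  have "hi' - lo' = (hi - lo) * (1 - 1 / \<kappa>)"
    using \<kappa> by (simp add: lo'_def hi'_def field_simps)
  also have "\<dots> \<le> \<kappa> * (1 - 1 / \<kappa>) ^ (length Ms - 1) * (1 - 1 / \<kappa>)"
    using osc \<kappa> by (intro mult_right_mono) auto
  also have "\<dots> = \<kappa> * (1 - 1 / \<kappa>) ^ (length (Ms @ [M]) - 1)"
    using snoc.hyps by (cases Ms) auto
  finally have o': "hi' - lo' \<le> \<kappa> * (1 - 1 / \<kappa>) ^ (length (Ms @ [M]) - 1)" .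
  have "0 \<le> (c - lo) / \<kappa>" "0 \<le> (hi - c) / \<kappa>" using c \<kappa> by simp_all
  then have "1 / \<kappa> \<le> lo'" "hi' \<le> \<kappa>"
    using lo hi unfolding lo'_def hi'_def by linarith+
  moreover have "lo' * tminor (?P ** M) I0 J \<le> tminor (?P ** M) I J \<and>
      tminor (?P ** M) I J \<le> hi' * tminor (?P ** M) I0 J" if J: "J \<in> ?S" for J
  proof -
    have "0 < tminor (?P ** M) I0 J" using PM I0 J unfolding STP_def by blast
    then show ?thesis using bounds[OF J] by (simp add: lo'_def hi'_def field_simps)
  qed
  ultimately show ?case using o' PM by (auto simp: mprod_append)
qed


lemma rows_initial_strict:
  "j < n \<Longrightarrow> j \<le> i \<Longrightarrow> i < n \<Longrightarrow> [0..<j] @ [i] \<in> strict_lists n (Suc j)"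
  by (auto simp: strict_lists_def sorted_wrt_append)

lemma initial_strict: "k \<le> n \<Longrightarrow> [0..<k] \<in> strict_lists n k"
  using upt_strict_lists[of 0 k n] by simp

text \<open>
  A further factor on the right averages the ratios of the minors with its own minors \<open>y\<close> as
  nonnegative weights, so that the averages stay in the same short interval.
\<close>

lemma minor_ratio_weighted:
  fixes Ms :: "('n::{finite,linorder}) rmat list"
  assumes \<kappa>: "1 < \<kappa>" and "Ms \<noteq> []" and Ms: "\<And>M. M \<in> set Ms \<Longrightarrow> comparable \<kappa> M"
    and I: "I \<in> strict_lists CARD('n) k" and I0: "I0 \<in> strict_lists CARD('n) k"
    and J: "J \<in> strict_lists CARD('n) k"
    and y: "\<And>K. K \<in> strict_lists CARD('n) k \<Longrightarrow> 0 \<le> y K"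
      "L \<in> strict_lists CARD('n) k" "0 < y L"
  defines "r \<equiv> (\<Sum>K\<in>strict_lists CARD('n) k. tminor (mprod Ms) I K * y K) /
      (\<Sum>K\<in>strict_lists CARD('n) k. tminor (mprod Ms) I0 K * y K)"
  shows "0 < (\<Sum>K\<in>strict_lists CARD('n) k. tminor (mprod Ms) I0 K * y K)"
    "1 / \<kappa> \<le> r" "r \<le> \<kappa>"
    "\<bar>r - tminor (mprod Ms) I J / tminor (mprod Ms) I0 J\<bar> \<le> \<kappa> * (1 - 1 / \<kappa>) ^ (length Ms - 1)"
proof -
  let ?S = "strict_lists CARD('n) k" and ?P = "mprod Ms"
  from minor_ratio_oscillation[OF assms(1-5)] obtain lo hi
    where P: "STP ?P" and lo: "1 / \<kappa> \<le> lo" and hi: "hi \<le> \<kappa>"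
      and osc: "hi - lo \<le> \<kappa> * (1 - 1 / \<kappa>) ^ (length Ms - 1)"
      and bnd: "\<And>J. J \<in> ?S \<Longrightarrow> lo * tminor ?P I0 J \<le> tminor ?P I J"
        "\<And>J. J \<in> ?S \<Longrightarrow> tminor ?P I J \<le> hi * tminor ?P I0 J" by blast
  have pos: "0 < tminor ?P I0 K" if "K \<in> ?S" for K using P that I0 unfolding STP_def by blast
  show sp: "0 < (\<Sum>K\<in>?S. tminor ?P I0 K * y K)"
    using pos y by (intro sum_pos2[OF _ y(2)] mult_pos_pos mult_nonneg_nonneg) (auto intro: less_imp_le)
  have "lo * (\<Sum>K\<in>?S. tminor ?P I0 K * y K) \<le> (\<Sum>K\<in>?S. tminor ?P I K * y K)"
    unfolding sum_distrib_left mult.assoc[symmetric] by (intro sum_mono mult_right_mono bnd y)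
  then have r1: "lo \<le> r" using sp by (simp add: r_def field_simps)
  have "(\<Sum>K\<in>?S. tminor ?P I K * y K) \<le> hi * (\<Sum>K\<in>?S. tminor ?P I0 K * y K)"
    unfolding sum_distrib_left mult.assoc[symmetric] by (intro sum_mono mult_right_mono bnd y)
  then have r2: "r \<le> hi" using sp by (simp add: r_def field_simps)
  have "lo \<le> tminor ?P I J / tminor ?P I0 J" "tminor ?P I J / tminor ?P I0 J \<le> hi"
    using bnd[OF J] pos[OF J] by (auto simp: field_simps)
  with r1 r2 lo hi osc show "1 / \<kappa> \<le> r" "r \<le> \<kappa>"
    "\<bar>r - tminor ?P I J / tminor ?P I0 J\<bar> \<le> \<kappa> * (1 - 1 / \<kappa>) ^ (length Ms - 1)" by linarith+
qed

lemma minor_ratio_bounds: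
  fixes Ms :: "('n::{finite,linorder}) rmat list"
  assumes "1 < \<kappa>" "Ms \<noteq> []" "\<And>M. M \<in> set Ms \<Longrightarrow> comparable \<kappa> M"
    and "I \<in> strict_lists CARD('n) k" "I0 \<in> strict_lists CARD('n) k"
    and "J \<in> strict_lists CARD('n) k" "J' \<in> strict_lists CARD('n) k"
  shows "1 / \<kappa> \<le> tminor (mprod Ms) I J / tminor (mprod Ms) I0 J"
    "tminor (mprod Ms) I J / tminor (mprod Ms) I0 J \<le> \<kappa>"
    "\<bar>tminor (mprod Ms) I J / tminor (mprod Ms) I0 J -
      tminor (mprod Ms) I J' / tminor (mprod Ms) I0 J'\<bar> \<le> \<kappa> * (1 - 1 / \<kappa>) ^ (length Ms - 1)"
proof -
  have e: "(\<Sum>K\<in>strict_lists CARD('n) k. f K * (if K = J then 1 else 0)) = f J" for f :: "nat list \<Rightarrow> real"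
    using assms(6) by (simp add: if_distrib cong: if_cong)
  show "1 / \<kappa> \<le> tminor (mprod Ms) I J / tminor (mprod Ms) I0 J"
    "tminor (mprod Ms) I J / tminor (mprod Ms) I0 J \<le> \<kappa>"
    "\<bar>tminor (mprod Ms) I J / tminor (mprod Ms) I0 J -
      tminor (mprod Ms) I J' / tminor (mprod Ms) I0 J'\<bar> \<le> \<kappa> * (1 - 1 / \<kappa>) ^ (length Ms - 1)"
    using minor_ratio_weighted[OF assms(1-5,7), of "\<lambda>K. if K = J then 1 else 0" J] assms(6)
    unfolding e by auto
qed

lemma STP_mprod:
  assumes "Ms \<noteq> []" "\<And>M. M \<in> set Ms \<Longrightarrow> STP M"
  shows "STP (mprod Ms)"
  using assms by (induction Ms rule: rev_nonempty_induct) (auto simp: mprod_append STP_mult)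

lemma minor_ratio_columns:
  fixes Ms :: "('n::{finite,linorder}) rmat list"
  assumes "Ms \<noteq> []" and Ms: "\<And>M. M \<in> set Ms \<Longrightarrow> comparable \<kappa> M"
    and I: "I \<in> strict_lists CARD('n) k"
    and J: "J \<in> strict_lists CARD('n) k" "J' \<in> strict_lists CARD('n) k"
  shows "tminor (mprod Ms) I J \<le> \<kappa> * tminor (mprod Ms) I J'"
proof -
  obtain Ns M where Ns: "Ms = Ns @ [M]" using assms(1) by (metis rev_exhaust)
  have M: "tminor M K J \<le> \<kappa> * tminor M K J'" if "K \<in> strict_lists CARD('n) k" for K
    using Ms[of M] that J unfolding Ns comparable_def by auto
  show ?thesis
  proof (cases "Ns = []")
    case True
    then show ?thesis using M[OF I] by (simp add: Ns)
  next
    case False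
    then have P: "STP (mprod Ns)" using Ms by (intro STP_mprod) (auto simp: Ns comparable_def)
    have "(\<Sum>K\<in>strict_lists CARD('n) k. tminor (mprod Ns) I K * tminor M K J) \<le>
        (\<Sum>K\<in>strict_lists CARD('n) k. tminor (mprod Ns) I K * (\<kappa> * tminor M K J'))"
      using P I M unfolding STP_def by (intro sum_mono mult_left_mono) (auto intro: less_imp_le)
    then show ?thesis
      using tminor_mult'[OF I, of J "mprod Ns" M] tminor_mult'[OF I, of J' "mprod Ns" M] J
      by (simp add: Ns mprod_append sum_distrib_left mult.left_commute strict_lists_def[of _ k])
  qed
qed

lemma regular_STP: "STP P \<Longrightarrow> regular P" for P :: "('n::{finite,linorder}) rmat"
  using initial_strict[of _ "CARD('n)"] by (force simp: STP_def regular_def)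

lemma regular_trp [simp]: "regular (trp P) = regular P"
  by (simp add: regular_def tminor_transpose)

lemma lower_factor_mprod_bound:
  fixes Ms :: "('n::{finite,linorder}) rmat list"
  assumes "1 < \<kappa>" "Ms \<noteq> []" "\<And>M. M \<in> set Ms \<Longrightarrow> comparable \<kappa> M" and ij: "i < CARD('n)" "j < CARD('n)"
  shows "\<bar>mn (lower_factor (mprod Ms)) i j\<bar> \<le> \<kappa>" "\<bar>mn (lower_factor (trp (mprod Ms))) i j\<bar> \<le> \<kappa>"
proof -
  have P: "STP (mprod Ms)" using assms by (intro STP_mprod) (auto simp: comparable_def)
  then have reg: "regular (mprod Ms)" by (rule regular_STP)
  have "\<bar>mn (lower_factor (mprod Ms)) i j\<bar> \<le> \<kappa> \<and> \<bar>mn (lower_factor (trp (mprod Ms))) i j\<bar> \<le> \<kappa>"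
  proof (cases "i < j")
    case True
    then have "mn (lower_factor (mprod Ms)) i j = 0" "mn (lower_factor (trp (mprod Ms))) i j = 0"
      using lower_unip_lower_factor[OF reg] lower_unip_lower_factor[of "trp (mprod Ms)"] reg ij
      by (auto simp: lower_unip_mn)
    then show ?thesis using assms(1) by simp
  next
    case False
    then have I: "[0..<j] @ [i] \<in> strict_lists CARD('n) (Suc j)" "[0..<Suc j] \<in> strict_lists CARD('n) (Suc j)"
      using ij rows_initial_strict[of j "CARD('n)" i] initial_strict[of "Suc j" "CARD('n)"] by auto
    let ?I = "[0..<j] @ [i]" and ?J = "[0..<Suc j]"
    have pos: "0 < tminor (mprod Ms) ?J ?J" "0 < tminor (mprod Ms) ?J ?I"
      using P I unfolding STP_def by blast+
    have 1: "mn (lower_factor (mprod Ms)) i j = tminor (mprod Ms) ?I ?J / tminor (mprod Ms) ?J ?J"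
      using ij by (simp add: lower_factor_def)
    have 2: "mn (lower_factor (trp (mprod Ms))) i j = tminor (mprod Ms) ?J ?I / tminor (mprod Ms) ?J ?J"
      using ij by (simp add: lower_factor_def tminor_transpose)
    have "0 \<le> 1 / \<kappa>" using assms(1) by simp
    then have "\<bar>mn (lower_factor (mprod Ms)) i j\<bar> \<le> \<kappa>"
      using minor_ratio_bounds(1,2)[OF assms(1-3) I(1,2,2,2)] unfolding 1 by linarith
    moreover have "\<bar>mn (lower_factor (trp (mprod Ms))) i j\<bar> \<le> \<kappa>"
      using minor_ratio_columns[OF assms(2,3) I(2,1,2)] pos unfolding 2 by (simp add: field_simps)
    ultimately show ?thesis by blast
  qed
  then show "\<bar>mn (lower_factor (mprod Ms)) i j\<bar> \<le> \<kappa>" "\<bar>mn (lower_factor (trp (mprod Ms))) i j\<bar> \<le> \<kappa>" by auto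
qed

text \<open>
  Only minors in initial columns matter for the flag spanned by a matrix.  The inequalities for
  noninitial rows are not strict, so that they survive in limits of unipotent matrices.
\<close>

definition nonneg_initial :: "('n::{finite,linorder}) rmat \<Rightarrow> bool" where
  "nonneg_initial Y \<longleftrightarrow> (\<forall>k\<le>CARD('n). 0 < lead Y k \<and> (\<forall>K\<in>strict_lists CARD('n) k. 0 \<le> tminor Y K [0..<k]))"

lemma nonneg_initial_STP: "STP Y \<Longrightarrow> nonneg_initial Y" for Y :: "('n::{finite,linorder}) rmat"
  using initial_strict[of _ "CARD('n)"] by (force simp: STP_def nonneg_initial_def intro: less_imp_le)

text \<open>
  The entries of the lower unipotent factor are ratios of minors in the same columns, hence hardly
  change under further factors on the right.
\<close>

lemma lower_factor_mprod_limit: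
  fixes Ms :: "('n::{finite,linorder}) rmat list"
  assumes "1 < \<kappa>" "Ms \<noteq> []" "\<And>M. M \<in> set Ms \<Longrightarrow> comparable \<kappa> M" and Y: "nonneg_initial Y"
  shows "regular (mprod Ms ** Y)"
    "i < CARD('n) \<Longrightarrow> j < CARD('n) \<Longrightarrow>
      \<bar>mn (lower_factor (mprod Ms ** Y)) i j - mn (lower_factor (mprod Ms)) i j\<bar> \<le> \<kappa> * (1 - 1 / \<kappa>) ^ (length Ms - 1)"
proof -
  let ?P = "mprod Ms"
  note w = minor_ratio_weighted[OF assms(1-3), where y = "\<lambda>K. tminor Y K [0..<k]" and L = "[0..<k]" and k = k for k]
  have mult: "tminor (?P ** Y) I [0..<k] = (\<Sum>K\<in>strict_lists CARD('n) k. tminor ?P I K * tminor Y K [0..<k])"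
    if "I \<in> strict_lists CARD('n) k" for I k
    using that by (simp add: tminor_mult')
  have "0 < lead (?P ** Y) k" if "k \<le> CARD('n)" for k
    using w(1)[of "[0..<k]" k "[0..<k]" "[0..<k]"] that initial_strict[OF that] Y
    by (simp add: mult nonneg_initial_def)
  then show reg: "regular (?P ** Y)" by (force simp: regular_def)
  have P: "STP ?P" using assms by (intro STP_mprod) (auto simp: comparable_def)
  then have regP: "regular ?P" by (rule regular_STP)
  assume ij: "i < CARD('n)" "j < CARD('n)"
  show "\<bar>mn (lower_factor (?P ** Y)) i j - mn (lower_factor ?P) i j\<bar> \<le> \<kappa> * (1 - 1 / \<kappa>) ^ (length Ms - 1)"
  proof (cases "i < j")
    case True
    then have "mn (lower_factor ?P) i j = 0" "mn (lower_factor (?P ** Y)) i j = 0"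
      using lower_unip_lower_factor[OF reg] lower_unip_lower_factor[OF regP] ij by (auto simp: lower_unip_mn)
    then show ?thesis using assms(1) by simp
  next
    case False
    then have I: "[0..<j] @ [i] \<in> strict_lists CARD('n) (Suc j)" "[0..<Suc j] \<in> strict_lists CARD('n) (Suc j)"
      using ij rows_initial_strict[of j "CARD('n)" i] initial_strict[of "Suc j" "CARD('n)"] by auto
    have "mn (lower_factor (?P ** Y)) i j = tminor (?P ** Y) ([0..<j] @ [i]) [0..<Suc j] / lead (?P ** Y) (Suc j)"
      "mn (lower_factor ?P) i j = tminor ?P ([0..<j] @ [i]) [0..<Suc j] / lead ?P (Suc j)"
      using ij by (simp_all add: lower_factor_def)
    then show ?thesis
      unfolding mult[OF I(1)] mult[OF I(2)]
      using w(4)[OF _ I(1,2,2)] Y I(2) ij by (auto simp: nonneg_initial_def simp del: upt_Suc)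
  qed
qed

definition dg :: "(nat \<Rightarrow> real) \<Rightarrow> ('n::{finite,linorder}) rmat" where
  "dg d = mk (\<lambda>i j. if i = j then d i else 0)"

lemma mn_dg_mult: "i < CARD('n) \<Longrightarrow> j < CARD('n) \<Longrightarrow> mn (dg d ** A) i j = d i * mn A i j"
  for A :: "('n::{finite,linorder}) rmat"
  by (simp add: mn_mult dg_def if_distrib[of "\<lambda>x. x * _"] cong: if_cong)

lemma mn_mult_dg: "i < CARD('n) \<Longrightarrow> j < CARD('n) \<Longrightarrow> mn (A ** dg d) i j = mn A i j * d j"
  for A :: "('n::{finite,linorder}) rmat"
  by (simp add: mn_mult dg_def if_distrib[of "\<lambda>x. _ * x"] cong: if_cong)

lemma lower_factor_dg_mult:
  fixes A :: "('n::{finite,linorder}) rmat"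
  assumes d: "\<And>i. i < CARD('n) \<Longrightarrow> d i \<noteq> 0" and A: "regular A"
  shows "regular (dg d ** A)"
    "i < CARD('n) \<Longrightarrow> j < CARD('n) \<Longrightarrow> mn (lower_factor (dg d ** A)) i j = d i / d j * mn (lower_factor A) i j"
proof -
  have m: "tminor (dg d ** A) I J = prod_list (map d I) * tminor A I J"
    if "set I \<subseteq> {..<CARD('n)}" "set J \<subseteq> {..<CARD('n)}" "length J = length I" for I J
  proof -
    have "tminor (dg d ** A) I J = minor (\<lambda>i j. d i * mn A i j) I J"
      by (rule minor_cong) (use that in \<open>auto simp: mn_dg_mult subset_iff\<close>)
    then show ?thesis by (simp add: minor_scale_rows)
  qed
  have nz: "prod_list (map d [0..<k]) \<noteq> 0" if "k \<le> CARD('n)" for k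
    using d that by (auto simp: prod_list_zero_iff)
  show "regular (dg d ** A)"
    unfolding regular_def
  proof (intro allI impI)
    fix k assume k: "k \<le> CARD('n)"
    have "lead (dg d ** A) k = prod_list (map d [0..<k]) * lead A k"
      by (rule m) (use k in auto)
    then show "lead (dg d ** A) k \<noteq> 0" using nz[OF k] A k by (simp add: regular_def)
  qed
  assume ij: "i < CARD('n)" "j < CARD('n)"
  have "tminor (dg d ** A) ([0..<j] @ [i]) [0..<Suc j] =
      prod_list (map d ([0..<j] @ [i])) * tminor A ([0..<j] @ [i]) [0..<Suc j]"
    by (rule m) (use ij in auto)
  moreover have "lead (dg d ** A) (Suc j) = prod_list (map d [0..<Suc j]) * lead A (Suc j)"
    by (rule m) (use ij in auto)
  ultimately have "mn (lower_factor (dg d ** A)) i j =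
      prod_list (map d ([0..<j] @ [i])) * tminor A ([0..<j] @ [i]) [0..<Suc j] /
      (prod_list (map d ([0..<j] @ [j])) * lead A (Suc j))"
    using ij by (simp add: lower_factor_def)
  then show "mn (lower_factor (dg d ** A)) i j = d i / d j * mn (lower_factor A) i j"
    using ij nz[of j] by (simp add: lower_factor_def)
qed

lemma LDU_factorization:
  fixes P :: "('n::{finite,linorder}) rmat"
  assumes "regular P"
  obtains d where "\<And>i. i < CARD('n) \<Longrightarrow> d i \<noteq> 0" "P = lower_factor P ** (dg d ** trp (lower_factor (trp P)))"
proof -
  define K where "K = lower_factor (trp P)"
  define S where "S = upper_factor (trp P)"
  have r: "regular (trp P)" using assms by simp
  have K: "lower_unip K" unfolding K_def by (rule lower_unip_lower_factor[OF r])
  have S: "upper_inv S" unfolding S_def by (rule upper_inv_upper_factor[OF r])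
  have "trp P ** S = K" unfolding K_def S_def by (rule mult_upper_factor[OF r])
  then have "K ** upper_factor S = trp P ** (S ** upper_factor S)" by (simp add: matrix_mul_assoc)
  then have "trp (trp P) = trp (K ** upper_factor S)" using upper_inv_inverse(2)[OF S] by simp
  then have P: "P = trp (upper_factor S) ** trp K" by (simp add: matrix_transpose_mul)
  define d where "d j = mn (upper_factor S) j j" for j
  have d: "d i \<noteq> 0" if "i < CARD('n)" for i
    using upper_inv_inverse(1)[OF S] that by (auto simp: d_def upper_inv_mn)
  define L where "L = trp (upper_factor S) ** dg (\<lambda>j. 1 / d j)"
  have L: "lower_unip L"
    using upper_inv_inverse(1)[OF S] d by (auto simp: L_def lower_unip_mn upper_inv_mn mn_mult_dg d_def[symmetric])
  have "L ** dg d = trp (upper_factor S)"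
    by (rule mn_eqI) (use d in \<open>simp add: L_def mn_mult_dg\<close>)
  then have P': "P = L ** (dg d ** trp K)" by (simp add: P matrix_mul_assoc)
  have "upper_inv (dg d ** trp K)"
    using K d by (auto simp: upper_inv_mn lower_unip_mn mn_dg_mult)
  then have "lower_factor P = L" unfolding P' by (rule lower_factor_eqI'(2)[OF _ L])
  with P' d that[of d] show ?thesis by (simp add: K_def)
qed

text \<open>
  Exchanging columns \<open>j\<close> and \<open>j + 1\<close> of \<open>L ** T\<close> changes the lower unipotent factor only by the
  elementary matrix with entry \<open>T(j+1,j+1) / T(j,j+1)\<close> in position \<open>(j+1, j)\<close>.
\<close>

lemma diagonal_gap:
  fixes L T :: "('n::{finite,linorder}) rmat"
  assumes L: "lower_unip L" and T: "upper_inv T" and j: "Suc j < CARD('n)" and nz: "mn T j (Suc j) \<noteq> 0"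
  defines "P \<equiv> L ** T" and "I1 \<equiv> [0..<j] @ [Suc j]" and "I0 \<equiv> [0..<Suc j]"
  shows "tminor P I1 I1 / tminor P I0 I1 - tminor P I1 I0 / tminor P I0 I0 =
    mn T (Suc j) (Suc j) / mn T j (Suc j)"
proof -
  define sw where "sw c = (if c = j then Suc j else if c = Suc j then j else c)" for c
  define \<epsilon> where "\<epsilon> = mn T (Suc j) (Suc j) / mn T j (Suc j)"
  have sw: "sw c < CARD('n)" if "c < CARD('n)" for c using that j by (simp add: sw_def)
  define T' :: "'n rmat" where "T' = mk (\<lambda>r c. mn T r (sw c))"
  define P' :: "'n rmat" where "P' = mk (\<lambda>r c. mn P r (sw c))"
  have P': "P' = L ** T'"
    by (rule mn_eqI) (use sw in \<open>simp add: P'_def T'_def P_def mn_mult\<close>)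
  define E :: "'n rmat" where
    "E = mk (\<lambda>r l. (if l = r then 1 else 0) + (if l = j then (if r = Suc j then \<epsilon> else 0) else 0))"
  define S' :: "'n rmat" where
    "S' = mk (\<lambda>r c. mn T r (sw c) - (if r = Suc j then \<epsilon> * mn T j (sw c) else 0))"
  have sum_E: "(\<Sum>l<CARD('n). mn E r l * f l) = f r + (if r = Suc j then \<epsilon> * f j else 0)"
    if "r < CARD('n)" for r f
    using that j by (simp add: E_def distrib_right sum.distrib if_distrib[of "\<lambda>x. x * _"] cong: if_cong)
  have T': "T' = E ** S'"
  proof (rule mn_eqI)
    fix r c assume rc: "r < CARD('n)" "c < CARD('n)"
    have "mn (E ** S') r c = mn S' r c + (if r = Suc j then \<epsilon> * mn S' j c else 0)"
      unfolding mn_mult by (rule sum_E[OF rc(1)])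
    with rc j show "mn T' r c = mn (E ** S') r c" by (simp add: S'_def T'_def)
  qed
  have E: "lower_unip E" unfolding lower_unip_mn by (auto simp: E_def)
  have T0: "mn T r c = 0" if "c < r" "r < CARD('n)" for r c using T that by (simp add: upper_inv_mn)
  have Td: "mn T r r \<noteq> 0" if "r < CARD('n)" for r using T that by (simp add: upper_inv_mn)
  have S': "upper_inv S'"
    unfolding upper_inv_mn
  proof (intro conjI allI impI)
    fix r c assume r: "r < CARD('n)" "c < r"
    consider "c = j" "r = Suc j" | "c = j" "Suc j < r" | "c = Suc j" | "c \<noteq> j" "c \<noteq> Suc j"
      using r by linarith
    then show "mn S' r c = 0"
    proof cases
      case 1
      then show ?thesis using r nz by (simp add: S'_def sw_def \<epsilon>_def)
    qed (use r T0 in \<open>auto simp: S'_def sw_def\<close>)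
  next
    fix r assume r: "r < CARD('n)"
    have "\<epsilon> \<noteq> 0" using Td[OF j] nz by (simp add: \<epsilon>_def)
    then show "mn S' r r \<noteq> 0"
      using r nz Td[of r] Td[of j] T0[of j "Suc j"] j by (auto simp: S'_def sw_def)
  qed
  have lamP': "lower_factor P' = L ** E"
    using lower_factor_eqI'(2)[OF S' lower_unip_mult[OF L E]] by (simp add: P' T' matrix_mul_assoc)
  have LE: "mn (L ** E) (Suc j) j = mn L (Suc j) j + \<epsilon>"
  proof -
    have "mn (L ** E) (Suc j) j = (\<Sum>l<CARD('n). mn L (Suc j) l * (if l = j then 1 else 0) +
        mn L (Suc j) l * (if l = Suc j then \<epsilon> else 0))"
      unfolding mn_mult by (rule sum.cong) (use j in \<open>auto simp: E_def\<close>)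
    also have "\<dots> = mn L (Suc j) j + mn L (Suc j) (Suc j) * \<epsilon>"
      using j by (simp add: sum.distrib if_distrib[of "\<lambda>x. _ * x"] cong: if_cong)
    finally show ?thesis using L j by (simp add: lower_unip_mn)
  qed
  have cols: "tminor P' R [0..<Suc j] = tminor P R I1"
    if "length R = Suc j" "set R \<subseteq> {..<CARD('n)}" for R
  proof -
    have "tminor P' R [0..<Suc j] = minor (\<lambda>r c. mn P r (sw c)) R [0..<Suc j]"
      by (rule minor_cong) (use that j in \<open>auto simp: P'_def\<close>)
    also have "\<dots> = tminor P (map (\<lambda>r. r) R) (map sw [0..<Suc j])"
      by (rule minor_map[symmetric]) (use that in simp)
    also have "map sw [0..<Suc j] = I1" by (auto simp: I1_def sw_def intro!: map_idI)
    finally show ?thesis by simp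
  qed
  have "mn (lower_factor P') (Suc j) j = tminor P' I1 [0..<Suc j] / tminor P' I0 [0..<Suc j]"
    using j by (simp add: lower_factor_def I1_def I0_def)
  moreover have "tminor P' I1 [0..<Suc j] = tminor P I1 I1"
    by (rule cols) (use j in \<open>auto simp: I1_def\<close>)
  moreover have "tminor P' I0 [0..<Suc j] = tminor P I0 I1"
    by (rule cols) (use j in \<open>auto simp: I0_def\<close>)
  ultimately have "tminor P I1 I1 / tminor P I0 I1 = mn L (Suc j) j + \<epsilon>"
    using lamP' LE by (simp only:)
  moreover have "tminor P I1 I0 / tminor P I0 I0 = mn (lower_factor P) (Suc j) j"
    using j by (simp add: lower_factor_def I1_def I0_def)
  moreover have "lower_factor P = L" unfolding P_def by (rule lower_factor_eqI'(2)[OF T L])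
  ultimately show ?thesis by (simp add: \<epsilon>_def)
qed

text \<open>
  The left hand side of \<open>diagonal_gap\<close> is a difference of two ratios of minors for the same pair of row
  sets, and the oscillation of such ratios is exponentially small in the number of factors.
\<close>

theorem mprod_factorization:
  fixes Ms :: "('n::{finite,linorder}) rmat list"
  assumes \<kappa>: "1 < \<kappa>" and "Ms \<noteq> []" "\<And>M. M \<in> set Ms \<Longrightarrow> comparable \<kappa> M"
  obtains d where "\<And>i. i < CARD('n) \<Longrightarrow> d i \<noteq> 0"
    "mprod Ms = lower_factor (mprod Ms) ** (dg d ** trp (lower_factor (trp (mprod Ms))))"
    "\<And>j. Suc j < CARD('n) \<Longrightarrow> \<bar>d (Suc j) / d j\<bar> \<le> \<kappa> * (\<kappa> * (1 - 1 / \<kappa>) ^ (length Ms - 1))"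
proof -
  let ?P = "mprod Ms"
  have P: "STP ?P" using assms by (intro STP_mprod) (auto simp: comparable_def)
  then have reg: "regular ?P" by (rule regular_STP)
  then have regt: "regular (trp ?P)" by simp
  obtain d where d: "\<And>i. i < CARD('n) \<Longrightarrow> d i \<noteq> 0" and eq: "?P = lower_factor ?P ** (dg d ** trp (lower_factor (trp ?P)))"
    using LDU_factorization[OF reg] by metis
  let ?K = "lower_factor (trp ?P)"
  let ?T = "dg d ** trp ?K"
  have K: "lower_unip ?K" by (rule lower_unip_lower_factor[OF regt])
  have T: "upper_inv ?T" using K d by (auto simp: upper_inv_mn lower_unip_mn mn_dg_mult)
  have "\<bar>d (Suc j) / d j\<bar> \<le> \<kappa> * (\<kappa> * (1 - 1 / \<kappa>) ^ (length Ms - 1))" if j: "Suc j < CARD('n)" for j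
  proof -
    let ?I1 = "[0..<j] @ [Suc j]" and ?I0 = "[0..<Suc j]"
    have I: "?I1 \<in> strict_lists CARD('n) (Suc j)" "?I0 \<in> strict_lists CARD('n) (Suc j)"
      using j rows_initial_strict[of j "CARD('n)" "Suc j"] initial_strict[of "Suc j" "CARD('n)"] by auto
    define u where "u = mn ?K (Suc j) j"
    have "u = tminor ?P ?I0 ?I1 / tminor ?P ?I0 ?I0"
      using j by (simp add: u_def lower_factor_def tminor_transpose)
    moreover have "0 < tminor ?P ?I0 ?I1" "0 < tminor ?P ?I0 ?I0" using P I unfolding STP_def by blast+
    ultimately have u: "0 < u" by simp
    have u\<kappa>: "\<bar>u\<bar> \<le> \<kappa>" unfolding u_def by (rule lower_factor_mprod_bound(2)[OF assms]) (use j in auto)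
    have T1: "mn ?T j (Suc j) = d j * u" "mn ?T (Suc j) (Suc j) = d (Suc j)"
      using j K by (simp_all add: mn_dg_mult u_def lower_unip_mn)
    have nz: "mn ?T j (Suc j) \<noteq> 0" using T1 d[of j] j u by simp
    have "tminor ?P ?I1 ?I1 / tminor ?P ?I0 ?I1 - tminor ?P ?I1 ?I0 / tminor ?P ?I0 ?I0 =
        mn ?T (Suc j) (Suc j) / mn ?T j (Suc j)"
      using diagonal_gap[OF lower_unip_lower_factor[OF reg] T j nz] by (simp only: eq[symmetric])
    then have "\<bar>d (Suc j) / (d j * u)\<bar> \<le> \<kappa> * (1 - 1 / \<kappa>) ^ (length Ms - 1)"
      using minor_ratio_bounds(3)[OF assms I(1,2,1,2)] unfolding T1 by simp
    then have "u * \<bar>d (Suc j) / (d j * u)\<bar> \<le> \<kappa> * (\<kappa> * (1 - 1 / \<kappa>) ^ (length Ms - 1))"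
      using u u\<kappa> by (intro mult_mono) auto
    moreover have "\<bar>d (Suc j) / d j\<bar> = u * \<bar>d (Suc j) / (d j * u)\<bar>"
      using u d[of j] j by (simp add: abs_mult abs_divide field_simps)
    ultimately show ?thesis by simp
  qed
  with d eq that show ?thesis by blast
qed

section \<open>Convergence of matrices and their factors\<close>

lemma tendsto_mn: "(f \<longlongrightarrow> A) G \<Longrightarrow> ((\<lambda>x. mn (f x) i j) \<longlongrightarrow> mn A i j) G"
  unfolding mn_def by (intro tendsto_vec_nth)

lemma tendsto_matrixI:
  fixes A :: "('n::{finite,linorder}) rmat"
  assumes "\<And>i j. i < CARD('n) \<Longrightarrow> j < CARD('n) \<Longrightarrow> ((\<lambda>x. mn (f x) i j) \<longlongrightarrow> mn A i j) G"
  shows "(f \<longlongrightarrow> A) G"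
proof (intro vec_tendstoI)
  fix i j :: 'n
  show "((\<lambda>x. f x $ i $ j) \<longlongrightarrow> A $ i $ j) G"
    using assms[of "ix i" "ix j"] by (simp add: mn_def)
qed

lemma tendsto_mult_matrix:
  fixes A B :: "('n::{finite,linorder}) rmat"
  assumes "(f \<longlongrightarrow> A) G" "(g \<longlongrightarrow> B) G"
  shows "((\<lambda>x. f x ** g x) \<longlongrightarrow> A ** B) G"
  by (rule tendsto_matrixI, unfold mn_mult)
    (intro tendsto_sum tendsto_mult tendsto_mn assms)

lemma tendsto_trp:
  fixes A :: "('n::{finite,linorder}) rmat"
  assumes "(f \<longlongrightarrow> A) G"
  shows "((\<lambda>x. trp (f x)) \<longlongrightarrow> trp A) G"
  by (rule tendsto_matrixI) (simp add: tendsto_mn[OF assms])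

lemma tendsto_tminor:
  "(f \<longlongrightarrow> A) G \<Longrightarrow> ((\<lambda>x. tminor (f x) I J) \<longlongrightarrow> tminor A I J) G"
  unfolding minor_def leibniz_det_def by (intro tendsto_intros tendsto_mn)

lemma lead_nonzero: "regular A \<Longrightarrow> k \<le> CARD('n) \<Longrightarrow> lead A k \<noteq> 0"
  for A :: "('n::{finite,linorder}) rmat"
  by (simp add: regular_def)

lemma tendsto_lower_factor:
  fixes A :: "('n::{finite,linorder}) rmat"
  assumes "(f \<longlongrightarrow> A) G" "regular A"
  shows "((\<lambda>x. lower_factor (f x)) \<longlongrightarrow> lower_factor A) G"
proof (rule tendsto_matrixI)
  fix i j assume ij: "i < CARD('n)" "j < CARD('n)"
  have "((\<lambda>x. tminor (f x) ([0..<j] @ [i]) [0..<Suc j] / lead (f x) (Suc j)) \<longlongrightarrow>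
      tminor A ([0..<j] @ [i]) [0..<Suc j] / lead A (Suc j)) G"
    by (intro tendsto_divide tendsto_tminor assms lead_nonzero) (use ij in simp)
  with ij show "((\<lambda>x. mn (lower_factor (f x)) i j) \<longlongrightarrow> mn (lower_factor A) i j) G"
    by (simp add: lower_factor_def del: upt_Suc)
qed

lemma tendsto_upper_factor:
  fixes A :: "('n::{finite,linorder}) rmat"
  assumes "(f \<longlongrightarrow> A) G" "regular A"
  shows "((\<lambda>x. upper_factor (f x)) \<longlongrightarrow> upper_factor A) G"
proof (rule tendsto_matrixI)
  fix c j assume ij: "c < CARD('n)" "j < CARD('n)"
  have "((\<lambda>x. (-1) ^ (j + c) * leibniz_det j (\<lambda>r l. mn (f x) r (if l < c then l else Suc l)) / lead (f x) (Suc j)) \<longlongrightarrow>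
      (-1) ^ (j + c) * leibniz_det j (\<lambda>r l. mn A r (if l < c then l else Suc l)) / lead A (Suc j)) G"
    unfolding leibniz_det_def
    by (intro tendsto_intros tendsto_tminor tendsto_mn assms lead_nonzero) (use ij in simp)
  with ij show "((\<lambda>x. mn (upper_factor (f x)) c j) \<longlongrightarrow> mn (upper_factor A) c j) G"
    by (cases "c \<le> j") (simp_all add: upper_factor_def del: upt_Suc)
qed

lemma eventually_regular:
  fixes A :: "('n::{finite,linorder}) rmat"
  assumes "(f \<longlongrightarrow> A) G" "regular A"
  shows "\<forall>\<^sub>F x in G. regular (f x)"
proof -
  have "\<forall>\<^sub>F x in G. lead (f x) k \<noteq> 0" if "k \<in> {..CARD('n)}" for k
    using that assms by (intro tendsto_imp_eventually_ne[OF tendsto_tminor] lead_nonzero) auto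
  then have "\<forall>\<^sub>F x in G. \<forall>k\<in>{..CARD('n)}. lead (f x) k \<noteq> 0"
    by (intro eventually_ball_finite) auto
  then show ?thesis by (rule eventually_mono) (auto simp: regular_def)
qed

lemma lower_unip_limit:
  fixes L :: "('n::{finite,linorder}) rmat"
  assumes lim: "Ls \<longlonglongrightarrow> L" and Ls: "\<And>m. lower_unip (Ls m)"
  shows "lower_unip L"
  unfolding lower_unip_mn
proof (intro conjI allI impI)
  fix i j assume "j < CARD('n)" "i < j"
  then have "mn (Ls m) i j = 0" for m using Ls by (auto simp: lower_unip_mn)
  then show "mn L i j = 0" using tendsto_mn[OF lim, of i j] by (simp add: LIMSEQ_const_iff)
next
  fix i assume "i < CARD('n)"
  then have "mn (Ls m) i i = 1" for m using Ls by (auto simp: lower_unip_mn)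
  then show "mn L i i = 1" using tendsto_mn[OF lim, of i i] by (simp add: LIMSEQ_const_iff)
qed

lemma open_eventually_nhds:
  assumes "\<And>x. x \<in> S \<Longrightarrow> \<forall>\<^sub>F y in nhds x. y \<in> S"
  shows "open S"
proof (subst open_subopen, intro ballI)
  fix x assume "x \<in> S"
  from assms[OF this] show "\<exists>T. open T \<and> x \<in> T \<and> T \<subseteq> S"
    unfolding eventually_nhds by blast
qed

lemma regular_invertible: "regular A \<Longrightarrow> invertible A" for A :: "('n::{finite,linorder}) rmat"
  by (simp add: invertible_det_nz det_eq_lead regular_def)

lemma upper_inv_invertible: "upper_inv S \<Longrightarrow> invertible S"
  using upper_inv_inverse[of S] unfolding invertible_def by blast

section \<open>Flags as cosets of upper triangular matrices\<close>

definition std_flag :: "nat \<Rightarrow> ('n::{finite,linorder}) rvec set" where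
  "std_flag i = {v. \<forall>k. i \<le> ix k \<longrightarrow> v $ k = 0}"

abbreviation fl :: "('n::{finite,linorder}) rmat \<Rightarrow> 'n flag" where
  "fl \<equiv> flag_of_matrix"

lemma std_flag_eq_span: "std_flag i = span ((\<lambda>k. axis k 1) ` {k :: 'n::{finite,linorder}. ix k < i})"
proof
  show "span ((\<lambda>k. axis k 1) ` {k :: 'n. ix k < i}) \<subseteq> std_flag i"
    by (rule span_minimal) (auto simp: std_flag_def axis_def subspace_def)
  show "std_flag i \<subseteq> span ((\<lambda>k. axis k 1) ` {k :: 'n. ix k < i})"
  proof
    fix v :: "'n rvec" assume v: "v \<in> std_flag i"
    have "v = (\<Sum>k\<in>UNIV. v $ k *\<^sub>R axis k 1)"
      by (simp add: Finite_Cartesian_Product.vec_eq_iff axis_def if_distrib cong: if_cong)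
    also have "\<dots> = (\<Sum>k\<in>{k. ix k < i}. v $ k *\<^sub>R axis k 1)"
      by (rule sum.mono_neutral_right) (use v in \<open>auto simp: std_flag_def not_less\<close>)
    also have "\<dots> \<in> span ((\<lambda>k. axis k 1) ` {k :: 'n. ix k < i})"
      by (intro span_sum span_scale span_base) auto
    finally show "v \<in> span ((\<lambda>k. axis k 1) ` {k :: 'n. ix k < i})" .
  qed
qed

lemma fl_eq_image: "fl A i = (\<lambda>v. A *v v) ` std_flag i"
proof -
  have "(\<lambda>v. A *v v) ` std_flag i = span ((\<lambda>v. A *v v) ` (\<lambda>k. axis k 1) ` {k. ix k < i})"
    unfolding std_flag_eq_span by (rule linear_span_image[symmetric]) (rule matrix_vector_mul_linear)
  then show ?thesis
    by (simp add: flag_of_matrix_def image_image matrix_vector_mult_basis ix_def)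
qed

lemma fl_mult: "fl (A ** B) i = (\<lambda>v. A *v v) ` fl B i"
  by (simp add: fl_eq_image image_image matrix_vector_mul_assoc)

lemma mult_upper_std_flag:
  fixes S :: "('n::{finite,linorder}) rmat" and v :: "'n rvec"
  assumes "upper_inv S" "v \<in> std_flag i"
  shows "S *v v \<in> std_flag i"
  unfolding std_flag_def
proof (intro CollectI allI impI)
  fix k :: 'n assume k: "i \<le> ix k"
  have z: "S $ k $ l * v $ l = 0" for l
  proof (cases "i \<le> ix l")
    case False
    then have "ix l < ix k" using k by linarith
    then show ?thesis using assms(1) by (simp add: upper_inv_def)
  qed (use assms(2) in \<open>simp add: std_flag_def\<close>)
  show "(S *v v) $ k = 0" by (simp only: matrix_vector_mult_def vec_lambda_beta z sum.neutral_const)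
qed

lemma fl_upper:
  fixes S :: "('n::{finite,linorder}) rmat"
  assumes S: "upper_inv S"
  shows "fl S i = std_flag i"
proof (intro subset_antisym subsetI)
  fix v :: "'n rvec"
  { assume "v \<in> fl S i" then show "v \<in> std_flag i" using mult_upper_std_flag[OF S] by (auto simp: fl_eq_image) }
  assume "v \<in> std_flag i"
  then have "upper_factor S *v v \<in> std_flag i" by (rule mult_upper_std_flag[OF upper_inv_inverse(1)[OF S]])
  moreover have "v = S *v (upper_factor S *v v)"
    by (simp add: matrix_vector_mul_assoc upper_inv_inverse[OF S])
  ultimately show "v \<in> fl S i" unfolding fl_eq_image by blast
qed

lemma fl_mult_upper: "upper_inv S \<Longrightarrow> fl (A ** S) = fl A"
  by (intro ext) (simp only: fl_mult fl_upper fl_eq_image[of A])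

lemma fl_lower_factor: "regular A \<Longrightarrow> fl (lower_factor A) = fl A"
  using fl_mult_upper[OF upper_inv_upper_factor] mult_upper_factor by metis

lemma fl_uminus [simp]: "fl (- A) = fl A"
proof (intro ext)
  fix i
  have "v \<in> uminus ` std_flag i" if "v \<in> std_flag i" for v :: "'a rvec"
    by (rule image_eqI[of _ _ "- v"]) (use that in \<open>auto simp: std_flag_def\<close>)
  then have neg: "uminus ` std_flag i = (std_flag i :: 'a rvec set)" by (auto simp: std_flag_def)
  have mv: "(- A) *v v = A *v (- v)" for v :: "'a rvec"
    by (simp add: Finite_Cartesian_Product.vec_eq_iff matrix_vector_mult_def sum_negf)
  have "fl (- A) i = (\<lambda>v. A *v v) ` uminus ` std_flag i"
    unfolding fl_eq_image image_image mv ..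
  then show "fl (- A) i = fl A i" by (simp add: neg fl_eq_image)
qed

lemma inj_matrix_vector_mult: "invertible A \<Longrightarrow> inj (\<lambda>v. A *v v)" for A :: "('n::finite) rmat"
  unfolding invertible_def by (metis (no_types, lifting) injI matrix_vector_mul_assoc matrix_vector_mul_lid)

lemma dim_std_flag: "dim (std_flag i :: ('n::{finite,linorder}) rvec set) = min i CARD('n)"
proof -
  have "independent ((\<lambda>k. axis k 1 :: 'n rvec) ` {k. ix k < i})"
    by (rule independent_mono[OF independent_Basis]) (auto simp: Basis_vec_def)
  then have "dim (std_flag i :: 'n rvec set) = card ((\<lambda>k. axis k 1 :: 'n rvec) ` {k :: 'n. ix k < i})"
    unfolding std_flag_eq_span by (rule dim_span_eq_card_independent)
  also have "\<dots> = card {k :: 'n. ix k < i}"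
    by (rule card_image) (auto simp: inj_on_def axis_eq_axis)
  also have "\<dots> = card (ix ` {k :: 'n. ix k < i})"
    by (rule card_image[symmetric]) (rule inj_on_subset[OF inj_ix], simp)
  also have "ix ` {k :: 'n. ix k < i} = {..<min i CARD('n)}"
  proof (intro subset_antisym subsetI)
    fix j assume "j \<in> {..<min i CARD('n)}"
    then show "j \<in> ix ` {k :: 'n. ix k < i}" by (intro image_eqI[of _ _ "en j"]) auto
  qed auto
  finally show ?thesis by simp
qed

lemma fl_in_flags:
  fixes A :: "('n::{finite,linorder}) rmat"
  assumes "invertible A"
  shows "fl A \<in> flags"
  unfolding flags_def
proof (intro CollectI conjI allI)
  fix i
  show "subspace (fl A i)" by (simp add: flag_of_matrix_def)
  have "dim (fl A i) = dim (std_flag i :: 'n rvec set)"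
    unfolding fl_eq_image
    by (rule dim_image_eq) (auto intro: inj_on_subset[OF inj_matrix_vector_mult[OF assms]])
  then show "dim (fl A i) = min i CARD('n)" by (simp add: dim_std_flag)
next
  show "mono (fl A)"
    unfolding mono_def flag_of_matrix_def by (intro allI impI span_mono image_mono) auto
qed

lemma flags_surj:
  fixes F :: "('n::{finite,linorder}) flag"
  assumes "F \<in> flags"
  obtains A where "invertible A" "F = fl A"
proof -
  have F: "subspace (F i)" "dim (F i) = min i CARD('n)" "mono F" for i
    using assms by (auto simp: flags_def)
  have "\<exists>v. v \<in> F (Suc (ix k)) \<and> v \<notin> F (ix k)" for k :: 'n
  proof (rule ccontr)
    assume "\<nexists>v. v \<in> F (Suc (ix k)) \<and> v \<notin> F (ix k)"
    then have "dim (F (Suc (ix k))) \<le> dim (F (ix k))" by (intro dim_subset) blast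
    then show False using ix_bound[of k] by (simp add: F)
  qed
  then have "\<exists>v. \<forall>k :: 'n. v k \<in> F (Suc (ix k)) \<and> v k \<notin> F (ix k)" by (intro choice allI)
  then obtain v where v: "\<And>k :: 'n. v k \<in> F (Suc (ix k))" "\<And>k. v k \<notin> F (ix k)" by blast
  define A :: "'n rmat" where "A = (\<chi> i j. v j $ i)"
  have col: "column k A = v k" for k
    by (simp add: A_def column_def Finite_Cartesian_Product.vec_eq_iff)
  have sub: "v k \<in> F i" if "ix k < i" for k i
    using v(1)[of k] monoD[OF F(3), of "Suc (ix k)" i] that by (auto simp: Suc_le_eq)
  have "x = 0" if x: "A *v x = 0" for x
  proof (rule ccontr)
    assume "x \<noteq> 0"
    then have ne: "{k. x $ k \<noteq> 0} \<noteq> {}" by (auto simp: Finite_Cartesian_Product.vec_eq_iff)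
    define m where "m = Max {k. x $ k \<noteq> 0}"
    have m: "x $ m \<noteq> 0" using Max_in[OF _ ne] by (simp add: m_def)
    have le: "k \<le> m" if "x $ k \<noteq> 0" for k using that by (simp add: m_def)
    have "A *v x = (\<Sum>k\<in>UNIV. x $ k *\<^sub>R v k)"
      by (simp add: Finite_Cartesian_Product.vec_eq_iff matrix_vector_mult_def A_def mult.commute)
    also have "\<dots> = x $ m *\<^sub>R v m + (\<Sum>k\<in>UNIV - {m}. x $ k *\<^sub>R v k)"
      by (rule sum.remove) auto
    finally have "x $ m *\<^sub>R v m = - (\<Sum>k\<in>UNIV - {m}. x $ k *\<^sub>R v k)"
      using x by (simp add: eq_neg_iff_add_eq_0)
    moreover have "(\<Sum>k\<in>UNIV - {m}. x $ k *\<^sub>R v k) \<in> F (ix m)"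
    proof (rule subspace_sum[OF F(1)])
      fix k assume "k \<in> UNIV - {m}"
      then show "x $ k *\<^sub>R v k \<in> F (ix m)"
        using le[of k] sub[of k "ix m"] F(1) by (cases "x $ k = 0") (auto simp: subspace_0 subspace_scale)
    qed
    ultimately have "x $ m *\<^sub>R v m \<in> F (ix m)" using F(1) by (simp add: subspace_neg)
    then have "(1 / x $ m) *\<^sub>R (x $ m *\<^sub>R v m) \<in> F (ix m)" by (rule subspace_scale[OF F(1)])
    with m v(2) show False by simp
  qed
  then have inv: "invertible A"
    by (simp add: invertible_left_inverse matrix_left_invertible_ker)
  have "fl A i = F i" for i
  proof (rule subspace_dim_equal)
    show "fl A i \<subseteq> F i"
      unfolding flag_of_matrix_def
      by (rule span_minimal) (use sub F(1) col in \<open>auto simp: ix_def\<close>)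
    show "subspace (fl A i)" by (simp add: flag_of_matrix_def)
    show "dim (F i) \<le> dim (fl A i)" using fl_in_flags[OF inv] by (simp add: flags_def F)
  qed (rule F)
  with inv that show ?thesis by blast
qed

lemma fl_eqD:
  fixes A :: "('n::{finite,linorder}) rmat"
  assumes "invertible A" "invertible B" "fl A = fl B"
  obtains S where "upper_inv S" "B = A ** S"
proof -
  obtain A' where A': "A ** A' = mat 1" "A' ** A = mat 1" using assms(1) by (auto simp: invertible_def)
  define S where "S = A' ** B"
  have "fl S i = std_flag i" for i
  proof -
    have "fl S i = (\<lambda>v. A' *v v) ` fl A i" by (simp add: S_def fl_mult assms(3))
    also have "\<dots> = std_flag i" by (simp add: fl_eq_image image_image matrix_vector_mul_assoc A')
    finally show ?thesis .
  qed
  then have *: "S *v axis j 1 \<in> std_flag (Suc (ix j))" for j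
    using fl_eq_image[of S "Suc (ix j)"] by (force simp: std_flag_def axis_def)
  have tri: "S $ i $ j = 0" if "j < i" for i j
  proof -
    have "S $ i $ j = (S *v axis j 1) $ i"
      by (simp add: matrix_vector_mult_basis column_def)
    then show ?thesis using *[of j] that by (auto simp: std_flag_def Suc_le_eq)
  qed
  have "det S \<noteq> 0"
  proof -
    have "invertible S"
      using A' assms(2) unfolding S_def by (intro invertible_mult) (auto simp: invertible_def)
    then show ?thesis by (simp add: invertible_det_nz)
  qed
  moreover have "mn S i j = 0" if "j < i" "i < CARD('n)" for i j
    unfolding mn_def by (rule tri) (use that in \<open>simp flip: ix_less_iff\<close>)
  then have "leibniz_det CARD('n) (mn S) = (\<Prod>i<CARD('n). mn S i i)"
    by (intro leibniz_det_upper_triangular)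
  moreover have "lead S CARD('n) = leibniz_det CARD('n) (mn S)"
    unfolding minor_def length_upt by (simp, rule leibniz_det_cong) simp
  ultimately have diag: "mn S i i \<noteq> 0" if "i < CARD('n)" for i
    using that by (auto simp: det_eq_lead)
  have "S $ i $ i \<noteq> 0" for i using diag[OF ix_bound[of i]] by (simp add: mn_def)
  with tri have "upper_inv S" by (simp add: upper_inv_def)
  moreover have "B = A ** S" by (simp add: S_def matrix_mul_assoc A')
  ultimately show ?thesis by (rule that)
qed

section \<open>Transversality and charts\<close>

text \<open>
  This matrix spans the coordinate flag opposite to the standard one, the base point for
  transversality.
\<close>

definition reversal :: "('n::{finite,linorder}) rmat" where
  "reversal = mk (\<lambda>i j. if i + j + 1 = CARD('n) then 1 else 0)"

lemma mn_reversal: "i < CARD('n) \<Longrightarrow> j < CARD('n) \<Longrightarrow>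
    mn (reversal :: ('n::{finite,linorder}) rmat) i j = (if i + j + 1 = CARD('n) then 1 else 0)"
  by (simp add: reversal_def)

lemma mn_reversal_mult: "i < CARD('n) \<Longrightarrow> j < CARD('n) \<Longrightarrow> mn (reversal ** A) i j = mn A (CARD('n) - Suc i) j"
  for A :: "('n::{finite,linorder}) rmat"
proof -
  assume ij: "i < CARD('n)" "j < CARD('n)"
  have "mn (reversal ** A) i j = (\<Sum>l<CARD('n). if l = CARD('n) - Suc i then mn A l j else 0)"
    unfolding mn_mult by (rule sum.cong) (use ij in \<open>auto simp: mn_reversal\<close>)
  then show ?thesis using ij by simp
qed

lemma reversal_reversal [simp]: "reversal ** reversal = (mat 1 :: ('n::{finite,linorder}) rmat)"
  by (rule mn_eqI) (auto simp: mn_reversal_mult mn_one mn_reversal)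

lemma invertible_reversal: "invertible (reversal :: ('n::{finite,linorder}) rmat)"
  unfolding invertible_def using reversal_reversal by blast

lemma reversal_mult_vec: "(reversal *v v) $ k = v $ en (CARD('n) - Suc (ix k))"
  for v :: "('n::{finite,linorder}) rvec"
proof -
  have "(reversal *v v) $ k = (\<Sum>l<CARD('n). (if ix k + l + 1 = CARD('n) then 1 else 0) * v $ en l)"
    by (simp add: matrix_vector_mult_def reversal_def mk_def sum_en)
  also have "\<dots> = (\<Sum>l<CARD('n). if l = CARD('n) - Suc (ix k) then v $ en l else 0)"
  proof (rule sum.cong[OF refl])
    fix l
    have "ix k + l + 1 = CARD('n) \<longleftrightarrow> l = CARD('n) - Suc (ix k)" using ix_bound[of k] by linarith
    then show "(if ix k + l + 1 = CARD('n) then 1 else 0) * v $ en l =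
        (if l = CARD('n) - Suc (ix k) then v $ en l else 0)" by simp
  qed
  finally show ?thesis using ix_bound[of k] by simp
qed

lemma fl_reversal: "i \<le> CARD('n) \<Longrightarrow> fl reversal (CARD('n) - i) = {v :: ('n::{finite,linorder}) rvec. \<forall>k. ix k < i \<longrightarrow> v $ k = 0}"
proof (intro subset_antisym subsetI)
  fix v :: "'n rvec" assume i: "i \<le> CARD('n)"
  { assume "v \<in> fl reversal (CARD('n) - i)"
    then obtain u where "u \<in> std_flag (CARD('n) - i)" "v = reversal *v u" by (auto simp: fl_eq_image)
    then show "v \<in> {v. \<forall>k. ix k < i \<longrightarrow> v $ k = 0}" using i by (auto simp: reversal_mult_vec std_flag_def) }
  assume v: "v \<in> {v. \<forall>k. ix k < i \<longrightarrow> v $ k = 0}"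
  have "reversal *v v \<in> std_flag (CARD('n) - i)"
    unfolding std_flag_def
  proof (intro CollectI allI impI)
    fix k :: 'n assume "CARD('n) - i \<le> ix k"
    then have "CARD('n) - Suc (ix k) < i" using ix_bound[of k] i by linarith
    then have "ix (en (CARD('n) - Suc (ix k)) :: 'n) < i" using ix_bound[of k] by simp
    then show "(reversal *v v) $ k = 0" using v by (simp add: reversal_mult_vec)
  qed
  moreover have "v = reversal *v (reversal *v v)" by (simp add: matrix_vector_mul_assoc)
  ultimately show "v \<in> fl reversal (CARD('n) - i)" unfolding fl_eq_image by blast
qed

text \<open>
  A flag is transverse to the opposite coordinate flag iff its subspaces project injectively to the
  initial coordinates, which the leading minors detect.
\<close>

lemma transverse_reversal_iff_regular:
  fixes Z :: "('n::{finite,linorder}) rmat"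
  assumes Z: "invertible Z"
  shows "transverse (fl Z) (fl reversal) \<longleftrightarrow> regular Z"
proof -
  have "fl Z i \<inter> fl reversal (CARD('n) - i) \<noteq> {0} \<longleftrightarrow> lead Z i = 0" if i: "i \<le> CARD('n)" for i
  proof -
    have coord: "(Z *v u) $ en r = (\<Sum>j<i. mn Z r j * u $ en j)" if "u \<in> std_flag i" for u r
    proof -
      have "(Z *v u) $ en r = (\<Sum>j<CARD('n). mn Z r j * u $ en j)"
        by (simp add: matrix_vector_mult_def sum_en mn_def)
      also have "\<dots> = (\<Sum>j<i. mn Z r j * u $ en j)"
        by (rule sum.mono_neutral_right) (use that i in \<open>auto simp: std_flag_def\<close>)
      finally show ?thesis .
    qed
    have zero: "0 \<in> fl Z i \<inter> fl reversal (CARD('n) - i)"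
      by (simp add: flag_of_matrix_def span_zero)
    have lead: "lead Z i = leibniz_det i (mn Z)"
      unfolding minor_def length_upt by (simp, rule leibniz_det_cong) simp
    show ?thesis
    proof
      assume "fl Z i \<inter> fl reversal (CARD('n) - i) \<noteq> {0}"
      then obtain v where v: "v \<in> fl Z i" "v \<in> fl reversal (CARD('n) - i)" "v \<noteq> 0" using zero by blast
      then obtain u where u: "u \<in> std_flag i" "v = Z *v u" by (auto simp: fl_eq_image)
      have "u \<noteq> 0" using u v by auto
      then obtain k where k: "u $ k \<noteq> 0" by (auto simp: Finite_Cartesian_Product.vec_eq_iff)
      then have "ix k < i" using u(1) by (force simp: std_flag_def not_less[symmetric])
      moreover have "(\<Sum>j<i. mn Z r j * u $ en j) = 0" if r: "r < i" for r
        using coord[OF u(1), of r] v(2) u(2) r i by (auto simp: fl_reversal)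
      ultimately show "lead Z i = 0"
        unfolding lead leibniz_det_eq_0_iff using k by (intro exI[of _ "\<lambda>j. u $ en j"]) (auto intro!: exI[of _ "ix k"])
    next
      assume "lead Z i = 0"
      then obtain w where w: "\<exists>j<i. w j \<noteq> 0" "\<forall>r<i. (\<Sum>j<i. mn Z r j * w j) = 0"
        unfolding lead leibniz_det_eq_0_iff by blast
      define u :: "'n rvec" where "u = (\<chi> k. if ix k < i then w (ix k) else 0)"
      have u: "u \<in> std_flag i" by (auto simp: u_def std_flag_def)
      have uw: "u $ en j = w j" if "j < i" for j using that i by (simp add: u_def)
      have "u \<noteq> 0" using w(1) uw by (metis zero_index)
      then have "Z *v u \<noteq> 0" using inj_matrix_vector_mult[OF Z] by (metis injD mult_zero_right matrix_vector_mult_0_right)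
      moreover have "Z *v u \<in> fl reversal (CARD('n) - i)"
      proof -
        have "(Z *v u) $ k = 0" if k: "ix k < i" for k
          using coord[OF u, of "ix k"] w(2) uw k by simp
        then show ?thesis by (simp add: fl_reversal[OF i])
      qed
      ultimately show "fl Z i \<inter> fl reversal (CARD('n) - i) \<noteq> {0}" using u by (auto simp: fl_eq_image)
    qed
  qed
  then show ?thesis unfolding transverse_def regular_def by blast
qed

lemma transverse_mult:
  fixes Y :: "('n::{finite,linorder}) rmat"
  assumes "invertible Y"
  shows "transverse (fl (Y ** A)) (fl (Y ** B)) \<longleftrightarrow> transverse (fl A) (fl B)"
proof -
  have "(\<lambda>v. Y *v v) ` fl A i \<inter> (\<lambda>v. Y *v v) ` fl B j = {0} \<longleftrightarrow> fl A i \<inter> fl B j = {0}" for i j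
  proof -
    have "(\<lambda>v. Y *v v) ` fl A i \<inter> (\<lambda>v. Y *v v) ` fl B j = (\<lambda>v. Y *v v) ` (fl A i \<inter> fl B j)"
      by (rule image_Int[OF inj_matrix_vector_mult[OF assms], symmetric])
    also have "\<dots> = {0} \<longleftrightarrow> fl A i \<inter> fl B j = {0}"
      using inj_image_eq_iff[OF inj_matrix_vector_mult[OF assms], of "fl A i \<inter> fl B j" "{0}"] by simp
    finally show ?thesis .
  qed
  then show ?thesis by (simp add: transverse_def fl_mult)
qed

lemma transverse_iff_regular:
  fixes Y :: "('n::{finite,linorder}) rmat"
  assumes "invertible Y" "invertible Z"
  shows "transverse (fl (Y ** Z)) (fl (Y ** reversal)) \<longleftrightarrow> regular Z"
  using transverse_mult[OF assms(1)] transverse_reversal_iff_regular[OF assms(2)] by simp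

text \<open>
  The translate by \<open>V\<close> of the part of the big cell whose unipotent coordinates lie in \<open>W\<close>.
\<close>

definition chart :: "('n::{finite,linorder}) rmat \<Rightarrow> 'n rmat set \<Rightarrow> 'n flag set" where
  "chart V W = {fl (V ** Z) | Z. regular Z \<and> lower_factor Z \<in> W}"

lemma in_chart_iff:
  fixes V :: "('n::{finite,linorder}) rmat"
  assumes V: "V' ** V = mat 1" "V ** V' = mat 1" and A: "invertible A"
  shows "fl A \<in> chart V W \<longleftrightarrow> regular (V' ** A) \<and> lower_factor (V' ** A) \<in> W"
proof
  have iV: "invertible V" using V by (auto simp: invertible_def)
  assume "fl A \<in> chart V W"
  then obtain Z where Z: "regular Z" "lower_factor Z \<in> W" "fl A = fl (V ** Z)" by (auto simp: chart_def)
  have "invertible (V ** Z)" using iV regular_invertible[OF Z(1)] by (rule invertible_mult)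
  then obtain S where S: "upper_inv S" "A = (V ** Z) ** S" using fl_eqD[OF _ A] Z(3) by metis
  then have "V' ** A = Z ** S" by (simp add: matrix_mul_assoc V)
  with S Z show "regular (V' ** A) \<and> lower_factor (V' ** A) \<in> W"
    by (simp add: regular_mult_upper lower_factor_mult_upper)
next
  assume "regular (V' ** A) \<and> lower_factor (V' ** A) \<in> W"
  moreover have "V ** (V' ** A) = A" by (simp add: matrix_mul_assoc V)
  ultimately show "fl A \<in> chart V W" unfolding chart_def by (intro CollectI exI[of _ "V' ** A"]) simp
qed

lemma openin_chart:
  fixes V :: "('n::{finite,linorder}) rmat"
  assumes V: "V' ** V = mat 1" "V ** V' = mat 1" and W: "open W"
  shows "openin flag_topology (chart V W)"
  unfolding openin_flag_topology
proof
  have iV: "invertible V" using V by (auto simp: invertible_def)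
  show "chart V W \<subseteq> flags"
    unfolding chart_def using invertible_mult[OF iV regular_invertible] by (auto intro!: fl_in_flags)
  show "open {A. invertible A \<and> fl A \<in> chart V W}"
  proof (rule open_eventually_nhds)
    fix A assume "A \<in> {A. invertible A \<and> fl A \<in> chart V W}"
    then have A: "regular (V' ** A)" "lower_factor (V' ** A) \<in> W" using in_chart_iff[OF V] by auto
    have lim: "((\<lambda>B. V' ** B) \<longlongrightarrow> V' ** A) (nhds A)"
      by (intro tendsto_mult_matrix tendsto_const filterlim_ident)
    from eventually_regular[OF lim A(1)] topological_tendstoD[OF tendsto_lower_factor[OF lim A(1)] W A(2)]
    show "\<forall>\<^sub>F B in nhds A. B \<in> {A. invertible A \<and> fl A \<in> chart V W}"
    proof eventually_elim
      case (elim B)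
      have "invertible (V ** (V' ** B))" using iV regular_invertible[OF elim(1)] by (rule invertible_mult)
      then have "invertible B" by (simp add: matrix_mul_assoc V)
      with elim show ?case using in_chart_iff[OF V] by blast
    qed
  qed
qed

lemma topspace_flag_topology [simp]: "topspace flag_topology = (flags :: ('n::{finite,linorder}) flag set)"
proof -
  have "openin flag_topology (flags :: 'n flag set)"
    unfolding openin_flag_topology
  proof
    have "{A :: 'n rmat. invertible A \<and> fl A \<in> flags} = {A. invertible A}"
      using fl_in_flags by auto
    also have "open \<dots>"
      unfolding invertible_det_nz det_eq_lead
      by (rule open_eventually_nhds)
        (auto intro!: tendsto_imp_eventually_ne[OF tendsto_tminor] filterlim_ident)
    finally show "open {A :: 'n rmat. invertible A \<and> fl A \<in> flags}" .
  qed simp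
  moreover have "U \<subseteq> flags" if "openin flag_topology U" for U :: "'n flag set"
    using that by (simp add: openin_flag_topology)
  ultimately show ?thesis
    by (metis openin_subset openin_topspace subset_antisym)
qed

lemma eventually_fl_in:
  assumes "openin flag_topology U" "fl C \<in> U" "invertible C" "(f \<longlongrightarrow> C) G"
  shows "\<forall>\<^sub>F x in G. fl (f x) \<in> U"
proof -
  have "open {A. invertible A \<and> fl A \<in> U}" using assms(1) by (simp add: openin_flag_topology)
  from topological_tendstoD[OF assms(4) this] show ?thesis
    using assms(2,3) by (auto elim: eventually_mono)
qed

section \<open>Generic flags and separation of flags\<close>

lemma eventually_not_in_finite: "finite S \<Longrightarrow> \<forall>\<^sub>F t in at (a::real) within T. t \<notin> S"
proof -
  assume "finite S"
  then have "\<forall>\<^sub>F t in at a within T. \<forall>s\<in>S. t \<noteq> s"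
    by (intro eventually_ball_finite) (auto intro: eventually_neq_at_within)
  then show ?thesis by (rule eventually_mono) auto
qed

text \<open>
  On the segment from \<open>X\<close> to the inverse of \<open>V\<close> the leading minors of the product with \<open>V\<close> are
  polynomials in the parameter with value 1 at the end point.
\<close>

lemma regular_dense:
  fixes V X :: "('n::{finite,linorder}) rmat"
  assumes V: "invertible V" and Q: "\<forall>\<^sub>F Y in nhds X. Q Y"
  shows "\<exists>Y. Q Y \<and> regular (V ** Y)"
proof -
  obtain V' where V': "V ** V' = mat 1" using V by (auto simp: invertible_def)
  define Y where "Y t = X + t *\<^sub>R (V' - X)" for t
  define a where "a = mn (V ** X)"
  define b where "b i j = mn (V ** V') i j - mn (V ** X) i j" for i j
  have mnY: "mn (V ** Y t) i j = a i j + t * b i j" for t i j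
  proof -
    have "mn (V ** Y t) i j = (\<Sum>l<CARD('n). mn V i l * mn X l j + t * (mn V i l * mn V' l j - mn V i l * mn X l j))"
      unfolding mn_mult by (rule sum.cong) (auto simp: Y_def mn_def algebra_simps)
    then show ?thesis
      by (simp add: a_def b_def mn_mult sum.distrib sum_subtractf sum_distrib_left[symmetric])
  qed
  define p where "p k = (\<Sum>\<sigma> | \<sigma> permutes {..<k}. of_int (sign \<sigma>) * (\<Prod>i<k. [:a ([0..<k] ! i) ([0..<k] ! \<sigma> i), b ([0..<k] ! i) ([0..<k] ! \<sigma> i):]))" for k
  have p: "poly (p k) t = lead (V ** Y t) k" for k t
    by (simp add: p_def minor_def leibniz_det_def mnY poly_sum poly_prod)
  have "V ** Y 1 = mat 1" by (simp add: Y_def V')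
  moreover have "lower_unip (mat 1 :: 'n rmat)" by (auto simp: lower_unip_mn mn_one)
  ultimately have "poly (p k) 1 = 1" if "k \<le> CARD('n)" for k
    using lead_lower_unip[of "mat 1 :: 'n rmat" k] that by (simp add: p)
  then have nz: "p k \<noteq> 0" if "k \<le> CARD('n)" for k using that by force
  have "finite (\<Union>k\<in>{..CARD('n)}. {t. poly (p k) t = 0})"
    using nz by (auto intro!: poly_roots_finite)
  from eventually_not_in_finite[OF this]
  have "\<forall>\<^sub>F t in at_right 0. regular (V ** Y t)"
    by (rule eventually_mono) (auto simp: regular_def p)
  moreover have "(Y \<longlongrightarrow> Y 0) (at_right 0)"
    unfolding Y_def by (intro tendsto_intros)
  then have "(Y \<longlongrightarrow> X) (at_right 0)" by (simp add: Y_def)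
  then have "\<forall>\<^sub>F t in at_right 0. Q (Y t)" using Q by (rule eventually_compose_filterlim[rotated])
  ultimately have "\<forall>\<^sub>F t in at_right 0. Q (Y t) \<and> regular (V ** Y t)" by eventually_elim auto
  then show ?thesis using eventually_happens'[OF trivial_limit_at_right_real] by blast
qed

text \<open>
  The first condition is open and nonempty, and the second one is dense.
\<close>

lemma regular_common:
  fixes V1 V2 :: "('n::{finite,linorder}) rmat"
  assumes "invertible V1" "invertible V2"
  shows "\<exists>Y. regular (V1 ** Y) \<and> regular (V2 ** Y)"
proof -
  obtain X where X: "V1 ** X = mat 1" using assms(1) by (auto simp: invertible_def)
  have "regular (mat 1 :: 'n rmat)"
    by (rule regular_lower_unip) (auto simp: lower_unip_mn mn_one)
  moreover have "((\<lambda>Y. V1 ** Y) \<longlongrightarrow> V1 ** X) (nhds X)"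
    by (intro tendsto_mult_matrix tendsto_const filterlim_ident)
  ultimately have "\<forall>\<^sub>F Y in nhds X. regular (V1 ** Y)" by (intro eventually_regular) (auto simp: X)
  then show ?thesis by (rule regular_dense[OF assms(2)])
qed

lemma transverse_common:
  fixes F G :: "('n::{finite,linorder}) flag"
  assumes "F \<in> flags" "G \<in> flags"
  shows "\<exists>H\<in>flags. transverse H F \<and> transverse H G"
proof -
  obtain A B where A: "invertible A" "F = fl A" and B: "invertible B" "G = fl B"
    using assms flags_surj by metis
  obtain A' B' where A': "A ** A' = mat 1" "A' ** A = mat 1" and B': "B ** B' = mat 1" "B' ** B = mat 1"
    using A B by (auto simp: invertible_def)
  have "invertible A'" "invertible B'" using A' B' by (auto simp: invertible_def)
  then have w: "invertible (reversal ** A')" "invertible (reversal ** B')"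
    by (auto intro!: invertible_mult invertible_reversal)
  from regular_common[OF this] obtain Y where Y: "regular (reversal ** A' ** Y)" "regular (reversal ** B' ** Y)" by blast
  have e: "Y = (A ** reversal) ** (reversal ** A' ** Y)" "Y = (B ** reversal) ** (reversal ** B' ** Y)"
    "A = (A ** reversal) ** reversal" "B = (B ** reversal) ** reversal"
  proof -
    have "(A ** reversal) ** (reversal ** A' ** Y) = A ** (reversal ** reversal) ** A' ** Y"
      "(B ** reversal) ** (reversal ** B' ** Y) = B ** (reversal ** reversal) ** B' ** Y"
      by (simp_all only: matrix_mul_assoc)
    then show "Y = (A ** reversal) ** (reversal ** A' ** Y)" "Y = (B ** reversal) ** (reversal ** B' ** Y)"
      by (simp_all add: A' B')
    have "(A ** reversal) ** reversal = A ** (reversal ** reversal)" "(B ** reversal) ** reversal = B ** (reversal ** reversal)"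
      by (simp_all only: matrix_mul_assoc)
    then show "A = (A ** reversal) ** reversal" "B = (B ** reversal) ** reversal" by simp_all
  qed
  have iA: "invertible (A ** reversal)" and iB: "invertible (B ** reversal)"
    using A B by (auto intro: invertible_mult invertible_reversal)
  have "invertible Y"
    by (subst e(1)) (intro invertible_mult iA regular_invertible Y)
  moreover have "transverse (fl Y) F"
    using transverse_iff_regular[OF iA regular_invertible[OF Y(1)]] Y(1) A(2) e by metis
  moreover have "transverse (fl Y) G"
    using transverse_iff_regular[OF iB regular_invertible[OF Y(2)]] Y(2) B(2) e by metis
  ultimately show ?thesis using fl_in_flags by blast
qed

text \<open>
  Two flags lie in a common chart, and the unipotent coordinates there are elements of a Hausdorff
  space.
\<close>

lemma flags_separated:
  fixes F G :: "('n::{finite,linorder}) flag"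
  assumes "F \<in> flags" "G \<in> flags" "F \<noteq> G"
  shows "\<exists>U V. openin flag_topology U \<and> openin flag_topology V \<and> F \<in> U \<and> G \<in> V \<and> U \<inter> V = {}"
proof -
  obtain A B where A: "invertible A" "F = fl A" and B: "invertible B" "G = fl B"
    using assms flags_surj by metis
  have "invertible (trp A)" "invertible (trp B)" using A B by (simp_all add: invertible_det_nz)
  from regular_common[OF this] obtain Y where "regular (trp A ** Y)" "regular (trp B ** Y)" by blast
  then have "regular (trp (trp A ** Y))" "regular (trp (trp B ** Y))" by simp_all
  then have Y: "regular (trp Y ** A)" "regular (trp Y ** B)"
    by (simp_all add: matrix_transpose_mul)
  obtain A' where A': "A ** A' = mat 1" using A by (auto simp: invertible_def)
  have "invertible (trp Y ** A ** A')"
  proof (rule invertible_mult[OF regular_invertible[OF Y(1)]])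
    show "invertible A'" using A' matrix_left_right_inverse[of A A'] by (auto simp: invertible_def)
  qed
  then have "invertible (trp Y)" by (simp add: A' flip: matrix_mul_assoc)
  then obtain V where V: "trp Y ** V = mat 1" "V ** trp Y = mat 1" by (auto simp: invertible_def)
  have "lower_factor (trp Y ** A) \<noteq> lower_factor (trp Y ** B)"
  proof
    assume eq: "lower_factor (trp Y ** A) = lower_factor (trp Y ** B)"
    have "fl (trp Y ** A) = fl (trp Y ** B)" using fl_lower_factor[OF Y(1)] fl_lower_factor[OF Y(2)] eq by simp
    then have "fl (V ** (trp Y ** A)) = fl (V ** (trp Y ** B))"
      by (intro ext) (simp only: fl_mult[of V])
    then show False using assms(3) A B V by (simp add: matrix_mul_assoc)
  qed
  then obtain W W' where W: "open W" "open W'" "lower_factor (trp Y ** A) \<in> W" "lower_factor (trp Y ** B) \<in> W'" "W \<inter> W' = {}"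
    using hausdorff by metis
  have "chart V W \<inter> chart V W' = {}"
  proof (intro equals0I)
    fix H assume H: "H \<in> chart V W \<inter> chart V W'"
    then have "H \<in> flags" using openin_chart[OF V W(1)] openin_flag_topology by blast
    then obtain C where C: "invertible C" "H = fl C" using flags_surj by metis
    then show False using H W(5) in_chart_iff[OF V C(1)] by blast
  qed
  moreover have "F \<in> chart V W" "G \<in> chart V W'"
    unfolding A(2) B(2) in_chart_iff[OF V A(1)] in_chart_iff[OF V B(1)] using Y W by simp_all
  ultimately show ?thesis
    using openin_chart[OF V W(1)] openin_chart[OF V W(2)]
    by (intro exI[of _ "chart V W"] exI[of _ "chart V W'"] conjI)
qed

section \<open>The action of PSL on flags\<close>

lemma PSL_rep:
  fixes h :: "('n::finite) rmat set"
  assumes "h \<in> carrier PSL"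
  shows "h \<noteq> {}" "A \<in> h \<Longrightarrow> det A = 1" "A \<in> h \<Longrightarrow> B \<in> h \<Longrightarrow> B = A \<or> B = - A"
proof -
  obtain a where a: "a \<in> carrier SL" "h = SL_centre #>\<^bsub>SL\<^esub> a"
    using assms by (auto simp: PSL_def FactGroup_def RCOSETS_def)
  then have h: "h = {z ** a |z. z \<in> SL_centre}" and da: "det a = 1"
    by (auto simp: r_coset_def SL_def)
  have c: "z \<in> SL_centre \<Longrightarrow> (z = mat 1 \<or> z = - mat 1) \<and> det z = 1" for z :: "'n rmat"
    by (auto simp: SL_centre_def SL_def)
  show "h \<noteq> {}" unfolding h by (auto simp: SL_centre_def SL_def)
  show "A \<in> h \<Longrightarrow> det A = 1" unfolding h using c da by (auto simp: det_mul)
  show "A \<in> h \<Longrightarrow> B \<in> h \<Longrightarrow> B = A \<or> B = - A"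
    unfolding h by (auto simp: uminus_mat_mult dest!: c)
qed

lemma PSL_mult_rep:
  "A \<in> h \<Longrightarrow> B \<in> k \<Longrightarrow> A ** B \<in> h \<otimes>\<^bsub>PSL\<^esub> k"
  by (auto simp: PSL_def FactGroup_def set_mult_def SL_def)

lemma PSL_one_rep: "mat 1 \<in> \<one>\<^bsub>PSL\<^esub>"
  by (auto simp: PSL_def FactGroup_def SL_centre_def SL_def)

lemma PSL_invertible: "h \<in> carrier PSL \<Longrightarrow> A \<in> h \<Longrightarrow> invertible A"
  using PSL_rep(2) by (force simp: invertible_det_nz)

lemma flag_act_fl:
  fixes h :: "('n::{finite,linorder}) rmat set"
  assumes h: "h \<in> carrier PSL" and A: "A \<in> h"
  shows "flag_act h (fl X) = fl (A ** X)"
proof -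
  have "(\<lambda>B i. (\<lambda>v. B *v v) ` fl X i) ` h = {fl (A ** X)}"
  proof -
    have *: "(\<lambda>i. (\<lambda>v. B *v v) ` fl X i) = fl (A ** X)" if "B \<in> h" for B
    proof -
      have "(\<lambda>i. (\<lambda>v. B *v v) ` fl X i) = fl (B ** X)" by (intro ext) (rule fl_mult[symmetric])
      moreover have neg: "(- A) ** X = - (A ** X)"
        using uminus_mat_mult(1)[of A] uminus_mat_mult(1)[of "A ** X"] by (metis matrix_mul_assoc)
      have "fl (B ** X) = fl (A ** X)"
        using PSL_rep(3)[OF h A that] by (elim disjE) (simp_all only: neg fl_uminus)
      ultimately show ?thesis by (rule trans)
    qed
    have "(\<lambda>B i. (\<lambda>v. B *v v) ` fl X i) ` h = (\<lambda>_. fl (A ** X)) ` h"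
      by (rule image_cong[OF refl *])
    also have "\<dots> = {fl (A ** X)}" by (rule image_constant[OF A])
    finally show ?thesis .
  qed
  then show ?thesis by (simp add: flag_act_def)
qed

lemma flag_act_in_flags:
  fixes h :: "('n::{finite,linorder}) rmat set"
  assumes h: "h \<in> carrier PSL" and F: "F \<in> flags"
  shows "flag_act h F \<in> flags"
proof -
  obtain A where "A \<in> h" using PSL_rep(1)[OF h] by blast
  obtain X where "invertible X" "F = fl X" using flags_surj[OF F] by metis
  then show ?thesis
    using PSL_invertible[OF h \<open>A \<in> h\<close>] by (simp add: flag_act_fl[OF h \<open>A \<in> h\<close>] fl_in_flags invertible_mult)
qed

lemma flag_act_mult:
  fixes h k :: "('n::{finite,linorder}) rmat set"
  assumes h: "h \<in> carrier PSL" and k: "k \<in> carrier PSL" and F: "F \<in> flags"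
  shows "flag_act (h \<otimes>\<^bsub>PSL\<^esub> k) F = flag_act h (flag_act k F)"
proof -
  obtain A B where AB: "A \<in> h" "B \<in> k" using PSL_rep(1)[OF h] PSL_rep(1)[OF k] by blast
  obtain X where X: "F = fl X" using flags_surj[OF F] by metis
  have "h \<otimes>\<^bsub>PSL\<^esub> k \<in> carrier PSL" using group.is_monoid[OF group_PSL] h k by (rule monoid.m_closed)
  from flag_act_fl[OF this PSL_mult_rep[OF AB]] show ?thesis
    by (simp add: X flag_act_fl[OF h AB(1)] flag_act_fl[OF k AB(2)] matrix_mul_assoc)
qed

lemma flag_act_one:
  fixes F :: "('n::{finite,linorder}) flag"
  assumes "F \<in> flags"
  shows "flag_act \<one>\<^bsub>PSL\<^esub> F = F"
proof -
  obtain X where X: "F = fl X" using flags_surj[OF assms] by metis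
  have "\<one>\<^bsub>PSL\<^esub> \<in> carrier (PSL :: 'n rmat set monoid)" by (rule monoid.one_closed[OF group.is_monoid[OF group_PSL]])
  from flag_act_fl[OF this PSL_one_rep] show ?thesis by (simp add: X)
qed

lemma flag_act_inv:
  fixes h :: "('n::{finite,linorder}) rmat set"
  assumes h: "h \<in> carrier PSL" and F: "F \<in> flags"
  shows "flag_act h (flag_act (inv\<^bsub>PSL\<^esub> h) F) = F" "flag_act (inv\<^bsub>PSL\<^esub> h) (flag_act h F) = F"
  using flag_act_mult[OF h group.inv_closed[OF group_PSL h] F]
    flag_act_mult[OF group.inv_closed[OF group_PSL h] h F]
  by (simp_all add: group.r_inv[OF group_PSL h] group.l_inv[OF group_PSL h] flag_act_one[OF F])

lemma flag_act_transverse: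
  fixes h :: "('n::{finite,linorder}) rmat set"
  assumes h: "h \<in> carrier PSL" and "F \<in> flags" "G \<in> flags"
  shows "transverse (flag_act h F) (flag_act h G) \<longleftrightarrow> transverse F G"
proof -
  obtain A where A: "A \<in> h" using PSL_rep(1)[OF h] by blast
  obtain X Y where "F = fl X" "G = fl Y" using assms(2,3) flags_surj by metis
  then show ?thesis
    by (simp add: flag_act_fl[OF h A] transverse_mult[OF PSL_invertible[OF h A]])
qed

lemma openin_flag_act_vimage:
  fixes h :: "('n::{finite,linorder}) rmat set"
  assumes h: "h \<in> carrier PSL" and U: "openin flag_topology U"
  shows "openin flag_topology {F \<in> flags. flag_act h F \<in> U}"
proof -
  obtain A where A: "A \<in> h" using PSL_rep(1)[OF h] by blast
  have "open {X. invertible X \<and> fl X \<in> {F \<in> flags. flag_act h F \<in> U}}"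
  proof (rule open_eventually_nhds)
    fix X assume "X \<in> {X. invertible X \<and> fl X \<in> {F \<in> flags. flag_act h F \<in> U}}"
    then have X: "invertible X" "fl (A ** X) \<in> U" by (auto simp: flag_act_fl[OF h A])
    have "\<forall>\<^sub>F Y in nhds X. fl (A ** Y) \<in> U"
      by (rule eventually_fl_in[OF U X(2)])
        (use X PSL_invertible[OF h A] in \<open>auto intro!: invertible_mult tendsto_mult_matrix tendsto_const filterlim_ident\<close>)
    moreover have "open {X :: 'n rmat. invertible X}"
      using openin_topspace[of "flag_topology :: 'n flag topology"] fl_in_flags
      by (auto simp: openin_flag_topology elim!: back_subst[where P = "open"])
    then have "\<forall>\<^sub>F Y in nhds X. invertible Y"
      using X(1) by (auto simp: eventually_nhds)
    ultimately show "\<forall>\<^sub>F Y in nhds X. Y \<in> {X. invertible X \<and> fl X \<in> {F \<in> flags. flag_act h F \<in> U}}"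
      by eventually_elim (auto simp: flag_act_fl[OF h A] fl_in_flags)
  qed
  then show ?thesis by (auto simp: openin_flag_topology)
qed

section \<open>Contracting sequences\<close>

lemma contracting_subseq:
  assumes "contracting h Fp Fm" "strict_mono r"
  shows "contracting (\<lambda>m. h (r m)) Fp Fm"
  unfolding contracting_def
proof (intro conjI ballI impI)
  fix H :: "'a flag" assume H: "H \<in> flags" "transverse H Fm"
  then obtain N where N: "openin flag_topology N" "H \<in> N"
    "\<And>U. openin flag_topology U \<Longrightarrow> Fp \<in> U \<Longrightarrow>
      \<forall>\<^sub>F m in sequentially. \<forall>K\<in>N. transverse K Fm \<longrightarrow> flag_act (h m) K \<in> U"
    using assms(1) unfolding contracting_def by blast
  show "\<exists>N. openin flag_topology N \<and> H \<in> N \<and> (\<forall>U. openin flag_topology U \<and> Fp \<in> U \<longrightarrow>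
      (\<forall>\<^sub>F m in sequentially. \<forall>K\<in>N. transverse K Fm \<longrightarrow> flag_act (h (r m)) K \<in> U))"
    using N by (intro exI[of _ N]) (auto intro: eventually_subseq[OF assms(2)])
qed (use assms(1) in \<open>auto simp: contracting_def\<close>)

lemma contracting_converges:
  assumes "contracting h Fp Fm" "H \<in> flags" "transverse H Fm" "openin flag_topology U" "Fp \<in> U"
  shows "\<forall>\<^sub>F m in sequentially. flag_act (h m) H \<in> U"
proof -
  obtain N where N: "H \<in> N" "\<forall>\<^sub>F m in sequentially. \<forall>K\<in>N. transverse K Fm \<longrightarrow> flag_act (h m) K \<in> U"
    using assms unfolding contracting_def by blast
  from N(2) show ?thesis by (rule eventually_mono) (use N(1) assms(3) in blast)
qed

text \<open>
  A flag transverse to both repelling flags converges to both attracting flags.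
\<close>

lemma contracting_unique:
  assumes "contracting h Fp Fm" "contracting h Fp' Fm'"
  shows "Fp = Fp'"
proof (rule ccontr)
  assume "Fp \<noteq> Fp'"
  moreover have fl: "Fp \<in> flags" "Fm \<in> flags" "Fp' \<in> flags" "Fm' \<in> flags"
    using assms by (auto simp: contracting_def)
  ultimately obtain U V where UV: "openin flag_topology U" "openin flag_topology V" "Fp \<in> U" "Fp' \<in> V" "U \<inter> V = {}"
    using flags_separated by metis
  obtain H where H: "H \<in> flags" "transverse H Fm" "transverse H Fm'"
    using transverse_common[OF fl(2,4)] by blast
  have "\<forall>\<^sub>F m in sequentially. flag_act (h m) H \<in> U \<and> flag_act (h m) H \<in> V"
    using contracting_converges[OF assms(1) H(1,2) UV(1,3)] contracting_converges[OF assms(2) H(1,3) UV(2,4)]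
    by eventually_elim auto
  then show False using UV(5) eventually_happens'[OF trivial_limit_sequentially] by blast
qed

lemma contracting_translate:
  fixes g :: "('n::{finite,linorder}) rmat set"
  assumes g: "g \<in> carrier PSL" and h: "\<And>m. h m \<in> carrier PSL" and c: "contracting h Fp Fm"
  shows "contracting (\<lambda>m. g \<otimes>\<^bsub>PSL\<^esub> h m) (flag_act g Fp) Fm"
  unfolding contracting_def
proof (intro conjI ballI impI)
  fix H :: "'n flag" assume H: "H \<in> flags" "transverse H Fm"
  then obtain N where N: "openin flag_topology N" "H \<in> N"
    "\<And>U. openin flag_topology U \<Longrightarrow> Fp \<in> U \<Longrightarrow>
      \<forall>\<^sub>F m in sequentially. \<forall>K\<in>N. transverse K Fm \<longrightarrow> flag_act (h m) K \<in> U"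
    using c unfolding contracting_def by blast
  have sub: "K \<in> flags" if "K \<in> N" for K using N(1) that by (auto simp: openin_flag_topology)
  show "\<exists>N. openin flag_topology N \<and> H \<in> N \<and> (\<forall>U. openin flag_topology U \<and> flag_act g Fp \<in> U \<longrightarrow>
      (\<forall>\<^sub>F m in sequentially. \<forall>K\<in>N. transverse K Fm \<longrightarrow> flag_act (g \<otimes>\<^bsub>PSL\<^esub> h m) K \<in> U))"
  proof (intro exI[of _ N] conjI N allI impI)
    fix U :: "'n flag set" assume U: "openin flag_topology U \<and> flag_act g Fp \<in> U"
    have "Fp \<in> flags" using c by (simp add: contracting_def)
    with N(3)[OF openin_flag_act_vimage[OF g, of U]] U
    have "\<forall>\<^sub>F m in sequentially. \<forall>K\<in>N. transverse K Fm \<longrightarrow> flag_act (h m) K \<in> {F \<in> flags. flag_act g F \<in> U}"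
      by blast
    then show "\<forall>\<^sub>F m in sequentially. \<forall>K\<in>N. transverse K Fm \<longrightarrow> flag_act (g \<otimes>\<^bsub>PSL\<^esub> h m) K \<in> U"
      by (rule eventually_mono) (use sub flag_act_mult[OF g h] in auto)
  qed
qed (use c g in \<open>auto simp: contracting_def flag_act_in_flags\<close>)

lemma gap_tendsto:
  fixes d :: "nat \<Rightarrow> nat \<Rightarrow> real"
  assumes d: "\<And>m i. i < n \<Longrightarrow> d m i \<noteq> 0"
    and gap: "\<And>j. Suc j < n \<Longrightarrow> (\<lambda>m. d m (Suc j) / d m j) \<longlonglongrightarrow> 0"
    and ij: "j < i" "i < n"
  shows "(\<lambda>m. d m i / d m j) \<longlonglongrightarrow> 0"
  using ij
proof (induction i)
  case (Suc i)
  show ?case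
  proof (cases "i = j")
    case False
    then have "(\<lambda>m. d m (Suc i) / d m i * (d m i / d m j)) \<longlonglongrightarrow> 0 * 0"
      using Suc by (intro tendsto_mult gap) auto
    then show ?thesis using d Suc.prems by simp
  qed (use gap Suc.prems in simp)
qed simp

text \<open>
  A diagonal matrix multiplies the coordinate in position \<open>(i, j)\<close> by \<open>d i / d j\<close>.
\<close>

lemma lower_factor_dg_tendsto:
  fixes X :: "('n::{finite,linorder}) rmat"
  assumes d: "\<And>m i. i < CARD('n) \<Longrightarrow> d m i \<noteq> 0"
    and gap: "\<And>j. Suc j < CARD('n) \<Longrightarrow> (\<lambda>m. d m (Suc j) / d m j) \<longlonglongrightarrow> 0"
    and X: "Xs \<longlonglongrightarrow> X" "regular X"
  shows "(\<lambda>m. lower_factor (dg (d m) ** Xs m)) \<longlonglongrightarrow> mat 1"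
proof (rule tendsto_matrixI)
  fix i j assume ij: "i < CARD('n)" "j < CARD('n)"
  note reg = eventually_regular[OF X]
  have lim: "(\<lambda>m. mn (lower_factor (Xs m)) i j) \<longlonglongrightarrow> mn (lower_factor X) i j"
    by (intro tendsto_mn tendsto_lower_factor X)
  have "(\<lambda>m. d m i / d m j * mn (lower_factor (Xs m)) i j) \<longlonglongrightarrow> mn (mat 1 :: 'n rmat) i j"
  proof -
    consider "i < j" | "i = j" | "j < i" by linarith
    then show ?thesis
    proof cases
      case 1
      have "\<forall>\<^sub>F m in sequentially. d m i / d m j * mn (lower_factor (Xs m)) i j = 0"
        using reg by eventually_elim (use 1 ij lower_unip_lower_factor in \<open>auto simp: lower_unip_mn\<close>)
      then show ?thesis using 1 ij by (simp add: mn_one tendsto_eventually)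
    next
      case 2
      have "mn (lower_factor X) i i = 1" using lower_unip_lower_factor[OF X(2)] ij by (simp add: lower_unip_mn)
      then show ?thesis using lim 2 ij d by (simp add: mn_one)
    next
      case 3
      have "(\<lambda>m. d m i / d m j) \<longlonglongrightarrow> 0"
        by (rule gap_tendsto[where n = "CARD('n)" and d = d, OF _ _ 3 ij(1)]) (fact d gap)+
      then have "(\<lambda>m. d m i / d m j * mn (lower_factor (Xs m)) i j) \<longlonglongrightarrow> 0 * mn (lower_factor X) i j"
        by (intro tendsto_mult lim)
      then show ?thesis using 3 ij by (simp add: mn_one)
    qed
  qed
  moreover have "\<forall>\<^sub>F m in sequentially. d m i / d m j * mn (lower_factor (Xs m)) i j = mn (lower_factor (dg (d m) ** Xs m)) i j"
    using reg by (rule eventually_mono) (rule lower_factor_dg_mult(2)[OF d _ ij, symmetric])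
  ultimately show "(\<lambda>m. mn (lower_factor (dg (d m) ** Xs m)) i j) \<longlonglongrightarrow> mn (mat 1 :: 'n rmat) i j"
    by (rule Lim_transform_eventually)
qed

text \<open>
  In unipotent coordinates a diagonal matrix with small gaps moves bounded sets close to the identity
  matrix.  The uniformity follows by contradiction, since a bounded sequence of coordinates has a
  convergent subsequence.
\<close>

lemma contracting_LDU:
  fixes B C L U V' :: "('n::{finite,linorder}) rmat"
  assumes h: "\<And>m X. invertible X \<Longrightarrow>
      flag_act (h m) (fl X) = fl (B ** (Ls m ** (dg (d m) ** (Us m ** (C ** X)))))"
    and B: "invertible B" and L: "Ls \<longlonglongrightarrow> L" "invertible L" and U: "Us \<longlonglongrightarrow> U"
    and V': "V' ** (U ** C) = mat 1" "(U ** C) ** V' = mat 1"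
    and d: "\<And>m i. i < CARD('n) \<Longrightarrow> d m i \<noteq> 0"
    and gap: "\<And>j. Suc j < CARD('n) \<Longrightarrow> (\<lambda>m. d m (Suc j) / d m j) \<longlonglongrightarrow> 0"
  shows "contracting h (fl (B ** L)) (fl (V' ** reversal))"
  unfolding contracting_def
proof (intro conjI ballI impI)
  have iBL: "invertible (B ** L)" using B L by (intro invertible_mult)
  have iV': "invertible V'" using V' by (auto simp: invertible_def)
  show "fl (B ** L) \<in> flags" "fl (V' ** reversal) \<in> flags"
    using iBL iV' by (auto intro!: fl_in_flags invertible_mult invertible_reversal)
  fix H :: "'n flag" assume "H \<in> flags" and tr: "transverse H (fl (V' ** reversal))"
  then obtain X0 where X0: "invertible X0" "H = fl X0" using flags_surj by metis
  define Z0 where "Z0 = (U ** C) ** X0"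
  have X0Z: "X0 = V' ** Z0" by (simp add: Z0_def matrix_mul_assoc V'(1)[unfolded matrix_mul_assoc])
  have "invertible Z0" unfolding Z0_def using V' X0 by (intro invertible_mult[of "U ** C"]) (auto simp: invertible_def)
  then have Z0: "regular Z0" using tr transverse_iff_regular[OF iV'] X0 X0Z by metis
  define R where "R = norm (lower_factor Z0) + 1"
  define N where "N = chart V' (ball 0 R)"
  have N: "openin flag_topology N" unfolding N_def by (rule openin_chart[OF V'(2,1)]) simp
  have HN: "H \<in> N"
    unfolding N_def X0(2) in_chart_iff[OF V'(2,1) X0(1)] Z0_def[symmetric] using Z0 by (simp add: R_def)
  have key: "\<forall>\<^sub>F m in sequentially. \<forall>K\<in>N. flag_act (h m) K \<in> W"
    if W: "openin flag_topology W" "fl (B ** L) \<in> W" for W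
  proof (rule ccontr)
    assume "\<not> (\<forall>\<^sub>F m in sequentially. \<forall>K\<in>N. flag_act (h m) K \<in> W)"
    then have "\<exists>\<^sub>F m in sequentially. \<exists>K\<in>N. flag_act (h m) K \<notin> W"
      by (simp add: not_eventually)
    then have "infinite {m. \<exists>K\<in>N. flag_act (h m) K \<notin> W}"
      by (simp add: frequently_cofinite[symmetric] cofinite_eq_sequentially)
    then obtain r :: "nat \<Rightarrow> nat" where r: "strict_mono r" "\<And>i. \<exists>K\<in>N. flag_act (h (r i)) K \<notin> W"
      using infinite_enumerate[of "{m. \<exists>K\<in>N. flag_act (h m) K \<notin> W}"] by auto
    have "\<exists>Z. lower_unip Z \<and> norm Z < R \<and> flag_act (h (r i)) (fl (V' ** Z)) \<notin> W" for i
    proof -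
      obtain Z where Z: "regular Z" "lower_factor Z \<in> ball 0 R" "flag_act (h (r i)) (fl (V' ** Z)) \<notin> W"
        using r(2)[of i] by (auto simp: N_def chart_def)
      have "fl (V' ** lower_factor Z) = fl (V' ** Z)"
        using fl_lower_factor[OF Z(1)] by (intro ext) (simp only: fl_mult[of V'])
      with Z show ?thesis using lower_unip_lower_factor[OF Z(1)] by (intro exI[of _ "lower_factor Z"]) auto
    qed
    then obtain Z where Z: "\<And>i. lower_unip (Z i)" "\<And>i. norm (Z i) < R"
      "\<And>i. flag_act (h (r i)) (fl (V' ** Z i)) \<notin> W" by metis
    have "bounded (range Z)" unfolding bounded_iff using Z(2) by (intro exI[of _ R]) (auto intro: less_imp_le)
    then obtain Z' s where s: "strict_mono s" "(\<lambda>i. Z (s i)) \<longlonglongrightarrow> Z'"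
      using bounded_imp_convergent_subsequence[of Z] by (auto simp: o_def)
    have "lower_unip Z'" by (rule lower_unip_limit[OF s(2) Z(1)])
    then have Z': "regular Z'" by (rule regular_lower_unip)
    define q where "q i = r (s i)" for i
    have q: "strict_mono q" unfolding q_def using r(1) s(1) by (simp add: strict_mono_def)
    have Lq: "(\<lambda>i. Ls (q i)) \<longlonglongrightarrow> L" "(\<lambda>i. Us (q i)) \<longlonglongrightarrow> U"
      using LIMSEQ_subseq_LIMSEQ[OF L(1) q] LIMSEQ_subseq_LIMSEQ[OF U q] by (auto simp: o_def)
    define Xs where "Xs i = Us (q i) ** (C ** (V' ** Z (s i)))" for i
    have "Xs \<longlonglongrightarrow> U ** (C ** (V' ** Z'))"
      unfolding Xs_def by (intro tendsto_mult_matrix tendsto_const Lq s)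
    moreover have "U ** (C ** (V' ** Z')) = Z'"
      using V'(2) by (metis matrix_mul_assoc matrix_mul_lid)
    ultimately have Xs: "Xs \<longlonglongrightarrow> Z'" by simp
    have gq: "(\<lambda>i. d (q i) (Suc j) / d (q i) j) \<longlonglongrightarrow> 0" if "Suc j < CARD('n)" for j
      using LIMSEQ_subseq_LIMSEQ[OF gap[OF that] q] by (simp add: o_def)
    have "(\<lambda>i. lower_factor (dg (d (q i)) ** Xs i)) \<longlonglongrightarrow> mat 1"
      using lower_factor_dg_tendsto[of "\<lambda>i. d (q i)" Xs Z'] d gq Xs Z' by blast
    then have "(\<lambda>i. B ** (Ls (q i) ** lower_factor (dg (d (q i)) ** Xs i))) \<longlonglongrightarrow> B ** (L ** mat 1)"
      by (intro tendsto_mult_matrix tendsto_const Lq)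
    then have "(\<lambda>i. B ** (Ls (q i) ** lower_factor (dg (d (q i)) ** Xs i))) \<longlonglongrightarrow> B ** L" by simp
    from eventually_fl_in[OF W iBL this]
    have "\<forall>\<^sub>F i in sequentially. fl (B ** (Ls (q i) ** lower_factor (dg (d (q i)) ** Xs i))) \<in> W" .
    moreover have "\<forall>\<^sub>F i in sequentially. regular (Xs i)" by (rule eventually_regular[OF Xs Z'])
    ultimately have "\<forall>\<^sub>F i in sequentially. False"
    proof eventually_elim
      case (elim i)
      have rg: "regular (dg (d (q i)) ** Xs i)" using lower_factor_dg_mult(1)[OF d elim(2)] .
      have "invertible (V' ** Z (s i))"
        using iV' regular_invertible[OF regular_lower_unip[OF Z(1)]] by (rule invertible_mult)
      from h[OF this, of "q i"] have "flag_act (h (q i)) (fl (V' ** Z (s i))) =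
          fl (B ** (Ls (q i) ** (dg (d (q i)) ** Xs i)))" by (simp add: Xs_def)
      also have "\<dots> = fl (B ** (Ls (q i) ** lower_factor (dg (d (q i)) ** Xs i)))"
        using fl_lower_factor[OF rg] by (intro ext) (simp only: fl_mult[of B] fl_mult[of "Ls (q i)"])
      finally show False using elim(1) Z(3)[of "s i"] by (simp add: q_def)
    qed
    then show False by simp
  qed
  show "\<exists>N. openin flag_topology N \<and> H \<in> N \<and> (\<forall>U. openin flag_topology U \<and> fl (B ** L) \<in> U \<longrightarrow>
      (\<forall>\<^sub>F m in sequentially. \<forall>K\<in>N. transverse K (fl (V' ** reversal)) \<longrightarrow> flag_act (h m) K \<in> U))"
  proof (intro exI[of _ N] conjI N HN allI impI)
    fix W assume "openin flag_topology W \<and> fl (B ** L) \<in> W"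
    then have "\<forall>\<^sub>F m in sequentially. \<forall>K\<in>N. flag_act (h m) K \<in> W" using key by blast
    then show "\<forall>\<^sub>F m in sequentially. \<forall>K\<in>N. transverse K (fl (V' ** reversal)) \<longrightarrow> flag_act (h m) K \<in> W"
      by (rule eventually_mono) blast
  qed
qed

section \<open>Ordered bases and orientations\<close>

definition lin_comb :: "(nat \<Rightarrow> real) \<Rightarrow> ('n::finite) rvec list \<Rightarrow> 'n rvec" where
  "lin_comb w vs = (\<Sum>i<length vs. w i *\<^sub>R vs ! i)"

lemma sum_set_list:
  assumes "distinct vs"
  shows "(\<Sum>v\<in>set vs. f v) = (\<Sum>i<length vs. f (vs ! i))"
  using sum.reindex_bij_betw[OF bij_betw_nth[OF assms refl refl], of f] by simp

lemma lin_comb_eq_0_iff: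
  assumes "distinct vs" "independent (set vs)"
  shows "lin_comb w vs = 0 \<longleftrightarrow> (\<forall>i<length vs. w i = 0)"
proof
  assume 0: "lin_comb w vs = 0"
  define u where "u v = w (the_inv_into {..<length vs} ((!) vs) v)" for v
  have inj: "inj_on ((!) vs) {..<length vs}" using assms(1) by (simp add: inj_on_nth)
  have u: "u (vs ! i) = w i" if "i < length vs" for i
    using that by (simp add: u_def the_inv_into_f_f[OF inj])
  have "(\<Sum>v\<in>set vs. u v *\<^sub>R v) = lin_comb w vs"
    unfolding sum_set_list[OF assms(1)] lin_comb_def by (rule sum.cong) (auto simp: u)
  with 0 have "\<forall>v\<in>set vs. u v = 0" using assms(2) by (simp add: independent_explicit)
  then show "\<forall>i<length vs. w i = 0" using u by force
qed (simp add: lin_comb_def)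

lemma ordered_basisI:
  assumes "\<And>w. lin_comb w vs = 0 \<Longrightarrow> \<forall>i<length vs. w i = 0"
  shows "distinct vs" "independent (set vs)"
proof -
  have s: "(\<Sum>i<length vs. (if i = j then c else 0) *\<^sub>R vs ! i) = c *\<^sub>R vs ! j" if "j < length vs" for c j
    using that by (simp add: if_distrib[of "\<lambda>x. x *\<^sub>R _"] cong: if_cong)
  show d: "distinct vs"
    unfolding distinct_conv_nth
  proof (intro allI impI notI)
    fix i j assume ij: "i < length vs" "j < length vs" "i \<noteq> j" "vs ! i = vs ! j"
    have "lin_comb (\<lambda>l. (if l = i then 1 else 0) + (if l = j then - 1 else 0)) vs = 0"
      using ij s[of i 1] s[of j "- 1"] by (simp add: lin_comb_def scaleR_add_left sum.distrib)
    from assms[OF this] ij show False by auto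
  qed
  show "independent (set vs)"
    unfolding independent_explicit
  proof (intro conjI allI impI ballI)
    fix u v assume "(\<Sum>v\<in>set vs. u v *\<^sub>R v) = 0" "v \<in> set vs"
    moreover from this have "lin_comb (\<lambda>i. u (vs ! i)) vs = 0"
      by (simp add: lin_comb_def sum_set_list[OF d])
    ultimately show "u v = 0" using assms by (auto simp: in_set_conv_nth)
  qed simp
qed

lemma in_span_list:
  assumes "distinct vs" "v \<in> span (set vs)"
  obtains w where "v = lin_comb w vs"
proof -
  from assms(2) obtain u where "v = (\<Sum>x\<in>set vs. u x *\<^sub>R x)" by (auto simp: span_finite)
  then have "v = lin_comb (\<lambda>i. u (vs ! i)) vs" by (simp add: lin_comb_def sum_set_list[OF assms(1)])
  with that show ?thesis by blast
qed

lemma lin_comb_in_span: "lin_comb w vs \<in> span (set vs)"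
  unfolding lin_comb_def by (intro span_sum span_scale span_base) auto

lemma leibniz_det_mult:
  "leibniz_det d (\<lambda>i j. \<Sum>l<d. A i l * B l j) = leibniz_det d A * leibniz_det d B"
proof -
  have e: "minor C [0..<d] [0..<d] = leibniz_det d C" for C
    unfolding minor_def length_upt by (simp, rule leibniz_det_cong) simp
  have "strict_lists d d = {[0..<d]}"
    using strict_list_initial[of _ d d] initial_strict[of d d] by (auto simp: strict_lists_def)
  then show ?thesis using Cauchy_Binet[of "[0..<d]" "[0..<d]" A B d] by (simp add: e)
qed

lemma leibniz_det_diag: "leibniz_det d (\<lambda>i j. if i = j then c j else 0) = (\<Prod>i<d. c i)"
  by (subst leibniz_det_upper_triangular) auto

definition rescale :: "(nat \<Rightarrow> real) \<Rightarrow> ('n::finite) rvec list \<Rightarrow> 'n rvec list" where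
  "rescale c vs = map (\<lambda>i. c i *\<^sub>R vs ! i) [0..<length vs]"

lemma length_rescale [simp]: "length (rescale c vs) = length vs"
  by (simp add: rescale_def)

lemma nth_rescale [simp]: "i < length vs \<Longrightarrow> rescale c vs ! i = c i *\<^sub>R vs ! i"
  by (simp add: rescale_def)

lemma pos_related_rescale: "0 < (\<Prod>i<length vs. c i) \<Longrightarrow> pos_related vs (rescale c vs)"
  unfolding pos_related_def
  by (intro conjI exI[of _ "\<lambda>i j. if i = j then c j else 0"])
    (auto simp: leibniz_det_diag if_distrib[of "\<lambda>x. x *\<^sub>R _"] cong: if_cong)

lemma pos_related_refl: "pos_related vs vs"
  unfolding pos_related_def
  by (intro conjI exI[of _ "\<lambda>i j. if i = j then 1 else 0"])
    (auto simp: leibniz_det_diag if_distrib[of "\<lambda>x. x *\<^sub>R _"] cong: if_cong)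

lemma pos_related_trans:
  assumes "pos_related us vs" "pos_related vs ws"
  shows "pos_related us ws"
proof -
  let ?d = "length us"
  obtain M N where M: "0 < leibniz_det ?d M" "\<And>i. i < ?d \<Longrightarrow> vs ! i = (\<Sum>j<?d. M i j *\<^sub>R us ! j)"
    and N: "0 < leibniz_det ?d N" "\<And>i. i < ?d \<Longrightarrow> ws ! i = (\<Sum>j<?d. N i j *\<^sub>R vs ! j)"
    and len: "length vs = ?d" "length ws = ?d"
    using assms unfolding pos_related_def by auto
  have "ws ! i = (\<Sum>l<?d. (\<Sum>j<?d. N i j * M j l) *\<^sub>R us ! l)" if "i < ?d" for i
  proof -
    have "ws ! i = (\<Sum>j<?d. \<Sum>l<?d. (N i j * M j l) *\<^sub>R us ! l)"
      unfolding N(2)[OF that] by (rule sum.cong) (simp_all add: M(2) scaleR_sum_right)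
    also have "\<dots> = (\<Sum>l<?d. \<Sum>j<?d. (N i j * M j l) *\<^sub>R us ! l)" by (rule sum.swap)
    finally show ?thesis by (simp add: scaleR_sum_left)
  qed
  then show ?thesis
    unfolding pos_related_def using M(1) N(1) len
    by (intro conjI exI[of _ "\<lambda>i l. \<Sum>j<?d. N i j * M j l"]) (auto simp: leibniz_det_mult)
qed

lemma pos_related_rescale_both:
  assumes "pos_related us vs" "\<And>i. c i * c i = 1"
  shows "pos_related (rescale c us) (rescale c vs)"
proof -
  obtain M where M: "0 < leibniz_det (length us) M"
    "\<And>i. i < length us \<Longrightarrow> vs ! i = (\<Sum>j<length us. M i j *\<^sub>R us ! j)" and len: "length vs = length us"
    using assms(1) unfolding pos_related_def by auto
  define N where "N i j = c i * (M i j * c j)" for i j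
  have "leibniz_det (length us) N = (\<Prod>i<length us. c i * c i) * leibniz_det (length us) M"
    unfolding N_def
    by (simp add: leibniz_det_scale_rows[of _ c "\<lambda>i j. M i j * c j"] leibniz_det_scale_cols prod.distrib)
  then have "0 < leibniz_det (length us) N" using M(1) assms(2) by simp
  moreover have "rescale c vs ! i = (\<Sum>j<length us. N i j *\<^sub>R rescale c us ! j)" if "i < length us" for i
  proof -
    have "(\<Sum>j<length us. N i j *\<^sub>R rescale c us ! j) = (\<Sum>j<length us. c i *\<^sub>R M i j *\<^sub>R us ! j)"
      by (rule sum.cong) (auto simp: N_def mult.assoc assms(2))
    then show ?thesis using that len M(2) by (simp add: scaleR_sum_right)
  qed
  ultimately show ?thesis unfolding pos_related_def using len by auto
qed

lemma transpose_kernel: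
  assumes "leibniz_det d M \<noteq> 0" "\<And>j. j < d \<Longrightarrow> (\<Sum>i<d. w i * M i j) = 0" "i < d"
  shows "w i = 0"
  using assms leibniz_det_eq_0_iff[of d "\<lambda>i j. M j i"] unfolding leibniz_det_transpose[of d M]
  by (auto simp: mult.commute)

lemma lin_comb_change:
  assumes "length ws = length vs" "\<And>i. i < length vs \<Longrightarrow> ws ! i = (\<Sum>j<length vs. M i j *\<^sub>R vs ! j)"
  shows "lin_comb w ws = lin_comb (\<lambda>j. \<Sum>i<length vs. w i * M i j) vs"
proof -
  have "lin_comb w ws = (\<Sum>i<length vs. \<Sum>j<length vs. (w i * M i j) *\<^sub>R vs ! j)"
    unfolding lin_comb_def assms(1) by (rule sum.cong) (simp_all add: assms(2) scaleR_sum_right)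
  also have "\<dots> = (\<Sum>j<length vs. \<Sum>i<length vs. (w i * M i j) *\<^sub>R vs ! j)" by (rule sum.swap)
  finally show ?thesis by (simp add: lin_comb_def scaleR_sum_left)
qed

lemma length_ordered_basis: "vs \<in> ordered_bases V \<Longrightarrow> length vs = dim V"
  by (auto simp: ordered_bases_def distinct_card dim_eq_card_independent)

lemma orient_subset_ordered_bases:
  assumes v: "vs \<in> ordered_bases V" and w: "ws \<in> orient vs"
  shows "ws \<in> ordered_bases V"
proof -
  obtain M where M: "0 < leibniz_det (length vs) M"
    "\<And>i. i < length vs \<Longrightarrow> ws ! i = (\<Sum>j<length vs. M i j *\<^sub>R vs ! j)" and len: "length ws = length vs"
    using w by (auto simp: orient_def pos_related_def)
  have dv: "distinct vs" "independent (set vs)" "span (set vs) = V" using v by (auto simp: ordered_bases_def)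
  have "\<forall>i<length ws. u i = 0" if "lin_comb u ws = 0" for u
  proof -
    have "lin_comb (\<lambda>j. \<Sum>i<length vs. u i * M i j) vs = 0"
      using that lin_comb_change[OF len M(2), of u] by simp
    then have "(\<Sum>i<length vs. u i * M i j) = 0" if "j < length vs" for j
      using lin_comb_eq_0_iff[OF dv(1,2), of "\<lambda>j. \<Sum>i<length vs. u i * M i j"] that by simp
    then have "u i = 0" if "i < length vs" for i
      using transpose_kernel[of "length vs" M u i] M(1) that by simp
    then show ?thesis by (simp add: len)
  qed
  from ordered_basisI[OF this] have dw: "distinct ws" "independent (set ws)" by auto
  have "set ws \<subseteq> V"
  proof
    fix x assume "x \<in> set ws"
    then obtain i where "i < length vs" "x = ws ! i" using len by (auto simp: in_set_conv_nth)
    then have "x = lin_comb (M i) vs" using M(2) by (simp add: lin_comb_def)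
    then show "x \<in> V" using lin_comb_in_span[of "M i" vs] dv(3) by simp
  qed
  then have "span (set ws) \<subseteq> V" using span_minimal[of "set ws" V] dv(3) subspace_span by metis
  moreover have "dim V \<le> dim (span (set ws))"
    using dw dv len by (metis dim_span dim_span_eq_card_independent distinct_card order_refl)
  ultimately have "span (set ws) = V"
    using dv(3) by (intro subspace_dim_equal) (auto simp: subspace_span)
  with dw show ?thesis by (simp add: ordered_bases_def)
qed

text \<open>
  The determinant of the change of basis to a positive basis is nonzero, and rescaling multiplies it
  by the product of the factors.
\<close>

lemma orientation_dichotomy:
  assumes O: "P \<in> orientations V" and v: "vs \<in> ordered_bases V" and c: "(\<Prod>i<length vs. c i) < 0"
  shows "rescale c vs \<in> P \<longleftrightarrow> vs \<notin> P"
proof -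
  obtain us where us: "us \<in> ordered_bases V" and P: "P = orient us" using O by (auto simp: orientations_def)
  have len: "length us = length vs" using length_ordered_basis us v by metis
  let ?d = "length vs"
  have du: "distinct us" "independent (set us)" "span (set us) = V" using us by (auto simp: ordered_bases_def)
  have dv: "distinct vs" "independent (set vs)" "span (set vs) = V" using v by (auto simp: ordered_bases_def)
  have "\<exists>w. vs ! i = lin_comb w us" if "i < ?d" for i
  proof -
    have "vs ! i \<in> span (set us)" using that dv(3) du(3) span_base[of "vs ! i" "set vs"] by simp
    then show ?thesis using in_span_list[OF du(1)] by metis
  qed
  then obtain M where M: "\<And>i. i < ?d \<Longrightarrow> vs ! i = lin_comb (M i) us" by metis
  then have M': "vs ! i = (\<Sum>j<length us. M i j *\<^sub>R us ! j)" if "i < length us" for i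
    using that len by (simp add: lin_comb_def)
  have "leibniz_det ?d M \<noteq> 0"
  proof
    assume "leibniz_det ?d M = 0"
    then obtain w where w: "\<exists>i<?d. w i \<noteq> 0" "\<And>j. j < ?d \<Longrightarrow> (\<Sum>i<?d. M i j * w i) = 0"
      using leibniz_det_eq_0_iff[of ?d "\<lambda>i j. M j i"] leibniz_det_transpose[of ?d M] by auto
    have "lin_comb w vs = lin_comb (\<lambda>j. \<Sum>i<length us. w i * M i j) us"
      by (rule lin_comb_change[OF len[symmetric] M'])
    also have "\<dots> = 0" using w(2) by (simp add: lin_comb_def len mult.commute)
    finally have "lin_comb w vs = 0" .
    then show False using w(1) lin_comb_eq_0_iff[OF dv(1,2)] by blast
  qed
  moreover have uniq: "pos_related us ws \<longleftrightarrow> 0 < leibniz_det ?d N"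
    if ws: "length ws = ?d" "\<And>i. i < ?d \<Longrightarrow> ws ! i = lin_comb (N i) us" for ws N
  proof
    assume "pos_related us ws"
    then obtain K where K: "0 < leibniz_det ?d K" "\<And>i. i < ?d \<Longrightarrow> ws ! i = lin_comb (K i) us"
      by (auto simp: pos_related_def lin_comb_def len)
    have "K i j = N i j" if "i < ?d" "j < ?d" for i j
    proof -
      have "lin_comb (\<lambda>j. K i j - N i j) us = lin_comb (K i) us - lin_comb (N i) us"
        by (simp add: lin_comb_def scaleR_diff_left sum_subtractf)
      also have "\<dots> = 0" using K(2) ws(2) that by simp
      finally show ?thesis using lin_comb_eq_0_iff[OF du(1,2)] that len by auto
    qed
    then have "leibniz_det ?d K = leibniz_det ?d N" by (intro leibniz_det_cong)
    with K show "0 < leibniz_det ?d N" by simp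
  next
    assume "0 < leibniz_det ?d N"
    then show "pos_related us ws" unfolding pos_related_def using ws len by (auto simp: lin_comb_def)
  qed
  moreover have "rescale c vs ! i = lin_comb (\<lambda>j. c i * M i j) us" if "i < ?d" for i
    using that M by (simp add: lin_comb_def scaleR_sum_right)
  ultimately have "(rescale c vs \<in> P \<longleftrightarrow> 0 < (\<Prod>i<?d. c i) * leibniz_det ?d M)"
    and "vs \<in> P \<longleftrightarrow> 0 < leibniz_det ?d M"
    using uniq[of "rescale c vs" "\<lambda>i j. c i * M i j"] uniq[OF refl M]
    by (simp_all add: P orient_def leibniz_det_scale_rows)
  with c \<open>leibniz_det ?d M \<noteq> 0\<close> show ?thesis by (auto simp: zero_less_mult_iff)
qed

lemma orientations_subset: "P \<in> orientations V \<Longrightarrow> P \<subseteq> ordered_bases V"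
  using orient_subset_ordered_bases by (auto simp: orientations_def)

lemma orientation_rescale:
  assumes "P \<in> orientations V" "vs \<in> P" "0 < (\<Prod>i<length vs. c i)"
  shows "rescale c vs \<in> P"
  using assms pos_related_trans[OF _ pos_related_rescale[OF assms(3)]]
  by (auto simp: orientations_def orient_def)

lemma opposite_orientation:
  assumes P: "P \<in> orientations V"
  shows "opposite P = ordered_bases V - P"
proof -
  obtain us where us: "us \<in> ordered_bases V" "us \<in> P"
    using P pos_related_refl by (auto simp: orientations_def orient_def)
  have "(\<Union>vs\<in>P. set vs) \<subseteq> V"
    using orientations_subset[OF P] span_superset by (fastforce simp: ordered_bases_def)
  moreover have "V = span (set us)" using us by (simp add: ordered_bases_def)
  ultimately have "span (\<Union>vs\<in>P. set vs) = V"
    using us(2) by (intro subset_antisym) (metis span_minimal subspace_span, auto intro!: span_mono)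
  then show ?thesis by (simp add: opposite_def)
qed

lemma rescale_minus: "rescale (\<lambda>_. - 1) vs = map uminus vs"
  by (rule nth_equalityI) auto

lemma rescale_rescale: "rescale c (rescale d vs) = rescale (\<lambda>i. c i * d i) vs"
  by (rule nth_equalityI) auto

lemma rescale_one: "rescale (\<lambda>_. 1) vs = vs"
  by (rule nth_equalityI) auto

lemma rescale_ordered_basis:
  assumes v: "vs \<in> ordered_bases V" and c: "\<And>i. i < length vs \<Longrightarrow> c i \<noteq> 0"
  shows "rescale c vs \<in> ordered_bases V"
proof (cases "0 < (\<Prod>i<length vs. c i)")
  case True
  then show ?thesis using orient_subset_ordered_bases[OF v] pos_related_rescale by (auto simp: orient_def)
next
  case False
  have "(\<Prod>i<length vs. c i) \<noteq> 0" using c by simp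
  with False have neg: "(\<Prod>i<length vs. c i) < 0" by linarith
  then have len: "length vs \<noteq> 0" by (metis lessThan_0 not_one_less_zero prod.empty)
  define e where "e i = (if i = 0 then - 1 else 1 :: real)" for i :: nat
  have "(\<Prod>i<length vs. e i * c i) = - (\<Prod>i<length vs. c i)"
  proof -
    have "(\<Prod>i<length vs. e i) = (\<Prod>i\<in>{0}. e i)"
      by (rule prod.mono_neutral_right) (use len in \<open>auto simp: e_def\<close>)
    then show ?thesis by (simp add: prod.distrib e_def)
  qed
  with neg have "rescale (\<lambda>i. e i * c i) vs \<in> ordered_bases V"
    using orient_subset_ordered_bases[OF v] pos_related_rescale[of "\<lambda>i. e i * c i" vs] by (auto simp: orient_def)
  then have ws: "rescale e (rescale c vs) \<in> ordered_bases V" by (simp add: rescale_rescale)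
  then have d: "distinct (rescale e (rescale c vs))" "independent (set (rescale e (rescale c vs)))"
    "span (set (rescale e (rescale c vs))) = V" by (auto simp: ordered_bases_def)
  have "\<forall>i<length (rescale c vs). w i = 0" if "lin_comb w (rescale c vs) = 0" for w
  proof -
    have "lin_comb (\<lambda>i. w i * e i) (rescale e (rescale c vs)) = lin_comb w (rescale c vs)"
      unfolding lin_comb_def by (rule sum.cong) (auto simp: e_def)
    then show ?thesis using that lin_comb_eq_0_iff[OF d(1,2), of "\<lambda>i. w i * e i"] by (auto simp: e_def split: if_splits)
  qed
  from ordered_basisI[OF this] have dc: "distinct (rescale c vs)" "independent (set (rescale c vs))" by auto
  have "span (set (rescale c vs)) = span (set (rescale e (rescale c vs)))"
  proof (rule span_eq[THEN iffD2], intro conjI subsetI)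
    fix x assume "x \<in> set (rescale c vs)"
    then obtain i where i: "i < length vs" "x = rescale c vs ! i" by (auto simp: in_set_conv_nth)
    then have "x = e i *\<^sub>R (rescale e (rescale c vs) ! i)" by (simp add: e_def)
    then show "x \<in> span (set (rescale e (rescale c vs)))" using i by (metis length_rescale nth_mem span_base span_scale)
  next
    fix x assume "x \<in> set (rescale e (rescale c vs))"
    then obtain i where i: "i < length vs" "x = rescale e (rescale c vs) ! i" by (auto simp: in_set_conv_nth)
    then have "x = e i *\<^sub>R (rescale c vs ! i)" by simp
    then show "x \<in> span (set (rescale c vs))" using i by (metis length_rescale nth_mem span_base span_scale)
  qed
  with d dc show ?thesis by (simp add: ordered_bases_def)
qed

lemma rescale_in_opposite:
  assumes P: "P \<in> orientations V" and v: "vs \<in> P" and c: "(\<Prod>i<length vs. c i) < 0"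
  shows "rescale c vs \<in> opposite P"
proof -
  have vb: "vs \<in> ordered_bases V" using orientations_subset[OF P] v by blast
  have "rescale c vs \<in> ordered_bases V"
    by (rule rescale_ordered_basis[OF vb]) (use c in \<open>auto simp: prod_zero_iff less_le\<close>)
  moreover have "rescale c vs \<notin> P" using orientation_dichotomy[OF P vb c] v by blast
  ultimately show ?thesis by (simp add: opposite_orientation[OF P])
qed

lemma rescale_of_opposite:
  assumes P: "P \<in> orientations V" and v: "vs \<in> opposite P" and c: "(\<Prod>i<length vs. c i) < 0"
  shows "rescale c vs \<in> P"
  using orientation_dichotomy[OF P _ c] v by (auto simp: opposite_orientation[OF P])

lemma opposite_in_orientations:
  assumes P: "P \<in> orientations V" and V: "dim V \<noteq> 0"
  shows "opposite P \<in> orientations V"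
proof -
  obtain us where us: "us \<in> ordered_bases V" "P = orient us" using P by (auto simp: orientations_def)
  have uP: "us \<in> P" using us pos_related_refl by (simp add: orient_def)
  define e where "e i = (if i = 0 then - 1 else 1 :: real)" for i :: nat
  have len: "length us \<noteq> 0" using length_ordered_basis[OF us(1)] V by simp
  have pe: "(\<Prod>i<m. e i) = - 1" if "m \<noteq> 0" for m
  proof -
    have "(\<Prod>i<m. e i) = (\<Prod>i\<in>{0}. e i)"
      by (rule prod.mono_neutral_right) (use that in \<open>auto simp: e_def\<close>)
    then show ?thesis by (simp add: e_def)
  qed
  have eo: "rescale e us \<in> opposite P" using rescale_in_opposite[OF P uP, of e] pe[OF len] by simp
  then have eb: "rescale e us \<in> ordered_bases V" by (simp add: opposite_orientation[OF P])
  then have Q: "orient (rescale e us) \<in> orientations V" by (simp add: orientations_def)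
  have twice: "rescale e (rescale e vs) = vs" for vs :: "'a rvec list"
    by (rule nth_equalityI) (auto simp: e_def)
  have "opposite P = orient (rescale e us)"
  proof (intro subset_antisym subsetI)
    fix vs assume "vs \<in> opposite P"
    then have vb: "vs \<in> ordered_bases V" "vs \<notin> P" by (auto simp: opposite_orientation[OF P])
    then have "length vs \<noteq> 0" using length_ordered_basis[of vs V] V by simp
    then have "rescale e vs \<in> P" using orientation_dichotomy[OF P vb(1), of e] vb(2) pe by simp
    then have "pos_related us (rescale e vs)" by (simp add: us orient_def)
    from pos_related_rescale_both[OF this, of e] show "vs \<in> orient (rescale e us)"
      by (simp add: orient_def twice) (simp add: e_def)
  next
    fix vs assume v: "vs \<in> orient (rescale e us)"
    then have vb: "vs \<in> ordered_bases V" using orientations_subset[OF Q] by blast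
    then have "length vs \<noteq> 0" using length_ordered_basis[of vs V] V by simp
    have "pos_related (rescale e us) vs" using v by (simp add: orient_def)
    from pos_related_rescale_both[OF this, of e] have "rescale e vs \<in> P"
      by (simp add: us orient_def twice) (simp add: e_def)
    with vb show "vs \<in> opposite P"
      using orientation_dichotomy[OF P vb, of e] pe[OF \<open>length vs \<noteq> 0\<close>]
      by (simp add: opposite_orientation[OF P])
  qed
  with Q show ?thesis by simp
qed

section \<open>Positive bases of flags\<close>

definition cols :: "('n::{finite,linorder}) rmat \<Rightarrow> nat list \<Rightarrow> 'n rvec list" where
  "cols A cs = map (\<lambda>c. column (en c) A) cs"

definition DET :: "('n::{finite,linorder}) rvec list \<Rightarrow> real" where
  "DET vs = leibniz_det CARD('n) (\<lambda>i j. vs ! i $ en j)"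

lemma length_cols [simp]: "length (cols A cs) = length cs"
  by (simp add: cols_def)

lemma cols_append: "cols A (cs @ ds) = cols A cs @ cols A ds"
  by (simp add: cols_def)

lemma column_nth [simp]: "column j A $ i = A $ i $ j"
  by (simp add: column_def)

lemma DET_cols: "DET (cols A [0..<CARD('n)]) = det A" for A :: "('n::{finite,linorder}) rmat"
proof -
  have "DET (cols A [0..<CARD('n)]) = leibniz_det CARD('n) (\<lambda>i j. mn A j i)"
    unfolding DET_def by (rule leibniz_det_cong) (simp add: cols_def mn_def)
  also have "\<dots> = leibniz_det CARD('n) (mn A)" by (rule leibniz_det_transpose)
  also have "\<dots> = lead A CARD('n)"
    unfolding minor_def length_upt by (simp, rule leibniz_det_cong) simp
  finally show ?thesis by (simp add: det_eq_lead)
qed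

lemma standard_orientation_iff:
  fixes ws :: "('n::{finite,linorder}) rvec list"
  shows "ws \<in> standard_orientation \<longleftrightarrow> length ws = CARD('n) \<and> 0 < DET ws"
proof -
  have st: "standard_orientation = orient (map (\<lambda>j. axis (en j) 1 :: 'n rvec) [0..<CARD('n)])"
    unfolding standard_orientation_def sorted_list_of_UNIV by (simp add: o_def)
  have coord: "(\<Sum>j<CARD('n). M j *\<^sub>R map (\<lambda>j. axis (en j) 1 :: 'n rvec) [0..<CARD('n)] ! j) $ en c = M c"
    if "c < CARD('n)" for M c
  proof -
    have eq: "en c = (en j :: 'n) \<longleftrightarrow> j = c" if "j < CARD('n)" for j
      using that \<open>c < CARD('n)\<close> by (metis ix_en)
    have "(\<Sum>j<CARD('n). M j *\<^sub>R map (\<lambda>j. axis (en j) 1 :: 'n rvec) [0..<CARD('n)] ! j) $ en c =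
        (\<Sum>j<CARD('n). if j = c then M j else 0)"
      unfolding sum_component
    proof (rule sum.cong[OF refl])
      fix j assume "j \<in> {..<CARD('n)}"
      then show "(M j *\<^sub>R map (\<lambda>j. axis (en j) 1 :: 'n rvec) [0..<CARD('n)] ! j) $ en c = (if j = c then M j else 0)"
        using eq[of j] by (simp add: axis_def)
    qed
    then show ?thesis using that by simp
  qed
  show ?thesis
  proof
    assume "ws \<in> standard_orientation"
    then obtain M where len: "length ws = CARD('n)" and M: "0 < leibniz_det CARD('n) M"
      "\<And>i. i < CARD('n) \<Longrightarrow> ws ! i = (\<Sum>j<CARD('n). M i j *\<^sub>R map (\<lambda>j. axis (en j) 1) [0..<CARD('n)] ! j)"
      unfolding st orient_def pos_related_def by auto
    have "DET ws = leibniz_det CARD('n) M"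
      unfolding DET_def by (rule leibniz_det_cong) (simp only: M(2) coord)
    with len M show "length ws = CARD('n) \<and> 0 < DET ws" by simp
  next
    assume *: "length ws = CARD('n) \<and> 0 < DET ws"
    have "ws ! i = (\<Sum>j<CARD('n). ws ! i $ en j *\<^sub>R map (\<lambda>j. axis (en j) 1) [0..<CARD('n)] ! j)" for i
      unfolding Finite_Cartesian_Product.vec_eq_iff all_en by (intro allI impI) (rule coord[symmetric])
    then show "ws \<in> standard_orientation"
      unfolding st orient_def pos_related_def using * by (auto simp: DET_def intro!: exI[of _ "\<lambda>i j. ws ! i $ en j"])
  qed
qed

lemma oriented_sum_pos:
  fixes vs ws us :: "('n::{finite,linorder}) rvec list"
  assumes "oriented_sum (oriented_sum P Q) R = standard_orientation" "vs \<in> P" "ws \<in> Q" "us \<in> R"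
  shows "length (vs @ ws @ us) = CARD('n)" "0 < DET (vs @ ws @ us)"
proof -
  have "vs @ ws \<in> oriented_sum P Q"
    using assms pos_related_refl[of "vs @ ws"] unfolding oriented_sum_def orient_def by blast
  then have "(vs @ ws) @ us \<in> oriented_sum (oriented_sum P Q) R"
    using assms pos_related_refl[of "(vs @ ws) @ us"] unfolding oriented_sum_def orient_def by blast
  then show "length (vs @ ws @ us) = CARD('n)" "0 < DET (vs @ ws @ us)"
    unfolding assms(1) standard_orientation_iff by simp_all
qed

lemma rescale_append:
  "rescale c vs @ rescale d ws = rescale (\<lambda>i. if i < length vs then c i else d (i - length vs)) (vs @ ws)"
  by (rule nth_equalityI) (auto simp: nth_append)

lemma DET_rescale:
  fixes vs :: "('n::{finite,linorder}) rvec list"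
  assumes "length vs = CARD('n)"
  shows "DET (rescale c vs) = (\<Prod>i<CARD('n). c i) * DET vs"
  unfolding DET_def leibniz_det_scale_rows[symmetric]
  by (rule leibniz_det_cong) (simp add: assms)

lemma DET_rescale3:
  fixes vs ws us :: "('n::{finite,linorder}) rvec list"
  assumes "length (vs @ ws @ us) = CARD('n)"
  shows "DET (rescale (\<lambda>_. a) vs @ rescale (\<lambda>_. b) ws @ rescale (\<lambda>_. c) us) =
    a ^ length vs * b ^ length ws * c ^ length us * DET (vs @ ws @ us)"
proof -
  define f where "f i = (if i < length vs then a else if i < length vs + length ws then b else c)" for i
  have "rescale (\<lambda>_. a) vs @ rescale (\<lambda>_. b) ws @ rescale (\<lambda>_. c) us = rescale f (vs @ ws @ us)"
    by (rule nth_equalityI) (auto simp: nth_append f_def)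
  moreover have "(\<Prod>i<CARD('n). f i) = a ^ length vs * b ^ length ws * c ^ length us"
  proof -
    let ?p = "length vs" and ?q = "length ws" and ?r = "length us"
    have "prod f {0..<?p} = a ^ ?p" by (simp add: f_def)
    moreover have "prod f {?p..<?p + ?q} = b ^ ?q"
      using prod.cong[of "{?p..<?p + ?q}" "{?p..<?p + ?q}" f "\<lambda>_. b"] by (simp add: f_def)
    moreover have "prod f {?p + ?q..<?p + ?q + ?r} = c ^ ?r"
      using prod.cong[of "{?p + ?q..<?p + ?q + ?r}" "{?p + ?q..<?p + ?q + ?r}" f "\<lambda>_. c"] by (simp add: f_def)
    moreover have "prod f {0..<?p + ?q + ?r} =
        prod f {0..<?p} * prod f {?p..<?p + ?q} * prod f {?p + ?q..<?p + ?q + ?r}"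
      by (simp add: prod.atLeastLessThan_concat)
    ultimately show ?thesis using assms by (simp add: lessThan_atLeast0 add.assoc)
  qed
  ultimately show ?thesis by (simp add: DET_rescale[OF assms])
qed

lemma Flag_plusD:
  fixes X :: "('n::{finite,linorder}) oflag set"
  assumes "X \<in> Flag_plus"
  obtains F0 where "F0 \<in> lifts"
    "X = {G. G \<in> lifts \<and> (G = F0 \<or> even CARD('n) \<and> G = reverse_odd F0)}"
  using assms unfolding Flag_plus_def quotient_def by auto

lemma lifts_orientation:
  assumes "F \<in> lifts"
  obtains G where "G \<in> flags" "\<And>i. F i \<in> orientations (G i)"
  using assms unfolding lifts_def by blast

lemma reverse_odd_minus:
  fixes F :: "('n::{finite,linorder}) oflag"
  assumes F: "F \<in> lifts" and i: "i < CARD('n)"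
  shows "vs \<in> F i \<Longrightarrow> map uminus vs \<in> reverse_odd F i"
    "vs \<in> reverse_odd F i \<Longrightarrow> map uminus vs \<in> F i"
proof -
  obtain G where G: "G \<in> flags" "F i \<in> orientations (G i)" using lifts_orientation[OF F] by metis
  have len: "length vs = i" if "vs \<in> ordered_bases (G i)" for vs
    using length_ordered_basis[OF that] G(1) i by (simp add: flags_def)
  have sub: "F i \<subseteq> ordered_bases (G i)" by (rule orientations_subset[OF G(2)])
  have prod: "(\<Prod>j<i. - 1 :: real) = (if odd i then - 1 else 1)" by simp
  { assume v: "vs \<in> F i"
    then have "length vs = i" using len sub by blast
    with v show "map uminus vs \<in> reverse_odd F i"
      using rescale_in_opposite[OF G(2) v, of "\<lambda>_. - 1"] orientation_rescale[OF G(2) v, of "\<lambda>_. - 1"] i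
      by (auto simp: reverse_odd_def rescale_minus) }
  { assume v: "vs \<in> reverse_odd F i"
    then have "length vs = i" using len sub i opposite_orientation[OF G(2)]
      by (auto simp: reverse_odd_def split: if_splits)
    with v show "map uminus vs \<in> F i"
      using rescale_of_opposite[OF G(2), of vs "\<lambda>_. - 1"] orientation_rescale[OF G(2), of vs "\<lambda>_. - 1"] i
      by (auto simp: reverse_odd_def rescale_minus split: if_splits) }
qed

lemma reverse_odd_lifts:
  fixes F :: "('n::{finite,linorder}) oflag"
  assumes F: "F \<in> lifts"
  shows "reverse_odd F \<in> lifts"
proof -
  obtain G where G: "G \<in> flags" "\<And>i. F i \<in> orientations (G i)" using lifts_orientation[OF F] by metis
  have "reverse_odd F i \<in> orientations (G i)" for i
  proof (cases "odd i \<and> i < CARD('n)")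
    case True
    then have "dim (G i) \<noteq> 0" using G(1) odd_pos[of i] by (auto simp: flags_def)
    then show ?thesis using True opposite_in_orientations[OF G(2)] by (simp add: reverse_odd_def)
  qed (use G in \<open>auto simp: reverse_odd_def\<close>)
  then have "\<exists>G\<in>flags. \<forall>i. reverse_odd F i \<in> orientations (G i)" using G(1) by blast
  moreover have "\<forall>i\<ge>CARD('n). reverse_odd F i = standard_orientation"
    using F by (auto simp: lifts_def reverse_odd_def)
  ultimately show ?thesis by (simp add: lifts_def)
qed

text \<open>
  Reversing the orientations in odd dimensions is the effect of the matrix \<open>-1\<close>, so that the two lifts
  of a point are exchanged by changing the signs of all basis vectors.
\<close>

lemma lifts_differ_by_sign:
  fixes X :: "('n::{finite,linorder}) oflag set"
  assumes X: "X \<in> Flag_plus" and "F \<in> X" "G \<in> X"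
  obtains \<epsilon> :: real where "\<epsilon> = 1 \<or> \<epsilon> = - 1 \<and> even CARD('n)"
    "\<And>i vs. i < CARD('n) \<Longrightarrow> vs \<in> F i \<Longrightarrow> rescale (\<lambda>_. \<epsilon>) vs \<in> G i"
proof -
  obtain F0 where F0: "F0 \<in> lifts" "X = {G. G \<in> lifts \<and> (G = F0 \<or> even CARD('n) \<and> G = reverse_odd F0)}"
    by (rule Flag_plusD[OF X])
  show thesis
  proof (cases "F = G")
    case True
    then show thesis using that[of 1] by (simp add: rescale_one)
  next
    case False
    then have "even CARD('n)" "F = F0 \<and> G = reverse_odd F0 \<or> F = reverse_odd F0 \<and> G = F0"
      using assms(2,3) unfolding F0(2) by auto
    then show thesis using that[of "- 1"] reverse_odd_minus[OF F0(1)] by (auto simp: rescale_minus)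
  qed
qed

lemma minus_lift:
  fixes X :: "('n::{finite,linorder}) oflag set"
  assumes X: "X \<in> Flag_plus" and F: "F \<in> X" and n: "even CARD('n)"
  obtains G where "G \<in> X" "\<And>i vs. i < CARD('n) \<Longrightarrow> vs \<in> F i \<Longrightarrow> map uminus vs \<in> G i"
proof -
  obtain F0 where F0: "F0 \<in> lifts" "X = {G. G \<in> lifts \<and> (G = F0 \<or> even CARD('n) \<and> G = reverse_odd F0)}"
    by (rule Flag_plusD[OF X])
  have "F0 \<in> X" "reverse_odd F0 \<in> X" using F0 n reverse_odd_lifts by auto
  moreover have "F = F0 \<or> F = reverse_odd F0" using F unfolding F0(2) by auto
  ultimately show thesis using that reverse_odd_minus[OF F0(1)] by metis
qed

lemma tminor_scaleR: "tminor (c *\<^sub>R M) I J = c ^ length I * tminor M I J"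
proof -
  have "mn (c *\<^sub>R M) = (\<lambda>i j. c * mn M i j)" by (simp add: mn_def fun_eq_iff)
  moreover have "prod_list (map (\<lambda>_. c) I) = c ^ length I" by (induction I) auto
  ultimately show ?thesis using minor_scale_rows[of "\<lambda>_. c" "mn M" I J] by simp
qed

lemma det_scaleR: "det (c *\<^sub>R M) = c ^ CARD('n) * det M" for M :: "('n::{finite,linorder}) rmat"
  by (simp add: det_eq_lead tminor_scaleR)

text \<open>
  Such a basis identifies the pair of flags with the two opposite coordinate flags, so that the
  position of other flags is visible in the minors of transition matrices.
\<close>

definition adapted :: "('n::{finite,linorder}) rmat \<Rightarrow> 'n oflag set \<Rightarrow> 'n oflag set \<Rightarrow> bool" where
  "adapted A X Y \<longleftrightarrow> 0 < det A \<and> (\<exists>F\<in>X. \<exists>G\<in>Y. \<forall>i<CARD('n).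
     cols A [0..<i] \<in> F i \<and> cols A [CARD('n) - i..<CARD('n)] \<in> G i)"

lemma cols_mult: "cols (H ** A) cs = map (\<lambda>v. H *v v) (cols A cs)"
proof -
  have "column j (H ** A) = H *v column j A" for j
    by (simp add: Finite_Cartesian_Product.vec_eq_iff matrix_matrix_mult_def matrix_vector_mult_def)
  then show ?thesis by (simp add: cols_def)
qed

lemma adapted_act:
  assumes h: "h \<in> carrier PSL" and H: "H \<in> h" and A: "adapted A X Y"
  shows "adapted (H ** A) (Flag_plus_act h X) (Flag_plus_act h Y)"
proof -
  obtain F G where "F \<in> X" "G \<in> Y"
    "\<forall>i<CARD('a). cols A [0..<i] \<in> F i \<and> cols A [CARD('a) - i..<CARD('a)] \<in> G i" and d: "0 < det A"
    using A by (auto simp: adapted_def)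
  then show ?thesis
    unfolding adapted_def cols_mult Flag_plus_act_def using H PSL_rep(2)[OF h H]
    by (intro conjI bexI[of _ "\<lambda>i. map (\<lambda>v. H *v v) ` F i"] bexI[of _ "\<lambda>i. map (\<lambda>v. H *v v) ` G i"])
      (auto simp: det_mul)
qed

lemma act_lift_inverse:
  fixes h :: "('n::{finite,linorder}) rmat set"
  assumes h: "h \<in> carrier PSL" and H: "H \<in> h" and X: "X \<in> Flag_plus" and F: "F \<in> Flag_plus_act h X"
  obtains F' where "F' \<in> X" "\<And>i vs. i < CARD('n) \<Longrightarrow> map (\<lambda>v. H *v v) vs \<in> F i \<Longrightarrow> vs \<in> F' i"
proof -
  obtain K G where K: "K \<in> h" "G \<in> X" and F: "F = (\<lambda>i. map (\<lambda>v. K *v v) ` G i)"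
    using F by (auto simp: Flag_plus_act_def)
  have inj: "inj (\<lambda>v. H *v v)" by (rule inj_matrix_vector_mult[OF PSL_invertible[OF h H]])
  from PSL_rep(3)[OF h H K(1)] show thesis
  proof
    assume "K = H"
    then have "vs \<in> G i" if "map (\<lambda>v. H *v v) vs \<in> F i" for i vs
      using that inj_mapI[OF inj] unfolding F by (auto simp: inj_image_mem_iff)
    then show thesis using that[OF K(2)] by blast
  next
    assume KH: "K = - H"
    have "det K = 1" "det H = 1" using PSL_rep(2)[OF h] K H by auto
    moreover have "det (- H) = (- 1) ^ CARD('n) * det H" using det_scaleR[of "- 1" H] by simp
    ultimately have "(- 1 :: real) ^ CARD('n) = 1" using KH by simp
    then have n: "even CARD('n)" by (metis neg_one_odd_power one_neq_neg_one)
    obtain G' where G': "G' \<in> X" "\<And>i vs. i < CARD('n) \<Longrightarrow> vs \<in> G i \<Longrightarrow> map uminus vs \<in> G' i"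
      using minus_lift[OF X K(2) n] by metis
    have "vs \<in> G' i" if i: "i < CARD('n)" and v: "map (\<lambda>v. H *v v) vs \<in> F i" for i vs
    proof -
      obtain us where us: "us \<in> G i" "map (\<lambda>v. H *v v) vs = map (\<lambda>v. K *v v) us" using v unfolding F by auto
      have "K *v v = H *v (- v)" for v
        unfolding KH by (simp add: Finite_Cartesian_Product.vec_eq_iff matrix_vector_mult_def sum_negf)
      then have "map (\<lambda>v. H *v v) vs = map (\<lambda>v. H *v v) (map uminus us)" using us(2) by (simp add: o_def)
      then have "vs = map uminus us" using inj_mapI[OF inj] by (metis injD)
      then show ?thesis using G'(2)[OF i us(1)] by simp
    qed
    then show thesis using that[OF G'(1)] by blast
  qed
qed

lemma adapted_act_inverse:
  fixes h :: "('n::{finite,linorder}) rmat set"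
  assumes h: "h \<in> carrier PSL" and H: "H \<in> h" and X: "X \<in> Flag_plus" and Y: "Y \<in> Flag_plus"
    and A: "adapted (H ** A) (Flag_plus_act h X) (Flag_plus_act h Y)"
  shows "adapted A X Y"
proof -
  obtain F G where FG: "F \<in> Flag_plus_act h X" "G \<in> Flag_plus_act h Y"
    "\<forall>i<CARD('n). cols (H ** A) [0..<i] \<in> F i \<and> cols (H ** A) [CARD('n) - i..<CARD('n)] \<in> G i"
    and d: "0 < det (H ** A)"
    using A by (auto simp: adapted_def)
  obtain F' where F': "F' \<in> X" "\<And>i vs. i < CARD('n) \<Longrightarrow> map (\<lambda>v. H *v v) vs \<in> F i \<Longrightarrow> vs \<in> F' i"
    using act_lift_inverse[OF h H X FG(1)] by metis
  obtain G' where G': "G' \<in> Y" "\<And>i vs. i < CARD('n) \<Longrightarrow> map (\<lambda>v. H *v v) vs \<in> G i \<Longrightarrow> vs \<in> G' i"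
    using act_lift_inverse[OF h H Y FG(2)] by metis
  have "\<forall>i<CARD('n). cols A [0..<i] \<in> F' i \<and> cols A [CARD('n) - i..<CARD('n)] \<in> G' i"
    using F'(2) G'(2) FG(3) by (simp add: cols_mult)
  moreover have "0 < det A" using d PSL_rep(2)[OF h H] by (simp add: det_mul)
  ultimately show ?thesis unfolding adapted_def using F'(1) G'(1) by blast
qed

section \<open>Hyperconvexity and total positivity\<close>

lemma minor_suffix:
  assumes "sorted_wrt (\<lambda>p q. A p q = 0) qs" "\<And>q r. q \<in> set qs \<Longrightarrow> r \<in> set rs \<Longrightarrow> A r q = 0"
    "length cs = length rs"
  shows "minor A (rs @ qs) (cs @ qs) = minor A rs cs * prod_list (map (\<lambda>q. A q q) qs)"
  using assms
proof (induction qs rule: rev_induct)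
  case (snoc q qs)
  have "minor A ((rs @ qs) @ [q]) ((cs @ qs) @ [q]) = minor A (rs @ qs) (cs @ qs) * A q q"
    by (rule minor_last_col) (use snoc.prems in \<open>auto simp: sorted_wrt_append\<close>)
  moreover have "minor A (rs @ qs) (cs @ qs) = minor A rs cs * prod_list (map (\<lambda>q. A q q) qs)"
    by (rule snoc.IH) (use snoc.prems in \<open>auto simp: sorted_wrt_append\<close>)
  ultimately show ?case by simp
qed simp

lemma cols_mult_nth:
  fixes A V :: "('n::{finite,linorder}) rmat"
  assumes "c < length cs"
  shows "cols (A ** V) cs ! c = (\<Sum>l<CARD('n). mn V l (cs ! c) *\<^sub>R column (en l) A)"
  using assms
  by (simp add: cols_def Finite_Cartesian_Product.vec_eq_iff matrix_matrix_mult_def sum_en mn_def mult.commute)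

lemma prod_list_map_one: "(\<And>x. x \<in> set xs \<Longrightarrow> f x = (1::real)) \<Longrightarrow> prod_list (map f xs) = 1"
  by (induction xs) auto

text \<open>
  The columns of \<open>A\<close> are coordinate vectors in the basis \<open>A\<close> itself, so that the determinant reduces
  to the minor of \<open>M\<close> in the remaining rows.
\<close>

lemma DET_middle:
  fixes A M :: "('n::{finite,linorder}) rmat"
  assumes ik: "i + k \<le> CARD('n)"
  shows "DET (cols A [0..<i] @ cols (A ** M) [0..<k] @ cols A [i+k..<CARD('n)]) =
    det A * tminor M [i..<i+k] [0..<k]"
proof -
  let ?n = "CARD('n)"
  define V :: "'n rmat" where
    "V = mk (\<lambda>l c. if i \<le> c \<and> c < i + k then mn M l (c - i) else if l = c then 1 else 0)"
  have unit: "(\<Sum>l<?n. mn V l c *\<^sub>R column (en l) A) = column (en c) A" if "c < ?n" "\<not> (i \<le> c \<and> c < i + k)" for c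
  proof -
    have "(\<Sum>l<?n. mn V l c *\<^sub>R column (en l) A) = (\<Sum>l<?n. if l = c then column (en l) A else 0)"
      by (rule sum.cong) (use that in \<open>auto simp: V_def\<close>)
    then show ?thesis using that by simp
  qed
  have "cols (A ** V) [0..<?n] = cols A [0..<i] @ cols (A ** M) [0..<k] @ cols A [i+k..<?n]"
  proof (rule nth_equalityI)
    fix c assume "c < length (cols (A ** V) [0..<?n])"
    then have c: "c < ?n" by simp
    then have l: "cols (A ** V) [0..<?n] ! c = (\<Sum>l<?n. mn V l c *\<^sub>R column (en l) A)"
      by (subst cols_mult_nth) auto
    consider "c < i" | "i \<le> c" "c < i + k" | "i + k \<le> c" by linarith
    then show "cols (A ** V) [0..<?n] ! c = (cols A [0..<i] @ cols (A ** M) [0..<k] @ cols A [i+k..<?n]) ! c"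
    proof cases
      case 2
      have "(\<Sum>l<?n. mn V l c *\<^sub>R column (en l) A) = (\<Sum>l<?n. mn M l (c - i) *\<^sub>R column (en l) A)"
        by (rule sum.cong) (use 2 c in \<open>auto simp: V_def\<close>)
      also have "\<dots> = cols (A ** M) [0..<k] ! (c - i)" using 2 by (subst cols_mult_nth) auto
      moreover have "c - i < k" using 2 by linarith
      ultimately show ?thesis using 2 l by (simp add: nth_append)
    qed (use c l unit[OF c] in \<open>auto simp: nth_append cols_def\<close>)
  qed (use ik in simp)
  then have "DET (cols A [0..<i] @ cols (A ** M) [0..<k] @ cols A [i+k..<?n]) = det (A ** V)"
    using DET_cols[of "A ** V"] by simp
  also have "\<dots> = det A * lead V ?n" by (simp only: det_mul det_eq_lead[of V])
  also have "lead V ?n = tminor M [i..<i+k] [0..<k]"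
  proof -
    have e: "[0..<?n] = [0..<i] @ ([i..<i+k] @ [i+k..<?n])"
      using upt_add_eq_append[of 0 i "?n - i"] upt_add_eq_append[of i "i + k" "?n - (i + k)"] ik by simp
    have "lead V ?n = prod_list (map (\<lambda>p. mn V p p) [0..<i]) *
        tminor V ([i..<i+k] @ [i+k..<?n]) ([i..<i+k] @ [i+k..<?n])"
      unfolding e by (rule minor_prefix) (use ik in \<open>auto simp: sorted_wrt_iff_nth_less V_def\<close>)
    also have "prod_list (map (\<lambda>p. mn V p p) [0..<i]) = 1"
      by (rule prod_list_map_one) (use ik in \<open>auto simp: V_def\<close>)
    also have "tminor V ([i..<i+k] @ [i+k..<?n]) ([i..<i+k] @ [i+k..<?n]) =
        tminor V [i..<i+k] [i..<i+k] * prod_list (map (\<lambda>q. mn V q q) [i+k..<?n])"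
      by (rule minor_suffix) (use ik in \<open>auto simp: sorted_wrt_iff_nth_less V_def\<close>)
    also have "prod_list (map (\<lambda>q. mn V q q) [i+k..<?n]) = 1"
      by (rule prod_list_map_one) (use ik in \<open>auto simp: V_def\<close>)
    also have "tminor V [i..<i+k] [i..<i+k] = minor (\<lambda>l c. mn M l (c - i)) [i..<i+k] [i..<i+k]"
      by (rule minor_cong) (use ik in \<open>auto simp: V_def\<close>)
    also have "\<dots> = tminor M (map (\<lambda>l. l) [i..<i+k]) (map (\<lambda>c. c - i) [i..<i+k])"
      by (rule minor_map[symmetric]) simp
    also have "map (\<lambda>c. c - i) [i..<i+k] = [0..<k]" by (rule nth_equalityI) auto
    finally show ?thesis by simp
  qed
  finally show ?thesis .
qed

lemma DET_outer:
  fixes A M :: "('n::{finite,linorder}) rmat"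
  assumes pk: "p + k \<le> CARD('n)"
  shows "DET (cols (A ** M) [0..<p] @ cols (A ** M) [CARD('n) - k..<CARD('n)] @ cols A [p+k..<CARD('n)]) =
    det A * tminor M [0..<p+k] ([0..<p] @ [CARD('n) - k..<CARD('n)])"
proof -
  let ?n = "CARD('n)"
  define f where "f c = (if c < p then c else ?n - k + (c - p))" for c
  define V :: "'n rmat" where
    "V = mk (\<lambda>l c. if c < p + k then mn M l (f c) else if l = c then 1 else 0)"
  have "cols (A ** V) [0..<?n] = cols (A ** M) [0..<p] @ cols (A ** M) [?n - k..<?n] @ cols A [p+k..<?n]"
  proof (rule nth_equalityI)
    fix c assume "c < length (cols (A ** V) [0..<?n])"
    then have c: "c < ?n" by simp
    then have l: "cols (A ** V) [0..<?n] ! c = (\<Sum>l<?n. mn V l c *\<^sub>R column (en l) A)"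
      by (subst cols_mult_nth) auto
    have low: "(\<Sum>l<?n. mn V l c *\<^sub>R column (en l) A) = (\<Sum>l<?n. mn M l (f c) *\<^sub>R column (en l) A)" if "c < p + k"
      by (rule sum.cong) (use c that in \<open>auto simp: V_def\<close>)
    consider "c < p" | "p \<le> c" "c < p + k" | "p + k \<le> c" by linarith
    then show "cols (A ** V) [0..<?n] ! c = (cols (A ** M) [0..<p] @ cols (A ** M) [?n - k..<?n] @ cols A [p+k..<?n]) ! c"
    proof cases
      case 1
      then have "(\<Sum>l<?n. mn M l (f c) *\<^sub>R column (en l) A) = cols (A ** M) [0..<p] ! c"
        by (subst cols_mult_nth) (auto simp: f_def)
      then show ?thesis using 1 l low by (simp add: nth_append)
    next
      case 2
      then have "(\<Sum>l<?n. mn M l (f c) *\<^sub>R column (en l) A) = cols (A ** M) [?n - k..<?n] ! (c - p)"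
        using pk by (subst cols_mult_nth) (auto simp: f_def)
      then show ?thesis using 2 l low pk by (auto simp: nth_append)
    next
      case 3
      have "(\<Sum>l<?n. mn V l c *\<^sub>R column (en l) A) = (\<Sum>l<?n. if l = c then column (en l) A else 0)"
        by (rule sum.cong) (use 3 c in \<open>auto simp: V_def\<close>)
      then show ?thesis using 3 c l pk by (auto simp: nth_append cols_def)
    qed
  qed (use pk in simp)
  then have "DET (cols (A ** M) [0..<p] @ cols (A ** M) [?n - k..<?n] @ cols A [p+k..<?n]) = det (A ** V)"
    using DET_cols[of "A ** V"] by simp
  also have "\<dots> = det A * lead V ?n" by (simp only: det_mul det_eq_lead[of V])
  also have "lead V ?n = tminor M [0..<p+k] ([0..<p] @ [?n - k..<?n])"
  proof -
    have e: "[0..<?n] = [0..<p+k] @ [p+k..<?n]"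
      using pk by (metis le_add_diff_inverse upt_add_eq_append zero_le)
    have "lead V ?n = lead V (p + k) * prod_list (map (\<lambda>q. mn V q q) [p+k..<?n])"
      unfolding e by (rule minor_suffix) (use pk in \<open>auto simp: sorted_wrt_iff_nth_less V_def\<close>)
    also have "prod_list (map (\<lambda>q. mn V q q) [p+k..<?n]) = 1"
      by (rule prod_list_map_one) (use pk in \<open>auto simp: V_def\<close>)
    also have "lead V (p + k) = minor (\<lambda>l c. mn M l (f c)) [0..<p+k] [0..<p+k]"
      by (rule minor_cong) (use pk in \<open>auto simp: V_def\<close>)
    also have "\<dots> = tminor M (map (\<lambda>l. l) [0..<p+k]) (map f [0..<p+k])"
      by (rule minor_map[symmetric]) simp
    also have "map f [0..<p+k] = [0..<p] @ [?n - k..<?n]"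
      by (rule nth_equalityI) (use pk in \<open>auto simp: f_def nth_append\<close>)
    finally show ?thesis by simp
  qed
  finally show ?thesis .
qed

lemma lin_comb_snoc: "lin_comb c (vs @ [v]) = lin_comb c vs + c (length vs) *\<^sub>R v"
  unfolding lin_comb_def by (auto simp: nth_append intro!: sum.cong)

lemma lin_comb_append: "lin_comb c (vs @ us) = lin_comb c vs + lin_comb (\<lambda>l. c (length vs + l)) us"
proof (induction us rule: rev_induct)
  case (snoc u us)
  then show ?case
    using lin_comb_snoc[of c "vs @ us" u] lin_comb_snoc[of "\<lambda>l. c (length vs + l)" us u] by simp
qed (simp add: lin_comb_def)

lemma cols_ordered_basis:
  fixes A :: "('n::{finite,linorder}) rmat"
  assumes A: "invertible A" and cs: "distinct cs" "set cs \<subseteq> {..<CARD('n)}"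
  shows "cols A cs \<in> ordered_bases (span (set (cols A cs)))"
proof -
  have "\<forall>i<length (cols A cs). w i = 0" if 0: "lin_comb w (cols A cs) = 0" for w
  proof (intro allI impI)
    fix i assume "i < length (cols A cs)"
    then have i: "i < length cs" by simp
    define x :: "'n rvec" where "x = (\<Sum>l<length cs. w l *\<^sub>R axis (en (cs ! l)) 1)"
    have "A *v x = (\<Sum>l<length cs. A *v (w l *\<^sub>R axis (en (cs ! l)) 1))"
      unfolding x_def by (rule linear_sum[OF matrix_vector_mul_linear])
    also have "\<dots> = lin_comb w (cols A cs)"
      unfolding lin_comb_def by (rule sum.cong) (auto simp: cols_def matrix_vector_mult_scaleR matrix_vector_mult_basis)
    finally have "A *v x = A *v 0" using 0 by simp
    then have "x = 0" using inj_matrix_vector_mult[OF A] by (metis injD)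
    have "x $ en (cs ! i) = (\<Sum>l<length cs. if l = i then w l else 0)"
      unfolding x_def sum_component
    proof (rule sum.cong[OF refl])
      fix l assume l: "l \<in> {..<length cs}"
      have "en (cs ! i) = (en (cs ! l) :: 'n) \<longleftrightarrow> l = i"
      proof
        assume "en (cs ! i) = (en (cs ! l) :: 'n)"
        moreover have "cs ! i < CARD('n)" "cs ! l < CARD('n)"
          using cs(2) i l by (auto simp: subset_iff)
        ultimately have "cs ! i = cs ! l" by (metis ix_en)
        then show "l = i" using cs(1) i l by (simp add: nth_eq_iff_index_eq)
      qed simp
      then show "(w l *\<^sub>R axis (en (cs ! l)) 1 :: 'n rvec) $ en (cs ! i) = (if l = i then w l else 0)"
        by (simp add: axis_def)
    qed
    then show "w i = 0" using \<open>x = 0\<close> i by simp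
  qed
  from ordered_basisI[OF this] show ?thesis by (simp add: ordered_bases_def)
qed

lemma fl_eq_span_cols:
  fixes A :: "('n::{finite,linorder}) rmat"
  assumes "i \<le> CARD('n)"
  shows "fl A i = span (set (cols A [0..<i]))"
proof -
  have "{k :: 'n. ix k < i} = en ` {0..<i}"
  proof (intro subset_antisym subsetI)
    fix k :: 'n assume "k \<in> {k. ix k < i}"
    then show "k \<in> en ` {0..<i}" by (intro image_eqI[of _ _ "ix k"]) auto
  qed (use assms in auto)
  then show ?thesis
    unfolding flag_of_matrix_def cols_def ix_def[symmetric] by (simp add: image_image)
qed

lemma mn_mult_reversal: "i < CARD('n) \<Longrightarrow> j < CARD('n) \<Longrightarrow> mn (A ** reversal) i j = mn A i (CARD('n) - Suc j)"
  for A :: "('n::{finite,linorder}) rmat"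
proof -
  assume ij: "i < CARD('n)" "j < CARD('n)"
  have "mn (A ** reversal) i j = (\<Sum>l<CARD('n). if l = CARD('n) - Suc j then mn A i l else 0)"
    unfolding mn_mult by (rule sum.cong) (use ij in \<open>auto simp: mn_reversal\<close>)
  then show ?thesis using ij by simp
qed

lemma fl_reversal_eq_span_cols:
  fixes A :: "('n::{finite,linorder}) rmat"
  assumes i: "i \<le> CARD('n)"
  shows "fl (A ** reversal) i = span (set (cols A [CARD('n) - i..<CARD('n)]))"
proof -
  have c: "column (en c) (A ** reversal) = column (en (CARD('n) - Suc c)) A" if "c < CARD('n)" for c
    unfolding Finite_Cartesian_Product.vec_eq_iff all_en
    using that mn_mult_reversal[of _ c A] by (auto simp: mn_def)
  have "set (cols (A ** reversal) [0..<i]) = (\<lambda>c. column (en (CARD('n) - Suc c)) A) ` {0..<i}"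
    using i by (auto simp: cols_def c)
  also have "\<dots> = (\<lambda>c. column (en c) A) ` (\<lambda>c. CARD('n) - Suc c) ` {0..<i}" by (simp add: image_image)
  also have "(\<lambda>c. CARD('n) - Suc c) ` {0..<i} = {CARD('n) - i..<CARD('n)}"
  proof (intro subset_antisym subsetI)
    fix c assume "c \<in> {CARD('n) - i..<CARD('n)}"
    then show "c \<in> (\<lambda>c. CARD('n) - Suc c) ` {0..<i}"
      using i by (intro image_eqI[of _ _ "CARD('n) - Suc c"]) auto
  qed (use i in auto)
  finally show ?thesis using fl_eq_span_cols[OF i, of "A ** reversal"] by (simp add: cols_def)
qed

lemma Nil_in_lift: "F \<in> lifts \<Longrightarrow> [] \<in> F 0" for F :: "('n::{finite,linorder}) oflag"
proof -
  assume "F \<in> lifts"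
  then obtain G where G: "G \<in> flags" "\<And>i. F i \<in> orientations (G i)" using lifts_orientation by metis
  then obtain vs where vs: "vs \<in> ordered_bases (G 0)" "F 0 = orient vs" by (auto simp: orientations_def)
  have "length vs = 0" using length_ordered_basis[OF vs(1)] G(1) by (simp add: flags_def)
  then show ?thesis using vs(2) pos_related_refl[of vs] by (simp add: orient_def)
qed

lemma Flag_plus_lifts: "X \<in> Flag_plus \<Longrightarrow> F \<in> X \<Longrightarrow> F \<in> lifts"
  by (erule Flag_plusD) auto

text \<open>
  Transverse flags \<open>F\<close> and \<open>G\<close> meet in lines \<open>F(i+1) \<inter> G(n-i)\<close>, whose generators form a basis adapted
  to both; the signs of the generators are chosen inductively to match the orientations of \<open>F\<close>, and
  positivity of the pair then forces those of \<open>G\<close>.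
\<close>

lemma adapted_exists:
  fixes X Y :: "('n::{finite,linorder}) oflag set"
  assumes X: "X \<in> Flag_plus" and Y: "Y \<in> Flag_plus" and FX: "F \<in> X" and GY: "G \<in> Y"
    and pos: "\<And>i vs us. 0 < i \<Longrightarrow> i < CARD('n) \<Longrightarrow> vs \<in> F i \<Longrightarrow> us \<in> G (CARD('n) - i) \<Longrightarrow>
      length (vs @ us) = CARD('n) \<and> 0 < DET (vs @ us)"
  shows "\<exists>A. adapted A X Y"
proof -
  let ?n = "CARD('n)"
  have lF: "F \<in> lifts" and lG: "G \<in> lifts" using Flag_plus_lifts X Y FX GY by blast+
  obtain F0 where F0: "F0 \<in> flags" "\<And>i. F i \<in> orientations (F0 i)" using lifts_orientation[OF lF] by metis
  obtain G0 where G0: "G0 \<in> flags" "\<And>i. G i \<in> orientations (G0 i)" using lifts_orientation[OF lG] by metis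
  have ex: "\<exists>vs. vs \<in> P \<and> vs \<in> ordered_bases V" if "P \<in> orientations V" for P and V :: "'n rvec set"
    using that pos_related_refl by (auto simp: orientations_def orient_def)
  have sub: "subspace (F0 i)" "subspace (G0 i)" "dim (F0 i) = min i ?n" "dim (G0 i) = min i ?n" for i
    using F0 G0 by (auto simp: flags_def)
  have "transverse F0 G0"
    unfolding transverse_def
  proof (intro allI impI)
    fix i assume i: "i \<le> ?n"
    have "v = 0" if v: "v \<in> F0 i" "v \<in> G0 (?n - i)" for v
    proof -
      consider "i = 0" | "i = ?n" | "0 < i" "i < ?n" using i by linarith
      then show ?thesis
      proof cases
        case 1
        then show ?thesis using v sub(3)[of 0] by (auto simp: dim_eq_0)
      next
        case 2
        then show ?thesis using v sub(4)[of 0] by (auto simp: dim_eq_0)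
      next
        case 3
        obtain vs where vs: "vs \<in> F i" "vs \<in> ordered_bases (F0 i)" using ex[OF F0(2)] by metis
        obtain us where us: "us \<in> G (?n - i)" "us \<in> ordered_bases (G0 (?n - i))" using ex[OF G0(2)] by metis
        have dv: "distinct vs" "independent (set vs)" "span (set vs) = F0 i"
          and du: "distinct us" "span (set us) = G0 (?n - i)"
          using vs us by (auto simp: ordered_bases_def)
        obtain a where a: "v = lin_comb a vs" using in_span_list[OF dv(1)] v(1) dv(3) by metis
        obtain b where b: "v = lin_comb b us" using in_span_list[OF du(1)] v(2) du(2) by metis
        note D = pos[OF 3 vs(1) us(1)]
        define c where "c l = (if l < length vs then a l else - b (l - length vs))" for l
        have "lin_comb c vs = lin_comb a vs" "lin_comb (\<lambda>l. c (length vs + l)) us = lin_comb (\<lambda>l. - b l) us"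
          unfolding lin_comb_def by (auto intro!: sum.cong simp: c_def)
        then have "lin_comb c (vs @ us) = lin_comb a vs + lin_comb (\<lambda>l. - b l) us" by (simp add: lin_comb_append)
        also have "\<dots> = 0" using a b by (simp add: lin_comb_def sum_negf)
        finally have c0: "lin_comb c (vs @ us) = 0" .
        have "c l = 0" if "l < ?n" for l
        proof (rule transpose_kernel[where d = ?n and M = "\<lambda>i j. (vs @ us) ! i $ en j"])
          show "leibniz_det ?n (\<lambda>i j. (vs @ us) ! i $ en j) \<noteq> 0" using D by (simp add: DET_def)
          fix j
          have "lin_comb c (vs @ us) $ en j = (\<Sum>l<?n. c l * (vs @ us) ! l $ en j)"
            unfolding lin_comb_def sum_component using D by simp
          then show "(\<Sum>l<?n. c l * (vs @ us) ! l $ en j) = 0" using c0 by simp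
        qed (rule that)
        then have "a l = 0" if "l < length vs" for l
          using that D by (auto simp: c_def dest!: meta_spec[of _ l])
        then show ?thesis by (simp add: a lin_comb_def)
      qed
    qed
    then show "F0 i \<inter> G0 (?n - i) = {0}" using subspace_0[OF sub(1)] subspace_0[OF sub(2)] by blast
  qed
  obtain P Q where P: "invertible P" "F0 = fl P" and Q: "invertible Q" "G0 = fl Q"
    using F0 G0 flags_surj by metis
  define Q1 where "Q1 = Q ** reversal"
  have iQ1: "invertible Q1" unfolding Q1_def using Q(1) invertible_reversal by (rule invertible_mult)
  have Qw: "Q = Q1 ** reversal"
  proof -
    have "Q1 ** reversal = Q ** (reversal ** reversal)" unfolding Q1_def by (simp only: matrix_mul_assoc)
    then show ?thesis by simp
  qed
  obtain Q2 where Q2: "Q1 ** Q2 = mat 1" "Q2 ** Q1 = mat 1" using iQ1 by (auto simp: invertible_def)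
  define Z where "Z = Q2 ** P"
  have PZ: "P = Q1 ** Z" by (simp add: Z_def matrix_mul_assoc Q2)
  have "invertible Z" unfolding Z_def using Q2 P(1) by (intro invertible_mult) (auto simp: invertible_def)
  then have Z: "regular Z"
    using \<open>transverse F0 G0\<close> transverse_iff_regular[OF iQ1] P(2) Q(2) PZ Qw by metis
  define B where "B = Q1 ** lower_factor Z"
  have B: "invertible B"
    unfolding B_def by (intro invertible_mult iQ1 regular_invertible regular_lower_unip lower_unip_lower_factor Z)
  have FB: "F0 = fl B"
    using fl_lower_factor[OF Z] by (intro ext) (simp only: P(2) PZ B_def fl_mult[of Q1])
  define S where "S = reversal ** lower_factor Z ** reversal"
  have "upper_inv S"
    unfolding upper_inv_mn S_def using lower_unip_lower_factor[OF Z] by (auto simp: mn_mult_reversal mn_reversal_mult lower_unip_mn)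
  moreover have "B ** reversal = Q ** S"
  proof -
    have "Q ** S = Q1 ** (reversal ** reversal) ** lower_factor Z ** reversal" unfolding Qw S_def by (simp only: matrix_mul_assoc)
    then show ?thesis by (simp add: B_def)
  qed
  ultimately have GB: "G0 = fl (B ** reversal)" using Q(2) fl_mult_upper by metis
  have bF: "cols B [0..<i] \<in> ordered_bases (F0 i)" if "i \<le> ?n" for i
    unfolding FB fl_eq_span_cols[OF that] by (rule cols_ordered_basis[OF B]) (use that in auto)
  have bG: "cols B [?n - i..<?n] \<in> ordered_bases (G0 i)" if "i \<le> ?n" for i
    unfolding GB fl_reversal_eq_span_cols[OF that] by (rule cols_ordered_basis[OF B]) (use that in auto)
  define \<sigma> where "\<sigma> i = (if cols B [0..<i] \<in> F i then 1 else - 1 :: real)" for i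
  define \<epsilon> where "\<epsilon> j = \<sigma> (Suc j) * \<sigma> j" for j
  have \<sigma>2: "\<sigma> i * \<sigma> i = 1" for i by (simp add: \<sigma>_def)
  have \<sigma>0: "\<sigma> 0 = 1" using Nil_in_lift[OF lF] by (simp add: \<sigma>_def cols_def)
  have prod_\<epsilon>: "(\<Prod>j<i. \<epsilon> j) = \<sigma> i" for i
    by (induction i) (auto simp: \<sigma>0 \<epsilon>_def mult.left_commute \<sigma>2 mult.commute)
  have \<epsilon>: "\<epsilon> j \<noteq> 0" for j by (simp add: \<epsilon>_def \<sigma>_def)
  define A where "A = B ** dg \<epsilon>"
  have colA: "column (en c) A = \<epsilon> c *\<^sub>R column (en c) B" if "c < ?n" for c
    unfolding Finite_Cartesian_Product.vec_eq_iff all_en A_def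
    using that mn_mult_dg[of _ c B \<epsilon>] by (auto simp: mn_def)
  have scl1: "cols A [0..<i] = rescale \<epsilon> (cols B [0..<i])" if "i \<le> ?n" for i
    by (rule nth_equalityI) (use that in \<open>auto simp: cols_def colA\<close>)
  have scl2: "cols A [?n - i..<?n] = rescale (\<lambda>k. \<epsilon> (?n - i + k)) (cols B [?n - i..<?n])" if "i \<le> ?n" for i
    by (rule nth_equalityI) (use that in \<open>auto simp: cols_def colA\<close>)
  have inF: "cols A [0..<i] \<in> F i" if i: "i \<le> ?n" for i
  proof (cases "cols B [0..<i] \<in> F i")
    case True
    then have "\<sigma> i = 1" by (simp add: \<sigma>_def)
    then show ?thesis using orientation_rescale[OF F0(2) True, of \<epsilon>] prod_\<epsilon>[of i] by (simp add: scl1[OF i])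
  next
    case False
    then have "\<sigma> i = - 1" by (simp add: \<sigma>_def)
    then show ?thesis using orientation_dichotomy[OF F0(2) bF[OF i], of \<epsilon>] False prod_\<epsilon>[of i] by (simp add: scl1[OF i])
  qed
  have "F ?n = standard_orientation" using lF by (simp add: lifts_def)
  then have detA: "0 < det A" using inF[of ?n] by (simp add: standard_orientation_iff DET_cols)
  have inG: "cols A [?n - i..<?n] \<in> G i" if i: "i < ?n" for i
  proof (rule ccontr)
    assume notin: "cols A [?n - i..<?n] \<notin> G i"
    then have "i \<noteq> 0" using Nil_in_lift[OF lG] by (metis cols_def diff_zero list.map(1) upt_conv_Nil order_refl)
    then have i0: "0 < ?n - i" "?n - i < ?n" "?n - (?n - i) = i" using i by auto
    let ?us = "cols A [?n - i..<?n]" and ?vs = "cols A [0..<?n - i]"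
    define e where "e k = (if k = 0 then - 1 else 1 :: real)" for k :: nat
    have us: "?us \<in> ordered_bases (G0 i)"
      using rescale_ordered_basis[OF bG, of i] \<epsilon> i by (simp add: scl2)
    have "(\<Prod>k<i. e k) = (\<Prod>k\<in>{0}. e k)"
      by (rule prod.mono_neutral_right) (use \<open>i \<noteq> 0\<close> in \<open>auto simp: e_def\<close>)
    then have pe: "(\<Prod>k<length ?us. e k) = - 1" using i by (simp add: e_def)
    have "rescale e ?us \<in> G i" using orientation_dichotomy[OF G0(2) us, of e] notin pe by simp
    then have "0 < DET (?vs @ rescale e ?us)"
      using pos[OF i0(1,2) inF, of "rescale e ?us"] i0 by simp
    moreover have "?vs @ rescale e ?us = rescale (\<lambda>k. if k < ?n - i then 1 else e (k - (?n - i))) (?vs @ ?us)"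
      using rescale_append[of "\<lambda>_. 1" ?vs e ?us] by (simp add: rescale_one cong: if_cong)
    moreover have "?vs @ ?us = cols A [0..<?n]"
      unfolding cols_append[symmetric] using upt_add_eq_append[of 0 "?n - i" i] i by simp
    moreover have "(\<Prod>k<?n. if k < ?n - i then 1 else e (k - (?n - i))) = - 1"
    proof -
      have "(\<Prod>k<?n. if k < ?n - i then 1 else e (k - (?n - i))) = (\<Prod>k\<in>{?n - i}. if k < ?n - i then 1 else e (k - (?n - i)))"
        by (rule prod.mono_neutral_right) (use i \<open>i \<noteq> 0\<close> in \<open>auto simp: e_def\<close>)
      then show ?thesis by (simp add: e_def)
    qed
    ultimately show False using detA by (simp add: DET_rescale DET_cols)
  qed
  show ?thesis
    using detA inF inG FX GY unfolding adapted_def by (intro exI[of _ A] conjI bexI[of _ F] bexI[of _ G]) auto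
qed

text \<open>
  This is the case of the zero subspace of the third flag.
\<close>

lemma hyperconvex_adapted_exists:
  fixes X Y Z :: "('n::{finite,linorder}) oflag set"
  assumes "hyperconvex X Y Z"
  shows "\<exists>A. adapted A X Y"
proof -
  obtain F1 F2 F3 where F: "F1 \<in> X" "F2 \<in> Y" "F3 \<in> Z" and XYZ: "X \<in> Flag_plus" "Y \<in> Flag_plus" "Z \<in> Flag_plus"
    and pos: "\<And>i1 i2 i3. i1 < CARD('n) \<Longrightarrow> i2 < CARD('n) \<Longrightarrow> i3 < CARD('n) \<Longrightarrow> i1 + i2 + i3 = CARD('n) \<Longrightarrow>
      oriented_sum (oriented_sum (F1 i1) (F2 i2)) (F3 i3) = standard_orientation"
    using assms unfolding hyperconvex_def by blast
  have Nil: "[] \<in> F3 0" using Nil_in_lift Flag_plus_lifts F(3) XYZ(3) by blast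
  show ?thesis
  proof (rule adapted_exists[OF XYZ(1,2) F(1,2)])
    fix i vs us assume "0 < i" "i < CARD('n)" "vs \<in> F1 i" "us \<in> F2 (CARD('n) - i)"
    then show "length (vs @ us) = CARD('n) \<and> 0 < DET (vs @ us)"
      using oriented_sum_pos[OF pos _ _ Nil, of i "CARD('n) - i" vs us] by simp
  qed
qed

lemma sign_power: "\<epsilon> ^ n = 1 \<Longrightarrow> k \<le> n \<Longrightarrow> \<epsilon> = 1 \<or> \<epsilon> = - 1 \<Longrightarrow> \<epsilon> ^ (n - k) = \<epsilon> ^ k" for \<epsilon> :: real
proof -
  assume n: "\<epsilon> ^ n = 1" and k: "k \<le> n" and e: "\<epsilon> = 1 \<or> \<epsilon> = - 1"
  have "\<epsilon> ^ (n - k) * \<epsilon> ^ k = 1" using n k by (simp flip: power_add)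
  moreover have "\<epsilon> ^ k = 1 \<or> \<epsilon> ^ k = - 1" using e by (metis neg_one_even_power neg_one_odd_power power_one)
  ultimately show ?thesis by auto
qed

text \<open>
  Subspaces of dimensions \<open>(i, k, n - i - k)\<close> give the minor of \<open>M\<close> in the rows from \<open>i\<close> on and the
  first \<open>k\<close> columns.  Passing to other lifts of the flags changes the sign of the bases, and hence of
  the transition matrix, only globally.
\<close>

lemma hyperconvex_minors:
  fixes X1 X2 X3 Y :: "('n::{finite,linorder}) oflag set"
  assumes hyp: "hyperconvex X1 X2 X3" and A: "adapted A X1 X3" and B: "adapted (A ** M) X2 Y" and n: "2 \<le> CARD('n)"
  obtains \<eta> :: real where "\<eta> = 1 \<or> \<eta> = - 1 \<and> even CARD('n)"
    "\<And>i k. i + k \<le> CARD('n) \<Longrightarrow> k < CARD('n) \<Longrightarrow> 0 < \<eta> ^ k * tminor M [i..<i+k] [0..<k]"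
proof -
  let ?n = "CARD('n)"
  obtain F1 F2 F3 where F: "F1 \<in> X1" "F2 \<in> X2" "F3 \<in> X3" and X: "X1 \<in> Flag_plus" "X2 \<in> Flag_plus" "X3 \<in> Flag_plus"
    and pos: "\<And>i1 i2 i3. i1 < ?n \<Longrightarrow> i2 < ?n \<Longrightarrow> i3 < ?n \<Longrightarrow> i1 + i2 + i3 = ?n \<Longrightarrow>
      oriented_sum (oriented_sum (F1 i1) (F2 i2)) (F3 i3) = standard_orientation"
    using hyp unfolding hyperconvex_def by blast
  obtain F G where A: "F \<in> X1" "G \<in> X3" "0 < det A"
    "\<And>i. i < ?n \<Longrightarrow> cols A [0..<i] \<in> F i" "\<And>i. i < ?n \<Longrightarrow> cols A [?n - i..<?n] \<in> G i"
    using A unfolding adapted_def by blast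
  obtain F' where B: "F' \<in> X2" "\<And>i. i < ?n \<Longrightarrow> cols (A ** M) [0..<i] \<in> F' i"
    using B unfolding adapted_def by blast
  obtain \<epsilon>1 :: real where \<epsilon>1: "\<epsilon>1 = 1 \<or> \<epsilon>1 = - 1 \<and> even ?n" "\<And>i vs. i < ?n \<Longrightarrow> vs \<in> F i \<Longrightarrow> rescale (\<lambda>_. \<epsilon>1) vs \<in> F1 i"
    using lifts_differ_by_sign[OF X(1) A(1) F(1)] by blast
  obtain \<epsilon>2 :: real where \<epsilon>2: "\<epsilon>2 = 1 \<or> \<epsilon>2 = - 1 \<and> even ?n" "\<And>i vs. i < ?n \<Longrightarrow> vs \<in> F' i \<Longrightarrow> rescale (\<lambda>_. \<epsilon>2) vs \<in> F2 i"
    using lifts_differ_by_sign[OF X(2) B(1) F(2)] by blast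
  obtain \<epsilon>3 :: real where \<epsilon>3: "\<epsilon>3 = 1 \<or> \<epsilon>3 = - 1 \<and> even ?n" "\<And>i vs. i < ?n \<Longrightarrow> vs \<in> G i \<Longrightarrow> rescale (\<lambda>_. \<epsilon>3) vs \<in> F3 i"
    using lifts_differ_by_sign[OF X(3) A(2) F(3)] by blast
  have key: "0 < \<epsilon>1 ^ i * \<epsilon>2 ^ k * \<epsilon>3 ^ (?n - i - k) * tminor M [i..<i+k] [0..<k]"
    if ik: "i + k \<le> ?n" "k < ?n" "i < ?n" "0 < i + k" for i k
  proof -
    let ?j = "?n - i - k"
    let ?a = "cols A [0..<i]" and ?b = "cols (A ** M) [0..<k]" and ?c = "cols A [?n - ?j..<?n]"
    have j: "?j < ?n" "i + k + ?j = ?n" "?n - ?j = i + k" using ik by auto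
    note in3 = \<epsilon>1(2)[OF ik(3) A(4)[OF ik(3)]] \<epsilon>2(2)[OF ik(2) B(2)[OF ik(2)]] \<epsilon>3(2)[OF j(1) A(5)[OF j(1)]]
    have "0 < DET (rescale (\<lambda>_. \<epsilon>1) ?a @ rescale (\<lambda>_. \<epsilon>2) ?b @ rescale (\<lambda>_. \<epsilon>3) ?c)"
      by (rule oriented_sum_pos(2)[OF pos[OF ik(3,2) j(1,2)] in3])
    also have "\<dots> = \<epsilon>1 ^ i * \<epsilon>2 ^ k * \<epsilon>3 ^ ?j * DET (?a @ ?b @ ?c)"
      using DET_rescale3[of ?a ?b ?c \<epsilon>1 \<epsilon>2 \<epsilon>3] j by simp
    also have "DET (?a @ ?b @ ?c) = det A * tminor M [i..<i+k] [0..<k]"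
      using DET_middle[OF ik(1), of A M] j by simp
    finally have "0 < (\<epsilon>1 ^ i * \<epsilon>2 ^ k * \<epsilon>3 ^ ?j * tminor M [i..<i+k] [0..<k]) * det A"
      by (simp only: mult_ac)
    then show ?thesis using A(3) by (simp add: zero_less_mult_iff)
  qed
  have e1n: "\<epsilon>1 ^ ?n = 1" using \<epsilon>1(1) by auto
  have "\<epsilon>1 = \<epsilon>3"
  proof (cases "even ?n")
    case True
    then have "odd (?n - 1)" using n by simp
    then have "\<epsilon>3 ^ (?n - 1) = \<epsilon>3" using \<epsilon>3(1) by auto
    moreover have "0 < \<epsilon>1 * \<epsilon>3 ^ (?n - 1)" using key[of 1 0] n by simp
    ultimately show ?thesis using \<epsilon>1(1) \<epsilon>3(1) by auto
  qed (use \<epsilon>1(1) \<epsilon>3(1) in auto)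
  have "0 < (\<epsilon>1 * \<epsilon>2) ^ k * tminor M [i..<i+k] [0..<k]" if ik: "i + k \<le> ?n" "k < ?n" for i k
  proof (cases "k = 0")
    case False
    then have "i < ?n" using ik by linarith
    have "\<epsilon>1 ^ i * \<epsilon>1 ^ (?n - i - k) = \<epsilon>1 ^ (?n - k)" using ik by (simp flip: power_add)
    also have "\<dots> = \<epsilon>1 ^ k" by (rule sign_power[OF e1n]) (use ik \<epsilon>1(1) in auto)
    finally have "\<epsilon>1 ^ i * \<epsilon>2 ^ k * \<epsilon>3 ^ (?n - i - k) = (\<epsilon>1 * \<epsilon>2) ^ k"
      using \<open>\<epsilon>1 = \<epsilon>3\<close> by (simp add: power_mult_distrib mult.assoc mult.left_commute[of "\<epsilon>2 ^ k"] mult.commute)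
    then show ?thesis using key[OF ik \<open>i < ?n\<close>] False by simp
  qed simp
  then show thesis using that[of "\<epsilon>1 * \<epsilon>2"] \<epsilon>1(1) \<epsilon>2(1) by auto
qed

text \<open>
  Here the dimensions \<open>(p, k, n - p - k)\<close> give the minors in initial rows whose columns are the first
  \<open>p\<close> and the last \<open>k\<close>.
\<close>

lemma hyperconvex_row_minors:
  fixes X1 X2 X3 Y :: "('n::{finite,linorder}) oflag set"
  assumes hyp: "hyperconvex X2 Y X3" and A: "adapted A X1 X3" and B: "adapted (A ** M) X2 Y" and n: "2 \<le> CARD('n)"
  obtains \<eta> :: real where "\<eta> = 1 \<or> \<eta> = - 1 \<and> even CARD('n)"
    "\<And>p k. p + k \<le> CARD('n) \<Longrightarrow> p < CARD('n) \<Longrightarrow> k < CARD('n) \<Longrightarrow>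
      0 < \<eta> ^ (p + k) * tminor M [0..<p+k] ([0..<p] @ [CARD('n)-k..<CARD('n)])"
proof -
  let ?n = "CARD('n)"
  obtain F1 F2 F3 where F: "F1 \<in> X2" "F2 \<in> Y" "F3 \<in> X3" and X: "X2 \<in> Flag_plus" "Y \<in> Flag_plus" "X3 \<in> Flag_plus"
    and pos: "\<And>i1 i2 i3. i1 < ?n \<Longrightarrow> i2 < ?n \<Longrightarrow> i3 < ?n \<Longrightarrow> i1 + i2 + i3 = ?n \<Longrightarrow>
      oriented_sum (oriented_sum (F1 i1) (F2 i2)) (F3 i3) = standard_orientation"
    using hyp unfolding hyperconvex_def by blast
  obtain G where A: "G \<in> X3" "0 < det A" "\<And>i. i < ?n \<Longrightarrow> cols A [?n - i..<?n] \<in> G i"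
    using A unfolding adapted_def by blast
  obtain F' G' where B: "F' \<in> X2" "G' \<in> Y" "0 < det (A ** M)" "\<And>i. i < ?n \<Longrightarrow> cols (A ** M) [0..<i] \<in> F' i"
    "\<And>i. i < ?n \<Longrightarrow> cols (A ** M) [?n - i..<?n] \<in> G' i"
    using B unfolding adapted_def by blast
  obtain \<epsilon>1 :: real where \<epsilon>1: "\<epsilon>1 = 1 \<or> \<epsilon>1 = - 1 \<and> even ?n" "\<And>i vs. i < ?n \<Longrightarrow> vs \<in> F' i \<Longrightarrow> rescale (\<lambda>_. \<epsilon>1) vs \<in> F1 i"
    using lifts_differ_by_sign[OF X(1) B(1) F(1)] by blast
  obtain \<epsilon>2 :: real where \<epsilon>2: "\<epsilon>2 = 1 \<or> \<epsilon>2 = - 1 \<and> even ?n" "\<And>i vs. i < ?n \<Longrightarrow> vs \<in> G' i \<Longrightarrow> rescale (\<lambda>_. \<epsilon>2) vs \<in> F2 i"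
    using lifts_differ_by_sign[OF X(2) B(2) F(2)] by blast
  obtain \<epsilon>3 :: real where \<epsilon>3: "\<epsilon>3 = 1 \<or> \<epsilon>3 = - 1 \<and> even ?n" "\<And>i vs. i < ?n \<Longrightarrow> vs \<in> G i \<Longrightarrow> rescale (\<lambda>_. \<epsilon>3) vs \<in> F3 i"
    using lifts_differ_by_sign[OF X(3) A(1) F(3)] by blast
  have detM: "0 < det M" using A(2) B(3) by (simp add: det_mul zero_less_mult_iff)
  have key: "0 < \<epsilon>1 ^ p * \<epsilon>2 ^ k * \<epsilon>3 ^ (?n - p - k) * tminor M [0..<p+k] ([0..<p] @ [?n-k..<?n])"
    if pk: "p + k \<le> ?n" "p < ?n" "k < ?n" "0 < p + k" for p k
  proof -
    let ?j = "?n - p - k"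
    let ?a = "cols (A ** M) [0..<p]" and ?b = "cols (A ** M) [?n-k..<?n]" and ?c = "cols A [?n - ?j..<?n]"
    have j: "?j < ?n" "p + k + ?j = ?n" "?n - ?j = p + k" using pk by auto
    note in3 = \<epsilon>1(2)[OF pk(2) B(4)[OF pk(2)]] \<epsilon>2(2)[OF pk(3) B(5)[OF pk(3)]] \<epsilon>3(2)[OF j(1) A(3)[OF j(1)]]
    have "0 < DET (rescale (\<lambda>_. \<epsilon>1) ?a @ rescale (\<lambda>_. \<epsilon>2) ?b @ rescale (\<lambda>_. \<epsilon>3) ?c)"
      by (rule oriented_sum_pos(2)[OF pos[OF pk(2,3) j(1,2)] in3])
    also have "\<dots> = \<epsilon>1 ^ p * \<epsilon>2 ^ k * \<epsilon>3 ^ ?j * DET (?a @ ?b @ ?c)"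
      using DET_rescale3[of ?a ?b ?c \<epsilon>1 \<epsilon>2 \<epsilon>3] j pk by simp
    also have "DET (?a @ ?b @ ?c) = det A * tminor M [0..<p+k] ([0..<p] @ [?n-k..<?n])"
      using DET_outer[OF pk(1), of A M] j by simp
    finally have "0 < (\<epsilon>1 ^ p * \<epsilon>2 ^ k * \<epsilon>3 ^ ?j * tminor M [0..<p+k] ([0..<p] @ [?n-k..<?n])) * det A"
      by (simp only: mult_ac)
    then show ?thesis using A(2) by (simp add: zero_less_mult_iff)
  qed
  have e1n: "\<epsilon>3 ^ ?n = 1" using \<epsilon>3(1) by auto
  have "\<epsilon>1 = \<epsilon>2"
  proof (cases "even ?n")
    case True
    then have "odd (?n - 1)" using n by simp
    then have e: "\<epsilon>2 ^ (?n - 1) = \<epsilon>2" using \<epsilon>2(1) by auto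
    have l: "[0..<1 + (?n - 1)] = [0..<?n]" "[0..<1] @ [?n - (?n - 1)..<?n] = [0..<?n]"
      using n upt_add_eq_append[of 0 1 "?n - 1"] by simp_all
    have "0 < \<epsilon>1 * \<epsilon>2 ^ (?n - 1) * lead M ?n"
      using key[of 1 "?n - 1"] n unfolding l by simp
    then have "0 < \<epsilon>1 * \<epsilon>2" using detM e by (auto simp: det_eq_lead zero_less_mult_iff)
    then show ?thesis using \<epsilon>1(1) \<epsilon>2(1) by auto
  qed (use \<epsilon>1(1) \<epsilon>2(1) in auto)
  have "0 < (\<epsilon>1 * \<epsilon>3) ^ (p + k) * tminor M [0..<p+k] ([0..<p] @ [?n-k..<?n])"
    if pk: "p + k \<le> ?n" "p < ?n" "k < ?n" for p k
  proof (cases "p + k = 0")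
    case False
    have "\<epsilon>3 ^ (?n - p - k) = \<epsilon>3 ^ (p + k)"
      using sign_power[OF e1n pk(1)] \<epsilon>3(1) by auto
    then have "\<epsilon>1 ^ p * \<epsilon>2 ^ k * \<epsilon>3 ^ (?n - p - k) = (\<epsilon>1 * \<epsilon>3) ^ (p + k)"
      using \<open>\<epsilon>1 = \<epsilon>2\<close> by (simp add: power_mult_distrib power_add)
    then show ?thesis using key[OF pk] False by simp
  qed simp
  then show thesis using that[of "\<epsilon>1 * \<epsilon>3"] \<epsilon>1(1) \<epsilon>3(1) by auto
qed

text \<open>
  The two families of minors are those in the criterion for total positivity.  The two signs agree
  because both are the sign of the entry in the upper left corner.
\<close>

theorem hyperconvex_STP:
  fixes X1 X2 X3 Y :: "('n::{finite,linorder}) oflag set"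
  assumes "hyperconvex X1 X2 X3" "hyperconvex X2 Y X3"
    and A: "adapted A X1 X3" and B: "adapted (A ** M) X2 Y" and n: "2 \<le> CARD('n)"
  shows "\<exists>\<eta> :: real. (\<eta> = 1 \<or> \<eta> = - 1) \<and> STP (\<eta> *\<^sub>R M)"
proof -
  let ?n = "CARD('n)"
  obtain \<eta> :: real where \<eta>: "\<eta> = 1 \<or> \<eta> = - 1 \<and> even ?n"
    and col: "\<And>i k. i + k \<le> ?n \<Longrightarrow> k < ?n \<Longrightarrow> 0 < \<eta> ^ k * tminor M [i..<i+k] [0..<k]"
    using hyperconvex_minors[OF assms(1) A B n] by metis
  obtain \<eta>' :: real where \<eta>': "\<eta>' = 1 \<or> \<eta>' = - 1 \<and> even ?n"
    and row: "\<And>p k. p + k \<le> ?n \<Longrightarrow> p < ?n \<Longrightarrow> k < ?n \<Longrightarrow> 0 < \<eta>' ^ (p + k) * tminor M [0..<p+k] ([0..<p] @ [?n-k..<?n])"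
    using hyperconvex_row_minors[OF assms(2) A B n] by metis
  have "0 < \<eta> * tminor M [0] [0]" using col[of 0 1] n by simp
  moreover have "0 < \<eta>' * tminor M [0] [0]" using row[of 1 0] n by simp
  ultimately have same: "\<eta>' = \<eta>" using \<eta> \<eta>' by (auto simp: zero_less_mult_iff)
  have "0 < det A" "0 < det (A ** M)" using A B by (auto simp: adapted_def)
  then have "0 < det M" by (simp add: det_mul zero_less_mult_iff)
  moreover have "\<eta> ^ ?n = 1" using \<eta> by auto
  ultimately have full: "0 < \<eta> ^ ?n * lead M ?n" by (simp add: det_eq_lead)
  have "STP (\<eta> *\<^sub>R M)"
  proof (rule STP_criterion)
    fix i k assume ik: "i + k \<le> ?n"
    show "0 < tminor (\<eta> *\<^sub>R M) [i..<i+k] [0..<k]"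
    proof (cases "k < ?n")
      case True
      then show ?thesis using col[OF ik] by (simp add: tminor_scaleR)
    next
      case False
      then have "k = ?n" "i = 0" using ik by auto
      then show ?thesis using full by (simp add: tminor_scaleR)
    qed
  next
    fix p k assume pk: "p + k \<le> ?n"
    consider "p < ?n" "k < ?n" | "p = ?n" "k = 0" | "p = 0" "k = ?n" using pk by linarith
    then show "0 < tminor (\<eta> *\<^sub>R M) [0..<p+k] ([0..<p] @ [?n-k..<?n])"
    proof cases
      case 1
      then show ?thesis using row[OF pk] same by (simp add: tminor_scaleR)
    qed (use full in \<open>simp_all add: tminor_scaleR\<close>)
  qed
  then show ?thesis using \<eta> by blast
qed

section \<open>The cyclic order of the projective line\<close>

lemma leibniz_det_1: "leibniz_det (Suc 0) M = M 0 0"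
  using leibniz_det_last_row[of 0 M] by (simp add: leibniz_det_def)

lemma leibniz_det_2: "leibniz_det 2 M = M 0 0 * M 1 1 - M 0 1 * M 1 0"
  using leibniz_det_last_row[of 1 M] by (simp add: numeral_2_eq_2 leibniz_det_1)

definition area :: "real^2 \<Rightarrow> real^2 \<Rightarrow> real" where
  "area u v = u $ en 0 * v $ en 1 - u $ en 1 * v $ en 0"

lemma pair_standard_iff: "[u, v] \<in> standard_orientation \<longleftrightarrow> 0 < area u v"
  unfolding standard_orientation_iff by (simp add: DET_def leibniz_det_2 area_def)

lemma area_simps:
  "area (u + u') v = area u v + area u' v" "area u (v + v') = area u v + area u v'"
  "area (c *\<^sub>R u) v = c * area u v" "area u (c *\<^sub>R v) = c * area u v"
  "area u u = 0" "area (- u) v = - area u v" "area u (- v) = - area u v" "area v u = - area u v"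
  by (simp_all add: area_def algebra_simps)

lemma area_nonzero_basis:
  assumes "area u w \<noteq> 0"
  shows "v = (area v w / area u w) *\<^sub>R u + (area u v / area u w) *\<^sub>R w"
proof -
  have "v $ en i = ((area v w / area u w) *\<^sub>R u + (area u v / area u w) *\<^sub>R w) $ en i"
    if "i < CARD(2)" for i
  proof -
    have "i = 0 \<or> i = 1" using that by auto
    then show ?thesis using assms by (auto simp: field_simps) (simp_all add: area_def algebra_simps)
  qed
  then show ?thesis unfolding Finite_Cartesian_Product.vec_eq_iff all_en by blast
qed

lemma area_eq_0:
  assumes "area u w = 0" "u \<noteq> 0"
  shows "w \<in> span {u}"
proof -
  have "\<not> (u $ en 0 = 0 \<and> u $ en 1 = 0)"
  proof
    assume z: "u $ en 0 = 0 \<and> u $ en 1 = 0"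
    have "\<forall>k<CARD(2). u $ en k = 0 $ en k"
    proof (intro allI impI)
      fix k :: nat assume "k < CARD(2)"
      then have "k = 0 \<or> k = 1" by auto
      then show "u $ en k = 0 $ en k" using z by auto
    qed
    then have "u = 0" unfolding Finite_Cartesian_Product.vec_eq_iff all_en[where 'n = 2] .
    with assms(2) show False by simp
  qed
  then obtain x where x: "area u x \<noteq> 0"
    using that[of "\<chi> k. if k = en 0 then - u $ en 1 else u $ en 0"]
  proof -
    have ne: "en 1 \<noteq> (en 0 :: 2)"
    proof
      assume "en 1 = (en 0 :: 2)"
      then have "ix (en 1 :: 2) = ix (en 0 :: 2)" by simp
      then show False by simp
    qed
    assume "\<not> (u $ en 0 = 0 \<and> u $ en 1 = 0)"
    then have "0 < u $ en 0 * u $ en 0 + u $ en 1 * u $ en 1"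
      by (simp add: sum_squares_gt_zero_iff)
    then have "area u (\<chi> k. if k = en 0 then - u $ en 1 else u $ en 0) \<noteq> 0"
      using ne by (auto simp: area_def)
    moreover assume "\<And>x. area u x \<noteq> 0 \<Longrightarrow> thesis"
    ultimately show thesis by blast
  qed
  have "w = (area w x / area u x) *\<^sub>R u" using area_nonzero_basis[OF x, of w] assms(1) by simp
  then show ?thesis by (metis span_base span_scale singletonI)
qed

lemma RP1_span:
  assumes "L \<in> RP1"
  obtains u where "u \<noteq> 0" "L = span {u}"
proof -
  have L: "subspace L" "dim L = 1" using assms by (auto simp: RP1_def)
  obtain B where B: "B \<subseteq> L" "independent B" "L \<subseteq> span B" "card B = 1"
    using basis_exists[of L] L(2) by metis
  then obtain u where u: "B = {u}" by (metis card_1_singletonE)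
  have "u \<noteq> 0" using B(2) u by (auto simp: dependent_zero)
  moreover have "L = span {u}" using B u L(1) by (metis span_minimal subset_antisym)
  ultimately show thesis by (rule that)
qed

lemma span_in_RP1: "u \<noteq> 0 \<Longrightarrow> span {u} \<in> RP1"
  by (simp add: RP1_def dim_eq_card_independent subspace_span)

lemma cyclically_ordered_rotate: "cyclically_ordered x y z \<Longrightarrow> cyclically_ordered y z x"
proof -
  assume "cyclically_ordered x y z"
  then obtain u v w where R: "x \<in> RP1" "y \<in> RP1" "z \<in> RP1" and uvw: "u \<in> x" "v \<in> y" "w \<in> z"
    and p: "0 < area u v" "0 < area v w" "0 < area u w"
    unfolding cyclically_ordered_def pair_standard_iff by blast
  have "- u \<in> x" using R(1) uvw(1) by (auto simp: RP1_def subspace_neg)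
  moreover have "0 < area w (- u)" "0 < area v (- u)"
    using p area_simps(8)[of u w] area_simps(8)[of u v] by (simp_all add: area_simps(7))
  ultimately show ?thesis
    unfolding cyclically_ordered_def pair_standard_iff using R uvw(2,3) p(2) by blast
qed

lemma cyclically_ordered_total:
  assumes R: "a \<in> RP1" "x \<in> RP1" "b \<in> RP1" and ne: "x \<noteq> a" "x \<noteq> b" "a \<noteq> b"
  shows "cyclically_ordered a x b \<or> cyclically_ordered b x a"
proof -
  obtain u where u: "u \<noteq> 0" "a = span {u}" by (rule RP1_span[OF R(1)])
  obtain v where v: "v \<noteq> 0" "x = span {v}" by (rule RP1_span[OF R(2)])
  obtain w where w: "w \<noteq> 0" "b = span {w}" by (rule RP1_span[OF R(3)])
  have ne0: "area p q \<noteq> 0" if "p \<noteq> 0" "q \<noteq> 0" "span {p} \<noteq> span {q}" for p q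
  proof
    assume 0: "area p q = 0"
    then have "q \<in> span {p}" using area_eq_0 that(1) by blast
    moreover have "p \<in> span {q}" using area_eq_0[of q p] 0 that(2) area_simps(8)[of p q] by simp
    ultimately have "span {p} = span {q}" by (intro subset_antisym span_minimal) (auto simp: subspace_span)
    with that(3) show False by simp
  qed
  have mem: "s *\<^sub>R p \<in> span {p}" for s and p :: "real^2" by (simp add: span_base span_scale)
  define s where "s = sgn (area u w)"
  define t where "t = sgn (area u v)"
  have "area u w \<noteq> 0" "area u v \<noteq> 0" "area v w \<noteq> 0" using ne0 u v w ne by auto
  define w' where "w' = s *\<^sub>R w"
  define v' where "v' = t *\<^sub>R v"
  have uw: "0 < area u w'" and uv: "0 < area u v'" and vw: "area v' w' \<noteq> 0"
    using \<open>area u w \<noteq> 0\<close> \<open>area u v \<noteq> 0\<close> \<open>area v w \<noteq> 0\<close>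
    by (auto simp: w'_def v'_def area_simps(3,4) s_def t_def sgn_if)
  have in': "u \<in> a" "v' \<in> x" "w' \<in> b" "- u \<in> a"
    using mem[of 1 u] mem[of "- 1" u] mem u v w by (auto simp: w'_def v'_def)
  show ?thesis
  proof (cases "0 < area v' w'")
    case True
    then show ?thesis unfolding cyclically_ordered_def pair_standard_iff using R in' uw uv by blast
  next
    case False
    then have "0 < area w' v'" using vw area_simps(8)[of v' w'] by simp
    moreover have "0 < area v' (- u)" "0 < area w' (- u)"
      using uv uw area_simps(8)[of u v'] area_simps(8)[of u w'] by (simp_all add: area_simps(7))
    ultimately show ?thesis unfolding cyclically_ordered_def pair_standard_iff using R in' by blast
  qed
qed

lemma topspace_RP1 [simp]: "topspace RP1_topology = RP1"
proof -
  have "openin RP1_topology RP1"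
    unfolding openin_RP1_topology
  proof
    have "{v :: real^2. v \<noteq> 0 \<and> span {v} \<in> RP1} = - {0}" using span_in_RP1 by auto
    then show "open {v :: real^2. v \<noteq> 0 \<and> span {v} \<in> RP1}" by (simp add: open_Compl)
  qed simp
  moreover have "U \<subseteq> RP1" if "openin RP1_topology U" for U using that by (simp add: openin_RP1_topology)
  ultimately show ?thesis by (metis openin_subset openin_topspace subset_antisym)
qed

lemma endpoints_in_closure:
  assumes R: "a \<in> RP1" "b \<in> RP1" "a \<noteq> b"
  shows "a \<in> RP1_topology closure_of arc a b" "b \<in> RP1_topology closure_of arc a b"
proof -
  obtain u where u: "u \<noteq> 0" "a = span {u}" by (rule RP1_span[OF R(1)])
  obtain w0 where w0: "w0 \<noteq> 0" "b = span {w0}" by (rule RP1_span[OF R(2)])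
  have "area u w0 \<noteq> 0"
  proof
    assume 0: "area u w0 = 0"
    then have "w0 \<in> span {u}" using area_eq_0 u(1) by blast
    moreover have "u \<in> span {w0}" using area_eq_0[of w0 u] 0 w0(1) area_simps(8)[of u w0] by simp
    ultimately have "span {u} = span {w0}" by (intro subset_antisym span_minimal) (auto simp: subspace_span)
    with R(3) u w0 show False by simp
  qed
  define w where "w = sgn (area u w0) *\<^sub>R w0"
  have uw: "0 < area u w" using \<open>area u w0 \<noteq> 0\<close> by (auto simp: w_def area_simps(3,4) sgn_if)
  have wb: "w \<in> b" by (simp add: w_def w0 span_base span_scale)
  have "w \<noteq> 0" using uw by (auto simp: area_def)
  have wspan: "span {w} = b"
  proof -
    have "w0 = (1 / sgn (area u w0)) *\<^sub>R w" using \<open>area u w0 \<noteq> 0\<close> by (simp add: w_def sgn_zero_iff)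
    then have "w0 \<in> span {w}" by (metis span_base span_scale singletonI)
    then show ?thesis using wb unfolding w0(2) by (intro subset_antisym span_minimal) (auto simp: subspace_span)
  qed
  have inarc: "span {s *\<^sub>R u + t *\<^sub>R w} \<in> arc a b" "s *\<^sub>R u + t *\<^sub>R w \<noteq> 0" if "0 < s" "0 < t" for s t
  proof -
    let ?v = "s *\<^sub>R u + t *\<^sub>R w"
    have p: "0 < area u ?v" "0 < area ?v w" using that uw by (simp_all add: area_simps(1-5))
    have "area u 0 = 0" by (simp add: area_def)
    with p(1) show nz: "?v \<noteq> 0" by (metis less_irrefl)
    have "u \<in> a" "?v \<in> span {?v}" by (simp_all add: u span_base)
    then show "span {?v} \<in> arc a b"
      unfolding arc_def cyclically_ordered_def pair_standard_iff using R wb p uw span_in_RP1[OF nz] by blast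
  qed
  have near: "\<exists>y\<in>arc a b. y \<in> T"
    if T: "openin RP1_topology T" "span {p} \<in> T" "p \<noteq> 0" and pq: "\<And>t. 0 < t \<Longrightarrow> span {p + t *\<^sub>R q} \<in> arc a b" for T p q
  proof -
    have "open {v. v \<noteq> 0 \<and> span {v} \<in> T}" using T(1) by (simp add: openin_RP1_topology)
    moreover have "((\<lambda>t. p + t *\<^sub>R q) \<longlongrightarrow> p + 0 *\<^sub>R q) (at_right 0)" by (intro tendsto_intros)
    ultimately have "\<forall>\<^sub>F t in at_right 0. p + t *\<^sub>R q \<in> {v. v \<noteq> 0 \<and> span {v} \<in> T}"
      using T(2,3) by (intro topological_tendstoD) auto
    moreover have "\<forall>\<^sub>F t :: real in at_right 0. 0 < t" by (simp add: eventually_at_right_less)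
    ultimately have "\<forall>\<^sub>F t in at_right 0. 0 < t \<and> span {p + t *\<^sub>R q} \<in> T" by eventually_elim auto
    then obtain t :: real where "0 < t" "span {p + t *\<^sub>R q} \<in> T"
      using eventually_happens'[OF trivial_limit_at_right_real] by blast
    then show ?thesis using pq by blast
  qed
  show "a \<in> RP1_topology closure_of arc a b"
    unfolding in_closure_of topspace_RP1
    using R(1) near[of _ u w] u inarc(1)[of 1] by auto
  show "b \<in> RP1_topology closure_of arc a b"
    unfolding in_closure_of topspace_RP1
  proof (intro conjI R(2) allI impI)
    fix T assume T: "b \<in> T \<and> openin RP1_topology T"
    have "\<exists>y\<in>arc a b. y \<in> T"
      by (rule near[of T w u]) (use T wspan \<open>w \<noteq> 0\<close> inarc(1)[of _ 1] in \<open>auto simp: add.commute\<close>)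
    then show "\<exists>y. y \<in> arc a b \<and> y \<in> T" by blast
  qed
qed

text \<open>
  Otherwise, as any three distinct points are cyclically ordered in one of two ways, an endpoint of one
  interval would lie in the other interval.
\<close>

lemma disjoint_arcs_cyclically_ordered:
  assumes R: "a \<in> RP1" "b \<in> RP1" "a \<noteq> b" "c \<in> RP1" "d \<in> RP1" "c \<noteq> d"
    and disj: "disjnt (RP1_topology closure_of arc a b) (RP1_topology closure_of arc c d)"
  shows "cyclically_ordered b c a" "cyclically_ordered c d a"
proof -
  let ?ab = "RP1_topology closure_of arc a b" and ?cd = "RP1_topology closure_of arc c d"
  have mem: "a \<in> ?ab" "b \<in> ?ab" "c \<in> ?cd" "d \<in> ?cd" using endpoints_in_closure R by auto
  then have ne: "c \<noteq> a" "c \<noteq> b" "a \<noteq> d" using disj by (auto simp: disjnt_iff)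
  have sub: "arc p q \<subseteq> RP1_topology closure_of arc p q" for p q
    by (rule closure_of_subset) (auto simp: arc_def cyclically_ordered_def)
  have "\<not> cyclically_ordered a c b" using sub[of a b] mem disj by (auto simp: arc_def disjnt_iff)
  then show "cyclically_ordered b c a" using cyclically_ordered_total[OF R(1,4,2)] ne R(3) by auto
  have "\<not> cyclically_ordered c a d" using sub[of c d] mem disj by (auto simp: arc_def disjnt_iff)
  then have "cyclically_ordered d a c" using cyclically_ordered_total[OF R(4,1,5)] ne R(6) by auto
  then show "cyclically_ordered c d a" using cyclically_ordered_rotate by blast
qed

section \<open>Reduced words in a free group\<close>

definition inv_letter :: "'i \<times> bool \<Rightarrow> 'i \<times> bool" where
  "inv_letter s = (fst s, \<not> snd s)"

lemma inv_letter_simps [simp]: "inv_letter (inv_letter s) = s" "inv_letter s \<noteq> s" "s \<noteq> inv_letter s"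
  "inv_letter s = inv_letter t \<longleftrightarrow> s = t" "fst (inv_letter s) = fst s"
  by (auto simp: inv_letter_def prod_eq_iff)

lemma reduced_iff: "reduced w \<longleftrightarrow> (\<forall>k. Suc k < length w \<longrightarrow> w ! Suc k \<noteq> inv_letter (w ! k))"
  unfolding reduced_def inv_letter_def by (auto simp: prod_eq_iff)

lemma reduced_Cons: "reduced (s # w) \<longleftrightarrow> reduced w \<and> (w = [] \<or> hd w \<noteq> inv_letter s)"
  unfolding reduced_iff by (cases w) (auto simp: nth_Cons' less_Suc_eq_0_disj)

lemma reduced_Nil [simp]: "reduced []"
  by (simp add: reduced_def)

lemma reduced_append:
  "reduced (v @ w) \<longleftrightarrow> reduced v \<and> reduced w \<and> (v = [] \<or> w = [] \<or> hd w \<noteq> inv_letter (last v))"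
proof (induction v)
  case (Cons s v)
  then show ?case by (cases v) (auto simp: reduced_Cons)
qed simp

definition inv_word :: "('i \<times> bool) list \<Rightarrow> ('i \<times> bool) list" where
  "inv_word w = rev (map inv_letter w)"

lemma fst_set_inv_word [simp]: "fst ` set (inv_word w) = fst ` set w"
  by (simp add: inv_word_def image_image)

lemma inv_word_simps [simp]: "inv_word [] = []" "inv_word (s # w) = inv_word w @ [inv_letter s]"
  "length (inv_word w) = length w" "inv_word w = [] \<longleftrightarrow> w = []"
  by (simp_all add: inv_word_def)

lemma last_inv_word: "w \<noteq> [] \<Longrightarrow> last (inv_word w) = inv_letter (hd w)"
  by (cases w) auto

lemma reduced_inv_word [simp]: "reduced (inv_word w) \<longleftrightarrow> reduced w"
proof (induction w)
  case (Cons s w)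
  then show ?case
    using last_inv_word[of w] by (cases "w = []") (auto simp: reduced_append reduced_Cons)
qed simp

locale free_group =
  fixes F :: "('f, 'e) monoid_scheme" (structure) and I :: "'i set" and x :: "'i \<Rightarrow> 'f"
  assumes free: "free_basis F I x"
begin

sublocale group F
  using free by (simp add: free_basis_def)

lemma generator_closed: "i \<in> I \<Longrightarrow> x i \<in> carrier F"
  using free by (auto simp: free_basis_def)

definition val :: "('i \<times> bool) list \<Rightarrow> 'f" where
  "val w = word_value F x w"

definition lval :: "'i \<times> bool \<Rightarrow> 'f" where
  "lval s = (if snd s then x (fst s) else inv (x (fst s)))"

definition rwords :: "('i \<times> bool) list set" where
  "rwords = {w. reduced w \<and> fst ` set w \<subseteq> I}"

lemma val_Nil [simp]: "val [] = \<one>"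
  by (simp add: val_def word_value_def)

lemma val_Cons: "val (s # w) = lval s \<otimes> val w"
  by (simp add: val_def word_value_def lval_def split_beta)

lemma lval_closed: "fst s \<in> I \<Longrightarrow> lval s \<in> carrier F"
  using generator_closed by (simp add: lval_def)

lemma val_closed [simp]: "fst ` set w \<subseteq> I \<Longrightarrow> val w \<in> carrier F"
  by (induction w) (auto simp: val_Cons lval_closed)

lemma val_append: "fst ` set v \<subseteq> I \<Longrightarrow> fst ` set w \<subseteq> I \<Longrightarrow> val (v @ w) = val v \<otimes> val w"
  by (induction v) (auto simp: val_Cons lval_closed m_assoc)

lemma lval_inv: "fst s \<in> I \<Longrightarrow> lval (inv_letter s) = inv (lval s)"
  using generator_closed by (simp add: lval_def inv_letter_def)

lemma val_inv_word: "fst ` set w \<subseteq> I \<Longrightarrow> val (inv_word w) = inv (val w)"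
proof (induction w)
  case (Cons s w)
  then have "val (inv_word w @ [inv_letter s]) = val (inv_word w) \<otimes> val [inv_letter s]"
    by (intro val_append) auto
  with Cons show ?case
    by (simp add: val_Cons lval_inv lval_closed inv_mult_group)
qed simp

lemma rwords_inv: "w \<in> rwords \<Longrightarrow> inv_word w \<in> rwords"
  by (simp add: rwords_def)

text \<open>
  Cancelling the longest common prefix of two words leaves a reduced word representing
  the quotient.
\<close>

lemma val_quotient:
  assumes "v \<in> rwords" "w \<in> rwords"
  obtains p v' w' where "v = p @ v'" "w = p @ w'" "inv_word v' @ w' \<in> rwords"
    "v' = [] \<or> w' = [] \<or> hd v' \<noteq> hd w'"
    "val (inv_word v' @ w') = inv (val v) \<otimes> val w"
proof -
  have "\<exists>p v' w'. v = p @ v' \<and> w = p @ w' \<and> (v' = [] \<or> w' = [] \<or> hd v' \<noteq> hd w')"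
  proof (induction v arbitrary: w)
    case (Cons s v)
    show ?case
    proof (cases "w \<noteq> [] \<and> hd w = s")
      case True
      then obtain u where u: "w = s # u" by (cases w) auto
      obtain p v' w' where "v = p @ v'" "u = p @ w'" "v' = [] \<or> w' = [] \<or> hd v' \<noteq> hd w'" using Cons by blast
      then show ?thesis unfolding u by (intro exI[of _ "s # p"] exI[of _ v'] exI[of _ w']) simp
    next
      case False
      then show ?thesis by (intro exI[of _ "[]"] exI[of _ "s # v"] exI[of _ w]) auto
    qed
  qed simp
  then obtain p v' w' where e: "v = p @ v'" "w = p @ w'" and ne: "v' = [] \<or> w' = [] \<or> hd v' \<noteq> hd w'" by blast
  have sub: "fst ` set p \<subseteq> I" "fst ` set v' \<subseteq> I" "fst ` set w' \<subseteq> I"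
    using assms unfolding e rwords_def by auto
  have "inv_word v' @ w' \<in> rwords"
  proof -
    have "reduced (inv_word v')" "reduced w'" using assms unfolding e rwords_def by (auto simp: reduced_append)
    then have "reduced (inv_word v' @ w')" using ne last_inv_word[of v'] by (auto simp: reduced_append)
    moreover have "fst ` set (inv_word v' @ w') \<subseteq> I" using sub by (simp add: image_Un)
    ultimately show ?thesis by (simp add: rwords_def)
  qed
  moreover have "val (inv_word v' @ w') = inv (val v) \<otimes> val w"
  proof -
    have "inv (val v) \<otimes> val w = inv (val v') \<otimes> inv (val p) \<otimes> (val p \<otimes> val w')"
      using sub by (simp add: e val_append inv_mult_group)
    also have "\<dots> = inv (val v') \<otimes> val w'"
      using sub by (simp add: m_assoc) (simp add: m_assoc[symmetric])
    also have "\<dots> = val (inv_word v' @ w')"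
      using sub by (simp add: val_append val_inv_word)
    finally show ?thesis by simp
  qed
  ultimately show thesis using that e ne by blast
qed

lemma val_inj:
  assumes "v \<in> rwords" "w \<in> rwords" "val v = val w"
  shows "v = w"
proof -
  obtain p v' w' where e: "v = p @ v'" "w = p @ w'" "inv_word v' @ w' \<in> rwords"
    "val (inv_word v' @ w') = inv (val v) \<otimes> val w"
    using val_quotient[OF assms(1,2)] by metis
  have "val v \<in> carrier F" using assms(1) by (auto simp: rwords_def)
  then have "val (inv_word v' @ w') = \<one>" using e(4) assms(3) by simp
  then have "inv_word v' @ w' = []"
    using e(3) free unfolding free_basis_def rwords_def val_def by blast
  then show ?thesis using e by simp
qed

lemma val_mult_letter:
  assumes "w \<in> rwords" "fst s \<in> I"
  shows "\<exists>u\<in>rwords. val u = lval s \<otimes> val w \<and> length u \<le> Suc (length w)"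
proof (cases "w \<noteq> [] \<and> hd w = inv_letter s")
  case True
  then obtain u where u: "w = inv_letter s # u" by (cases w) auto
  have "u \<in> rwords" using assms u by (auto simp: rwords_def reduced_Cons)
  moreover have "val u = lval s \<otimes> val w"
    using assms u \<open>u \<in> rwords\<close> by (auto simp: val_Cons lval_inv lval_closed rwords_def m_assoc[symmetric])
  ultimately show ?thesis using u by auto
next
  case False
  then have "s # w \<in> rwords" using assms by (auto simp: rwords_def reduced_Cons)
  then show ?thesis by (intro bexI[of _ "s # w"]) (auto simp: val_Cons)
qed

lemma reduce_word: "fst ` set w \<subseteq> I \<Longrightarrow> \<exists>u\<in>rwords. val u = val w \<and> length u \<le> length w"
proof (induction w)
  case (Cons s w)
  then obtain u where u: "u \<in> rwords" "val u = val w" "length u \<le> length w" by auto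
  obtain u' where "u' \<in> rwords" "val u' = lval s \<otimes> val u" "length u' \<le> Suc (length u)"
    using val_mult_letter[OF u(1), of s] Cons.prems by auto
  with u show ?case by (intro bexI[of _ u']) (auto simp: val_Cons)
qed (auto simp: rwords_def)

lemma val_surj: "y \<in> carrier F \<Longrightarrow> \<exists>w\<in>rwords. val w = y"
proof -
  assume "y \<in> carrier F"
  then have "y \<in> generate F (x ` I)" using free by (simp add: free_basis_def)
  then have "\<exists>w. fst ` set w \<subseteq> I \<and> val w = y"
  proof (induction rule: generate.induct)
    case one
    then show ?case by (intro exI[of _ "[]"]) simp
  next
    case (incl h)
    then obtain i where "i \<in> I" "h = x i" by auto
    then show ?case using generator_closed by (intro exI[of _ "[(i, True)]"]) (simp add: val_Cons lval_def)
  next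
    case (inv h)
    then obtain i where "i \<in> I" "h = x i" by auto
    then show ?case using generator_closed by (intro exI[of _ "[(i, False)]"]) (simp add: val_Cons lval_def)
  next
    case (eng h1 h2)
    then obtain v w where "fst ` set v \<subseteq> I" "val v = h1" "fst ` set w \<subseteq> I" "val w = h2" by blast
    then show ?case by (intro exI[of _ "v @ w"]) (auto simp: val_append)
  qed
  then show ?thesis using reduce_word by metis
qed

definition nf :: "'f \<Rightarrow> ('i \<times> bool) list" where
  "nf y = (THE w. w \<in> rwords \<and> val w = y)"

lemma nf: "y \<in> carrier F \<Longrightarrow> nf y \<in> rwords \<and> val (nf y) = y"
  unfolding nf_def by (rule theI') (use val_surj val_inj in metis)

lemma nf_val: "w \<in> rwords \<Longrightarrow> nf (val w) = w"
  using nf[of "val w"] val_inj[of "nf (val w)" w] by (auto simp: rwords_def)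

lemma x_inj: "inj_on x I"
proof (rule inj_onI)
  fix i j assume "i \<in> I" "j \<in> I" "x i = x j"
  then have "val [(i, True)] = val [(j, True)]" by (simp add: val_Cons lval_def)
  moreover have "[(i, True)] \<in> rwords" "[(j, True)] \<in> rwords"
    using \<open>i \<in> I\<close> \<open>j \<in> I\<close> by (auto simp: rwords_def reduced_Cons)
  ultimately show "i = j" using val_inj by blast
qed

lemma word_length_eq:
  assumes "y \<in> carrier F"
  shows "word_length F (x ` I) y = length (nf y)"
  unfolding word_length_def
proof (rule Least_equality)
  let ?w = "map (\<lambda>(i, e). (x i, e)) (nf y)"
  have conv: "word_value F (\<lambda>s. s) (map (\<lambda>(i, e). (x i, e)) w) = val w" for w
    by (induction w) (auto simp: val_def word_value_def split_beta)
  have "fst ` set ?w \<subseteq> x ` I" using nf[OF assms] by (auto simp: rwords_def)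
  then show "\<exists>w. length w = length (nf y) \<and> fst ` set w \<subseteq> x ` I \<and> word_value F (\<lambda>s. s) w = y"
    using conv[of "nf y"] nf[OF assms] by (intro exI[of _ ?w]) auto
  fix k assume "\<exists>w. length w = k \<and> fst ` set w \<subseteq> x ` I \<and> word_value F (\<lambda>s. s) w = y"
  then obtain w where w: "length w = k" "fst ` set w \<subseteq> x ` I" "word_value F (\<lambda>s. s) w = y" by blast
  define v where "v = map (\<lambda>(s, e). (the_inv_into I x s, e)) w"
  have inI: "fst ` set v \<subseteq> I"
  proof
    fix i assume "i \<in> fst ` set v"
    then obtain s e where "(s, e) \<in> set w" "i = the_inv_into I x s" by (auto simp: v_def)
    then have "s \<in> x ` I" using w(2) by force
    then show "i \<in> I" using the_inv_into_into[OF x_inj _ subset_refl] \<open>i = _\<close> by simp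
  qed
  have "map (\<lambda>(i, e). (x i, e)) v = w"
    unfolding v_def map_map
  proof (rule map_idI)
    fix s assume s: "s \<in> set w"
    then have "fst s \<in> x ` I" using w(2) by force
    from f_the_inv_into_f[OF x_inj this]
    show "((\<lambda>(i, e). (x i, e)) \<circ> (\<lambda>(s, e). (the_inv_into I x s, e))) s = s"
      by (simp add: split_beta)
  qed
  then have vy: "val v = y" using conv[of v] w(3) by simp
  obtain u where u: "u \<in> rwords" "val u = val v" "length u \<le> length v" using reduce_word[OF inI] by auto
  have "nf y = u" using nf_val[OF u(1)] u(2) vy by simp
  then have "length (nf y) \<le> length v" using u(3) by simp
  then show "length (nf y) \<le> k" using w(1) by (simp add: v_def)
qed

end

section \<open>The boundary of a free group\<close>

fun lcp :: "'a list \<Rightarrow> 'a list \<Rightarrow> nat" where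
  "lcp (a # v) (b # w) = (if a = b then Suc (lcp v w) else 0)"
| "lcp _ _ = 0"

lemma lcp_ge_iff: "N \<le> lcp v w \<longleftrightarrow> N \<le> length v \<and> N \<le> length w \<and> take N v = take N w"
proof (induction v w arbitrary: N rule: lcp.induct)
  case (1 a v b w)
  then show ?case by (cases N) auto
qed auto

lemma lcp_append: "v = [] \<or> w = [] \<or> hd v \<noteq> hd w \<Longrightarrow> lcp (p @ v) (p @ w) = length p"
proof (induction p)
  case Nil
  then show ?case by (cases v; cases w) auto
qed auto

lemma lcp_ultrametric: "min (lcp u v) (lcp v w) \<le> lcp u w"
proof -
  let ?N = "min (lcp u v) (lcp v w)"
  have "?N \<le> lcp u v" "?N \<le> lcp v w" by auto
  then show ?thesis unfolding lcp_ge_iff by simp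
qed

context free_group
begin

lemma nf_one [simp]: "nf \<one> = []"
  using nf_val[of "[]"] by (simp add: rwords_def)

lemma word_dist_eq:
  assumes "y \<in> carrier F" "z \<in> carrier F"
  shows "word_dist F (x ` I) y z = real (length (nf y)) + real (length (nf z)) - 2 * real (lcp (nf y) (nf z))"
proof -
  have yz: "nf y \<in> rwords" "nf z \<in> rwords" "val (nf y) = y" "val (nf z) = z" using nf assms by auto
  obtain p v w where e: "nf y = p @ v" "nf z = p @ w" "inv_word v @ w \<in> rwords"
    "v = [] \<or> w = [] \<or> hd v \<noteq> hd w" "val (inv_word v @ w) = inv y \<otimes> z"
    using val_quotient[OF yz(1,2)] unfolding yz(3,4) by metis
  have "word_length F (x ` I) (inv y \<otimes> z) = length (nf (inv y \<otimes> z))"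
    using assms by (intro word_length_eq) auto
  also have "\<dots> = length v + length w" using nf_val[OF e(3)] e(5) by simp
  finally show ?thesis
    using lcp_append[OF e(4), of p] e(1,2) by (simp add: word_dist_def)
qed

text \<open>
  The word metric of a basis is that of a tree, where the Gromov product is the length of the common
  part of two geodesics.
\<close>

lemma gromov_product_one:
  assumes "y \<in> carrier F" "z \<in> carrier F"
  shows "gromov_product F (x ` I) \<one> y z = real (lcp (nf y) (nf z))"
  using assms by (simp add: gromov_product_def word_dist_eq)

lemma gromov_product_translate:
  assumes c: "b \<in> carrier F" "y \<in> carrier F" "z \<in> carrier F"
  shows "gromov_product F (x ` I) b y z = gromov_product F (x ` I) \<one> (inv b \<otimes> y) (inv b \<otimes> z)"
proof -
  have "b \<otimes> (inv b \<otimes> z) = z" using c by (simp add: m_assoc[symmetric])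
  then have "inv (inv b \<otimes> y) \<otimes> (inv b \<otimes> z) = inv y \<otimes> z" using c by (simp add: inv_mult_group m_assoc)
  then show ?thesis using c by (simp add: gromov_product_def word_dist_def)
qed

text \<open>
  The ultrametric inequality for common prefixes is hyperbolicity with constant 0.
\<close>

lemma word_hyperbolic_free:
  assumes "finite I"
  shows "word_hyperbolic F (x ` I)"
  unfolding word_hyperbolic_def
proof (intro conjI exI[of _ 0] ballI)
  show "group F" by (rule is_group)
  show "x ` I \<subseteq> carrier F" "generate F (x ` I) = carrier F" using free by (auto simp: free_basis_def)
  fix b y1 y2 y3 assume c: "b \<in> carrier F" "y1 \<in> carrier F" "y2 \<in> carrier F" "y3 \<in> carrier F"
  have e: "gromov_product F (x ` I) b y z = real (lcp (nf (inv b \<otimes> y)) (nf (inv b \<otimes> z)))"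
    if "y \<in> carrier F" "z \<in> carrier F" for y z
    using gromov_product_translate[OF c(1) that] gromov_product_one[of "inv b \<otimes> y" "inv b \<otimes> z"] that c(1) by simp
  show "min (gromov_product F (x ` I) b y1 y2) (gromov_product F (x ` I) b y2 y3) - 0
      \<le> gromov_product F (x ` I) b y1 y3"
    using c lcp_ultrametric[of "nf (inv b \<otimes> y1)" "nf (inv b \<otimes> y2)" "nf (inv b \<otimes> y3)"]
    by (simp add: e)
qed (use assms in simp)

definition inf_words :: "(nat \<Rightarrow> 'i \<times> bool) set" where
  "inf_words = {\<omega>. \<forall>m. map \<omega> [0..<m] \<in> rwords}"

definition ends_at :: "(nat \<Rightarrow> 'f) \<Rightarrow> (nat \<Rightarrow> 'i \<times> bool) \<Rightarrow> bool" where
  "ends_at u \<omega> \<longleftrightarrow> (\<forall>N. \<forall>\<^sub>F i in sequentially. take N (nf (u i)) = map \<omega> [0..<N])"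

text \<open>
  The boundary point represented by an infinite reduced word: an equivalence class consists of the
  sequences whose normal forms converge letter by letter to a fixed word.
\<close>

definition bd :: "(nat \<Rightarrow> 'i \<times> bool) \<Rightarrow> (nat \<Rightarrow> 'f) set" where
  "bd \<omega> = {u. range u \<subseteq> carrier F \<and> ends_at u \<omega>}"

lemma rwords_take: "w \<in> rwords \<Longrightarrow> take N w \<in> rwords"
  using set_take_subset[of N w] append_take_drop_id[of N w] reduced_append[of "take N w" "drop N w"]
  by (auto simp: rwords_def)

lemma boundary_rel_iff:
  "(u, v) \<in> boundary_rel F (x ` I) \<longleftrightarrow> range u \<subseteq> carrier F \<and> range v \<subseteq> carrier F \<and>
    (\<forall>N. \<exists>K. \<forall>i\<ge>K. \<forall>j\<ge>K. N \<le> lcp (nf (u i)) (nf (v j)))"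
proof -
  have "filterlim (\<lambda>(i, j). gromov_product F (x ` I) \<one> (u i) (v j)) at_top (sequentially \<times>\<^sub>F sequentially)
    \<longleftrightarrow> (\<forall>N. \<exists>K. \<forall>i\<ge>K. \<forall>j\<ge>K. N \<le> lcp (nf (u i)) (nf (v j)))"
    if "range u \<subseteq> carrier F" "range v \<subseteq> carrier F"
  proof -
    have e: "(\<lambda>(i, j). gromov_product F (x ` I) \<one> (u i) (v j)) = (\<lambda>(i, j). real (lcp (nf (u i)) (nf (v j))))"
      using that by (auto simp: gromov_product_one image_subset_iff)
    have "filterlim (\<lambda>(i, j). real (lcp (nf (u i)) (nf (v j)))) at_top (sequentially \<times>\<^sub>F sequentially) \<longleftrightarrow>
        filterlim (\<lambda>(i, j). lcp (nf (u i)) (nf (v j))) at_top (sequentially \<times>\<^sub>F sequentially)"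
      using filterlim_sequentially_iff_filterlim_real[of "\<lambda>(i, j). lcp (nf (u i)) (nf (v j))"]
      by (simp add: case_prod_unfold)
    also have "\<dots> \<longleftrightarrow> (\<forall>N. \<exists>K. \<forall>i\<ge>K. \<forall>j\<ge>K. N \<le> lcp (nf (u i)) (nf (v j)))"
      unfolding filterlim_at_top eventually_prod_sequentially prod.case by blast
    finally show ?thesis unfolding e .
  qed
  then show ?thesis unfolding boundary_rel_def by auto
qed

lemma pref_ends_at: "\<omega> \<in> inf_words \<Longrightarrow> (\<lambda>i. val (map \<omega> [0..<i])) \<in> bd \<omega>"
proof -
  assume w: "\<omega> \<in> inf_words"
  have "val (map \<omega> [0..<i]) \<in> carrier F" "nf (val (map \<omega> [0..<i])) = map \<omega> [0..<i]" for i
    using w nf_val by (auto simp: inf_words_def rwords_def)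
  moreover have "\<forall>\<^sub>F i in sequentially. take N (map \<omega> [0..<i]) = map \<omega> [0..<N]" for N
    using eventually_ge_at_top[of N] by eventually_elim (simp add: take_map)
  ultimately show ?thesis by (auto simp: bd_def ends_at_def)
qed

lemma ends_at_exists:
  assumes "(u, u) \<in> boundary_rel F (x ` I)"
  shows "\<exists>\<omega>\<in>inf_words. u \<in> bd \<omega>"
proof -
  have c: "range u \<subseteq> carrier F" using assms by (simp add: boundary_rel_iff)
  have "\<forall>N. \<exists>K. \<forall>i\<ge>K. \<forall>j\<ge>K. N \<le> lcp (nf (u i)) (nf (u j))" using assms by (simp add: boundary_rel_iff)
  then obtain K where K: "\<And>N i j. K N \<le> i \<Longrightarrow> K N \<le> j \<Longrightarrow> N \<le> lcp (nf (u i)) (nf (u j))" by metis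
  define \<omega> where "\<omega> k = nf (u (K (Suc k))) ! k" for k
  have "\<forall>\<^sub>F i in sequentially. take N (nf (u i)) = map \<omega> [0..<N]" for N
  proof -
    have "\<forall>\<^sub>F i in sequentially. nf (u i) ! k = \<omega> k" for k
      using eventually_ge_at_top[of "K (Suc k)"]
    proof eventually_elim
      case (elim i)
      then have "take (Suc k) (nf (u i)) = take (Suc k) (nf (u (K (Suc k))))"
        using K[of "Suc k" i "K (Suc k)"] by (simp add: lcp_ge_iff)
      then show ?case unfolding \<omega>_def by (metis lessI nth_take)
    qed
    then have "\<forall>\<^sub>F i in sequentially. \<forall>k\<in>{..<N}. nf (u i) ! k = \<omega> k"
      by (intro eventually_ball_finite) auto
    moreover have "\<forall>\<^sub>F i in sequentially. N \<le> length (nf (u i))"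
      using eventually_ge_at_top[of "K N"] by eventually_elim (use K lcp_ge_iff in blast)
    ultimately show ?thesis
      by eventually_elim (auto intro!: nth_equalityI)
  qed
  then have "ends_at u \<omega>" by (simp add: ends_at_def)
  moreover have "map \<omega> [0..<m] \<in> rwords" for m
  proof -
    have "\<forall>\<^sub>F i in sequentially. take m (nf (u i)) = map \<omega> [0..<m]"
      using \<open>ends_at u \<omega>\<close> by (simp add: ends_at_def)
    then obtain i where "take m (nf (u i)) = map \<omega> [0..<m]"
      using eventually_happens'[OF trivial_limit_sequentially] by blast
    then show ?thesis using rwords_take nf c by (metis range_subsetD)
  qed
  ultimately show ?thesis using c by (auto simp: bd_def inf_words_def)
qed

lemma ends_at_length: "ends_at u \<omega> \<Longrightarrow> \<forall>\<^sub>F i in sequentially. N \<le> length (nf (u i))"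
proof -
  assume "ends_at u \<omega>"
  then have "\<forall>\<^sub>F i in sequentially. take N (nf (u i)) = map \<omega> [0..<N]" by (simp add: ends_at_def)
  then show ?thesis
  proof eventually_elim
    case (elim i)
    have "length (take N (nf (u i))) = N" unfolding elim by simp
    then show ?case by simp
  qed
qed

lemma boundary_rel_bd:
  assumes "u \<in> bd \<omega>"
  shows "(u, v) \<in> boundary_rel F (x ` I) \<longleftrightarrow> v \<in> bd \<omega>"
proof
  assume "(u, v) \<in> boundary_rel F (x ` I)"
  then have c: "range v \<subseteq> carrier F" and K: "\<forall>N. \<exists>K. \<forall>i\<ge>K. \<forall>j\<ge>K. N \<le> lcp (nf (u i)) (nf (v j))"
    by (auto simp: boundary_rel_iff)
  have "\<forall>\<^sub>F j in sequentially. take N (nf (v j)) = map \<omega> [0..<N]" for N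
  proof -
    obtain k where k: "\<And>i j. k \<le> i \<Longrightarrow> k \<le> j \<Longrightarrow> N \<le> lcp (nf (u i)) (nf (v j))" using K by metis
    have "\<forall>\<^sub>F i in sequentially. take N (nf (u i)) = map \<omega> [0..<N] \<and> k \<le> i"
      using assms eventually_ge_at_top[of k] by (auto simp: bd_def ends_at_def intro: eventually_conj)
    then obtain i where "take N (nf (u i)) = map \<omega> [0..<N]" "k \<le> i"
      using eventually_happens'[OF trivial_limit_sequentially] by blast
    then have "take N (nf (v j)) = map \<omega> [0..<N]" if "k \<le> j" for j
      using k[of i j] that by (simp add: lcp_ge_iff)
    then show ?thesis by (auto simp: eventually_sequentially)
  qed
  then show "v \<in> bd \<omega>" using c by (simp add: bd_def ends_at_def)
next
  assume v: "v \<in> bd \<omega>"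
  have "\<exists>K. \<forall>i\<ge>K. \<forall>j\<ge>K. N \<le> lcp (nf (u i)) (nf (v j))" for N
  proof -
    have "\<forall>\<^sub>F i in sequentially. (N \<le> length (nf (u i)) \<and> take N (nf (u i)) = map \<omega> [0..<N]) \<and>
        (N \<le> length (nf (v i)) \<and> take N (nf (v i)) = map \<omega> [0..<N])"
      using assms v ends_at_length by (auto simp: bd_def ends_at_def intro!: eventually_conj)
    then show ?thesis unfolding eventually_sequentially lcp_ge_iff by metis
  qed
  then show "(u, v) \<in> boundary_rel F (x ` I)" using assms v by (simp add: boundary_rel_iff bd_def)
qed

lemma gromov_boundary_eq: "gromov_boundary F (x ` I) = bd ` inf_words"
proof (intro subset_antisym subsetI)
  fix p assume "p \<in> gromov_boundary F (x ` I)"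
  then obtain u where u: "(u, u) \<in> boundary_rel F (x ` I)" "p = boundary_rel F (x ` I) `` {u}"
    by (auto simp: gromov_boundary_def quotient_def)
  obtain \<omega> where w: "\<omega> \<in> inf_words" "u \<in> bd \<omega>" using ends_at_exists[OF u(1)] by blast
  have "p = bd \<omega>" unfolding u(2) using boundary_rel_bd[OF w(2)] by auto
  with w show "p \<in> bd ` inf_words" by blast
next
  fix p assume "p \<in> bd ` inf_words"
  then obtain \<omega> where w: "\<omega> \<in> inf_words" "p = bd \<omega>" by blast
  obtain u where u: "u \<in> bd \<omega>" using pref_ends_at[OF w(1)] by blast
  have "p = boundary_rel F (x ` I) `` {u}" unfolding w(2) using boundary_rel_bd[OF u] by auto
  moreover have "(u, u) \<in> boundary_rel F (x ` I)" using boundary_rel_bd[OF u] u by blast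
  ultimately show "p \<in> gromov_boundary F (x ` I)" by (auto simp: gromov_boundary_def quotient_def)
qed

lemma bd_agree:
  assumes "u \<in> bd \<omega>" "v \<in> bd \<omega>'" "\<forall>\<^sub>F i in sequentially. N \<le> lcp (nf (u i)) (nf (v i))"
  shows "map \<omega> [0..<N] = map \<omega>' [0..<N]"
proof -
  have "\<forall>\<^sub>F i in sequentially. take N (nf (u i)) = map \<omega> [0..<N]" "\<forall>\<^sub>F i in sequentially. take N (nf (v i)) = map \<omega>' [0..<N]"
    using assms(1,2) by (auto simp: bd_def ends_at_def)
  with assms(3) have "\<forall>\<^sub>F i in sequentially. map \<omega> [0..<N] = map \<omega>' [0..<N]"
    by eventually_elim (simp add: lcp_ge_iff)
  then show ?thesis by simp
qed

lemma map_upt_eq_all: "(\<And>N. map \<omega> [0..<N] = map \<omega>' [0..<N]) \<Longrightarrow> \<omega> = \<omega>'"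
proof (rule ext)
  fix k assume "\<And>N. map \<omega> [0..<N] = map \<omega>' [0..<N]"
  from this[of "Suc k"] show "\<omega> k = \<omega>' k" by simp
qed

lemma bd_unique:
  assumes "u \<in> bd \<omega>" "u \<in> bd \<omega>'"
  shows "\<omega> = \<omega>'"
proof (rule map_upt_eq_all)
  fix N
  show "map \<omega> [0..<N] = map \<omega>' [0..<N]"
    by (rule bd_agree[OF assms]) (use assms(1) ends_at_length in \<open>auto simp: lcp_ge_iff bd_def\<close>)
qed

lemma bd_inj: "\<omega> \<in> inf_words \<Longrightarrow> bd \<omega> = bd \<omega>' \<Longrightarrow> \<omega> = \<omega>'"
  using bd_unique pref_ends_at by blast

lemma boundary_nhd_iff:
  assumes w: "\<omega> \<in> inf_words" and w': "\<omega>' \<in> inf_words"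
  shows "bd \<omega>' \<in> boundary_nhd F (x ` I) (bd \<omega>) (real N) \<longleftrightarrow> map \<omega>' [0..<N] = map \<omega> [0..<N]"
proof
  have gp: "gromov_product F (x ` I) \<one> (u i) (v j) = real (lcp (nf (u i)) (nf (v j)))"
    if "u \<in> bd \<omega>" "v \<in> bd \<omega>'" for u v i j
    using that by (auto simp: bd_def gromov_product_one image_subset_iff)
  {
    assume "bd \<omega>' \<in> boundary_nhd F (x ` I) (bd \<omega>) (real N)"
    then obtain u v where uv: "u \<in> bd \<omega>" "v \<in> bd \<omega>'"
      and "\<forall>\<^sub>F (i, j) in sequentially \<times>\<^sub>F sequentially. gromov_product F (x ` I) \<one> (u i) (v j) \<ge> real N"
      unfolding boundary_nhd_def by blast
    then have "\<forall>\<^sub>F (i, j) in sequentially \<times>\<^sub>F sequentially. N \<le> lcp (nf (u i)) (nf (v j))"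
      by (simp add: gp)
    then have "\<forall>\<^sub>F i in sequentially. N \<le> lcp (nf (u i)) (nf (v i))"
      unfolding eventually_prod_sequentially eventually_sequentially by auto
    from bd_agree[OF uv this] show "map \<omega>' [0..<N] = map \<omega> [0..<N]" by simp
  }
  assume eq: "map \<omega>' [0..<N] = map \<omega> [0..<N]"
  obtain u v where uv: "u \<in> bd \<omega>" "v \<in> bd \<omega>'" using pref_ends_at w w' by blast
  have "\<forall>\<^sub>F i in sequentially. take N (nf (v i)) = map \<omega>' [0..<N]"
    using uv(2) by (simp add: bd_def ends_at_def)
  then have "\<forall>\<^sub>F i in sequentially. take N (nf (v i)) = map \<omega> [0..<N]" unfolding eq .
  then have "\<forall>\<^sub>F i in sequentially. N \<le> length (nf (v i)) \<and> take N (nf (v i)) = map \<omega> [0..<N]"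
    using uv(2) ends_at_length by (auto simp: bd_def intro!: eventually_conj)
  moreover have "\<forall>\<^sub>F i in sequentially. N \<le> length (nf (u i)) \<and> take N (nf (u i)) = map \<omega> [0..<N]"
    using uv(1) ends_at_length by (auto simp: bd_def ends_at_def intro!: eventually_conj)
  ultimately have "\<forall>\<^sub>F i in sequentially. (N \<le> length (nf (v i)) \<and> take N (nf (v i)) = map \<omega> [0..<N]) \<and>
      N \<le> length (nf (u i)) \<and> take N (nf (u i)) = map \<omega> [0..<N]"
    by (rule eventually_conj)
  then have "\<forall>\<^sub>F (i, j) in sequentially \<times>\<^sub>F sequentially. N \<le> lcp (nf (u i)) (nf (v j))"
    unfolding eventually_sequentially eventually_prod_sequentially lcp_ge_iff by fastforce
  then have "\<forall>\<^sub>F (i, j) in sequentially \<times>\<^sub>F sequentially. gromov_product F (x ` I) \<one> (u i) (v j) \<ge> real N"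
    by (simp add: gp[OF uv])
  with uv w' show "bd \<omega>' \<in> boundary_nhd F (x ` I) (bd \<omega>) (real N)"
    unfolding boundary_nhd_def gromov_boundary_eq by blast
qed

definition conc :: "('i \<times> bool) list \<Rightarrow> (nat \<Rightarrow> 'i \<times> bool) \<Rightarrow> nat \<Rightarrow> 'i \<times> bool" where
  "conc w \<omega> k = (if k < length w then w ! k else \<omega> (k - length w))"

lemma map_conc: "map (conc w \<omega>) [0..<length w + m] = w @ map \<omega> [0..<m]"
  by (rule nth_equalityI) (auto simp: conc_def nth_append)

lemma conc_inf_words:
  assumes "\<omega> \<in> inf_words" "w \<in> rwords" "w \<noteq> [] \<Longrightarrow> \<omega> 0 \<noteq> inv_letter (last w)"
  shows "conc w \<omega> \<in> inf_words"
proof -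
  have "map (conc w \<omega>) [0..<m] \<in> rwords" for m
  proof -
    have "map \<omega> [0..<m] \<in> rwords" using assms(1) by (simp add: inf_words_def)
    moreover have "hd (map \<omega> [0..<m]) = \<omega> 0" if "m \<noteq> 0" using that by (simp add: hd_map)
    ultimately have "w @ map \<omega> [0..<m] \<in> rwords"
      using assms(2,3) by (cases "m = 0") (auto simp: rwords_def reduced_append)
    then have "map (conc w \<omega>) [0..<length w + m] \<in> rwords" by (simp add: map_conc)
    from rwords_take[OF this, of m] show ?thesis by (simp add: take_map)
  qed
  then show ?thesis by (simp add: inf_words_def)
qed

lemma drop_inf_words: "\<omega> \<in> inf_words \<Longrightarrow> (\<lambda>k. \<omega> (k + N)) \<in> inf_words"
proof -
  assume w: "\<omega> \<in> inf_words"
  have "map (\<lambda>k. \<omega> (k + N)) [0..<m] \<in> rwords" for m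
  proof -
    have "map \<omega> [0..<N] @ map (\<lambda>k. \<omega> (k + N)) [0..<m] = map \<omega> [0..<N + m]"
      by (rule nth_equalityI) (auto simp: nth_append)
    moreover have "map \<omega> [0..<N + m] \<in> rwords" using w by (simp add: inf_words_def)
    ultimately have "map \<omega> [0..<N] @ map (\<lambda>k. \<omega> (k + N)) [0..<m] \<in> rwords" by simp
    then show ?thesis by (auto simp: rwords_def reduced_append)
  qed
  then show ?thesis by (simp add: inf_words_def)
qed

lemma conc_drop: "conc (map \<omega> [0..<N]) (\<lambda>k. \<omega> (k + N)) = \<omega>"
  by (auto simp: conc_def fun_eq_iff)

lemma inf_words_not_inverse: "\<omega> \<in> inf_words \<Longrightarrow> \<omega> (Suc k) \<noteq> inv_letter (\<omega> k)"
proof -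
  assume "\<omega> \<in> inf_words"
  then have "reduced (map \<omega> [0..<Suc (Suc k)])" by (simp add: inf_words_def rwords_def del: upt_Suc)
  then show ?thesis by (auto simp: reduced_iff simp del: upt_Suc dest!: spec[of _ k])
qed

lemma inf_words_letter: "\<omega> \<in> inf_words \<Longrightarrow> fst (\<omega> k) \<in> I"
proof -
  assume "\<omega> \<in> inf_words"
  then have "map \<omega> [0..<Suc k] \<in> rwords" unfolding inf_words_def by blast
  then show ?thesis by (auto simp: rwords_def)
qed

text \<open>
  As there is no cancellation, the normal form of \<open>val w \<otimes> u i\<close> is \<open>w\<close> followed by that of \<open>u i\<close>.
\<close>

lemma boundary_act_bd:
  assumes w: "\<omega> \<in> inf_words" "w \<in> rwords" "w \<noteq> [] \<Longrightarrow> \<omega> 0 \<noteq> inv_letter (last w)"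
  shows "boundary_act F (val w) (bd \<omega>) = bd (conc w \<omega>)"
proof (intro subset_antisym subsetI)
  have y: "val w \<in> carrier F" using w(2) by (simp add: rwords_def)
  {
    fix v assume "v \<in> boundary_act F (val w) (bd \<omega>)"
    then obtain u where u: "u \<in> bd \<omega>" "v = (\<lambda>i. val w \<otimes> u i)" by (auto simp: boundary_act_def)
    have uc: "u i \<in> carrier F" for i using u(1) by (auto simp: bd_def)
    have ev: "\<forall>\<^sub>F i in sequentially. take (Suc 0) (nf (u i)) = map \<omega> [0..<Suc 0]"
      using u(1) unfolding bd_def ends_at_def by blast
    have nfv: "\<forall>\<^sub>F i in sequentially. nf (v i) = w @ nf (u i)"
      using ev
    proof eventually_elim
      case (elim i)
      have ui: "nf (u i) \<in> rwords" "val (nf (u i)) = u i" using nf[OF uc[of i]] by auto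
      have "nf (u i) \<noteq> []" "hd (nf (u i)) = \<omega> 0" using elim by (cases "nf (u i)"; simp)+
      then have "w @ nf (u i) \<in> rwords" using w(2,3) ui(1) by (auto simp: rwords_def reduced_append)
      moreover have "val (w @ nf (u i)) = v i"
        using w(2) ui by (subst val_append) (auto simp: rwords_def u(2))
      ultimately show ?case using nf_val by metis
    qed
    have "\<forall>\<^sub>F i in sequentially. take N (nf (v i)) = map (conc w \<omega>) [0..<N]" for N
    proof -
      have "\<forall>\<^sub>F i in sequentially. take N (nf (u i)) = map \<omega> [0..<N]" using u(1) by (simp add: bd_def ends_at_def)
      with nfv show ?thesis
      proof eventually_elim
        case (elim i)
        have "take N (nf (v i)) = take N (w @ take N (nf (u i)))" unfolding elim(1) by simp
        also have "\<dots> = take N (map (conc w \<omega>) [0..<length w + N])" unfolding elim(2) map_conc ..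
        finally show ?case by (simp add: take_map)
      qed
    qed
    moreover have "v i \<in> carrier F" for i using y uc by (simp add: u(2))
    ultimately show "v \<in> bd (conc w \<omega>)" by (auto simp: bd_def ends_at_def)
  }
  fix v assume v: "v \<in> bd (conc w \<omega>)"
  define u where "u i = inv (val w) \<otimes> v i" for i
  have vc: "v i \<in> carrier F" for i using v by (auto simp: bd_def)
  have "\<forall>\<^sub>F i in sequentially. take N (nf (u i)) = map \<omega> [0..<N]" for N
  proof -
    have "\<forall>\<^sub>F i in sequentially. take (length w + N) (nf (v i)) = map (conc w \<omega>) [0..<length w + N]"
      using v unfolding bd_def ends_at_def by blast
    then show ?thesis
    proof eventually_elim
      case (elim i)
      define r where "r = drop (length w) (nf (v i))"
      have "take (length w) (nf (v i)) = take (length w) (take (length w + N) (nf (v i)))" by simp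
      also have "\<dots> = w" unfolding elim map_conc by simp
      finally have vr: "nf (v i) = w @ r" unfolding r_def by (metis append_take_drop_id)
      have vi: "nf (v i) \<in> rwords" "val (nf (v i)) = v i" using nf[OF vc[of i]] by auto
      then have r: "r \<in> rwords" unfolding vr by (auto simp: rwords_def reduced_append)
      have "v i = val w \<otimes> val r" using vi(2) w(2) r unfolding vr by (simp add: val_append rwords_def)
      then have "u i = val r" using y r by (simp add: u_def m_assoc[symmetric] rwords_def)
      then have "nf (u i) = r" using nf_val[OF r] by simp
      moreover have "w @ take N r = w @ map \<omega> [0..<N]" using elim unfolding vr map_conc by simp
      ultimately show ?case by simp
    qed
  qed
  then have "u \<in> bd \<omega>" using y vc by (auto simp: bd_def ends_at_def u_def)
  moreover have "v = (\<lambda>i. val w \<otimes> u i)" using y vc by (auto simp: u_def m_assoc[symmetric])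
  ultimately show "v \<in> boundary_act F (val w) (bd \<omega>)" by (auto simp: boundary_act_def)
qed

text \<open>
  There are finitely many prefixes of each length, so that a diagonal sequence stabilizes all of them.
\<close>

lemma compact_ends:
  assumes fin: "finite I" and y: "\<And>m. y m \<in> carrier F"
    and len: "\<And>N. \<forall>\<^sub>F m in sequentially. N \<le> length (nf (y m))"
  obtains r \<omega> where "strict_mono r" "\<omega> \<in> inf_words" "(\<lambda>m. y (r m)) \<in> bd \<omega>"
proof -
  define P where "P n s \<longleftrightarrow> (\<exists>p. \<forall>i. take n (nf (y (s i))) = p)" for n and s :: "nat \<Rightarrow> nat"
  have "\<exists>r'. strict_mono r' \<and> P n (s \<circ> r')" if "strict_mono s" for n and s :: "nat \<Rightarrow> nat"
  proof -
    let ?f = "\<lambda>i :: nat. take n (nf (y (s i)))"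
    have "range ?f \<subseteq> {w. set w \<subseteq> I \<times> UNIV \<and> length w \<le> n}"
    proof safe
      fix i a b assume "(a, b) \<in> set (take n (nf (y (s i))))"
      then have "(a, b) \<in> set (nf (y (s i)))" by (rule in_set_takeD)
      then show "a \<in> I" using nf[OF y[of "s i"]] by (force simp: rwords_def)
    qed auto
    moreover have "finite {w :: ('i \<times> bool) list. set w \<subseteq> I \<times> UNIV \<and> length w \<le> n}"
      by (rule finite_lists_length_le) (use fin in simp)
    ultimately have "finite (range ?f)" by (rule finite_subset)
    then obtain i0 where "infinite {i \<in> UNIV. ?f i = ?f i0}"
      using pigeonhole_infinite[OF infinite_UNIV_nat, of ?f] by auto
    then obtain r' :: "nat \<Rightarrow> nat" where "strict_mono r'" "\<And>k. r' k \<in> {i \<in> UNIV. ?f i = ?f i0}"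
      using infinite_enumerate by blast
    then show ?thesis by (intro exI[of _ r']) (auto simp: P_def)
  qed
  then interpret subseqs P by unfold_locales
  define r where "r = diagseq"
  have r: "strict_mono r" unfolding r_def by (rule subseq_diagseq)
  have "P n (diagseq \<circ> ((+) (Suc n)))" for n
    by (rule diagseq_holds) (auto simp: P_def)
  then have "\<exists>p. \<forall>i. take n (nf (y (r (Suc n + i)))) = p" for n by (simp add: P_def r_def)
  then obtain p where p: "\<And>n i. take n (nf (y (r (Suc n + i)))) = p n" by metis
  have ev: "\<forall>\<^sub>F i in sequentially. take n (nf (y (r i))) = p n" for n
    using eventually_ge_at_top[of "Suc n"]
    by eventually_elim (metis p le_add_diff_inverse)
  have "(\<lambda>m. y (r m), \<lambda>m. y (r m)) \<in> boundary_rel F (x ` I)"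
    unfolding boundary_rel_iff
  proof (intro conjI allI)
    fix N
    have "\<forall>\<^sub>F i in sequentially. N \<le> length (nf (y (r i)))" by (rule eventually_subseq[OF r len])
    with ev[of N] have "\<forall>\<^sub>F i in sequentially. N \<le> length (nf (y (r i))) \<and> take N (nf (y (r i))) = p N"
      by (rule eventually_elim2) simp
    then show "\<exists>K. \<forall>i\<ge>K. \<forall>j\<ge>K. N \<le> lcp (nf (y (r i))) (nf (y (r j)))"
      unfolding eventually_sequentially lcp_ge_iff by metis
  qed (use y in auto)
  then obtain \<omega> where "\<omega> \<in> inf_words" "(\<lambda>m. y (r m)) \<in> bd \<omega>" using ends_at_exists by blast
  with r that show thesis by blast
qed

lemma escaping_length:
  assumes fin: "finite I" and y: "\<And>m. y m \<in> carrier F"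
    and esc: "\<And>K. finite K \<Longrightarrow> \<forall>\<^sub>F m in sequentially. y m \<notin> K"
  shows "\<forall>\<^sub>F m in sequentially. N \<le> length (nf (y m))"
proof -
  have "finite {w :: ('i \<times> bool) list. set w \<subseteq> I \<times> UNIV \<and> length w \<le> N}"
    by (rule finite_lists_length_le) (use fin in simp)
  from esc[OF finite_imageI[OF this, of val]] show ?thesis
  proof eventually_elim
    case (elim m)
    show ?case
    proof (rule ccontr)
      assume "\<not> N \<le> length (nf (y m))"
      moreover have "set (nf (y m)) \<subseteq> I \<times> UNIV" using nf[OF y[of m]] by (force simp: rwords_def)
      ultimately have "nf (y m) \<in> {w. set w \<subseteq> I \<times> UNIV \<and> length w \<le> N}" by simp
      then have "val (nf (y m)) \<in> val ` {w. set w \<subseteq> I \<times> UNIV \<and> length w \<le> N}" by (rule imageI)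
      then show False using elim nf[OF y[of m]] by simp
    qed
  qed
qed

end

section \<open>Words of totally positive matrices\<close>

lemma nonneg_initial_limit:
  fixes L :: "('n::{finite,linorder}) rmat"
  assumes "(\<lambda>m. Ls m) \<longlonglongrightarrow> L" "lower_unip L" "\<And>m. nonneg_initial (Ls m)"
  shows "nonneg_initial L"
  unfolding nonneg_initial_def
proof (intro allI impI conjI ballI)
  fix k assume k: "k \<le> CARD('n)"
  show "0 < lead L k" using lead_lower_unip[OF assms(2) k] by simp
  fix K assume "K \<in> strict_lists CARD('n) k"
  then show "0 \<le> tminor L K [0..<k]"
    using assms(3) k by (intro LIMSEQ_le_const[OF tendsto_tminor[OF assms(1)]]) (auto simp: nonneg_initial_def)
qed

lemma tminor_lower_factor:
  fixes A :: "('n::{finite,linorder}) rmat"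
  assumes A: "regular A" and J: "length J = k" and k: "k \<le> CARD('n)"
  shows "tminor (lower_factor A) J [0..<k] = tminor A J [0..<k] / lead A k"
proof -
  let ?d = "prod_list (map (\<lambda>i. mn (upper_factor A) i i) [0..<k])"
  have "1 = lead A k * ?d"
    using tminor_mult_upper[OF upper_inv_upper_factor[OF A] _ k, of "[0..<k]" A] lead_lower_unip[OF lower_unip_lower_factor[OF A] k]
    by (simp add: mult_upper_factor[OF A])
  moreover have "tminor (lower_factor A) J [0..<k] = tminor A J [0..<k] * ?d"
    using tminor_mult_upper[OF upper_inv_upper_factor[OF A] J k, of A] by (simp add: mult_upper_factor[OF A])
  ultimately show ?thesis using lead_nonzero[OF A k] by (simp add: field_simps)
qed

lemma nonneg_initial_lower_factor:
  fixes A :: "('n::{finite,linorder}) rmat"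
  assumes "STP A"
  shows "nonneg_initial (lower_factor A)"
proof -
  have "nonneg_initial A" by (rule nonneg_initial_STP[OF assms])
  then show ?thesis
    using tminor_lower_factor[OF regular_STP[OF assms]] lead_lower_unip[OF lower_unip_lower_factor[OF regular_STP[OF assms]]]
    by (auto simp: nonneg_initial_def strict_lists_def)
qed

lemma STP_trp: "STP A \<Longrightarrow> STP (trp A)"
  by (auto simp: STP_def tminor_transpose strict_lists_def)

text \<open>
  By the Cauchy--Binet formula the leading minors are sums of nonnegative terms, one of which is
  positive.  This positivity is the source of the transversality of limit flags.
\<close>

lemma regular_trp_mult:
  fixes K Y :: "('n::{finite,linorder}) rmat"
  assumes K: "nonneg_initial K" and Y: "nonneg_initial Y"
  shows "regular (trp K ** Y)"
proof -
  have "0 < lead (trp K ** Y) k" if k: "k \<le> CARD('n)" for k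
  proof -
    have ini: "[0..<k] \<in> strict_lists CARD('n) k" by (rule initial_strict[OF k])
    have t: "tminor (trp K) [0..<k] J = tminor K J [0..<k]" if "J \<in> strict_lists CARD('n) k" for J
      using that by (intro tminor_transpose) (simp add: strict_lists_def)
    have "0 < (\<Sum>J\<in>strict_lists CARD('n) k. tminor (trp K) [0..<k] J * tminor Y J [0..<k])"
      using K Y k t by (intro sum_pos2[OF _ ini]) (auto simp: nonneg_initial_def ini)
    then show ?thesis by (simp add: tminor_mult)
  qed
  then show ?thesis by (force simp: regular_def)
qed

lemma norm_matrix_bound:
  fixes A :: "('n::{finite,linorder}) rmat"
  assumes "\<And>i j. i < CARD('n) \<Longrightarrow> j < CARD('n) \<Longrightarrow> \<bar>mn A i j\<bar> \<le> c"
  shows "norm A \<le> (\<Sum>i\<in>(UNIV :: 'n set). \<Sum>j\<in>(UNIV :: 'n set). c)"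
proof -
  have "\<bar>A $ i $ j\<bar> \<le> c" for i j using assms[of "ix i" "ix j"] by (simp add: mn_def)
  then have "norm (A $ i) \<le> (\<Sum>j\<in>(UNIV :: 'n set). c)" for i
    by (intro order.trans[OF norm_le_l1_cart] sum_mono) auto
  then have "(\<Sum>i\<in>UNIV. norm (A $ i)) \<le> (\<Sum>i\<in>(UNIV :: 'n set). \<Sum>j\<in>(UNIV :: 'n set). c)"
    by (intro sum_mono) auto
  moreover have "norm A \<le> (\<Sum>i\<in>UNIV. norm (A $ i))"
    unfolding norm_vec_def by (rule L2_set_le_sum) simp
  ultimately show ?thesis by linarith
qed

lemma convergent_matrix_subsequence:
  fixes Ls :: "nat \<Rightarrow> ('n::{finite,linorder}) rmat"
  assumes "\<And>m i j. i < CARD('n) \<Longrightarrow> j < CARD('n) \<Longrightarrow> \<bar>mn (Ls m) i j\<bar> \<le> c"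
  obtains L r where "strict_mono r" "(\<lambda>m. Ls (r m)) \<longlonglongrightarrow> L"
proof -
  have "bounded (range Ls)"
    unfolding bounded_iff
    using norm_matrix_bound[OF assms] by (intro exI[of _ "\<Sum>i\<in>(UNIV :: 'n set). \<Sum>j\<in>(UNIV :: 'n set). c"]) blast
  then show thesis
    using that bounded_imp_convergent_subsequence[of Ls] by (auto simp: o_def)
qed

text \<open>
  The diagonal entries of the inverse grow; conjugation by the reversal makes them decay again.
\<close>

lemma dg_inverse_reflected:
  fixes d :: "nat \<Rightarrow> real"
  assumes d: "\<And>i. i < CARD('n) \<Longrightarrow> d i \<noteq> 0"
  shows "reversal ** dg (\<lambda>i. 1 / d (CARD('n) - Suc i)) ** reversal ** dg d = (mat 1 :: ('n::{finite,linorder}) rmat)"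
proof (rule mn_eqI)
  fix i j assume ij: "i < CARD('n)" "j < CARD('n)"
  have r: "CARD('n) - Suc j < CARD('n)" "CARD('n) - Suc (CARD('n) - Suc j) = j"
    "i + (CARD('n) - Suc j) + 1 = CARD('n) \<longleftrightarrow> i = j" using ij by auto
  have "mn (reversal ** dg (\<lambda>i. 1 / d (CARD('n) - Suc i)) ** reversal ** dg d :: 'n rmat) i j =
      mn (reversal :: 'n rmat) i (CARD('n) - Suc j) * (1 / d (CARD('n) - Suc (CARD('n) - Suc j))) * d j"
    by (simp only: mn_mult_dg[OF ij] mn_mult_reversal[OF ij] mn_mult_dg[OF ij(1) r(1)])
  then have "mn (reversal ** dg (\<lambda>i. 1 / d (CARD('n) - Suc i)) ** reversal ** dg d :: 'n rmat) i j =
      (if i = j then 1 else 0) * (1 / d j) * d j"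
    by (simp only: r mn_reversal[OF ij(1) r(1)])
  then show "mn (reversal ** dg (\<lambda>i. 1 / d (CARD('n) - Suc i)) ** reversal ** dg d :: 'n rmat) i j = mn (mat 1 :: 'n rmat) i j"
    using ij d by (simp add: mn_one)
qed

lemma cancel_factors:
  fixes Ba Ba' L L' D D' V U U' Bb Bb' X :: "('n::finite) rmat"
  assumes "Ba ** Ba' = mat 1" "L ** L' = mat 1" "D ** (V ** D' ** V) = mat 1" "U ** U' = mat 1" "Bb' ** Bb = mat 1"
  shows "(Ba ** (L ** (D ** (U ** Bb')))) ** (Bb ** ((U' ** V) ** (D' ** ((V ** L') ** (Ba' ** X))))) = X"
proof -
  have c: "A ** (A' ** Z) = Z" if "A ** A' = mat 1" for A A' Z :: "'n rmat"
    using that by (simp add: matrix_mul_assoc)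
  have "D ** (V ** (D' ** (V ** Z))) = Z" for Z :: "'n rmat"
    using c[OF assms(3), of Z] by (simp only: matrix_mul_assoc)
  then show ?thesis
    by (simp only: matrix_mul_assoc[symmetric] c[OF assms(1)] c[OF assms(2)] c[OF assms(4)] c[OF assms(5)])
qed

lemma invertible_right_factor:
  fixes N X Y :: "('n::finite) rmat"
  assumes "N ** Y = X" "invertible X"
  shows "invertible Y"
proof -
  have "det N * det Y \<noteq> 0" using assms(2) unfolding assms(1)[symmetric] invertible_det_nz det_mul .
  then show ?thesis by (simp add: invertible_det_nz)
qed

text \<open>
  All that the dynamics uses of a Schottky representation.  For such a representation the columns of
  \<open>B s\<close> will form a basis adapted to the two flags at the endpoints of the interval of the letter \<open>s\<close>; in
  these bases a representative of \<open>s\<close> is strictly totally positive up to sign whenever it is applied to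
  the interval of a letter that may follow \<open>s\<close> in a reduced word.
\<close>

locale schottky_matrices = free_group F I x
  for F :: "('f, 'e) monoid_scheme" (structure) and I :: "'i set" and x :: "'i \<Rightarrow> 'f" +
  fixes \<rho> :: "'f \<Rightarrow> ('n::{finite,linorder}) rmat set"
    and B :: "'i \<times> bool \<Rightarrow> 'n rmat" and H :: "'i \<times> bool \<Rightarrow> 'n rmat"
    and M :: "'i \<times> bool \<Rightarrow> 'i \<times> bool \<Rightarrow> 'n rmat"
  assumes finI: "finite I" and dim: "2 \<le> CARD('n)" and hom: "\<rho> \<in> hom F PSL"
    and H: "fst s \<in> I \<Longrightarrow> H s \<in> \<rho> (lval s)"
    and B: "fst s \<in> I \<Longrightarrow> invertible (B s)"
    and STP_M: "fst s \<in> I \<Longrightarrow> fst t \<in> I \<Longrightarrow> t \<noteq> inv_letter s \<Longrightarrow> STP (M s t)"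
    and transition: "fst s \<in> I \<Longrightarrow> fst t \<in> I \<Longrightarrow> t \<noteq> inv_letter s \<Longrightarrow>
      H s ** B t = B s ** M s t \<or> H s ** B t = - (B s ** M s t)"
begin

lemma rho_closed: "y \<in> carrier F \<Longrightarrow> \<rho> y \<in> carrier PSL"
  using hom by (auto simp: hom_def)

lemma rho_mult: "y \<in> carrier F \<Longrightarrow> z \<in> carrier F \<Longrightarrow> \<rho> (y \<otimes> z) = \<rho> y \<otimes>\<^bsub>PSL\<^esub> \<rho> z"
  using hom by (auto simp: hom_def)

lemma rho_inv: "y \<in> carrier F \<Longrightarrow> \<rho> (inv y) = inv\<^bsub>PSL\<^esub> (\<rho> y)"
  using group_hom.hom_inv[of F PSL \<rho>] hom group_PSL is_group
  by (simp add: group_hom_def group_hom_axioms_def)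

definition Binv :: "'i \<times> bool \<Rightarrow> 'n rmat" where
  "Binv s = (SOME A. B s ** A = mat 1 \<and> A ** B s = mat 1)"

lemma Binv: "fst s \<in> I \<Longrightarrow> B s ** Binv s = mat 1" "fst s \<in> I \<Longrightarrow> Binv s ** B s = mat 1"
  using someI_ex[OF B[unfolded invertible_def]] unfolding Binv_def by auto

definition \<kappa> :: real where
  "\<kappa> = (SOME \<kappa>. 1 < \<kappa> \<and> (\<forall>s t. fst s \<in> I \<longrightarrow> fst t \<in> I \<longrightarrow> t \<noteq> inv_letter s \<longrightarrow> comparable \<kappa> (M s t)))"

lemma \<kappa>: "1 < \<kappa>" "fst s \<in> I \<Longrightarrow> fst t \<in> I \<Longrightarrow> t \<noteq> inv_letter s \<Longrightarrow> comparable \<kappa> (M s t)"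
proof -
  let ?A = "{(s, t). fst s \<in> I \<and> fst t \<in> I \<and> t \<noteq> inv_letter s}"
  have "?A \<subseteq> (I \<times> UNIV) \<times> (I \<times> UNIV)" by auto
  then have "finite ?A" by (rule finite_subset) (use finI in auto)
  then have fin: "finite ((\<lambda>(s, t). M s t) ` ?A)" by (rule finite_imageI)
  have stp: "STP N" if "N \<in> (\<lambda>(s, t). M s t) ` ?A" for N using that STP_M by auto
  have ex: "\<exists>\<kappa>>1. \<forall>N\<in>(\<lambda>(s, t). M s t) ` ?A. comparable \<kappa> N" by (rule comparable_exists[OF fin stp])
  then obtain k where k: "1 < k" "\<forall>N\<in>(\<lambda>(s, t). M s t) ` ?A. comparable k N" by blast
  have "comparable k (M s t)" if "fst s \<in> I" "fst t \<in> I" "t \<noteq> inv_letter s" for s t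
    by (rule bspec[OF k(2)]) (use that in \<open>auto intro!: image_eqI[of _ _ "(s, t)"]\<close>)
  then have "\<exists>\<kappa>. 1 < \<kappa> \<and> (\<forall>s t. fst s \<in> I \<longrightarrow> fst t \<in> I \<longrightarrow> t \<noteq> inv_letter s \<longrightarrow> comparable \<kappa> (M s t))"
    using k(1) by (intro exI[of _ k] conjI allI impI)
  from someI_ex[OF this] show "1 < \<kappa>" "fst s \<in> I \<Longrightarrow> fst t \<in> I \<Longrightarrow> t \<noteq> inv_letter s \<Longrightarrow> comparable \<kappa> (M s t)"
    unfolding \<kappa>_def[symmetric] by blast+
qed

text \<open>
  The additional letter \<open>r\<close> determines the basis from which the last letter of the word starts; a word
  can be continued by any \<open>r\<close> that does not cancel its last letter.
\<close>

fun path :: "('i \<times> bool) list \<Rightarrow> 'i \<times> bool \<Rightarrow> 'n rmat list" where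
  "path [] r = []"
| "path [s] r = [M s r]"
| "path (s # t # w) r = M s t # path (t # w) r"

definition admissible :: "('i \<times> bool) list \<Rightarrow> 'i \<times> bool \<Rightarrow> bool" where
  "admissible w r \<longleftrightarrow> w \<in> rwords \<and> w \<noteq> [] \<and> fst r \<in> I \<and> r \<noteq> inv_letter (last w)"

abbreviation W :: "('i \<times> bool) list \<Rightarrow> 'i \<times> bool \<Rightarrow> 'n rmat" where
  "W w r \<equiv> mprod (path w r)"

lemma length_path [simp]: "length (path w r) = length w"
  by (induction w r rule: path.induct) auto

lemma path_comparable: "admissible w r \<Longrightarrow> N \<in> set (path w r) \<Longrightarrow> comparable \<kappa> N"
  by (induction w r rule: path.induct)
    (auto simp: admissible_def rwords_def reduced_Cons intro: \<kappa>(2))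

lemma path_append: "v \<noteq> [] \<Longrightarrow> path (v @ w) r = path v (hd (w @ [r])) @ path w r"
proof (induction v "hd (w @ [r])" rule: path.induct)
  case (2 s)
  then show ?case by (cases w) auto
qed auto

lemma path_nonempty: "admissible w r \<Longrightarrow> path w r \<noteq> []"
  by (metis admissible_def length_0_conv length_path)

lemma admissible_STP: "admissible w r \<Longrightarrow> STP (W w r)"
  using path_comparable path_nonempty by (intro STP_mprod) (auto simp: comparable_def)

lemma transition_flag:
  assumes "fst s \<in> I" "fst t \<in> I" "t \<noteq> inv_letter s"
  shows "flag_act (\<rho> (lval s)) (fl (B t ** Z)) = fl (B s ** (M s t ** Z))"
proof -
  have "flag_act (\<rho> (lval s)) (fl (B t ** Z)) = fl (H s ** (B t ** Z))"
    by (rule flag_act_fl[OF rho_closed[OF lval_closed[OF assms(1)]] H[OF assms(1)]])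
  also have "H s ** (B t ** Z) = (H s ** B t) ** Z" by (simp only: matrix_mul_assoc)
  also have "fl \<dots> = fl ((B s ** M s t) ** Z)"
  proof -
    have "- (B s ** M s t) ** Z = - ((B s ** M s t) ** Z)"
      using uminus_mat_mult(1)[of "B s ** M s t"] uminus_mat_mult(1)[of "(B s ** M s t) ** Z"] by (metis matrix_mul_assoc)
    then show ?thesis using transition[OF assms] fl_uminus by fastforce
  qed
  finally show ?thesis by (simp only: matrix_mul_assoc)
qed

lemma W_flag:
  assumes "admissible w r"
  shows "flag_act (\<rho> (val w)) (fl (B r ** Y)) = fl (B (hd w) ** (W w r ** Y))"
  using assms
proof (induction w r arbitrary: Y rule: path.induct)
  case (2 s r)
  then have s: "fst s \<in> I" "fst r \<in> I" "r \<noteq> inv_letter s" by (auto simp: admissible_def rwords_def)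
  have v: "val [s] = lval s" using s by (simp add: val_Cons lval_closed)
  show ?case using transition_flag[OF s] v by simp
next
  case (3 s t w r)
  then have s: "fst s \<in> I" "fst t \<in> I" "t \<noteq> inv_letter s" and a: "admissible (t # w) r"
    by (auto simp: admissible_def rwords_def reduced_Cons)
  have vc: "val (t # w) \<in> carrier F" using a by (intro val_closed) (auto simp: admissible_def rwords_def)
  have st: "admissible [s] t" using s by (auto simp: admissible_def rwords_def reduced_Cons)
  have "\<rho> (val (s # t # w)) = \<rho> (lval s) \<otimes>\<^bsub>PSL\<^esub> \<rho> (val (t # w))"
    using rho_mult[OF lval_closed[OF s(1)] vc] by (simp add: val_Cons)
  moreover obtain R where R: "R \<in> \<rho> (val (t # w))" using PSL_rep(1)[OF rho_closed[OF vc]] by blast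
  ultimately have "flag_act (\<rho> (val (s # t # w))) (fl (B r ** Y)) = fl ((H s ** R) ** (B r ** Y))"
    using flag_act_fl[OF _ PSL_mult_rep[OF H[OF s(1)] R]]
      rho_closed[of "val (s # t # w)"] 3(2) by (auto simp: admissible_def rwords_def)
  also have "\<dots> = flag_act (\<rho> (lval s)) (fl (R ** (B r ** Y)))"
    by (simp add: flag_act_fl[OF rho_closed[OF lval_closed[OF s(1)]] H[OF s(1)]] matrix_mul_assoc)
  also have "fl (R ** (B r ** Y)) = flag_act (\<rho> (val (t # w))) (fl (B r ** Y))"
    by (rule flag_act_fl[OF rho_closed[OF vc] R, symmetric])
  also have "\<dots> = fl (B t ** (W (t # w) r ** Y))" using 3(1)[OF a] by simp
  also have "flag_act (\<rho> (lval s)) \<dots> = fl (B s ** (M s t ** (W (t # w) r ** Y)))"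
    by (rule transition_flag[OF s])
  finally show ?case by (simp add: matrix_mul_assoc)
qed (simp add: admissible_def)

lemma W_flag':
  assumes "admissible w r"
  shows "flag_act (\<rho> (val w)) (fl X) = fl (B (hd w) ** (W w r ** (Binv r ** X)))"
proof -
  have "fst r \<in> I" using assms by (simp add: admissible_def)
  then have "X = B r ** (Binv r ** X)" by (simp add: matrix_mul_assoc Binv)
  then show ?thesis using W_flag[OF assms, of "Binv r ** X"] by simp
qed

lemma decay:
  fixes len :: "nat \<Rightarrow> nat"
  assumes "\<And>N. \<forall>\<^sub>F m in sequentially. N \<le> len m"
  shows "(\<lambda>m. c * (1 - 1 / \<kappa>) ^ (len m - 1)) \<longlonglongrightarrow> 0"
proof -
  have "filterlim (\<lambda>m. len m - 1) sequentially sequentially"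
    unfolding filterlim_at_top
  proof
    fix N show "\<forall>\<^sub>F m in sequentially. N \<le> len m - 1"
      using assms[of "Suc N"] by (rule eventually_mono) simp
  qed
  moreover have "(\<lambda>m. (1 - 1 / \<kappa>) ^ m) \<longlonglongrightarrow> 0"
    by (rule LIMSEQ_power_zero) (use \<kappa>(1) in simp)
  ultimately have "(\<lambda>m. (1 - 1 / \<kappa>) ^ (len m - 1)) \<longlonglongrightarrow> 0" by (rule filterlim_compose[rotated])
  from tendsto_mult_left[OF this, of c] show ?thesis by simp
qed

text \<open>
  Both triangular factors stay bounded while the diagonal gaps tend to 0, so that after passing to a
  subsequence the action has the form required by the contraction criterion; the same factors in
  reverse order describe the inverse elements, with attracting and repelling flags exchanged.
\<close>

theorem contraction_subsequence:
  assumes adm: "\<And>m. admissible (ws m) (r m)"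
    and len: "\<And>N. \<forall>\<^sub>F m in sequentially. N \<le> length (ws m)"
  obtains k a b L K where "strict_mono k" "fst a \<in> I" "fst b \<in> I"
    "\<And>m. hd (ws (k m)) = a" "\<And>m. r (k m) = b"
    "(\<lambda>m. lower_factor (W (ws (k m)) (r (k m)))) \<longlonglongrightarrow> L"
    "lower_unip L" "lower_unip K" "nonneg_initial K"
    "contracting (\<lambda>m. \<rho> (val (ws (k m)))) (fl (B a ** L)) (fl (B b ** upper_factor (trp K) ** reversal))"
    "\<exists>G. contracting (\<lambda>m. \<rho> (inv (val (ws (k m))))) (fl (B b ** upper_factor (trp K) ** reversal)) G"
proof -
  let ?P = "\<lambda>m. W (ws m) (r m)"
  have "range (\<lambda>m. (hd (ws m), r m)) \<subseteq> (I \<times> UNIV) \<times> (I \<times> UNIV)"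
  proof safe
    fix m a e assume "(a, e) = hd (ws m)"
    then have "(a, e) \<in> set (ws m)" using adm[of m] by (simp add: admissible_def)
    then show "a \<in> I" using adm[of m] by (force simp: admissible_def rwords_def)
  next
    fix m a e assume "(a, e) = r m"
    then show "a \<in> I" using adm[of m] by (metis admissible_def fst_conv)
  qed auto
  then have "finite (range (\<lambda>m. (hd (ws m), r m)))" by (rule finite_subset) (use finI in auto)
  then obtain m0 where "infinite {m. (hd (ws m), r m) = (hd (ws m0), r m0)}"
    using pigeonhole_infinite[OF infinite_UNIV_nat, of "\<lambda>m. (hd (ws m), r m)"] by auto
  then obtain k0 :: "nat \<Rightarrow> nat" where k0: "strict_mono k0" "\<And>m. (hd (ws (k0 m)), r (k0 m)) = (hd (ws m0), r m0)"
    using infinite_enumerate[of "{m. (hd (ws m), r m) = (hd (ws m0), r m0)}"] by auto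
  define a b where "a = hd (ws m0)" and "b = r m0"
  have bI: "fst b \<in> I" using adm[of m0] by (simp add: b_def admissible_def)
  have aI: "fst a \<in> I" using adm[of m0] hd_in_set[of "ws m0"] by (auto simp: a_def admissible_def rwords_def)
  have comp: "\<And>m N. N \<in> set (path (ws m) (r m)) \<Longrightarrow> comparable \<kappa> N" using path_comparable adm by blast
  have ne: "path (ws m) (r m) \<noteq> []" for m using path_nonempty adm by blast
  have stp: "STP (?P m)" for m by (rule admissible_STP[OF adm])
  have bound: "\<bar>mn (lower_factor (?P m)) i j\<bar> \<le> \<kappa>" "\<bar>mn (lower_factor (trp (?P m))) i j\<bar> \<le> \<kappa>" if "i < CARD('n)" "j < CARD('n)" for m i j
    using lower_factor_mprod_bound[OF \<kappa>(1) ne[of m] comp[of _ m] that] by blast+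
  obtain L k1 where k1: "strict_mono k1" "(\<lambda>m. lower_factor (?P (k0 (k1 m)))) \<longlonglongrightarrow> L"
    by (rule convergent_matrix_subsequence[of "\<lambda>m. lower_factor (?P (k0 m))" \<kappa>]) (use bound in auto)
  obtain K k2 where k2: "strict_mono k2" "(\<lambda>m. lower_factor (trp (?P (k0 (k1 (k2 m)))))) \<longlonglongrightarrow> K"
    by (rule convergent_matrix_subsequence[of "\<lambda>m. lower_factor (trp (?P (k0 (k1 m))))" \<kappa>]) (use bound in auto)
  define k where "k m = k0 (k1 (k2 m))" for m
  have k: "strict_mono k" unfolding k_def using k0(1) k1(1) k2(1) by (simp add: strict_mono_def)
  have hdk: "hd (ws (k m)) = a" "r (k m) = b" for m using k0(2)[of "k1 (k2 m)"] by (auto simp: a_def b_def k_def)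
  have Llim: "(\<lambda>m. lower_factor (?P (k m))) \<longlonglongrightarrow> L"
    using LIMSEQ_subseq_LIMSEQ[OF k1(2) k2(1)] by (simp add: o_def k_def)
  have Klim: "(\<lambda>m. lower_factor (trp (?P (k m)))) \<longlonglongrightarrow> K" using k2(2) by (simp add: k_def)
  have reg: "regular (?P m)" for m by (rule regular_STP[OF stp])
  have lowL: "lower_unip (lower_factor (?P m))" for m by (rule lower_unip_lower_factor[OF reg])
  have lowK: "lower_unip (lower_factor (trp (?P m)))" for m by (rule lower_unip_lower_factor) (simp add: reg)
  have L: "lower_unip L" by (rule lower_unip_limit[OF Llim lowL])
  have K: "lower_unip K" by (rule lower_unip_limit[OF Klim lowK])
  have nnK: "nonneg_initial K"
    by (rule nonneg_initial_limit[OF Klim K nonneg_initial_lower_factor[OF STP_trp[OF stp]]])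
  have "\<exists>d. (\<forall>i<CARD('n). d i \<noteq> 0) \<and> ?P m = lower_factor (?P m) ** (dg d ** trp (lower_factor (trp (?P m)))) \<and>
      (\<forall>j. Suc j < CARD('n) \<longrightarrow> \<bar>d (Suc j) / d j\<bar> \<le> \<kappa> * (\<kappa> * (1 - 1 / \<kappa>) ^ (length (ws m) - 1)))" for m
    by (rule mprod_factorization[OF \<kappa>(1) ne[of m] comp[of _ m]]) (simp_all only: length_path, blast)
  then obtain d where d: "\<And>m i. i < CARD('n) \<Longrightarrow> d m i \<noteq> 0"
    and P: "\<And>m. ?P m = lower_factor (?P m) ** (dg (d m) ** trp (lower_factor (trp (?P m))))"
    and gap: "\<And>m j. Suc j < CARD('n) \<Longrightarrow> \<bar>d m (Suc j) / d m j\<bar> \<le> \<kappa> * (\<kappa> * (1 - 1 / \<kappa>) ^ (length (ws m) - 1))"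
    by metis
  have gap0: "(\<lambda>m. d (k m) (Suc j) / d (k m) j) \<longlonglongrightarrow> 0" if "Suc j < CARD('n)" for j
  proof (rule Lim_null_comparison)
    show "\<forall>\<^sub>F m in sequentially. norm (d (k m) (Suc j) / d (k m) j) \<le> \<kappa> * \<kappa> * (1 - 1 / \<kappa>) ^ (length (ws (k m)) - 1)"
      using gap[OF that] by (simp add: mult.assoc)
    show "(\<lambda>m. \<kappa> * \<kappa> * (1 - 1 / \<kappa>) ^ (length (ws (k m)) - 1)) \<longlonglongrightarrow> 0"
      by (rule decay) (rule eventually_subseq[OF k len])
  qed
  let ?Us = "\<lambda>m. trp (lower_factor (trp (?P (k m))))"
  let ?U = "trp K"
  have U: "upper_inv ?U" by (rule lower_unip_imp_upper_inv[OF K])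
  have Ulim: "?Us \<longlonglongrightarrow> ?U" by (rule tendsto_trp[OF Klim])
  note Uinv = upper_inv_inverse[OF U]
  note Ba = Binv[OF aI] and Bb = Binv[OF bI]
  have rho: "\<rho> (val (ws m)) \<in> carrier PSL" "val (ws m) \<in> carrier F" for m
    using adm[of m] rho_closed by (auto simp: admissible_def rwords_def)
  have act: "flag_act (\<rho> (val (ws (k m)))) (fl X) = fl (B a ** (lower_factor (?P (k m)) ** (dg (d (k m)) ** (?Us m ** (Binv b ** X)))))" for m X
  proof -
    have "flag_act (\<rho> (val (ws (k m)))) (fl X) = fl (B a ** (?P (k m) ** (Binv b ** X)))"
      using W_flag'[OF adm[of "k m"]] hdk by simp
    then show ?thesis by (subst (asm) P) (simp only: matrix_mul_assoc)
  qed
  have c1: "contracting (\<lambda>m. \<rho> (val (ws (k m)))) (fl (B a ** L)) (fl ((B b ** upper_factor ?U) ** reversal))"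
  proof (rule contracting_LDU[where Ls = "\<lambda>m. lower_factor (?P (k m))" and d = "\<lambda>m. d (k m)" and Us = ?Us and C = "Binv b" and U = ?U])
    show "invertible (B a)" by (rule B[OF aI])
    show "invertible L" by (rule regular_invertible[OF regular_lower_unip[OF L]])
    have "(B b ** upper_factor ?U) ** (?U ** Binv b) = B b ** (upper_factor ?U ** ?U) ** Binv b" by (simp only: matrix_mul_assoc)
    then show "(B b ** upper_factor ?U) ** (?U ** Binv b) = mat 1" by (simp add: Uinv Bb)
    have "(?U ** Binv b) ** (B b ** upper_factor ?U) = ?U ** (Binv b ** B b) ** upper_factor ?U" by (simp only: matrix_mul_assoc)
    then show "(?U ** Binv b) ** (B b ** upper_factor ?U) = mat 1" by (simp add: Uinv Bb)
  qed (use act Llim Ulim d gap0 in auto)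
  let ?Li = "\<lambda>L. trp (upper_factor (trp L)) :: 'n rmat"
  let ?d' = "\<lambda>m i. 1 / d (k m) (CARD('n) - Suc i)"
  have Uinv_m: "upper_factor (?Us m) ** ?Us m = mat 1" for m
    by (rule upper_inv_inverse(3)[OF lower_unip_imp_upper_inv[OF lowK]])
  have act': "flag_act (\<rho> (inv (val (ws (k m))))) (fl X) =
      fl (B b ** ((upper_factor (?Us m) ** reversal) ** (dg (?d' m) ** ((reversal ** ?Li (lower_factor (?P (k m)))) ** (Binv a ** X)))))"
    if X: "invertible X" for m X
  proof -
    define Y where "Y = B b ** ((upper_factor (?Us m) ** reversal) ** (dg (?d' m) ** ((reversal ** ?Li (lower_factor (?P (k m)))) ** (Binv a ** X))))"
    let ?N = "B a ** (lower_factor (?P (k m)) ** (dg (d (k m)) ** (?Us m ** Binv b)))"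
    have inv2: "dg (d (k m)) ** (reversal ** dg (?d' m) ** reversal) = (mat 1 :: 'n rmat)"
      by (rule matrix_left_right_inverse[THEN iffD1, OF dg_inverse_reflected[OF d]])
    have NY: "?N ** Y = X"
      unfolding Y_def
      by (rule cancel_factors[OF Ba(1) lower_unip_inverse(1)[OF lowL] inv2
            upper_inv_inverse(2)[OF lower_unip_imp_upper_inv[OF lowK]] Bb(2)])
    have "invertible Y" by (rule invertible_right_factor[OF NY X])
    have "fl X = flag_act (\<rho> (val (ws (k m)))) (fl Y)"
    proof -
      have "fl (?N ** Y) = flag_act (\<rho> (val (ws (k m)))) (fl Y)" by (simp only: act matrix_mul_assoc)
      then show ?thesis by (simp only: NY)
    qed
    then have "flag_act (\<rho> (inv (val (ws (k m))))) (fl X) = fl Y"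
      using flag_act_inv(2)[OF rho(1) fl_in_flags[OF \<open>invertible Y\<close>]] by (simp add: rho_inv[OF rho(2)])
    then show ?thesis by (simp add: Y_def)
  qed
  have "contracting (\<lambda>m. \<rho> (inv (val (ws (k m))))) (fl (B b ** (upper_factor ?U ** reversal))) (fl ((B a ** (L ** reversal)) ** reversal))"
  proof (rule contracting_LDU[where Ls = "\<lambda>m. upper_factor (?Us m) ** reversal" and d = ?d' and Us = "\<lambda>m. reversal ** ?Li (lower_factor (?P (k m)))"
        and C = "Binv a" and U = "reversal ** ?Li L"])
    have rU: "regular ?U" using regular_lower_unip[OF K] by simp
    have rL: "regular (trp L)" using regular_lower_unip[OF L] by simp
    show "invertible (B b)" by (rule B[OF bI])
    show "(\<lambda>m. upper_factor (?Us m) ** reversal) \<longlonglongrightarrow> upper_factor ?U ** reversal"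
      by (intro tendsto_mult_matrix tendsto_upper_factor[OF Ulim rU] tendsto_const)
    show "(\<lambda>m. reversal ** ?Li (lower_factor (?P (k m)))) \<longlonglongrightarrow> reversal ** ?Li L"
      by (intro tendsto_mult_matrix tendsto_trp tendsto_upper_factor[OF tendsto_trp[OF Llim] rL] tendsto_const)
    show "invertible (upper_factor ?U ** reversal)"
      by (intro invertible_mult invertible_reversal upper_inv_invertible Uinv(1))
    have "(B a ** (L ** reversal)) ** ((reversal ** ?Li L) ** Binv a) = B a ** (L ** (reversal ** reversal) ** ?Li L) ** Binv a"
      by (simp only: matrix_mul_assoc)
    then show "(B a ** (L ** reversal)) ** ((reversal ** ?Li L) ** Binv a) = mat 1"
      by (simp add: lower_unip_inverse(1)[OF L] Ba)
    then show "((reversal ** ?Li L) ** Binv a) ** (B a ** (L ** reversal)) = mat 1"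
      using matrix_left_right_inverse by blast
    fix m i assume "i < CARD('n)"
    then show "?d' m i \<noteq> 0" using d by simp
  next
    fix j assume j: "Suc j < CARD('n)"
    define l where "l = CARD('n) - Suc (Suc j)"
    have l: "Suc l < CARD('n)" "CARD('n) - Suc j = Suc l" using j by (auto simp: l_def)
    then show "(\<lambda>m. ?d' m (Suc j) / ?d' m j) \<longlonglongrightarrow> 0"
      using gap0[OF l(1)] by (simp add: l_def[symmetric] l(2))
  qed (use act' in auto)
  moreover have "B b ** (upper_factor ?U ** reversal) = B b ** upper_factor ?U ** reversal" by (simp only: matrix_mul_assoc)
  ultimately have c2: "\<exists>G. contracting (\<lambda>m. \<rho> (inv (val (ws (k m))))) (fl (B b ** upper_factor ?U ** reversal)) G" by auto
  show thesis by (rule that[OF k aI bI hdk(1) hdk(2) Llim L K nnK c1 c2])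
qed

end

section \<open>The boundary map\<close>

text \<open>
  The open counterpart of \<open>nonneg_initial\<close>: it holds for limits along infinite words and defines an
  open set of flags for each letter.
\<close>

definition positive_initial :: "('n::{finite,linorder}) rmat \<Rightarrow> bool" where
  "positive_initial L \<longleftrightarrow> (\<forall>k\<le>CARD('n). \<forall>J\<in>strict_lists CARD('n) k. 0 < tminor L J [0..<k])"

lemma positive_initial_nonneg: "positive_initial L \<Longrightarrow> nonneg_initial L"
  for L :: "('n::{finite,linorder}) rmat"
  using initial_strict by (auto simp: positive_initial_def nonneg_initial_def intro: less_imp_le)

lemma open_positive_initial: "open {L :: ('n::{finite,linorder}) rmat. positive_initial L}"
proof (rule open_eventually_nhds)
  fix L :: "'n rmat" assume L: "L \<in> {L. positive_initial L}"
  have "\<forall>\<^sub>F y in nhds L. 0 < tminor y J [0..<k]" if "k \<in> {..CARD('n)}" "J \<in> strict_lists CARD('n) k" for k J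
  proof (rule order_tendstoD(1)[OF tendsto_tminor])
    show "((\<lambda>y. y) \<longlongrightarrow> L) (nhds L)" by (rule filterlim_ident)
    show "0 < tminor L J [0..<k]" using L that by (simp add: positive_initial_def)
  qed
  then have "\<forall>\<^sub>F y in nhds L. \<forall>k\<in>{..CARD('n)}. \<forall>J\<in>strict_lists CARD('n) k. 0 < tminor y J [0..<k]"
    by (intro eventually_ball_finite ballI finite_strict_lists) auto
  then show "\<forall>\<^sub>F y in nhds L. y \<in> {L. positive_initial L}"
    by (rule eventually_mono) (auto simp: positive_initial_def)
qed

lemma flag_not_self_transverse:
  fixes F :: "('n::{finite,linorder}) flag"
  assumes "2 \<le> CARD('n)" "F \<in> flags"
  shows "\<not> transverse F F"
proof
  assume "transverse F F"
  moreover have "1 \<le> CARD('n)" using assms(1) by simp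
  ultimately have "F 1 \<inter> F (CARD('n) - 1) = {0}" unfolding transverse_def by blast
  moreover have "F 1 \<subseteq> F (CARD('n) - 1)"
    using assms monoD[of F 1 "CARD('n) - 1"] by (simp add: flags_def)
  ultimately have "F 1 = {0}" by blast
  moreover have "dim (F 1) = min 1 CARD('n)" using assms(2) by (auto simp: flags_def)
  ultimately show False using assms(1) by simp
qed

context schottky_matrices
begin

lemma admissible_prefix:
  assumes "admissible (v @ u) r" "v \<noteq> []"
  shows "admissible v (hd (u @ [r]))"
  using assms by (cases u) (auto simp: admissible_def rwords_def reduced_append)

lemma lower_factor_prefix_estimate:
  assumes adm: "admissible (v @ u) r" and v: "v \<noteq> []" and ij: "i < CARD('n)" "j < CARD('n)"
  shows "\<bar>mn (lower_factor (W (v @ u) r)) i j - mn (lower_factor (W v (hd (u @ [r])))) i j\<bar> \<le> \<kappa> * (1 - 1 / \<kappa>) ^ (length v - 1)"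
proof (cases "u = []")
  case True
  then show ?thesis using \<kappa>(1) by simp
next
  case False
  have av: "admissible v (hd (u @ [r]))" by (rule admissible_prefix[OF adm v])
  have au: "admissible u r" using adm False by (auto simp: admissible_def rwords_def reduced_append)
  have "W (v @ u) r = W v (hd (u @ [r])) ** W u r" by (simp only: path_append[OF v] mprod_append)
  moreover have "\<bar>mn (lower_factor (W v (hd (u @ [r])) ** W u r)) i j - mn (lower_factor (W v (hd (u @ [r])))) i j\<bar>
      \<le> \<kappa> * (1 - 1 / \<kappa>) ^ (length (path v (hd (u @ [r]))) - 1)"
    by (rule lower_factor_mprod_limit(2)[OF \<kappa>(1) path_nonempty[OF av] path_comparable[OF av]
          nonneg_initial_STP[OF admissible_STP[OF au]] ij])
  ultimately show ?thesis by simp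
qed

abbreviation prefix_lower_factor :: "(nat \<Rightarrow> 'i \<times> bool) \<Rightarrow> nat \<Rightarrow> 'n rmat" where
  "prefix_lower_factor \<omega> m \<equiv> lower_factor (W (map \<omega> [0..<m]) (\<omega> m))"

lemma prefix_admissible:
  assumes "\<omega> \<in> inf_words" "0 < m"
  shows "admissible (map \<omega> [0..<m]) (\<omega> m)"
proof -
  obtain k where m: "m = Suc k" using assms(2) by (cases m) auto
  have "map \<omega> [0..<m] \<in> rwords" using assms(1) by (simp add: inf_words_def)
  moreover have "last (map \<omega> [0..<m]) = \<omega> k" by (simp add: m)
  ultimately show ?thesis
    using inf_words_not_inverse[OF assms(1), of k] inf_words_letter[OF assms(1), of m] by (simp add: admissible_def m)
qed

lemma prefix_lower_factor_estimate:
  assumes w: "\<omega> \<in> inf_words" and m: "0 < m" "m \<le> p" and ij: "i < CARD('n)" "j < CARD('n)"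
  shows "\<bar>mn (prefix_lower_factor \<omega> p) i j - mn (prefix_lower_factor \<omega> m) i j\<bar> \<le> \<kappa> * (1 - 1 / \<kappa>) ^ (m - 1)"
proof -
  have "[0..<p] = [0..<m] @ [m..<p]" using upt_add_eq_append[of 0 m "p - m"] m by simp
  then have e: "map \<omega> [0..<p] = map \<omega> [0..<m] @ map \<omega> [m..<p]" by simp
  have h: "hd (map \<omega> [m..<p] @ [\<omega> p]) = \<omega> m" using m by (cases "m = p") (auto simp: upt_rec[of m p])
  show ?thesis
    using lower_factor_prefix_estimate[OF prefix_admissible[OF w, of p, unfolded e] _ ij] m by (simp add: h e)
qed

lemma prefix_lower_factor_bounds:
  assumes w: "\<omega> \<in> inf_words" and m: "0 < m"
  shows "i < CARD('n) \<Longrightarrow> j < CARD('n) \<Longrightarrow> \<bar>mn (prefix_lower_factor \<omega> m) i j\<bar> \<le> \<kappa>"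
    "lower_unip (prefix_lower_factor \<omega> m)"
    "k \<le> CARD('n) \<Longrightarrow> J \<in> strict_lists CARD('n) k \<Longrightarrow> 1 / \<kappa> \<le> tminor (prefix_lower_factor \<omega> m) J [0..<k]"
proof -
  note a = prefix_admissible[OF w m]
  have reg: "regular (W (map \<omega> [0..<m]) (\<omega> m))" by (rule regular_STP[OF admissible_STP[OF a]])
  show "lower_unip (prefix_lower_factor \<omega> m)" by (rule lower_unip_lower_factor[OF reg])
  show "\<bar>mn (prefix_lower_factor \<omega> m) i j\<bar> \<le> \<kappa>" if "i < CARD('n)" "j < CARD('n)"
    by (rule lower_factor_mprod_bound(1)[OF \<kappa>(1) path_nonempty[OF a] path_comparable[OF a] that])
  assume k: "k \<le> CARD('n)" and J: "J \<in> strict_lists CARD('n) k"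
  then have l: "length J = k" by (simp add: strict_lists_def)
  note ini = initial_strict[OF k]
  show "1 / \<kappa> \<le> tminor (prefix_lower_factor \<omega> m) J [0..<k]"
    unfolding tminor_lower_factor[OF reg l k]
    by (rule minor_ratio_bounds(1)[OF \<kappa>(1) path_nonempty[OF a] path_comparable[OF a] J ini ini ini])
qed

definition approximates :: "(nat \<Rightarrow> 'i \<times> bool) \<Rightarrow> 'n rmat \<Rightarrow> bool" where
  "approximates \<omega> L \<longleftrightarrow> (\<forall>m>0. \<forall>i<CARD('n). \<forall>j<CARD('n). \<bar>mn L i j - mn (prefix_lower_factor \<omega> m) i j\<bar> \<le> \<kappa> * (1 - 1 / \<kappa>) ^ (m - 1))"

text \<open>
  The unipotent factors along the prefixes of \<open>\<omega>\<close> form a Cauchy sequence.  Strict positivity survives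
  in the limit because the ratios of minors are at least \<open>1 / \<kappa>\<close>.
\<close>

lemma end_matrix_exists:
  assumes w: "\<omega> \<in> inf_words"
  shows "\<exists>L. lower_unip L \<and> positive_initial L \<and> approximates \<omega> L"
proof -
  note b = prefix_lower_factor_bounds[OF w zero_less_Suc]
  obtain L r where r: "strict_mono r" and L: "(\<lambda>m. prefix_lower_factor \<omega> (Suc (r m))) \<longlonglongrightarrow> L"
    by (rule convergent_matrix_subsequence[of "\<lambda>m. prefix_lower_factor \<omega> (Suc m)" \<kappa>]) (use b(1) in auto)
  have "lower_unip L" by (rule lower_unip_limit[OF L b(2)])
  moreover have "positive_initial L"
    unfolding positive_initial_def
  proof (intro allI impI ballI)
    fix k J assume kJ: "k \<le> CARD('n)" "J \<in> strict_lists CARD('n) k"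
    have "1 / \<kappa> \<le> tminor L J [0..<k]"
      by (rule LIMSEQ_le_const[OF tendsto_tminor[OF L]], rule exI, intro allI impI) (rule b(3)[OF kJ])
    moreover have "0 < 1 / \<kappa>" using \<kappa>(1) by simp
    ultimately show "0 < tminor L J [0..<k]" by linarith
  qed
  moreover
  have "\<bar>mn L i j - mn (prefix_lower_factor \<omega> m) i j\<bar> \<le> \<kappa> * (1 - 1 / \<kappa>) ^ (m - 1)"
    if "0 < m" "i < CARD('n)" "j < CARD('n)" for m i j
  proof (rule LIMSEQ_le_const2)
    show "(\<lambda>p. \<bar>mn (prefix_lower_factor \<omega> (Suc (r p))) i j - mn (prefix_lower_factor \<omega> m) i j\<bar>) \<longlonglongrightarrow> \<bar>mn L i j - mn (prefix_lower_factor \<omega> m) i j\<bar>"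
      by (intro tendsto_rabs tendsto_diff tendsto_mn[OF L] tendsto_const)
    have "m \<le> Suc (r p)" if "m \<le> p" for p using seq_suble[OF r, of p] that by simp
    then show "\<exists>N. \<forall>p\<ge>N. \<bar>mn (prefix_lower_factor \<omega> (Suc (r p))) i j - mn (prefix_lower_factor \<omega> m) i j\<bar> \<le> \<kappa> * (1 - 1 / \<kappa>) ^ (m - 1)"
      by (intro exI[of _ m] allI impI prefix_lower_factor_estimate[OF w that(1) _ that(2,3)])
  qed
  then have "approximates \<omega> L" by (simp add: approximates_def)
  ultimately show ?thesis by blast
qed

definition end_matrix :: "(nat \<Rightarrow> 'i \<times> bool) \<Rightarrow> 'n rmat" where
  "end_matrix \<omega> = (SOME L. lower_unip L \<and> positive_initial L \<and>
    approximates \<omega> L)"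

lemma end_matrix:
  assumes "\<omega> \<in> inf_words"
  shows "lower_unip (end_matrix \<omega>)" "positive_initial (end_matrix \<omega>)"
    "0 < m \<Longrightarrow> i < CARD('n) \<Longrightarrow> j < CARD('n) \<Longrightarrow>
      \<bar>mn (end_matrix \<omega>) i j - mn (prefix_lower_factor \<omega> m) i j\<bar> \<le> \<kappa> * (1 - 1 / \<kappa>) ^ (m - 1)"
proof -
  have e: "lower_unip (end_matrix \<omega>) \<and> positive_initial (end_matrix \<omega>) \<and> approximates \<omega> (end_matrix \<omega>)"
    unfolding end_matrix_def by (rule someI_ex[OF end_matrix_exists[OF assms]])
  then show "lower_unip (end_matrix \<omega>)" "positive_initial (end_matrix \<omega>)" by blast+
  show "\<bar>mn (end_matrix \<omega>) i j - mn (prefix_lower_factor \<omega> m) i j\<bar> \<le> \<kappa> * (1 - 1 / \<kappa>) ^ (m - 1)"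
    if "0 < m" "i < CARD('n)" "j < CARD('n)"
    using e that by (simp add: approximates_def)
qed

definition end_flag :: "(nat \<Rightarrow> 'i \<times> bool) \<Rightarrow> 'n flag" where
  "end_flag \<omega> = fl (B (\<omega> 0) ** end_matrix \<omega>)"

lemma end_matrix_invertible: "\<omega> \<in> inf_words \<Longrightarrow> invertible (end_matrix \<omega>)"
  by (rule regular_invertible[OF regular_lower_unip[OF end_matrix(1)]])

lemma end_flag_in_flags: "\<omega> \<in> inf_words \<Longrightarrow> end_flag \<omega> \<in> flags"
  unfolding end_flag_def by (intro fl_in_flags invertible_mult B inf_words_letter end_matrix_invertible)

lemma lower_factor_tendsto_end_matrix:
  assumes w: "\<omega> \<in> inf_words" and adm: "\<And>m. admissible (ws m) (r m)"
    and agree: "\<And>N. \<forall>\<^sub>F m in sequentially. take N (ws m) = map \<omega> [0..<N]"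
  shows "(\<lambda>m. lower_factor (W (ws m) (r m))) \<longlonglongrightarrow> end_matrix \<omega>"
proof (rule tendsto_matrixI)
  fix i j assume ij: "i < CARD('n)" "j < CARD('n)"
  let ?a = "\<lambda>m. mn (lower_factor (W (ws m) (r m))) i j"
  show "?a \<longlonglongrightarrow> mn (end_matrix \<omega>) i j"
  proof (rule LIMSEQ_I)
    fix e :: real assume e: "0 < e"
    have "(\<lambda>m. 2 * \<kappa> * (1 - 1 / \<kappa>) ^ (m - 1)) \<longlonglongrightarrow> 0"
      by (rule decay) (rule eventually_ge_at_top)
    then have "\<forall>\<^sub>F m in sequentially. 2 * \<kappa> * (1 - 1 / \<kappa>) ^ (m - 1) < e \<and> 0 < m"
      using e by (intro eventually_conj order_tendstoD(2)[of _ 0] eventually_gt_at_top)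
    then obtain N where N: "2 * \<kappa> * (1 - 1 / \<kappa>) ^ (N - 1) < e" "0 < N"
      using eventually_happens'[OF sequentially_bot] by blast
    have "\<bar>?a m - mn (end_matrix \<omega>) i j\<bar> < e" if t: "take (Suc N) (ws m) = map \<omega> [0..<Suc N]" for m
    proof -
      define v where "v = map \<omega> [0..<N]"
      define u where "u = \<omega> N # drop (Suc N) (ws m)"
      have ws: "ws m = v @ u" using append_take_drop_id[of "Suc N" "ws m"] t by (simp add: u_def v_def)
      have "v \<noteq> []" "length v = N" using N(2) by (simp_all add: v_def)
      then have "\<bar>?a m - mn (prefix_lower_factor \<omega> N) i j\<bar> \<le> \<kappa> * (1 - 1 / \<kappa>) ^ (N - 1)"
        using lower_factor_prefix_estimate[OF adm[of m, unfolded ws] _ ij] by (simp add: ws) (simp add: u_def v_def)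
      moreover have "\<bar>mn (end_matrix \<omega>) i j - mn (prefix_lower_factor \<omega> N) i j\<bar> \<le> \<kappa> * (1 - 1 / \<kappa>) ^ (N - 1)"
        by (rule end_matrix(3)[OF w N(2) ij])
      ultimately show ?thesis using N(1) by linarith
    qed
    then have "\<forall>\<^sub>F m in sequentially. \<bar>?a m - mn (end_matrix \<omega>) i j\<bar> < e"
      using agree[of "Suc N"] by (rule eventually_mono[rotated]) blast
    then show "\<exists>n0. \<forall>m\<ge>n0. norm (?a m - mn (end_matrix \<omega>) i j) < e"
      by (simp add: eventually_sequentially)
  qed
qed

text \<open>
  As attracting flags are unique, this describes \<open>end_flag \<omega>\<close> in terms of the dynamics alone; it
  yields the equivariance of the boundary map and identifies its image with the limit set.
\<close>

lemma end_flag_contracting: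
  assumes w: "\<omega> \<in> inf_words" and u: "u \<in> bd \<omega>"
  obtains k Fm where "strict_mono k" "contracting (\<lambda>m. \<rho> (u (k m))) (end_flag \<omega>) Fm"
proof -
  have uc: "u m \<in> carrier F" for m using u by (auto simp: bd_def)
  have ends: "ends_at u \<omega>" using u by (simp add: bd_def)
  have "\<forall>\<^sub>F m in sequentially. 1 \<le> length (nf (u m))" by (rule ends_at_length[OF ends])
  then obtain N where N: "\<And>m. N \<le> m \<Longrightarrow> 1 \<le> length (nf (u m))" unfolding eventually_sequentially by blast
  define v where "v m = nf (u (m + N))" for m
  have adm: "admissible (v m) (last (v m))" for m
  proof -
    have "v m \<noteq> []" using N[of "m + N"] by (auto simp: v_def)
    moreover have "v m \<in> rwords" using nf[OF uc] by (simp add: v_def)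
    ultimately show ?thesis using last_in_set[of "v m"] by (auto simp: admissible_def rwords_def)
  qed
  have agree: "\<forall>\<^sub>F m in sequentially. take K (v m) = map \<omega> [0..<K]" for K
  proof -
    have "\<forall>\<^sub>F m in sequentially. take K (nf (u m)) = map \<omega> [0..<K]" using ends by (simp add: ends_at_def)
    then show ?thesis unfolding v_def by (rule sequentially_offset)
  qed
  have len: "\<forall>\<^sub>F m in sequentially. K \<le> length (v m)" for K
    using ends_at_length[OF ends, of K] unfolding v_def by (rule sequentially_offset)
  obtain k a b L K where k: "strict_mono k" and a: "\<And>m. hd (v (k m)) = a"
    and L: "(\<lambda>m. lower_factor (W (v (k m)) (last (v (k m))))) \<longlonglongrightarrow> L"
    and c: "contracting (\<lambda>m. \<rho> (val (v (k m)))) (fl (B a ** L)) (fl (B b ** upper_factor (trp K) ** reversal))"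
    by (rule contraction_subsequence[OF adm len]) blast
  have "(\<lambda>m. lower_factor (W (v (k m)) (last (v (k m))))) \<longlonglongrightarrow> end_matrix \<omega>"
    using lower_factor_tendsto_end_matrix[OF w adm agree] LIMSEQ_subseq_LIMSEQ[OF _ k] by (force simp: o_def)
  then have "L = end_matrix \<omega>" using L LIMSEQ_unique by blast
  moreover have "a = \<omega> 0"
  proof -
    have "\<forall>\<^sub>F m in sequentially. take 1 (v (k m)) = map \<omega> [0..<1]"
      by (rule eventually_subseq[OF k agree])
    then obtain m where "take 1 (v (k m)) = map \<omega> [0..<1]"
      using eventually_happens'[OF sequentially_bot] by blast
    then show ?thesis using a[of m] by (cases "v (k m)") auto
  qed
  moreover have "val (v m) = u (m + N)" for m using nf[OF uc] by (simp add: v_def)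
  ultimately have "contracting (\<lambda>m. \<rho> (u (k m + N))) (end_flag \<omega>) (fl (B b ** upper_factor (trp K) ** reversal))"
    using c by (simp add: end_flag_def)
  moreover have "strict_mono (\<lambda>m. k m + N)" using k by (simp add: strict_mono_def)
  ultimately show thesis by (rule that[rotated])
qed

end

context schottky_matrices
begin

lemma bd_subseq: "u \<in> bd \<omega> \<Longrightarrow> strict_mono k \<Longrightarrow> (\<lambda>m. u (k m)) \<in> bd \<omega>"
  using eventually_subseq by (fastforce simp: bd_def ends_at_def)

lemma end_flag_eqI:
  assumes w: "\<omega> \<in> inf_words" and u: "u \<in> bd \<omega>" and c: "contracting (\<lambda>m. \<rho> (u m)) Fp Fm"
  shows "end_flag \<omega> = Fp"
proof -
  obtain k G where k: "strict_mono k" and G: "contracting (\<lambda>m. \<rho> (u (k m))) (end_flag \<omega>) G"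
    by (rule end_flag_contracting[OF w u])
  show ?thesis by (rule contracting_unique[OF G contracting_subseq[OF c k]])
qed

lemma bd_closed: "u \<in> bd \<omega> \<Longrightarrow> u i \<in> carrier F"
  by (auto simp: bd_def)

lemma boundary_act_one [simp]: "boundary_act F \<one> (bd \<omega>) = bd \<omega>"
  using bd_closed by (simp add: boundary_act_def)

lemma boundary_act_mult:
  assumes "y \<in> carrier F" "z \<in> carrier F"
  shows "boundary_act F (y \<otimes> z) (bd \<omega>) = boundary_act F y (boundary_act F z (bd \<omega>))"
proof -
  have "(\<lambda>i. y \<otimes> z \<otimes> u i) = (\<lambda>i. y \<otimes> (z \<otimes> u i))" if "u \<in> bd \<omega>" for u
    using bd_closed[OF that] assms by (simp add: m_assoc)
  then show ?thesis unfolding boundary_act_def by (auto simp: image_iff)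
qed

lemma boundary_act_letter:
  assumes s: "fst s \<in> I" and w: "\<omega> \<in> inf_words"
  shows "\<exists>\<eta>\<in>inf_words. boundary_act F (lval s) (bd \<omega>) = bd \<eta>"
proof -
  have r: "[t] \<in> rwords" "val [t] = lval t" if "fst t \<in> I" for t
    using that by (auto simp: rwords_def reduced_Cons val_Cons lval_closed)
  show ?thesis
  proof (cases "\<omega> 0 = inv_letter s")
    case False
    then show ?thesis
      using boundary_act_bd[OF w r(1)[OF s]] conc_inf_words[OF w r(1)[OF s]] r(2)[OF s] by auto
  next
    case True
    define \<eta> where "\<eta> = (\<lambda>k. \<omega> (k + 1))"
    have \<eta>: "\<eta> \<in> inf_words" unfolding \<eta>_def by (rule drop_inf_words[OF w])
    have s': "fst (inv_letter s) \<in> I" using s by simp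
    have "conc [inv_letter s] \<eta> = \<omega>" using conc_drop[of \<omega> 1] True by (simp add: \<eta>_def)
    moreover have "\<eta> 0 \<noteq> inv_letter (inv_letter s)"
      using inf_words_not_inverse[OF w, of 0] True by (simp add: \<eta>_def)
    ultimately have "bd \<omega> = boundary_act F (lval (inv_letter s)) (bd \<eta>)"
      using boundary_act_bd[OF \<eta> r(1)[OF s']] r(2)[OF s'] by simp
    then have "boundary_act F (lval s) (bd \<omega>) = boundary_act F (lval s \<otimes> lval (inv_letter s)) (bd \<eta>)"
      using boundary_act_mult[OF lval_closed[OF s] lval_closed[OF s']] by simp
    also have "lval s \<otimes> lval (inv_letter s) = \<one>" by (simp add: lval_inv[OF s] lval_closed[OF s])
    finally show ?thesis using \<eta> by auto
  qed
qed

lemma boundary_act_inf_words: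
  assumes y: "y \<in> carrier F" and w: "\<omega> \<in> inf_words"
  shows "\<exists>\<eta>\<in>inf_words. boundary_act F y (bd \<omega>) = bd \<eta>"
proof -
  have "\<exists>\<eta>\<in>inf_words. boundary_act F (val v) (bd \<omega>) = bd \<eta>" if "fst ` set v \<subseteq> I" for v
    using that
  proof (induction v)
    case Nil
    show ?case using w by auto
  next
    case (Cons s v)
    then obtain \<eta> where \<eta>: "\<eta> \<in> inf_words" "boundary_act F (val v) (bd \<omega>) = bd \<eta>" by auto
    have sv: "fst s \<in> I" "val v \<in> carrier F" using Cons.prems by auto
    then show ?case
      using boundary_act_mult[OF lval_closed[OF sv(1)] sv(2)] boundary_act_letter[OF sv(1) \<eta>(1)] \<eta>(2)
      by (simp add: val_Cons)
  qed
  then show ?thesis using nf[OF y] by (force simp: rwords_def)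
qed

text \<open>
  Translating a contracting sequence by \<open>y\<close> translates its attracting flag, and the translated group
  elements converge to the translated end.
\<close>

lemma end_flag_equivariant:
  assumes y: "y \<in> carrier F" and w: "\<omega> \<in> inf_words" and e: "\<eta> \<in> inf_words"
    and act: "boundary_act F y (bd \<omega>) = bd \<eta>"
  shows "end_flag \<eta> = flag_act (\<rho> y) (end_flag \<omega>)"
proof -
  define u where "u i = val (map \<omega> [0..<i])" for i
  have u: "u \<in> bd \<omega>" unfolding u_def by (rule pref_ends_at[OF w])
  have uc: "u i \<in> carrier F" for i using u by (auto simp: bd_def)
  obtain k G where k: "strict_mono k" and G: "contracting (\<lambda>m. \<rho> (u (k m))) (end_flag \<omega>) G"
    by (rule end_flag_contracting[OF w u])
  have "contracting (\<lambda>m. \<rho> y \<otimes>\<^bsub>PSL\<^esub> \<rho> (u (k m))) (flag_act (\<rho> y) (end_flag \<omega>)) G"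
    by (rule contracting_translate[OF rho_closed[OF y] rho_closed[OF uc] G])
  then have c: "contracting (\<lambda>m. \<rho> (y \<otimes> u (k m))) (flag_act (\<rho> y) (end_flag \<omega>)) G"
    by (simp only: rho_mult[OF y uc])
  have "(\<lambda>i. y \<otimes> u i) \<in> bd \<eta>" using u act by (auto simp: boundary_act_def)
  then have "(\<lambda>m. y \<otimes> u (k m)) \<in> bd \<eta>" using bd_subseq[OF _ k] by fast
  then show ?thesis by (rule end_flag_eqI[OF e _ c])
qed

text \<open>
  Since \<open>a \<noteq> \<eta> 0\<close>, the inverses of the prefixes of \<open>\<eta>\<close> can be continued by the letter \<open>a\<close>.  The flag
  they repel is the one attracting the prefixes themselves, so that \<open>end_flag \<eta>\<close> is the opposite flag in
  a basis \<open>B a ** upper_factor (trp K)\<close> with nonnegative \<open>K\<close>.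
\<close>

lemma transverse_end_flag:
  assumes a: "fst a \<in> I" "a \<noteq> \<eta> 0" and e: "\<eta> \<in> inf_words" and Y: "nonneg_initial Y"
  shows "transverse (fl (B a ** Y)) (end_flag \<eta>)"
proof -
  define ws where "ws m = inv_word (map \<eta> [0..<Suc m])" for m
  have pr: "map \<eta> [0..<Suc m] \<in> rwords" for m using e unfolding inf_words_def by blast
  have "admissible (ws m) a" for m
  proof -
    have "ws m \<in> rwords" "ws m \<noteq> []" using rwords_inv[OF pr] by (simp_all add: ws_def)
    moreover have "last (ws m) = inv_letter (\<eta> 0)"
      unfolding ws_def by (subst last_inv_word) (simp_all add: hd_map del: upt_Suc)
    ultimately show ?thesis using a by (auto simp: admissible_def)
  qed
  moreover have "\<forall>\<^sub>F m in sequentially. N \<le> length (ws m)" for N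
    by (rule eventually_sequentiallyI[of N]) (simp add: ws_def)
  ultimately obtain k b K G where k: "strict_mono k" and b: "\<And>m. a = b"
    and K: "lower_unip K" "nonneg_initial K"
    and c: "contracting (\<lambda>m. \<rho> (inv (val (ws (k m))))) (fl (B b ** upper_factor (trp K) ** reversal)) G"
    by (rule contraction_subsequence[of ws "\<lambda>_. a"]) blast
  have "inv (val (ws m)) = val (map \<eta> [0..<Suc m])" for m
  proof -
    have "val (map \<eta> [0..<Suc m]) \<in> carrier F" using pr[of m] by (intro val_closed) (simp add: rwords_def)
    moreover have "val (ws m) = inv (val (map \<eta> [0..<Suc m]))"
      unfolding ws_def using pr[of m] by (intro val_inv_word) (simp add: rwords_def)
    ultimately show ?thesis by simp
  qed
  then have c': "contracting (\<lambda>m. \<rho> (val (map \<eta> [0..<Suc (k m)]))) (fl (B b ** upper_factor (trp K) ** reversal)) G"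
    using c by simp
  have "strict_mono (\<lambda>m. Suc (k m))" using k by (simp add: strict_mono_def)
  then have "(\<lambda>m. val (map \<eta> [0..<Suc (k m)])) \<in> bd \<eta>" by (rule bd_subseq[OF pref_ends_at[OF e]])
  then have z: "end_flag \<eta> = fl (B a ** upper_factor (trp K) ** reversal)"
    using end_flag_eqI[OF e _ c'] b by simp
  have U: "upper_inv (trp K)" by (rule lower_unip_imp_upper_inv[OF K(1)])
  note Ui = upper_inv_inverse[OF U]
  have reg: "regular (trp K ** Y)" by (rule regular_trp_mult[OF K(2) Y])
  have V: "invertible (B a ** upper_factor (trp K))"
    by (intro invertible_mult B a(1) upper_inv_invertible Ui(1))
  have "B a ** upper_factor (trp K) ** (trp K ** Y) = B a ** ((upper_factor (trp K) ** trp K) ** Y)"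
    by (simp only: matrix_mul_assoc)
  then have "B a ** upper_factor (trp K) ** (trp K ** Y) = B a ** Y" by (simp add: Ui(3))
  then show ?thesis
    using transverse_iff_regular[OF V regular_invertible[OF reg]] reg z by simp
qed

lemma boundary_act_tail:
  assumes w: "\<omega> \<in> inf_words"
  shows "map \<omega> [0..<N] \<in> rwords" "val (map \<omega> [0..<N]) \<in> carrier F"
    "boundary_act F (val (map \<omega> [0..<N])) (bd (\<lambda>k. \<omega> (k + N))) = bd \<omega>"
proof -
  show r: "map \<omega> [0..<N] \<in> rwords" using w by (simp add: inf_words_def)
  then show "val (map \<omega> [0..<N]) \<in> carrier F" by (intro val_closed) (simp add: rwords_def)
  have "\<omega> (0 + N) \<noteq> inv_letter (last (map \<omega> [0..<N]))" if "map \<omega> [0..<N] \<noteq> []"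
  proof -
    have "N \<noteq> 0" using that by auto
    then obtain k where "N = Suc k" using not0_implies_Suc by blast
    then show ?thesis using inf_words_not_inverse[OF w, of k] by simp
  qed
  from boundary_act_bd[OF drop_inf_words[OF w] r this]
  show "boundary_act F (val (map \<omega> [0..<N])) (bd (\<lambda>k. \<omega> (k + N))) = bd \<omega>" unfolding conc_drop .
qed

text \<open>
  Removing the common prefix reduces to ends with distinct first letters.
\<close>

lemma end_flags_transverse:
  assumes w: "\<omega> \<in> inf_words" and e: "\<eta> \<in> inf_words" and ne: "\<omega> \<noteq> \<eta>"
  shows "transverse (end_flag \<omega>) (end_flag \<eta>)"
proof -
  have "\<exists>k. \<omega> k \<noteq> \<eta> k" using ne by auto
  define N where "N = (LEAST k. \<omega> k \<noteq> \<eta> k)"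
  have N: "\<omega> N \<noteq> \<eta> N" unfolding N_def by (rule LeastI_ex) fact
  have below: "\<omega> k = \<eta> k" if "k < N" for k using not_less_Least that unfolding N_def by blast
  define v where "v = map \<omega> [0..<N]"
  have v': "v = map \<eta> [0..<N]" using below by (simp add: v_def)
  have vr: "v \<in> rwords" and vc: "val v \<in> carrier F" unfolding v_def by (rule boundary_act_tail[OF w])+
  have tail: "end_flag \<theta> = flag_act (\<rho> (val v)) (end_flag (\<lambda>k. \<theta> (k + N)))"
    if t: "\<theta> \<in> inf_words" "v = map \<theta> [0..<N]" for \<theta>
    using end_flag_equivariant[OF vc drop_inf_words[OF t(1)] t(1)] boundary_act_tail(3)[OF t(1), of N] t(2) by simp
  have "transverse (end_flag (\<lambda>k. \<omega> (k + N))) (end_flag (\<lambda>k. \<eta> (k + N)))"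
    unfolding end_flag_def[of "\<lambda>k. \<omega> (k + N)"]
    using N by (intro transverse_end_flag positive_initial_nonneg end_matrix drop_inf_words w e) (simp_all add: inf_words_letter[OF w])
  then show ?thesis
    unfolding tail[OF w v_def] tail[OF e v']
    by (simp add: flag_act_transverse rho_closed vc end_flag_in_flags drop_inf_words w e)
qed

definition sector :: "'i \<times> bool \<Rightarrow> 'n flag set" where
  "sector a = chart (B a) {L. positive_initial L}"

lemma openin_sector: "fst a \<in> I \<Longrightarrow> openin flag_topology (sector a)"
  unfolding sector_def by (rule openin_chart[OF Binv(2) Binv(1) open_positive_initial])

text \<open>
  The limit flag of an end with another first letter would be transverse to all flags in the sector, in
  particular to itself.
\<close>

lemma end_flag_in_sector_iff:
  assumes e: "\<eta> \<in> inf_words" and a: "fst a \<in> I"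
  shows "end_flag \<eta> \<in> sector a \<longleftrightarrow> \<eta> 0 = a"
proof
  assume "\<eta> 0 = a"
  moreover note L = end_matrix(1,2)[OF e]
  ultimately show "end_flag \<eta> \<in> sector a"
    using regular_lower_unip[OF L(1)] lower_factor_lower_unip[OF L(1)]
    unfolding sector_def chart_def end_flag_def by force
next
  assume "end_flag \<eta> \<in> sector a"
  then obtain Z where Z: "end_flag \<eta> = fl (B a ** Z)" "regular Z" "positive_initial (lower_factor Z)"
    by (auto simp: sector_def chart_def)
  have "fl (B a ** Z) = fl (B a ** lower_factor Z)" using fl_lower_factor[OF Z(2)] by (simp add: fl_mult fun_eq_iff)
  then have "transverse (end_flag \<eta>) (end_flag \<eta>)" if "a \<noteq> \<eta> 0"
    using transverse_end_flag[OF a that e positive_initial_nonneg[OF Z(3)]] Z(1) by simp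
  then show "\<eta> 0 = a" using flag_not_self_transverse[OF dim end_flag_in_flags[OF e]] by blast
qed

definition boundary_map :: "(nat \<Rightarrow> 'f) set \<Rightarrow> 'n flag" where
  "boundary_map p = end_flag (inv_into inf_words bd p)"

lemma boundary_map_bd: "\<omega> \<in> inf_words \<Longrightarrow> boundary_map (bd \<omega>) = end_flag \<omega>"
proof -
  assume w: "\<omega> \<in> inf_words"
  have "inj_on bd inf_words" by (rule inj_onI) (rule bd_inj)
  then show ?thesis using w by (simp add: boundary_map_def inv_into_f_f)
qed

lemma topspace_boundary: "topspace (boundary_topology F (x ` I)) = bd ` inf_words"
proof -
  have "openin (boundary_topology F (x ` I)) (gromov_boundary F (x ` I))"
    by (auto simp: openin_boundary_topology boundary_nhd_def)
  then have "gromov_boundary F (x ` I) \<subseteq> topspace (boundary_topology F (x ` I))" by (rule openin_subset)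
  moreover have "topspace (boundary_topology F (x ` I)) \<subseteq> gromov_boundary F (x ` I)"
    using openin_topspace[of "boundary_topology F (x ` I)"] unfolding openin_boundary_topology by blast
  ultimately show ?thesis by (simp add: gromov_boundary_eq)
qed

text \<open>
  The matrices of two ends with a long common prefix are both close to the unipotent factor of that
  prefix.
\<close>

lemma end_flag_depends_on_prefix:
  assumes w: "\<omega> \<in> inf_words" and U: "openin flag_topology U" "end_flag \<omega> \<in> U"
  shows "\<exists>N. \<forall>\<eta>\<in>inf_words. map \<eta> [0..<N] = map \<omega> [0..<N] \<longrightarrow> end_flag \<eta> \<in> U"
proof (rule ccontr)
  assume "\<not> ?thesis"
  then have "\<forall>N. \<exists>\<eta>. \<eta> \<in> inf_words \<and> map \<eta> [0..<N] = map \<omega> [0..<N] \<and> end_flag \<eta> \<notin> U" by blast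
  then obtain \<eta> where \<eta>: "\<And>N. \<eta> N \<in> inf_words" "\<And>N. map (\<eta> N) [0..<N] = map \<omega> [0..<N]" "\<And>N. end_flag (\<eta> N) \<notin> U"
    by metis
  have same: "\<eta> N k = \<omega> k" if "k < N" for k N using \<eta>(2)[of N] that by (simp add: map_eq_conv)
  have "(\<lambda>N. end_matrix (\<eta> N)) \<longlonglongrightarrow> end_matrix \<omega>"
  proof (rule tendsto_matrixI)
    fix i j assume ij: "i < CARD('n)" "j < CARD('n)"
    have "(\<lambda>N. mn (end_matrix (\<eta> N)) i j - mn (end_matrix \<omega>) i j) \<longlonglongrightarrow> 0"
    proof (rule Lim_null_comparison)
      show "(\<lambda>N. 2 * \<kappa> * (1 - 1 / \<kappa>) ^ (N - 1 - 1)) \<longlonglongrightarrow> 0"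
      proof (rule decay)
        fix K show "\<forall>\<^sub>F m in sequentially. K \<le> m - 1" by (rule eventually_sequentiallyI[of "Suc K"]) simp
      qed
      show "\<forall>\<^sub>F N in sequentially. norm (mn (end_matrix (\<eta> N)) i j - mn (end_matrix \<omega>) i j) \<le> 2 * \<kappa> * (1 - 1 / \<kappa>) ^ (N - 1 - 1)"
      proof (rule eventually_sequentiallyI[of 2])
        fix N :: nat assume "2 \<le> N"
        then have N: "0 < N - 1" "N - 1 < N" by auto
        have p: "prefix_lower_factor (\<eta> N) (N - 1) = prefix_lower_factor \<omega> (N - 1)"
        proof -
          have "map (\<eta> N) [0..<N - 1] = map \<omega> [0..<N - 1]" using same by (simp add: map_eq_conv)
          then show ?thesis by (simp only: same[OF N(2)])
        qed
        show "norm (mn (end_matrix (\<eta> N)) i j - mn (end_matrix \<omega>) i j) \<le> 2 * \<kappa> * (1 - 1 / \<kappa>) ^ (N - 1 - 1)"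
          using end_matrix(3)[OF \<eta>(1) N(1) ij, of N] end_matrix(3)[OF w N(1) ij] unfolding p real_norm_def by linarith
      qed
    qed
    then show "(\<lambda>N. mn (end_matrix (\<eta> N)) i j) \<longlonglongrightarrow> mn (end_matrix \<omega>) i j" by (simp add: LIM_zero_iff)
  qed
  then have "(\<lambda>N. B (\<omega> 0) ** end_matrix (\<eta> N)) \<longlonglongrightarrow> B (\<omega> 0) ** end_matrix \<omega>"
    by (intro tendsto_mult_matrix tendsto_const)
  moreover have "invertible (B (\<omega> 0) ** end_matrix \<omega>)"
    by (intro invertible_mult B inf_words_letter end_matrix_invertible w)
  ultimately have "\<forall>\<^sub>F N in sequentially. fl (B (\<omega> 0) ** end_matrix (\<eta> N)) \<in> U"
    using eventually_fl_in[OF U(1)] U(2) by (simp add: end_flag_def)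
  then have "\<forall>\<^sub>F N in sequentially. fl (B (\<omega> 0) ** end_matrix (\<eta> N)) \<in> U \<and> 0 < N"
    using eventually_gt_at_top[of "0 :: nat"] by (rule eventually_conj)
  then obtain N where "fl (B (\<omega> 0) ** end_matrix (\<eta> N)) \<in> U" "0 < N"
    using eventually_happens'[OF sequentially_bot] by blast
  then show False using \<eta>(3)[of N] same[of 0 N] by (simp add: end_flag_def)
qed

text \<open>
  The inverse of the prefix moves the remaining tail to the front, where the sector of its first letter
  detects it.
\<close>

lemma end_flag_separates_prefixes:
  assumes w: "\<omega> \<in> inf_words"
  shows "\<exists>O'. openin flag_topology O' \<and> end_flag \<omega> \<in> O' \<and>
    (\<forall>\<eta>\<in>inf_words. end_flag \<eta> \<in> O' \<longrightarrow> map \<eta> [0..<N] = map \<omega> [0..<N])"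
proof -
  define v where "v = map \<omega> [0..<N]"
  have vr: "v \<in> rwords" and vc: "val v \<in> carrier F" unfolding v_def by (rule boundary_act_tail[OF w])+
  let ?i = "inv (val v)"
  have ic: "?i \<in> carrier F" using vc by simp
  have aI: "fst (\<omega> N) \<in> I" by (rule inf_words_letter[OF w])
  have last: "\<omega> N \<noteq> inv_letter (last v)" if "v \<noteq> []"
    using prefix_admissible[OF w, of N] that by (cases "N = 0") (auto simp: v_def admissible_def)
  let ?O = "{G \<in> flags. flag_act (\<rho> ?i) G \<in> sector (\<omega> N)}"
  have opn: "openin flag_topology ?O" by (rule openin_flag_act_vimage[OF rho_closed[OF ic] openin_sector[OF aI]])
  have mem: "end_flag \<omega> \<in> ?O"
  proof -
    have "boundary_act F (?i \<otimes> val v) (bd (\<lambda>k. \<omega> (k + N))) = boundary_act F ?i (bd \<omega>)"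
      using boundary_act_mult[OF ic vc] boundary_act_tail(3)[OF w, of N] by (simp add: v_def)
    then have "boundary_act F ?i (bd \<omega>) = bd (\<lambda>k. \<omega> (k + N))" using vc by simp
    then have "end_flag (\<lambda>k. \<omega> (k + N)) = flag_act (\<rho> ?i) (end_flag \<omega>)"
      by (rule end_flag_equivariant[OF ic w drop_inf_words[OF w]])
    moreover have "end_flag (\<lambda>k. \<omega> (k + N)) \<in> sector (\<omega> N)"
      using end_flag_in_sector_iff[OF drop_inf_words[OF w] aI] by simp
    ultimately show ?thesis using end_flag_in_flags[OF w] by simp
  qed
  have "map \<eta> [0..<N] = map \<omega> [0..<N]" if e: "\<eta> \<in> inf_words" and O': "end_flag \<eta> \<in> ?O" for \<eta>
  proof -
    obtain \<theta> where t: "\<theta> \<in> inf_words" "boundary_act F ?i (bd \<eta>) = bd \<theta>" using boundary_act_inf_words[OF ic e] by blast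
    have "end_flag \<theta> \<in> sector (\<omega> N)" using end_flag_equivariant[OF ic e t] O' by simp
    then have t0: "\<theta> 0 = \<omega> N" using end_flag_in_sector_iff[OF t(1) aI] by simp
    have "bd \<eta> = boundary_act F (val v) (bd \<theta>)"
      using boundary_act_mult[OF vc ic, of \<eta>] t(2) vc by simp
    also have "\<dots> = bd (conc v \<theta>)" using boundary_act_bd[OF t(1) vr] last t0 by simp
    finally have "\<eta> = conc v \<theta>" by (rule bd_inj[OF e])
    then show ?thesis using map_conc[of v \<theta> 0] by (simp add: v_def)
  qed
  then show ?thesis using opn mem by blast
qed

theorem boundary_map_embedding: "embedding_map (boundary_topology F (x ` I)) flag_topology boundary_map"
  unfolding embedding_map_def
proof (rule bijective_open_imp_homeomorphic_map)
  let ?X = "boundary_topology F (x ` I)"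
  have img: "boundary_map ` topspace ?X = end_flag ` inf_words"
    unfolding topspace_boundary image_image using boundary_map_bd by simp
  have sub: "end_flag ` inf_words \<subseteq> flags" using end_flag_in_flags by blast
  show "boundary_map ` topspace ?X = topspace (subtopology flag_topology (boundary_map ` topspace ?X))"
    using sub by (auto simp: img)
  show "inj_on boundary_map (topspace ?X)"
  proof (rule inj_onI)
    fix p q assume "p \<in> topspace ?X" "q \<in> topspace ?X" and eq: "boundary_map p = boundary_map q"
    then obtain \<omega> \<eta> where w: "\<omega> \<in> inf_words" "p = bd \<omega>" and e: "\<eta> \<in> inf_words" "q = bd \<eta>"
      unfolding topspace_boundary by blast
    have "end_flag \<omega> = end_flag \<eta>" using eq boundary_map_bd w e by simp
    then show "p = q"
      using end_flags_transverse[OF w(1) e(1)] flag_not_self_transverse[OF dim end_flag_in_flags[OF e(1)]] w e by metis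
  qed
  show "continuous_map ?X (subtopology flag_topology (boundary_map ` topspace ?X)) boundary_map"
  proof (rule continuous_map_into_subtopology)
    show "continuous_map ?X flag_topology boundary_map"
      unfolding continuous_map_def
    proof (intro conjI allI impI)
      show "boundary_map \<in> topspace ?X \<rightarrow> topspace flag_topology"
        using sub unfolding topspace_flag_topology image_subset_iff_funcset[symmetric] img .
      fix U :: "'n flag set" assume U: "openin flag_topology U"
      show "openin ?X {p \<in> topspace ?X. boundary_map p \<in> U}"
        unfolding openin_boundary_topology gromov_boundary_eq topspace_boundary
      proof (intro conjI ballI)
        fix p assume "p \<in> {p \<in> bd ` inf_words. boundary_map p \<in> U}"
        then obtain \<omega> where w: "\<omega> \<in> inf_words" "p = bd \<omega>" "end_flag \<omega> \<in> U" using boundary_map_bd by auto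
        obtain N where N: "\<And>\<eta>. \<eta> \<in> inf_words \<Longrightarrow> map \<eta> [0..<N] = map \<omega> [0..<N] \<Longrightarrow> end_flag \<eta> \<in> U"
          using end_flag_depends_on_prefix[OF w(1) U w(3)] by blast
        have "boundary_nhd F (x ` I) p (real N) \<subseteq> {p \<in> bd ` inf_words. boundary_map p \<in> U}"
        proof
          fix q assume q: "q \<in> boundary_nhd F (x ` I) p (real N)"
          then have "q \<in> gromov_boundary F (x ` I)" by (simp add: boundary_nhd_def)
          then obtain \<eta> where e: "\<eta> \<in> inf_words" "q = bd \<eta>" unfolding gromov_boundary_eq by blast
          have "map \<eta> [0..<N] = map \<omega> [0..<N]" using boundary_nhd_iff[OF w(1) e(1)] q w(2) e(2) by simp
          then show "q \<in> {p \<in> bd ` inf_words. boundary_map p \<in> U}" using N[OF e(1)] e boundary_map_bd by simp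
        qed
        then show "\<exists>r. boundary_nhd F (x ` I) p r \<subseteq> {p \<in> bd ` inf_words. boundary_map p \<in> U}" by blast
      qed blast
    qed
  qed simp
  show "open_map ?X (subtopology flag_topology (boundary_map ` topspace ?X)) boundary_map"
    unfolding open_map_def
  proof (intro allI impI)
    fix U assume U: "openin ?X U"
    then have UB: "U \<subseteq> bd ` inf_words" and nb: "\<And>p. p \<in> U \<Longrightarrow> \<exists>r. boundary_nhd F (x ` I) p r \<subseteq> U"
      unfolding openin_boundary_topology gromov_boundary_eq by blast+
    have "\<exists>O'. openin flag_topology O' \<and> boundary_map p \<in> O' \<and> O' \<inter> end_flag ` inf_words \<subseteq> boundary_map ` U" if p: "p \<in> U" for p
    proof -
      obtain \<omega> where w: "\<omega> \<in> inf_words" "p = bd \<omega>" using p UB by blast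
      obtain r where r: "boundary_nhd F (x ` I) p r \<subseteq> U" using nb[OF p] by blast
      obtain N where "r \<le> real N" using real_arch_simple by blast
      then have N: "boundary_nhd F (x ` I) p (real N) \<subseteq> U"
        using r boundary_nhd_mono[of r "real N" F "x ` I" p] by blast
      obtain O' where O': "openin flag_topology O'" "end_flag \<omega> \<in> O'"
        "\<And>\<eta>. \<eta> \<in> inf_words \<Longrightarrow> end_flag \<eta> \<in> O' \<Longrightarrow> map \<eta> [0..<N] = map \<omega> [0..<N]"
        using end_flag_separates_prefixes[OF w(1), of N] by blast
      have "O' \<inter> end_flag ` inf_words \<subseteq> boundary_map ` U"
      proof
        fix G assume "G \<in> O' \<inter> end_flag ` inf_words"
        then obtain \<eta> where e: "\<eta> \<in> inf_words" "G = end_flag \<eta>" "end_flag \<eta> \<in> O'" by blast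
        then have "bd \<eta> \<in> boundary_nhd F (x ` I) p (real N)"
          using O'(3) boundary_nhd_iff[OF w(1) e(1)] w(2) by simp
        then show "G \<in> boundary_map ` U" using N e boundary_map_bd by (intro image_eqI[of _ _ "bd \<eta>"]) auto
      qed
      then show ?thesis using O'(1,2) w boundary_map_bd by auto
    qed
    then obtain V where V: "\<And>p. p \<in> U \<Longrightarrow> openin flag_topology (V p)" "\<And>p. p \<in> U \<Longrightarrow> boundary_map p \<in> V p"
      "\<And>p. p \<in> U \<Longrightarrow> V p \<inter> end_flag ` inf_words \<subseteq> boundary_map ` U" by metis
    have "openin flag_topology (\<Union>p\<in>U. V p)" using V(1) by blast
    moreover have "boundary_map ` U = (\<Union>p\<in>U. V p) \<inter> end_flag ` inf_words"
    proof
      show "(\<Union>p\<in>U. V p) \<inter> end_flag ` inf_words \<subseteq> boundary_map ` U" using V(3) by fast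
      have "boundary_map ` U \<subseteq> boundary_map ` topspace ?X" unfolding topspace_boundary by (rule image_mono[OF UB])
      then show "boundary_map ` U \<subseteq> (\<Union>p\<in>U. V p) \<inter> end_flag ` inf_words" using V(2) unfolding img by fast
    qed
    ultimately show "openin (subtopology flag_topology (boundary_map ` topspace ?X)) (boundary_map ` U)"
      unfolding img openin_subtopology by blast
  qed
qed

text \<open>
  A single map would send all flags transverse to \<open>Fm\<close> to the same flag, but there are at least two
  of them.
\<close>

lemma contracting_not_constant:
  assumes y: "y \<in> carrier F"
  shows "\<not> contracting (\<lambda>m. \<rho> y) Fp Fm"
proof
  assume c: "contracting (\<lambda>m. \<rho> y) Fp Fm"
  then have f: "Fp \<in> flags" "Fm \<in> flags" by (auto simp: contracting_def)
  have fixed: "flag_act (\<rho> y) G = Fp" if G: "G \<in> flags" "transverse G Fm" for G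
  proof (rule ccontr)
    assume "flag_act (\<rho> y) G \<noteq> Fp"
    then obtain U V where UV: "openin flag_topology U" "Fp \<in> U" "flag_act (\<rho> y) G \<in> V" "U \<inter> V = {}"
      using flags_separated[OF f(1) flag_act_in_flags[OF rho_closed[OF y] G(1)]] by metis
    have "\<forall>\<^sub>F m in sequentially. flag_act (\<rho> y) G \<in> U"
      by (rule contracting_converges[OF c G UV(1,2)])
    then show False using UV by auto
  qed
  obtain G where G: "G \<in> flags" "transverse G Fm" using transverse_common[OF f(2) f(2)] by blast
  obtain G' where G': "G' \<in> flags" "transverse G' Fm" "transverse G' G" using transverse_common[OF f(2) G(1)] by blast
  have "flag_act (\<rho> y) G = flag_act (\<rho> y) G'" using fixed G G' by simp
  then have "G = G'" using flag_act_inv(2)[OF rho_closed[OF y]] G(1) G'(1) by metis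
  then show False using G' flag_not_self_transverse[OF dim G(1)] by simp
qed

lemma contracting_escapes:
  assumes y: "\<And>m. y m \<in> carrier F" and c: "contracting (\<lambda>m. \<rho> (y m)) Fp Fm" and K: "finite K"
  shows "\<forall>\<^sub>F m in sequentially. y m \<notin> K"
proof (rule ccontr)
  assume "\<not> ?thesis"
  then have inf: "infinite {m. y m \<in> K}"
    by (simp add: frequently_sequentially not_eventually INFM_nat_le flip: frequently_cofinite cofinite_eq_sequentially)
  have "finite (y ` {m. y m \<in> K})" using K by (rule finite_subset[rotated]) auto
  from pigeonhole_infinite[OF inf this] obtain m0 where "infinite {m \<in> {m. y m \<in> K}. y m = y m0}" by blast
  from infinite_enumerate[OF this] obtain r :: "nat \<Rightarrow> nat" where r: "strict_mono r" "\<And>m. y (r m) = y m0" by auto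
  show False using contracting_subseq[OF c r(1)] contracting_not_constant[OF y[of m0]] by (simp add: r(2))
qed

lemma escaping_contracting:
  assumes y: "\<And>m. y m \<in> carrier F" and esc: "\<And>K. finite K \<Longrightarrow> \<forall>\<^sub>F m in sequentially. y m \<notin> K"
  obtains k \<omega> Fm where "strict_mono k" "\<omega> \<in> inf_words" "contracting (\<lambda>m. \<rho> (y (k m))) (end_flag \<omega>) Fm"
proof -
  obtain r \<omega> where r: "strict_mono r" and w: "\<omega> \<in> inf_words" "(\<lambda>m. y (r m)) \<in> bd \<omega>"
    by (rule compact_ends[OF finI y escaping_length[OF finI y esc]])
  obtain k Fm where k: "strict_mono k" "contracting (\<lambda>m. \<rho> (y (r (k m)))) (end_flag \<omega>) Fm"
    by (rule end_flag_contracting[OF w])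
  have "strict_mono (\<lambda>m. r (k m))" using r k(1) by (simp add: strict_mono_def)
  then show thesis using k(2) w(1) that by blast
qed

lemma limit_set: "end_flag ` inf_words = flag_limit_set (\<rho> ` carrier F)"
proof (intro equalityI subsetI)
  fix G assume "G \<in> end_flag ` inf_words"
  then obtain \<omega> where w: "\<omega> \<in> inf_words" "G = end_flag \<omega>" by blast
  note u = pref_ends_at[OF w(1)]
  obtain k Fm where "contracting (\<lambda>m. \<rho> (val (map \<omega> [0..<k m]))) (end_flag \<omega>) Fm"
    by (rule end_flag_contracting[OF w(1) u])
  moreover have "range (\<lambda>m. \<rho> (val (map \<omega> [0..<k m]))) \<subseteq> \<rho> ` carrier F" using bd_closed[OF u] by blast
  ultimately show "G \<in> flag_limit_set (\<rho> ` carrier F)" unfolding flag_limit_set_def w(2) by blast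
next
  fix G assume "G \<in> flag_limit_set (\<rho> ` carrier F)"
  then obtain h Fm where h: "range h \<subseteq> \<rho> ` carrier F" "contracting h G Fm" by (auto simp: flag_limit_set_def)
  then have "\<forall>m. \<exists>y. y \<in> carrier F \<and> h m = \<rho> y" by blast
  then obtain y where y: "\<And>m. y m \<in> carrier F" "\<And>m. h m = \<rho> (y m)" by metis
  have c: "contracting (\<lambda>m. \<rho> (y m)) G Fm" using h(2) by (simp flip: y(2))
  obtain k \<omega> G' where k: "strict_mono k" "\<omega> \<in> inf_words" "contracting (\<lambda>m. \<rho> (y (k m))) (end_flag \<omega>) G'"
    by (rule escaping_contracting[OF y(1) contracting_escapes[OF y(1) c]])
  have "G = end_flag \<omega>" by (rule contracting_unique[OF contracting_subseq[OF c k(1)] k(3)])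
  then show "G \<in> end_flag ` inf_words" using k(2) by blast
qed

theorem schottky_B_anosov: "B_anosov F \<rho>"
proof -
  have equi: "boundary_map (boundary_act F y p) = flag_act (\<rho> y) (boundary_map p)"
    if y: "y \<in> carrier F" and p: "p \<in> gromov_boundary F (x ` I)" for y p
  proof -
    obtain \<omega> where w: "\<omega> \<in> inf_words" "p = bd \<omega>" using p unfolding gromov_boundary_eq by blast
    obtain \<eta> where e: "\<eta> \<in> inf_words" "boundary_act F y (bd \<omega>) = bd \<eta>" using boundary_act_inf_words[OF y w(1)] by blast
    show ?thesis using end_flag_equivariant[OF y w(1) e] boundary_map_bd w e by simp
  qed
  have lim: "boundary_map ` gromov_boundary F (x ` I) = flag_limit_set (\<rho> ` carrier F)"
    unfolding gromov_boundary_eq image_image limit_set[symmetric] using boundary_map_bd by simp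
  have trans: "transverse (boundary_map p) (boundary_map q)"
    if "p \<in> gromov_boundary F (x ` I)" "q \<in> gromov_boundary F (x ` I)" "p \<noteq> q" for p q
  proof -
    have gp: "p \<in> bd ` inf_words" and gq: "q \<in> bd ` inf_words" using that(1,2) by (simp_all only: gromov_boundary_eq)
    obtain \<omega> \<eta> where w: "\<omega> \<in> inf_words" "p = bd \<omega>" and e: "\<eta> \<in> inf_words" "q = bd \<eta>"
      using gp gq by blast
    then have "\<omega> \<noteq> \<eta>" using that(3) by blast
    then show ?thesis using end_flags_transverse[OF w(1) e(1)] boundary_map_bd w e by simp
  qed
  have subseq: "\<exists>k Fp Fm. strict_mono k \<and> contracting (\<lambda>m. \<rho> (y (k m))) Fp Fm"
    if y: "range y \<subseteq> carrier F" "\<forall>K. finite K \<longrightarrow> (\<forall>\<^sub>F m in sequentially. y m \<notin> K)" for y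
  proof -
    have "\<And>m. y m \<in> carrier F" using y(1) by blast
    then show ?thesis using escaping_contracting[of y] y(2) by metis
  qed
  show ?thesis
    unfolding B_anosov_def
  proof (intro conjI exI[of _ "x ` I"] exI[of _ boundary_map] ballI impI allI)
    fix y p assume "y \<in> carrier F" "p \<in> gromov_boundary F (x ` I)"
    then show "boundary_map (boundary_act F y p) = flag_act (\<rho> y) (boundary_map p)" by (rule equi)
  next
    fix p q assume "p \<in> gromov_boundary F (x ` I)" "q \<in> gromov_boundary F (x ` I)" "p \<noteq> q"
    then show "transverse (boundary_map p) (boundary_map q)" by (rule trans)
  next
    fix y assume "range y \<subseteq> carrier F \<and> (\<forall>K. finite K \<longrightarrow> (\<forall>\<^sub>F m in sequentially. y m \<notin> K))"
    then show "\<exists>k Fp Fm. strict_mono k \<and> contracting (\<lambda>m. \<rho> (y (k m))) Fp Fm" by (elim conjE) (rule subseq)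
  qed (rule hom word_hyperbolic_free[OF finI] boundary_map_embedding lim)+
qed

end

section \<open>From interval data to matrices\<close>

lemma transition_matrix_exists:
  fixes X1 X2 X3 Y :: "('n::{finite,linorder}) oflag set"
  assumes hyp: "hyperconvex X1 X2 X3" "hyperconvex X2 Y X3"
    and A: "adapted A X1 X3" and C: "adapted C X2 Y" and n: "2 \<le> CARD('n)"
  shows "\<exists>M. STP M \<and> (A ** M = C \<or> A ** M = - C)"
proof -
  have "invertible A" using A by (simp add: adapted_def invertible_det_nz)
  then obtain A' where A': "A ** A' = mat 1" by (auto simp: invertible_def)
  then have AC: "A ** (A' ** C) = C" by (simp add: matrix_mul_assoc)
  then obtain \<eta> :: real where \<eta>: "\<eta> = 1 \<or> \<eta> = - 1" "STP (\<eta> *\<^sub>R (A' ** C))"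
    using hyperconvex_STP[OF hyp A _ n, of "A' ** C"] C by auto
  have "A ** (\<eta> *\<^sub>R (A' ** C)) = \<eta> *\<^sub>R C" using matrix_scalar_ac[of A \<eta> "A' ** C"] scalar_matrix_assoc[of \<eta> A "A' ** C"] AC by simp
  then show ?thesis using \<eta> by (intro exI[of _ "\<eta> *\<^sub>R (A' ** C)"]) auto
qed

lemma pull_back_adapted:
  fixes h :: "('n::{finite,linorder}) rmat set"
  assumes h: "h \<in> carrier PSL" "H \<in> h" and X: "X \<in> Flag_plus" and Y: "Y \<in> Flag_plus"
    and C: "adapted C (Flag_plus_act h X) (Flag_plus_act h Y)"
  shows "\<exists>A. adapted A X Y \<and> H ** A = C"
proof -
  obtain H' where H': "H ** H' = mat 1" using PSL_invertible[OF h] by (auto simp: invertible_def)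
  then have e: "H ** (H' ** C) = C" by (simp add: matrix_mul_assoc)
  then have "adapted (H' ** C) X Y" using adapted_act_inverse[OF h X Y, of "H' ** C"] C by simp
  then show ?thesis using e by blast
qed

text \<open>
  A representative of \<open>inv h\<close> inverts a representative of \<open>h\<close> only up to sign.
\<close>

lemma push_forward_adapted:
  fixes h :: "('n::{finite,linorder}) rmat set"
  assumes h: "h \<in> carrier PSL" and K: "K \<in> inv\<^bsub>PSL\<^esub> h" and C: "adapted C X Y"
  shows "\<exists>A. adapted A (Flag_plus_act h X) (Flag_plus_act h Y) \<and> (K ** A = C \<or> K ** A = - C)"
proof -
  interpret PSL: group "PSL :: 'n rmat set monoid" by (rule group_PSL)
  obtain H where H: "H \<in> h" using PSL_rep(1)[OF h] by blast
  have "K ** H \<in> \<one>\<^bsub>PSL\<^esub>" using PSL_mult_rep[OF K H] by (simp add: h)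
  then have "K ** H = mat 1 \<or> K ** H = - mat 1"
    by (rule PSL_rep(3)[OF PSL.one_closed PSL_one_rep])
  then have "K ** (H ** C) = C \<or> K ** (H ** C) = - C"
    by (auto simp: matrix_mul_assoc uminus_mat_mult)
  then show ?thesis using adapted_act[OF h H C] by blast
qed

theorem theorem1p3:
  fixes F :: "'f monoid" and g :: nat and x :: "nat \<Rightarrow> 'f"
    and \<rho> :: "'f \<Rightarrow> ('n::{finite,linorder}) rmat set"
  assumes "2 \<le> CARD('n)"
    and "1 \<le> g"
    and "free_basis F {1..g} x"
    and "purely_hyperbolic_schottky F g x \<rho>"
  shows "B_anosov F \<rho>"
proof -
  note n = assms(1) and free = assms(3) and sch = assms(4)
  interpret fg: free_group F "{1..g}" x by unfold_locales (rule free)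
  obtain a b :: "nat \<Rightarrow> bool \<Rightarrow> (real^2) set" and \<xi> :: "(real^2) set \<Rightarrow> 'n oflag set" and h :: "nat \<Rightarrow> 'n rmat set"
    where ab: "\<forall>j\<in>{1..g}. \<forall>s. a j s \<in> RP1 \<and> b j s \<in> RP1 \<and> a j s \<noteq> b j s"
    and dj: "\<forall>j\<in>{1..g}. \<forall>k\<in>{1..g}. \<forall>s t. (j, s) \<noteq> (k, t) \<longrightarrow>
           disjnt (RP1_topology closure_of arc (a j s) (b j s)) (RP1_topology closure_of arc (a k t) (b k t))"
    and \<xi>: "let E = {e. \<exists>j\<in>{1..g}. \<exists>s. e = a j s \<or> e = b j s} in
           (\<forall>e\<in>E. \<xi> e \<in> Flag_plus) \<and>
           (\<forall>e1\<in>E. \<forall>e2\<in>E. \<forall>e3\<in>E. cyclically_ordered e1 e2 e3 \<longrightarrow> hyperconvex (\<xi> e1) (\<xi> e2) (\<xi> e3))"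
    and h: "\<forall>j\<in>{1..g}. h j \<in> carrier PSL \<and>
           Flag_plus_act (h j) (\<xi> (b j False)) = \<xi> (a j True) \<and>
           Flag_plus_act (h j) (\<xi> (a j False)) = \<xi> (b j True)"
    and hom: "\<rho> \<in> hom F PSL" and \<rho>: "\<forall>j\<in>{1..g}. \<rho> (x j) = h j"
    using sch unfolding purely_hyperbolic_schottky_def by (elim exE conjE)
  define I where "I = {1..g}"
  define \<alpha> \<beta> where "\<alpha> s = a (fst s) (snd s)" and "\<beta> s = b (fst s) (snd s)" for s :: "nat \<times> bool"
  have R: "\<alpha> s \<in> RP1" "\<beta> s \<in> RP1" "\<alpha> s \<noteq> \<beta> s" if "fst s \<in> I" for s
    using ab that by (simp_all add: \<alpha>_def \<beta>_def I_def)
  have E: "\<alpha> s \<in> {e. \<exists>j\<in>{1..g}. \<exists>s. e = a j s \<or> e = b j s}" "\<beta> s \<in> {e. \<exists>j\<in>{1..g}. \<exists>s. e = a j s \<or> e = b j s}"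
    if "fst s \<in> I" for s
    using that by (auto simp: \<alpha>_def \<beta>_def I_def)
  have fp: "\<xi> (\<alpha> s) \<in> Flag_plus" "\<xi> (\<beta> s) \<in> Flag_plus" if "fst s \<in> I" for s
    using \<xi> E[OF that] unfolding Let_def by blast+
  \<comment> \<open>Both triples come from the cyclic order of the four endpoints of two disjoint intervals.\<close>
  have hyp: "hyperconvex (\<xi> (\<beta> u)) (\<xi> (\<alpha> t)) (\<xi> (\<alpha> u))" "hyperconvex (\<xi> (\<alpha> t)) (\<xi> (\<beta> t)) (\<xi> (\<alpha> u))"
    if "fst u \<in> I" "fst t \<in> I" "t \<noteq> u" for t u
  proof -
    have d: "disjnt (RP1_topology closure_of arc (\<alpha> u) (\<beta> u)) (RP1_topology closure_of arc (\<alpha> t) (\<beta> t))"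
      using dj that by (cases t; cases u) (auto simp: \<alpha>_def \<beta>_def I_def)
    have "cyclically_ordered (\<beta> u) (\<alpha> t) (\<alpha> u)" "cyclically_ordered (\<alpha> t) (\<beta> t) (\<alpha> u)"
      by (rule disjoint_arcs_cyclically_ordered[OF R[OF that(1)] R[OF that(2)] d])+
    then show "hyperconvex (\<xi> (\<beta> u)) (\<xi> (\<alpha> t)) (\<xi> (\<alpha> u))" "hyperconvex (\<xi> (\<alpha> t)) (\<xi> (\<beta> t)) (\<xi> (\<alpha> u))"
      using \<xi> E[OF that(1)] E[OF that(2)] unfolding Let_def by blast+
  qed
  have "\<exists>A. adapted A (\<xi> (\<alpha> s)) (\<xi> (\<beta> s))" if "fst s \<in> I" for s
    using hyperconvex_adapted_exists[OF hyp(2)[of "inv_letter s" s]] that by simp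
  then obtain B where B: "\<And>s. fst s \<in> I \<Longrightarrow> adapted (B s) (\<xi> (\<alpha> s)) (\<xi> (\<beta> s))" by metis
  \<comment> \<open>A letter maps the complement of the interval of the inverse letter \<open>u\<close> to its own interval; hence it
    maps a basis adapted to the endpoints of that complement, which are the endpoints of the interval of \<open>u\<close> in
    the opposite order, to the basis \<open>B s\<close>.\<close>
  have "\<exists>H A. H \<in> \<rho> (fg.lval s) \<and> adapted A (\<xi> (\<beta> (inv_letter s))) (\<xi> (\<alpha> (inv_letter s))) \<and>
      (H ** A = B s \<or> H ** A = - B s)" if s: "fst s \<in> I" for s
  proof -
    obtain j e where je: "s = (j, e)" by (cases s)
    have j: "j \<in> {1..g}" using s by (simp add: je I_def)
    have hj: "h j \<in> carrier PSL" "Flag_plus_act (h j) (\<xi> (b j False)) = \<xi> (a j True)"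
      "Flag_plus_act (h j) (\<xi> (a j False)) = \<xi> (b j True)" using h j by blast+
    show ?thesis
    proof (cases e)
      case True
      obtain H where H: "H \<in> h j" using PSL_rep(1)[OF hj(1)] by blast
      have fpj: "\<xi> (b j False) \<in> Flag_plus" "\<xi> (a j False) \<in> Flag_plus"
        using fp[of "(j, False)"] s by (simp_all add: je \<alpha>_def \<beta>_def)
      have "adapted (B s) (Flag_plus_act (h j) (\<xi> (b j False))) (Flag_plus_act (h j) (\<xi> (a j False)))"
        using B[OF s] True unfolding hj by (simp add: je \<alpha>_def \<beta>_def)
      from pull_back_adapted[OF hj(1) H fpj this] obtain A
        where "adapted A (\<xi> (b j False)) (\<xi> (a j False))" "H ** A = B s" by blast
      moreover have "fg.lval s = x j" using True by (simp add: fg.lval_def je)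
      ultimately show ?thesis
        using H \<rho> j True by (auto simp: je \<alpha>_def \<beta>_def inv_letter_def)
    next
      case False
      have xj: "x j \<in> carrier F" by (rule fg.generator_closed[OF j])
      have l: "\<rho> (fg.lval s) = inv\<^bsub>PSL\<^esub> (h j)"
        using group_hom.hom_inv[of F PSL \<rho>, OF _ xj] hom group_PSL fg.is_group False \<rho> j
        by (simp add: fg.lval_def je group_hom_def group_hom_axioms_def)
      have "inv\<^bsub>PSL\<^esub> (h j) \<in> carrier PSL" using group.inv_closed[OF group_PSL hj(1)] .
      then obtain K where K: "K \<in> inv\<^bsub>PSL\<^esub> (h j)" using PSL_rep(1) by blast
      have "adapted (B s) (\<xi> (a j False)) (\<xi> (b j False))"
        using B[OF s] False by (simp add: je \<alpha>_def \<beta>_def)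
      from push_forward_adapted[OF hj(1) K this] obtain A
        where "adapted A (\<xi> (b j True)) (\<xi> (a j True))" "K ** A = B s \<or> K ** A = - B s"
        unfolding hj by blast
      then show ?thesis using K l False by (auto simp: je \<alpha>_def \<beta>_def inv_letter_def)
    qed
  qed
  then obtain H A where H: "\<And>s. fst s \<in> I \<Longrightarrow> H s \<in> \<rho> (fg.lval s)"
    and A: "\<And>s. fst s \<in> I \<Longrightarrow> adapted (A s) (\<xi> (\<beta> (inv_letter s))) (\<xi> (\<alpha> (inv_letter s)))"
    and HA: "\<And>s. fst s \<in> I \<Longrightarrow> H s ** A s = B s \<or> H s ** A s = - B s"
    by metis
  have "\<exists>M. STP M \<and> (A s ** M = B t \<or> A s ** M = - B t)"
    if "fst s \<in> I" "fst t \<in> I" "t \<noteq> inv_letter s" for s t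
    using transition_matrix_exists[OF hyp A[OF that(1)] B[OF that(2)] n] that by simp
  then obtain M where M: "\<And>s t. fst s \<in> I \<Longrightarrow> fst t \<in> I \<Longrightarrow> t \<noteq> inv_letter s \<Longrightarrow>
      STP (M s t) \<and> (A s ** M s t = B t \<or> A s ** M s t = - B t)"
    by metis
  have iB: "invertible (B s)" if "fst s \<in> I" for s
    using B[OF that] by (simp add: adapted_def invertible_det_nz)
  interpret sm: schottky_matrices F I x \<rho> B H M
  proof (unfold_locales)
    show "free_basis F I x" using free by (simp add: I_def)
    show "finite I" by (simp add: I_def)
    fix s t :: "nat \<times> bool"
    assume st: "fst s \<in> I" "fst t \<in> I" "t \<noteq> inv_letter s"
    show "STP (M s t)" using M[OF st] by simp
    have neg: "X ** (- Y) = - (X ** Y)" "(- X) ** Y = - (X ** Y)" for X Y :: "'n rmat"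
      using matrix_scalar_ac[of X "-1" Y] scalar_matrix_assoc[of "-1" X Y] by simp_all
    have "(H s ** A s) ** M s t = H s ** (A s ** M s t)" by (simp only: matrix_mul_assoc)
    then show "H s ** B t = B s ** M s t \<or> H s ** B t = - (B s ** M s t)"
      using HA[OF st(1)] M[OF st] by (auto simp: neg)
  qed (use n hom H iB in auto)
  show ?thesis by (rule sm.schottky_B_anosov)
qed

end
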